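(* Let $(\mathcal{E},\mathcal{M},\mathcal{Q})$ be a small Boolean modal quasi-pretopos. Then there exist a graph $\mathbf{G}$ and a morphism of Boolean modal quasi-pretoposes $F:\mathcal{E}\longrightarrow\mathrm{Rel}^{\mathbf{G}}$ which is $\mathcal{M}$-conservative.
   Context: An f-regular category is a pair $(\mathcal{E},\mathcal{M})$ where $\mathcal{E}$ has finite limits and $\mathcal{M}$ is a class of monomorphisms containing all isomorphisms and regular monomorphisms, closed under composition and pullback, such that every arrow factors as $m\circ e$ with $m\in\mathcal{M}$ and $e\in\mathcal{M}^\bot$ (arrows left orthogonal to all of $\mathcal{M}$), with $\mathcal{M}^\bot$ pullback-stable. $\mathrm{Sub}_{\mathcal{M}}(X)$ is the poset of $\mathcal{M}$-subobjects of $X$; $f^*$ is pullback, $\exists_f$ its left adjoint. f-coherent: each $\mathrm{Sub}_{\mathcal{M}}(X)$ has finite joins preserved by $f^*$; Boolean: each $\mathrm{Sub}_{\mathcal{M}}(X)$ is a Boolean algebra. A Boolean modal category is a Boolean f-coherent category with join-preserving operators $\Diamond_X$ on $\mathrm{Sub}_{\mathcal{M}}(X)$ such that $\Diamond_X f^*S\le f^*\Diamond_YS$ for all $f:X\to Y$ and $\Diamond_A\iota^*S=\iota^*\Diamond_X\exists_\iota\iota^*S$ for $\iota:A\hookrightarrow X$ in $\mathcal{M}$. With quotients: a class $\mathcal{Q}\subseteq\mathcal{M}^\bot$ such that for $q:X\to Y$ in $\mathcal{Q}$, all $Z$ and $S\in\mathrm{Sub}_{\mathcal{M}}(Y\times Z)$,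 $\Diamond S\le\exists_{q\times1_Z}\Diamond(q\times1_Z)^*S$. A disjoint union of $A,B$ is an object $A+B$ with $\mathcal{M}$-subobjects $\iota_A:A\hookrightarrow A+B$, $\iota_B:B\hookrightarrow A+B$ that are Boolean complements of each other in $\mathrm{Sub}_{\mathcal{M}}(A+B)$ and satisfy $\Diamond A\le A$, $\Diamond B\le B$ in $\mathrm{Sub}_{\mathcal{M}}(A+B)$. A Boolean modal quasi-pretopos is a Boolean modal category with quotients in which every pair of objects has a disjoint union and every equivalence relation $R\in\mathrm{Sub}_{\mathcal{M}}(X\times X)$ is the kernel pair of some quotient $q:X\to Q$. A morphism of Boolean modal quasi-pretoposes is a functor preserving finite limits, $\mathcal{M}$, $\mathcal{M}^\bot$, finite joins of $\mathcal{M}$-subobjects, $\Diamond$, and quotients. $\mathcal{M}$-conservative: the induced maps $\mathrm{Sub}_{\mathcal{M}}(X)\to\mathrm{Sub}_{\mathcal{M}}(FX)$ are injective. $\mathrm{Rel}^{\mathbf{G}}$ (for a graph $\mathbf{G}$): objects assign sets $X_\alpha$ to nodes and relations $X_k\subseteq X_\alpha\times X_\beta$ to edges $k:\alpha\to\beta$; morphisms are families of functions preserving the relations; $\mathcal{M}$ = subobjects with induced relations; $(\Diamond S)_\alpha=\{s:\exists k:\alpha\to\beta,\exists t\in S_\beta,\ s\,k\,t\}$; quotients are componentwise surjective $f$ such that each $s\,k\,t$ in the codomain lifts to some $s'\,k\,t'$ with $f(s')=s$, $f(t')=t$; disjoint unions are computed componentwise as in sets. *)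

theory Defs
  imports
    "HOL-Library.FuncSet"
    "HOL-Algebra.Lattice"
    "Graph_Theory.Digraph"
begin

section \<open>Categories\<close>

text \<open>
  All carriers are sets over types of HOL, so every category below is small.
  Composition is written in the applicative order: \<open>Comp C g f\<close> is \<open>g\<close> after \<open>f\<close>.
  The functions are constrained on the carriers only.
\<close>

record ('o, 'a) category =
  Obj :: "'o set"
  Arr :: "'a set"
  Dom :: "'a \<Rightarrow> 'o"
  Cod :: "'a \<Rightarrow> 'o"
  Ident :: "'o \<Rightarrow> 'a"
  Comp :: "'a \<Rightarrow> 'a \<Rightarrow> 'a"

definition Hom :: "('o, 'a, 'x) category_scheme \<Rightarrow> 'o \<Rightarrow> 'o \<Rightarrow> 'a set" where
  "Hom C X Y = {f \<in> Arr C. Dom C f = X \<and> Cod C f = Y}"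

locale category =
  fixes C :: "('o, 'a, 'x) category_scheme"
  assumes Dom_Obj: "f \<in> Arr C \<Longrightarrow> Dom C f \<in> Obj C"
    and Cod_Obj: "f \<in> Arr C \<Longrightarrow> Cod C f \<in> Obj C"
    and Ident_Hom: "X \<in> Obj C \<Longrightarrow> Ident C X \<in> Hom C X X"
    and Comp_Hom: "f \<in> Hom C X Y \<Longrightarrow> g \<in> Hom C Y Z \<Longrightarrow> Comp C g f \<in> Hom C X Z"
    and Comp_Ident: "f \<in> Hom C X Y \<Longrightarrow> Comp C f (Ident C X) = f"
    and Ident_Comp: "f \<in> Hom C X Y \<Longrightarrow> Comp C (Ident C Y) f = f"
    and Comp_assoc: "f \<in> Hom C W X \<Longrightarrow> g \<in> Hom C X Y \<Longrightarrow> h \<in> Hom C Y Z \<Longrightarrow>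
      Comp C h (Comp C g f) = Comp C (Comp C h g) f"

record ('o, 'a, 'p, 'b) cat_functor =
  FObj :: "'o \<Rightarrow> 'p"
  FArr :: "'a \<Rightarrow> 'b"

definition is_functor ::
  "('o, 'a, 'x) category_scheme \<Rightarrow> ('p, 'b, 'y) category_scheme \<Rightarrow> ('o, 'a, 'p, 'b) cat_functor \<Rightarrow> bool"
where
  "is_functor C D F \<longleftrightarrow>
     (\<forall>X \<in> Obj C. FObj F X \<in> Obj D) \<and>
     (\<forall>X \<in> Obj C. \<forall>Y \<in> Obj C. \<forall>f \<in> Hom C X Y. FArr F f \<in> Hom D (FObj F X) (FObj F Y)) \<and>
     (\<forall>X \<in> Obj C. FArr F (Ident C X) = Ident D (FObj F X)) \<and>
     (\<forall>f \<in> Arr C. \<forall>g \<in> Arr C. Cod C f = Dom C g \<longrightarrow>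
        FArr F (Comp C g f) = Comp D (FArr F g) (FArr F f))"

definition is_mono :: "('o, 'a, 'x) category_scheme \<Rightarrow> 'a \<Rightarrow> bool" where
  "is_mono C m \<longleftrightarrow> m \<in> Arr C \<and>
     (\<forall>T \<in> Obj C. \<forall>f \<in> Hom C T (Dom C m). \<forall>g \<in> Hom C T (Dom C m).
        Comp C m f = Comp C m g \<longrightarrow> f = g)"

definition is_iso :: "('o, 'a, 'x) category_scheme \<Rightarrow> 'a \<Rightarrow> bool" where
  "is_iso C f \<longleftrightarrow> f \<in> Arr C \<and>
     (\<exists>g \<in> Hom C (Cod C f) (Dom C f).
        Comp C g f = Ident C (Dom C f) \<and> Comp C f g = Ident C (Cod C f))"

definition is_equalizer :: "('o, 'a, 'x) category_scheme \<Rightarrow> 'a \<Rightarrow> 'a \<Rightarrow> 'a \<Rightarrow> bool" where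
  "is_equalizer C f g m \<longleftrightarrow>
     f \<in> Arr C \<and> g \<in> Hom C (Dom C f) (Cod C f) \<and> m \<in> Arr C \<and> Cod C m = Dom C f \<and>
     Comp C f m = Comp C g m \<and>
     (\<forall>T \<in> Obj C. \<forall>t \<in> Hom C T (Dom C f). Comp C f t = Comp C g t \<longrightarrow>
        (\<exists>!h. h \<in> Hom C T (Dom C m) \<and> Comp C m h = t))"

definition is_regular_mono :: "('o, 'a, 'x) category_scheme \<Rightarrow> 'a \<Rightarrow> bool" where
  "is_regular_mono C m \<longleftrightarrow> (\<exists>f g. is_equalizer C f g m)"

text \<open>
  \<open>is_pullback C f g p q\<close>: the square with \<open>f \<circ> p = g \<circ> q\<close> is a pullback square,
  so \<open>p\<close> is a pullback of \<open>g\<close> along \<open>f\<close>.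
\<close>

definition is_pullback :: "('o, 'a, 'x) category_scheme \<Rightarrow> 'a \<Rightarrow> 'a \<Rightarrow> 'a \<Rightarrow> 'a \<Rightarrow> bool" where
  "is_pullback C f g p q \<longleftrightarrow>
     f \<in> Arr C \<and> g \<in> Arr C \<and> Cod C f = Cod C g \<and>
     p \<in> Arr C \<and> q \<in> Arr C \<and> Dom C p = Dom C q \<and> Cod C p = Dom C f \<and> Cod C q = Dom C g \<and>
     Comp C f p = Comp C g q \<and>
     (\<forall>T \<in> Obj C. \<forall>s \<in> Hom C T (Dom C f). \<forall>t \<in> Hom C T (Dom C g).
        Comp C f s = Comp C g t \<longrightarrow>
        (\<exists>!h. h \<in> Hom C T (Dom C p) \<and> Comp C p h = s \<and> Comp C q h = t))"

definition is_product :: "('o, 'a, 'x) category_scheme \<Rightarrow> 'o \<Rightarrow> 'o \<Rightarrow> 'o \<Rightarrow> 'a \<Rightarrow> 'a \<Rightarrow> bool" where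
  "is_product C X Y P p q \<longleftrightarrow>
     X \<in> Obj C \<and> Y \<in> Obj C \<and> P \<in> Obj C \<and> p \<in> Hom C P X \<and> q \<in> Hom C P Y \<and>
     (\<forall>T \<in> Obj C. \<forall>s \<in> Hom C T X. \<forall>t \<in> Hom C T Y.
        \<exists>!h. h \<in> Hom C T P \<and> Comp C p h = s \<and> Comp C q h = t)"

text \<open>
  A diagram of shape \<open>J\<close> (a directed multigraph) is a graph morphism from \<open>J\<close> into the
  underlying graph of the category. Cones over a functor on a finite category are the cones over
  the corresponding diagram on its finite underlying graph, and every finite graph is isomorphic
  to one on natural numbers.
\<close>

definition is_diagram ::
  "('o, 'a, 'x) category_scheme \<Rightarrow> ('v, 'e) pre_digraph \<Rightarrow> ('v \<Rightarrow> 'o) \<Rightarrow> ('e \<Rightarrow> 'a) \<Rightarrow> bool"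
where
  "is_diagram C J DO DA \<longleftrightarrow>
     (\<forall>v \<in> verts J. DO v \<in> Obj C) \<and>
     (\<forall>e \<in> arcs J. DA e \<in> Hom C (DO (tail J e)) (DO (head J e)))"

definition is_cone ::
  "('o, 'a, 'x) category_scheme \<Rightarrow> ('v, 'e) pre_digraph \<Rightarrow> ('v \<Rightarrow> 'o) \<Rightarrow> ('e \<Rightarrow> 'a) \<Rightarrow>
   'o \<Rightarrow> ('v \<Rightarrow> 'a) \<Rightarrow> bool"
where
  "is_cone C J DO DA L pr \<longleftrightarrow>
     L \<in> Obj C \<and> (\<forall>v \<in> verts J. pr v \<in> Hom C L (DO v)) \<and>
     (\<forall>e \<in> arcs J. Comp C (DA e) (pr (tail J e)) = pr (head J e))"

definition is_limit ::
  "('o, 'a, 'x) category_scheme \<Rightarrow> ('v, 'e) pre_digraph \<Rightarrow> ('v \<Rightarrow> 'o) \<Rightarrow> ('e \<Rightarrow> 'a) \<Rightarrow>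
   'o \<Rightarrow> ('v \<Rightarrow> 'a) \<Rightarrow> bool"
where
  "is_limit C J DO DA L pr \<longleftrightarrow>
     is_cone C J DO DA L pr \<and>
     (\<forall>T t. is_cone C J DO DA T t \<longrightarrow>
        (\<exists>!h. h \<in> Hom C T L \<and> (\<forall>v \<in> verts J. Comp C (pr v) h = t v)))"

definition has_finite_limits :: "('o, 'a, 'x) category_scheme \<Rightarrow> bool" where
  "has_finite_limits C \<longleftrightarrow>
     (\<forall>(J :: (nat, nat) pre_digraph) DO DA. fin_digraph J \<and> is_diagram C J DO DA \<longrightarrow>
        (\<exists>L pr. is_limit C J DO DA L pr))"

definition preserves_finite_limits ::
  "('o, 'a, 'x) category_scheme \<Rightarrow> ('p, 'b, 'y) category_scheme \<Rightarrow> ('o, 'a, 'p, 'b) cat_functor \<Rightarrow> bool"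
where
  "preserves_finite_limits C D F \<longleftrightarrow>
     (\<forall>(J :: (nat, nat) pre_digraph) DO DA L pr.
        fin_digraph J \<and> is_diagram C J DO DA \<and> is_limit C J DO DA L pr \<longrightarrow>
        is_limit D J (FObj F \<circ> DO) (FArr F \<circ> DA) (FObj F L) (FArr F \<circ> pr))"

section \<open>f-regular categories\<close>

record ('o, 'a) mono_category = "('o, 'a) category" +
  Mon :: "'a set"

definition orthogonal :: "('o, 'a, 'x) category_scheme \<Rightarrow> 'a \<Rightarrow> 'a \<Rightarrow> bool" where
  "orthogonal C e m \<longleftrightarrow>
     (\<forall>u \<in> Hom C (Dom C e) (Dom C m). \<forall>v \<in> Hom C (Cod C e) (Cod C m).
        Comp C m u = Comp C v e \<longrightarrow>
        (\<exists>!d. d \<in> Hom C (Cod C e) (Dom C m) \<and> Comp C d e = u \<and> Comp C m d = v))"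

definition MonPerp :: "('o, 'a, 'x) mono_category_scheme \<Rightarrow> 'a set" where
  "MonPerp C = {e \<in> Arr C. \<forall>m \<in> Mon C. orthogonal C e m}"

locale f_regular_category = category C
  for C :: "('o, 'a, 'x) mono_category_scheme" +
  assumes finite_limits: "has_finite_limits C"
    and Mon_mono: "m \<in> Mon C \<Longrightarrow> is_mono C m"
    and iso_Mon: "is_iso C m \<Longrightarrow> m \<in> Mon C"
    and regular_mono_Mon: "is_regular_mono C m \<Longrightarrow> m \<in> Mon C"
    and Mon_Comp: "m \<in> Mon C \<Longrightarrow> n \<in> Mon C \<Longrightarrow> Cod C n = Dom C m \<Longrightarrow> Comp C m n \<in> Mon C"
    and Mon_pullback: "is_pullback C f m m' f' \<Longrightarrow> m \<in> Mon C \<Longrightarrow> m' \<in> Mon C"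
    and factorization: "f \<in> Arr C \<Longrightarrow>
      \<exists>m \<in> Mon C. \<exists>e \<in> MonPerp C. Cod C e = Dom C m \<and> f = Comp C m e"
    and MonPerp_pullback: "is_pullback C f e e' f' \<Longrightarrow> e \<in> MonPerp C \<Longrightarrow> e' \<in> MonPerp C"

text \<open>
  An M-subobject of \<open>X\<close> is an equivalence class of M-arrows into \<open>X\<close>, represented as the set of
  its members.
\<close>

definition factors_through :: "('o, 'a, 'x) category_scheme \<Rightarrow> 'a \<Rightarrow> 'a \<Rightarrow> bool" where
  "factors_through C m n \<longleftrightarrow> (\<exists>h \<in> Hom C (Dom C m) (Dom C n). m = Comp C n h)"

definition MonInto :: "('o, 'a, 'x) mono_category_scheme \<Rightarrow> 'o \<Rightarrow> 'a set" where
  "MonInto C X = {m \<in> Mon C. Cod C m = X}"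

definition subobj_equiv :: "('o, 'a, 'x) mono_category_scheme \<Rightarrow> 'o \<Rightarrow> ('a \<times> 'a) set" where
  "subobj_equiv C X =
     {(m, n). m \<in> MonInto C X \<and> n \<in> MonInto C X \<and> factors_through C m n \<and> factors_through C n m}"

definition subobj :: "('o, 'a, 'x) mono_category_scheme \<Rightarrow> 'a \<Rightarrow> 'a set" where
  "subobj C m = subobj_equiv C (Cod C m) `` {m}"

definition Sub :: "('o, 'a, 'x) mono_category_scheme \<Rightarrow> 'o \<Rightarrow> 'a set gorder" where
  "Sub C X =
     \<lparr> carrier = MonInto C X // subobj_equiv C X,
       eq = (=),
       le = (\<lambda>S T. \<exists>m \<in> S. \<exists>n \<in> T. factors_through C m n) \<rparr>"

text \<open>
  The pullback \<open>f\<^sup>* S\<close> is the class of all pullbacks along \<open>f\<close> of representatives of \<open>S\<close>.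
\<close>

definition pb :: "('o, 'a, 'x) mono_category_scheme \<Rightarrow> 'a \<Rightarrow> 'a set \<Rightarrow> 'a set" where
  "pb C f S = {m. \<exists>n \<in> S. \<exists>g. is_pullback C f n m g}"

definition exists_along :: "('o, 'a, 'x) mono_category_scheme \<Rightarrow> 'a \<Rightarrow> 'a set \<Rightarrow> 'a set" where
  "exists_along C f S = (THE T. T \<in> carrier (Sub C (Cod C f)) \<and>
     (\<forall>U \<in> carrier (Sub C (Cod C f)).
        T \<sqsubseteq>\<^bsub>Sub C (Cod C f)\<^esub> U \<longleftrightarrow> S \<sqsubseteq>\<^bsub>Sub C (Dom C f)\<^esub> pb C f U))"

section \<open>Boolean modal categories\<close>

definition preserves_finite_joins ::
  "('s, 'x) gorder_scheme \<Rightarrow> ('t, 'y) gorder_scheme \<Rightarrow> ('s \<Rightarrow> 't) \<Rightarrow> bool"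
where
  "preserves_finite_joins L K h \<longleftrightarrow>
     (\<forall>A s. finite A \<and> A \<subseteq> carrier L \<and> is_lub L s A \<longrightarrow> is_lub K (h s) (h ` A))"

locale f_coherent_category = f_regular_category C
  for C :: "('o, 'a, 'x) mono_category_scheme" +
  assumes finite_joins: "X \<in> Obj C \<Longrightarrow> finite A \<Longrightarrow> A \<subseteq> carrier (Sub C X) \<Longrightarrow>
      \<exists>S. is_lub (Sub C X) S A"
    and pb_finite_joins: "f \<in> Arr C \<Longrightarrow>
      preserves_finite_joins (Sub C (Cod C f)) (Sub C (Dom C f)) (pb C f)"

definition is_complement :: "('s, 'x) gorder_scheme \<Rightarrow> 's \<Rightarrow> 's \<Rightarrow> bool" where
  "is_complement L x y \<longleftrightarrow> x \<in> carrier L \<and> y \<in> carrier L \<and>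
     x \<squnion>\<^bsub>L\<^esub> y = \<top>\<^bsub>L\<^esub> \<and> x \<sqinter>\<^bsub>L\<^esub> y = \<bottom>\<^bsub>L\<^esub>"

locale boolean_lattice = bounded_lattice L for L (structure) +
  assumes distrib: "x \<in> carrier L \<Longrightarrow> y \<in> carrier L \<Longrightarrow> z \<in> carrier L \<Longrightarrow>
      x \<sqinter> (y \<squnion> z) = (x \<sqinter> y) \<squnion> (x \<sqinter> z)"
    and complemented: "x \<in> carrier L \<Longrightarrow> \<exists>y. is_complement L x y"

locale boolean_f_coherent_category = f_coherent_category C
  for C :: "('o, 'a, 'x) mono_category_scheme" +
  assumes boolean: "X \<in> Obj C \<Longrightarrow> boolean_lattice (Sub C X)"

record ('o, 'a) modal_category = "('o, 'a) mono_category" +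
  Dia :: "'o \<Rightarrow> 'a set \<Rightarrow> 'a set"

locale boolean_modal_category = boolean_f_coherent_category C
  for C :: "('o, 'a, 'x) modal_category_scheme" +
  assumes Dia_closed: "X \<in> Obj C \<Longrightarrow> S \<in> carrier (Sub C X) \<Longrightarrow> Dia C X S \<in> carrier (Sub C X)"
    and Dia_finite_joins: "X \<in> Obj C \<Longrightarrow> preserves_finite_joins (Sub C X) (Sub C X) (Dia C X)"
    and Dia_pb: "f \<in> Hom C X Y \<Longrightarrow> S \<in> carrier (Sub C Y) \<Longrightarrow>
      Dia C X (pb C f S) \<sqsubseteq>\<^bsub>Sub C X\<^esub> pb C f (Dia C Y S)"
    and Dia_Mon: "i \<in> Mon C \<Longrightarrow> i \<in> Hom C A X \<Longrightarrow> S \<in> carrier (Sub C X) \<Longrightarrow>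
      Dia C A (pb C i S) = pb C i (Dia C X (exists_along C i (pb C i S)))"

record ('o, 'a) modal_category_with_quotients = "('o, 'a) modal_category" +
  Quo :: "'a set"

text \<open>
  In \<open>Quo_Dia\<close>, \<open>P\<close> and \<open>P'\<close> are arbitrary products \<open>X \<times> Z\<close> and \<open>Y \<times> Z\<close>, and the equations
  for \<open>h\<close> say that \<open>h = q \<times> 1\<close>.
\<close>

locale boolean_modal_category_with_quotients = boolean_modal_category C
  for C :: "('o, 'a, 'x) modal_category_with_quotients_scheme" +
  assumes Quo_MonPerp: "Quo C \<subseteq> MonPerp C"
    and Quo_Dia: "q \<in> Quo C \<Longrightarrow> q \<in> Hom C X Y \<Longrightarrow>
      is_product C X Z P p1 p2 \<Longrightarrow> is_product C Y Z P' p1' p2' \<Longrightarrow>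
      h \<in> Hom C P P' \<Longrightarrow> Comp C p1' h = Comp C q p1 \<Longrightarrow> Comp C p2' h = p2 \<Longrightarrow>
      S \<in> carrier (Sub C P') \<Longrightarrow>
      Dia C P' S \<sqsubseteq>\<^bsub>Sub C P'\<^esub> exists_along C h (Dia C P (pb C h S))"

section \<open>Boolean modal quasi-pretoposes\<close>

definition is_disjoint_union ::
  "('o, 'a, 'x) modal_category_scheme \<Rightarrow> 'o \<Rightarrow> 'o \<Rightarrow> 'o \<Rightarrow> 'a \<Rightarrow> 'a \<Rightarrow> bool"
where
  "is_disjoint_union C A B U i j \<longleftrightarrow>
     U \<in> Obj C \<and> i \<in> Mon C \<and> i \<in> Hom C A U \<and> j \<in> Mon C \<and> j \<in> Hom C B U \<and>
     is_complement (Sub C U) (subobj C i) (subobj C j) \<and>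
     Dia C U (subobj C i) \<sqsubseteq>\<^bsub>Sub C U\<^esub> subobj C i \<and>
     Dia C U (subobj C j) \<sqsubseteq>\<^bsub>Sub C U\<^esub> subobj C j"

definition is_equivalence_relation ::
  "('o, 'a, 'x) category_scheme \<Rightarrow> 'o \<Rightarrow> 'o \<Rightarrow> 'a \<Rightarrow> 'a \<Rightarrow> bool"
where
  "is_equivalence_relation C X R r1 r2 \<longleftrightarrow>
     X \<in> Obj C \<and> R \<in> Obj C \<and> r1 \<in> Hom C R X \<and> r2 \<in> Hom C R X \<and>
     (\<exists>d \<in> Hom C X R. Comp C r1 d = Ident C X \<and> Comp C r2 d = Ident C X) \<and>
     (\<exists>s \<in> Hom C R R. Comp C r1 s = r2 \<and> Comp C r2 s = r1) \<and>
     (\<forall>u v. is_pullback C r2 r1 u v \<longrightarrow>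
        (\<exists>t \<in> Hom C (Dom C u) R. Comp C r1 t = Comp C r1 u \<and> Comp C r2 t = Comp C r2 v))"

definition is_kernel_pair :: "('o, 'a, 'x) category_scheme \<Rightarrow> 'a \<Rightarrow> 'a \<Rightarrow> 'a \<Rightarrow> bool" where
  "is_kernel_pair C q r1 r2 \<longleftrightarrow> is_pullback C q q r1 r2"

locale boolean_modal_quasi_pretopos = boolean_modal_category_with_quotients C
  for C :: "('o, 'a, 'x) modal_category_with_quotients_scheme" +
  assumes disjoint_unions: "A \<in> Obj C \<Longrightarrow> B \<in> Obj C \<Longrightarrow> \<exists>U i j. is_disjoint_union C A B U i j"
    and effective: "is_product C X X P p1 p2 \<Longrightarrow> r \<in> MonInto C P \<Longrightarrow>
      is_equivalence_relation C X (Dom C r) (Comp C p1 r) (Comp C p2 r) \<Longrightarrow>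
      \<exists>q \<in> Quo C. Dom C q = X \<and> is_kernel_pair C q (Comp C p1 r) (Comp C p2 r)"

definition FSub ::
  "('p, 'b, 'y) mono_category_scheme \<Rightarrow> ('o, 'a, 'p, 'b) cat_functor \<Rightarrow> 'a set \<Rightarrow> 'b set"
where
  "FSub D F S = (\<Union>m \<in> S. subobj D (FArr F m))"

locale boolean_modal_quasi_pretopos_morphism =
  source: boolean_modal_quasi_pretopos C + target: boolean_modal_quasi_pretopos D
  for C :: "('o, 'a, 'x) modal_category_with_quotients_scheme"
    and D :: "('p, 'b, 'y) modal_category_with_quotients_scheme" +
  fixes F :: "('o, 'a, 'p, 'b) cat_functor"
  assumes functoriality: "is_functor C D F"
    and finite_limits: "preserves_finite_limits C D F"
    and Mon: "FArr F ` Mon C \<subseteq> Mon D"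
    and MonPerp: "FArr F ` MonPerp C \<subseteq> MonPerp D"
    and finite_joins: "X \<in> Obj C \<Longrightarrow>
      preserves_finite_joins (Sub C X) (Sub D (FObj F X)) (FSub D F)"
    and Dia: "X \<in> Obj C \<Longrightarrow> S \<in> carrier (Sub C X) \<Longrightarrow>
      FSub D F (Dia C X S) = Dia D (FObj F X) (FSub D F S)"
    and Quo: "FArr F ` Quo C \<subseteq> Quo D"

definition Mon_conservative ::
  "('o, 'a, 'x) mono_category_scheme \<Rightarrow> ('p, 'b, 'y) mono_category_scheme \<Rightarrow>
   ('o, 'a, 'p, 'b) cat_functor \<Rightarrow> bool"
where
  "Mon_conservative C D F \<longleftrightarrow> (\<forall>X \<in> Obj C. inj_on (FSub D F) (carrier (Sub C X)))"

section \<open>The category of relational structures over a graph\<close>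

text \<open>
  Objects assign subsets of \<open>'u\<close> to the nodes and relations to the edges. Outside the graph these
  are required to be empty, and the components of an arrow are extensional, so that equality of
  objects and arrows is the intended one.
\<close>

record ('v, 'e, 'u) rel_object =
  node_set :: "'v \<Rightarrow> 'u set"
  edge_rel :: "'e \<Rightarrow> ('u \<times> 'u) set"

record ('v, 'e, 'u) rel_arrow =
  source_obj :: "('v, 'e, 'u) rel_object"
  target_obj :: "('v, 'e, 'u) rel_object"
  component :: "'v \<Rightarrow> 'u \<Rightarrow> 'u"

context
  fixes G :: "('v, 'e) pre_digraph"
begin

definition rel_objects :: "('v, 'e, 'u) rel_object set" where
  "rel_objects = {X.
     (\<forall>a. a \<notin> verts G \<longrightarrow> node_set X a = {}) \<and>
     (\<forall>k. k \<notin> arcs G \<longrightarrow> edge_rel X k = {}) \<and>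
     (\<forall>k \<in> arcs G. edge_rel X k \<subseteq> node_set X (tail G k) \<times> node_set X (head G k))}"

definition rel_arrows :: "('v, 'e, 'u) rel_arrow set" where
  "rel_arrows = {f. source_obj f \<in> rel_objects \<and> target_obj f \<in> rel_objects \<and>
     (\<forall>a. component f a \<in> node_set (source_obj f) a \<rightarrow>\<^sub>E node_set (target_obj f) a) \<and>
     (\<forall>k \<in> arcs G. \<forall>(s, t) \<in> edge_rel (source_obj f) k.
        (component f (tail G k) s, component f (head G k) t) \<in> edge_rel (target_obj f) k)}"

definition rel_ident :: "('v, 'e, 'u) rel_object \<Rightarrow> ('v, 'e, 'u) rel_arrow" where
  "rel_ident X = \<lparr> source_obj = X, target_obj = X, component = (\<lambda>a. \<lambda>x \<in> node_set X a. x) \<rparr>"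

definition rel_comp ::
  "('v, 'e, 'u) rel_arrow \<Rightarrow> ('v, 'e, 'u) rel_arrow \<Rightarrow> ('v, 'e, 'u) rel_arrow"
where
  "rel_comp g f = \<lparr> source_obj = source_obj f, target_obj = target_obj g,
     component = (\<lambda>a. compose (node_set (source_obj f) a) (component g a) (component f a)) \<rparr>"

definition rel_mon :: "('v, 'e, 'u) rel_arrow set" where
  "rel_mon = {m \<in> rel_arrows.
     (\<forall>a \<in> verts G. inj_on (component m a) (node_set (source_obj m) a)) \<and>
     (\<forall>k \<in> arcs G.
        \<forall>s \<in> node_set (source_obj m) (tail G k). \<forall>t \<in> node_set (source_obj m) (head G k).
        (s, t) \<in> edge_rel (source_obj m) k \<longleftrightarrow>
        (component m (tail G k) s, component m (head G k) t) \<in> edge_rel (target_obj m) k)}"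

definition rel_image :: "('v, 'e, 'u) rel_arrow \<Rightarrow> 'v \<Rightarrow> 'u set" where
  "rel_image m a = component m a ` node_set (source_obj m) a"

text \<open>
  Equivalent arrows in \<open>rel_mon\<close> have the same image, so the union in \<open>rel_extent\<close> is over equal
  sets; conversely, a family of subsets is the image of the arrows of exactly one subobject.
\<close>

definition rel_extent :: "('v, 'e, 'u) rel_arrow set \<Rightarrow> 'v \<Rightarrow> 'u set" where
  "rel_extent S a = (\<Union>m \<in> S. rel_image m a)"

definition rel_dia ::
  "('v, 'e, 'u) rel_object \<Rightarrow> ('v, 'e, 'u) rel_arrow set \<Rightarrow> ('v, 'e, 'u) rel_arrow set"
where
  "rel_dia X S = {n \<in> rel_mon. target_obj n = X \<and>
     (\<forall>a. rel_image n a = {s. \<exists>k \<in> arcs G. tail G k = a \<and>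
        (\<exists>t \<in> rel_extent S (head G k). (s, t) \<in> edge_rel X k)})}"

definition rel_quo :: "('v, 'e, 'u) rel_arrow set" where
  "rel_quo = {f \<in> rel_arrows.
     (\<forall>a \<in> verts G. component f a ` node_set (source_obj f) a = node_set (target_obj f) a) \<and>
     (\<forall>k \<in> arcs G. \<forall>(s, t) \<in> edge_rel (target_obj f) k. \<exists>(s', t') \<in> edge_rel (source_obj f) k.
        component f (tail G k) s' = s \<and> component f (head G k) t' = t)}"

definition Rel ::
  "(('v, 'e, 'u) rel_object, ('v, 'e, 'u) rel_arrow) modal_category_with_quotients"
where
  "Rel = \<lparr> Obj = rel_objects, Arr = rel_arrows, Dom = source_obj, Cod = target_obj,
     Ident = rel_ident, Comp = rel_comp, Mon = rel_mon, Dia = rel_dia, Quo = rel_quo \<rparr>"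

end

text \<open>
  HOL cannot quantify existentially over types, so the elements, nodes and edges of the relational
  structures representing a category are drawn from fixed infinite types, taken large compared
  with the cardinality of the given category.
\<close>

type_synonym ('o, 'a) universe = "(nat + 'o + 'a) set set"

end

theory Submission
  imports Defs "HOL-Library.Countable_Set" "HOL-Library.Nat_Bijection"
begin

text \<open>
  A point of a relational structure at a node is an ultraproduct of germs along sequences of arrows
  in countable fragments of the category. In a countable fragment, a sequence meeting all
  requirements (lifting along arrows of \<open>M\<^sup>\<bottom>\<close>, deciding covers) yields a flat functor to sets
  preserving images and unions, and there are enough such sequences to separate subobjects. Given a
  model and a point of \<open>\<Diamond>S\<close> in it, one builds generically a second model with a point in \<open>S\<close>,
  and with it the accessibility relation: its stages are spans of which one leg is
  possible at the other, the axioms on \<open>\<Diamond>\<close> say exactly that such spans may be refined, and the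
  quotient axiom lifts related pairs. Ultraproducts over the finite sets of arrows remove the
  restriction to a fragment. Nodes are the models obtained and edges the accessibility relations
  between them.
\<close>

section \<open>Limits and subobjects in f-regular categories\<close>

text \<open>A sequence of length omega can meet only countably many requests, hence the countable
  fragments. Ultraproducts are then taken of whole Kripke structures rather than of single models,
  so that successors and separating points can be chosen coordinatewise. The delicate point is the
  relation between two models. Limits and \<open>Mon\<close> are preserved only if it is induced
  along every arrow of \<open>Mon\<close>: related values under \<open>m\<close> must come from
  related points. This constrains a relation still under construction, whose points may enter
  \<open>m\<close> at a later stage. Hence the requests \<open>Restrict\<close>, each with three
  possible outcomes: the span itself moves into \<open>m\<close>, or the old point never enters
  \<open>m\<close>, or the new point is committed to the complement of \<open>m\<close>, which
  exists by Booleanness. The old model is finished and cannot be adapted, so a choice about the new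
  point has to follow a choice already made by the old one; genericity of the old sequence is what
  makes that choice available. Nothing singles out one relation between two given models, which is
  why the result is a multigraph.\<close>

definition is_terminal :: "('o, 'a, 'x) category_scheme \<Rightarrow> 'o \<Rightarrow> bool" where
  "is_terminal C T \<longleftrightarrow> T \<in> Obj C \<and> (\<forall>X \<in> Obj C. \<exists>!h. h \<in> Hom C X T)"

text \<open>Membership of a generalised element in a subobject. Subobjects of one object are
  compared through it as sets of generalised elements (\<open>Sub_le\<close>,
  \<open>Sub_leI\<close>, \<open>Sub_eqI\<close>), which replaces most manipulation of
  representatives.\<close>

definition lies_in :: "('o, 'a, 'x) category_scheme \<Rightarrow> 'a \<Rightarrow> 'a set \<Rightarrow> bool" where
  "lies_in C f S \<longleftrightarrow> (\<exists>m \<in> S. factors_through C f m)"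

lemma ex1_unique: "\<exists>!x. P x \<Longrightarrow> P a \<Longrightarrow> P b \<Longrightarrow> a = b"
  by blast

section \<open>Composition, factorisation and universal properties in a category\<close>

context category
begin

abbreviation cmp (infixr "\<cdot>" 70) where "g \<cdot> f \<equiv> Comp C g f"

lemma HomI: "f \<in> Arr C \<Longrightarrow> Dom C f = X \<Longrightarrow> Cod C f = Y \<Longrightarrow> f \<in> Hom C X Y"
  by (simp add: Hom_def)

lemma HomD: "f \<in> Hom C X Y \<Longrightarrow> f \<in> Arr C" "f \<in> Hom C X Y \<Longrightarrow> Dom C f = X"
  "f \<in> Hom C X Y \<Longrightarrow> Cod C f = Y"
  by (simp_all add: Hom_def)

lemma comp_arr [simp]:
  assumes "f \<in> Arr C" "g \<in> Arr C" "Cod C f = Dom C g"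
  shows "g \<cdot> f \<in> Arr C" "Dom C (g \<cdot> f) = Dom C f" "Cod C (g \<cdot> f) = Cod C g"
  using Comp_Hom[of f "Dom C f" "Cod C f" g "Cod C g"] assms by (auto simp: Hom_def)

lemma ident_arr [simp]:
  assumes "X \<in> Obj C"
  shows "Ident C X \<in> Arr C" "Dom C (Ident C X) = X" "Cod C (Ident C X) = X"
  using Ident_Hom[OF assms] by (auto simp: Hom_def)

lemma comp_ident [simp]: "f \<in> Arr C \<Longrightarrow> Dom C f = X \<Longrightarrow> f \<cdot> Ident C X = f"
  by (rule Comp_Ident[of _ _ "Cod C f"]) (simp add: Hom_def)

lemma ident_comp [simp]: "f \<in> Arr C \<Longrightarrow> Cod C f = X \<Longrightarrow> Ident C X \<cdot> f = f"
  by (rule Ident_Comp[of _ "Dom C f"]) (simp add: Hom_def)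

lemma comp_assoc [simp]:
  assumes "f \<in> Arr C" "g \<in> Arr C" "h \<in> Arr C" "Cod C f = Dom C g" "Cod C g = Dom C h"
  shows "(h \<cdot> g) \<cdot> f = h \<cdot> g \<cdot> f"
  using Comp_assoc[of f "Dom C f" "Cod C f" g "Cod C g" h "Cod C h"] assms
  by (simp add: Hom_def)

declare Dom_Obj [simp] Cod_Obj [simp]

lemma factors_throughI:
  "h \<in> Arr C \<Longrightarrow> Dom C h = Dom C m \<Longrightarrow> Cod C h = Dom C n \<Longrightarrow> m = n \<cdot> h \<Longrightarrow> factors_through C m n"
  by (auto simp: factors_through_def Hom_def)

lemma factors_throughE:
  assumes "factors_through C m n"
  obtains h where "h \<in> Arr C" "Dom C h = Dom C m" "Cod C h = Dom C n" "m = n \<cdot> h"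
  using assms by (auto simp: factors_through_def Hom_def)

lemma factors_refl: "m \<in> Arr C \<Longrightarrow> factors_through C m m"
  by (rule factors_throughI[of "Ident C (Dom C m)"]) auto

lemma factors_comp:
  assumes "factors_through C f n" "n \<in> Arr C" "g \<in> Arr C" "Cod C g = Dom C f"
  shows "factors_through C (f \<cdot> g) n"
proof -
  obtain h where h: "h \<in> Arr C" "Dom C h = Dom C f" "Cod C h = Dom C n" "f = n \<cdot> h"
    using assms(1) by (rule factors_throughE)
  show ?thesis unfolding h(4) using h(1-3) assms(2-) by (intro factors_throughI[of "h \<cdot> g"]) auto
qed

lemma factors_trans:
  assumes "factors_through C l m" "factors_through C m n" "n \<in> Arr C"
  shows "factors_through C l n"
proof -
  obtain h where h: "h \<in> Arr C" "Dom C h = Dom C l" "Cod C h = Dom C m" "l = m \<cdot> h"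
    using assms(1) by (rule factors_throughE)
  show ?thesis unfolding h(4) by (rule factors_comp[OF assms(2,3) h(1,3)])
qed

lemma monoD:
  assumes "is_mono C m" "f \<in> Arr C" "g \<in> Arr C" "Dom C f = Dom C g" "Cod C f = Dom C m" "Cod C g = Dom C m"
    "m \<cdot> f = m \<cdot> g"
  shows "f = g"
proof -
  have "Dom C f \<in> Obj C" "f \<in> Hom C (Dom C f) (Dom C m)" "g \<in> Hom C (Dom C f) (Dom C m)"
    using assms by (auto simp: Hom_def)
  with assms(1,7) show ?thesis unfolding is_mono_def by blast
qed

lemma is_pullbackD:
  assumes "is_pullback C f g p q"
  shows "f \<in> Arr C" "g \<in> Arr C" "p \<in> Arr C" "q \<in> Arr C" "Cod C f = Cod C g" "Dom C q = Dom C p"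
    "Cod C p = Dom C f" "Cod C q = Dom C g" "f \<cdot> p = g \<cdot> q"
  using assms unfolding is_pullback_def by auto

lemma is_pullback_ex1:
  assumes "is_pullback C f g p q" "T \<in> Obj C" "s \<in> Hom C T (Dom C f)" "t \<in> Hom C T (Dom C g)" "f \<cdot> s = g \<cdot> t"
  shows "\<exists>!h. h \<in> Hom C T (Dom C p) \<and> p \<cdot> h = s \<and> q \<cdot> h = t"
proof -
  have "\<forall>T \<in> Obj C. \<forall>s \<in> Hom C T (Dom C f). \<forall>t \<in> Hom C T (Dom C g). f \<cdot> s = g \<cdot> t \<longrightarrow>
      (\<exists>!h. h \<in> Hom C T (Dom C p) \<and> p \<cdot> h = s \<and> q \<cdot> h = t)"
    using assms(1) unfolding is_pullback_def by (elim conjE)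
  with assms(2-) show ?thesis by simp
qed

lemma is_pullback_fill:
  assumes "is_pullback C f g p q" "s \<in> Arr C" "t \<in> Arr C" "Dom C s = Dom C t"
    "Cod C s = Dom C f" "Cod C t = Dom C g" "f \<cdot> s = g \<cdot> t"
  obtains h where "h \<in> Arr C" "Dom C h = Dom C s" "Cod C h = Dom C p" "p \<cdot> h = s" "q \<cdot> h = t"
proof -
  have "Dom C s \<in> Obj C" "s \<in> Hom C (Dom C s) (Dom C f)" "t \<in> Hom C (Dom C s) (Dom C g)"
    using assms by (auto simp: Hom_def)
  from is_pullback_ex1[OF assms(1) this assms(7)]
  obtain h where "h \<in> Hom C (Dom C s) (Dom C p)" "p \<cdot> h = s" "q \<cdot> h = t" by (elim ex1E conjE)
  with that show ?thesis by (auto simp: Hom_def)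
qed

lemma is_pullback_unique:
  assumes "is_pullback C f g p q" "h \<in> Arr C" "k \<in> Arr C" "Dom C h = Dom C k"
    "Cod C h = Dom C p" "Cod C k = Dom C p" "p \<cdot> h = p \<cdot> k" "q \<cdot> h = q \<cdot> k"
  shows "h = k"
proof -
  note D = is_pullbackD[OF assms(1)]
  have "\<exists>!l. l \<in> Hom C (Dom C h) (Dom C p) \<and> p \<cdot> l = p \<cdot> h \<and> q \<cdot> l = q \<cdot> h"
  proof -
    have "f \<cdot> p \<cdot> h = (f \<cdot> p) \<cdot> h" using D(1-8) assms(2-5) by simp
    also have "\<dots> = g \<cdot> q \<cdot> h" unfolding D(9) using D(1-8) assms(2-5) by simp
    finally have "f \<cdot> p \<cdot> h = g \<cdot> q \<cdot> h" .
    moreover have "Dom C h \<in> Obj C" "p \<cdot> h \<in> Hom C (Dom C h) (Dom C f)" "q \<cdot> h \<in> Hom C (Dom C h) (Dom C g)"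
      using D assms by (auto simp: Hom_def)
    ultimately show ?thesis by (intro is_pullback_ex1[OF assms(1)])
  qed
  thus ?thesis by (rule ex1_unique) (use assms in \<open>auto simp: Hom_def\<close>)
qed

lemma is_productD:
  assumes "is_product C X Y P p q"
  shows "p \<in> Arr C" "q \<in> Arr C" "Dom C p = P" "Dom C q = P" "Cod C p = X" "Cod C q = Y" "P \<in> Obj C"
    "X \<in> Obj C" "Y \<in> Obj C"
  using assms unfolding is_product_def Hom_def by auto

lemma is_product_ex1:
  assumes "is_product C X Y P p q" "T \<in> Obj C" "s \<in> Hom C T X" "t \<in> Hom C T Y"
  shows "\<exists>!h. h \<in> Hom C T P \<and> p \<cdot> h = s \<and> q \<cdot> h = t"
proof -
  have "\<forall>T \<in> Obj C. \<forall>s \<in> Hom C T X. \<forall>t \<in> Hom C T Y.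
      (\<exists>!h. h \<in> Hom C T P \<and> p \<cdot> h = s \<and> q \<cdot> h = t)"
    using assms(1) unfolding is_product_def by (elim conjE)
  with assms(2-) show ?thesis by simp
qed

lemma is_product_fill:
  assumes "is_product C X Y P p q" "s \<in> Arr C" "t \<in> Arr C" "Dom C s = Dom C t"
    "Cod C s = X" "Cod C t = Y"
  obtains h where "h \<in> Arr C" "Dom C h = Dom C s" "Cod C h = P" "p \<cdot> h = s" "q \<cdot> h = t"
proof -
  have "Dom C s \<in> Obj C" "s \<in> Hom C (Dom C s) X" "t \<in> Hom C (Dom C s) Y"
    using assms by (auto simp: Hom_def)
  from is_product_ex1[OF assms(1) this]
  obtain h where "h \<in> Hom C (Dom C s) P" "p \<cdot> h = s" "q \<cdot> h = t" by (elim ex1E conjE)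
  with that show ?thesis by (auto simp: Hom_def)
qed

lemma is_product_unique:
  assumes "is_product C X Y P p q" "h \<in> Arr C" "k \<in> Arr C" "Dom C h = Dom C k"
    "Cod C h = P" "Cod C k = P" "p \<cdot> h = p \<cdot> k" "q \<cdot> h = q \<cdot> k"
  shows "h = k"
proof -
  note D = is_productD[OF assms(1)]
  have "\<exists>!l. l \<in> Hom C (Dom C h) P \<and> p \<cdot> l = p \<cdot> h \<and> q \<cdot> l = q \<cdot> h"
  proof -
    have "Dom C h \<in> Obj C" "p \<cdot> h \<in> Hom C (Dom C h) X" "q \<cdot> h \<in> Hom C (Dom C h) Y"
      using D assms by (auto simp: Hom_def)
    thus ?thesis by (rule is_product_ex1[OF assms(1)])
  qed
  thus ?thesis by (rule ex1_unique) (use assms in \<open>auto simp: Hom_def\<close>)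
qed

lemma is_equalizerD:
  assumes "is_equalizer C f g m"
  shows "f \<in> Arr C" "g \<in> Arr C" "m \<in> Arr C" "Dom C g = Dom C f" "Cod C g = Cod C f" "Cod C m = Dom C f"
    "f \<cdot> m = g \<cdot> m"
  using assms unfolding is_equalizer_def Hom_def by auto

lemma is_equalizer_ex1:
  assumes "is_equalizer C f g m" "T \<in> Obj C" "t \<in> Hom C T (Dom C f)" "f \<cdot> t = g \<cdot> t"
  shows "\<exists>!h. h \<in> Hom C T (Dom C m) \<and> m \<cdot> h = t"
proof -
  have "\<forall>T \<in> Obj C. \<forall>t \<in> Hom C T (Dom C f). f \<cdot> t = g \<cdot> t \<longrightarrow>
      (\<exists>!h. h \<in> Hom C T (Dom C m) \<and> m \<cdot> h = t)"
    using assms(1) unfolding is_equalizer_def by (elim conjE)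
  with assms(2-) show ?thesis by simp
qed

lemma is_equalizer_fill:
  assumes "is_equalizer C f g m" "s \<in> Arr C" "Cod C s = Dom C f" "f \<cdot> s = g \<cdot> s"
  obtains h where "h \<in> Arr C" "Dom C h = Dom C s" "Cod C h = Dom C m" "m \<cdot> h = s"
proof -
  have "Dom C s \<in> Obj C" "s \<in> Hom C (Dom C s) (Dom C f)"
    using assms by (auto simp: Hom_def)
  from is_equalizer_ex1[OF assms(1) this assms(4)]
  obtain h where "h \<in> Hom C (Dom C s) (Dom C m)" "m \<cdot> h = s" by (elim ex1E conjE)
  with that show ?thesis by (auto simp: Hom_def)
qed

lemma is_equalizer_mono:
  assumes "is_equalizer C f g m"
  shows "is_mono C m"
  unfolding is_mono_def
proof (intro conjI ballI impI)
  note D = is_equalizerD[OF assms]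
  show "m \<in> Arr C" by (rule D)
  fix T h k assume T: "T \<in> Obj C" and hk: "h \<in> Hom C T (Dom C m)" "k \<in> Hom C T (Dom C m)" "m \<cdot> h = m \<cdot> k"
  note hk' = HomD[OF hk(1)]
  have "f \<cdot> m \<cdot> h = (f \<cdot> m) \<cdot> h" using D(1-6) hk' by simp
  also have "\<dots> = g \<cdot> m \<cdot> h" unfolding D(7) using D(1-6) hk' by simp
  finally have "f \<cdot> m \<cdot> h = g \<cdot> m \<cdot> h" .
  moreover have "m \<cdot> h \<in> Hom C T (Dom C f)" using D(1-6) hk' by (simp add: Hom_def)
  ultimately have "\<exists>!l. l \<in> Hom C T (Dom C m) \<and> m \<cdot> l = m \<cdot> h"
    by (intro is_equalizer_ex1[OF assms T])
  thus "h = k" using hk by auto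
qed

end

section \<open>Terminal objects, products, equalisers and pullbacks as limits over finite
  graphs\<close>

context
  fixes C :: "('o, 'a, 'x) category_scheme"
  assumes cat: "category C" and lims: "has_finite_limits C"
begin

interpretation category C by (rule cat)

lemma ex_terminal: "\<exists>T. is_terminal C T"
proof -
  let ?J = "\<lparr>verts = {}, arcs = {}, tail = \<lambda>_. 0, head = \<lambda>_. 0\<rparr> :: (nat, nat) pre_digraph"
  have "fin_digraph ?J" by unfold_locales auto
  moreover have "is_diagram C ?J DO DA" for DO DA by (simp add: is_diagram_def)
  ultimately obtain L pr where L: "is_limit C ?J (\<lambda>_. undefined) (\<lambda>_. undefined) L pr"
    using lims unfolding has_finite_limits_def by blast
  have cone: "is_cone C ?J DO DA T t \<longleftrightarrow> T \<in> Obj C" for DO DA T t by (simp add: is_cone_def)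
  have "is_terminal C L" using L unfolding is_limit_def cone is_terminal_def by simp
  thus ?thesis by blast
qed

lemma ex_product:
  assumes "X \<in> Obj C" "Y \<in> Obj C"
  shows "\<exists>P p q. is_product C X Y P p q"
proof -
  let ?J = "\<lparr>verts = {0, 1}, arcs = {}, tail = \<lambda>_. 0, head = \<lambda>_. 0\<rparr> :: (nat, nat) pre_digraph"
  let ?D = "\<lambda>v::nat. if v = 0 then X else Y"
  have "fin_digraph ?J" by unfold_locales auto
  moreover have "is_diagram C ?J ?D DA" for DA using assms by (simp add: is_diagram_def)
  ultimately obtain L pr where L: "is_limit C ?J ?D (\<lambda>_. undefined) L pr"
    using lims unfolding has_finite_limits_def by blast
  have cone: "is_cone C ?J ?D (\<lambda>_. undefined) T t \<longleftrightarrow> T \<in> Obj C \<and> t 0 \<in> Hom C T X \<and> t 1 \<in> Hom C T Y" for T t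
    by (auto simp add: is_cone_def)
  have "is_cone C ?J ?D (\<lambda>_. undefined) L pr" using L unfolding is_limit_def by blast
  note c = this[unfolded cone]
  have "is_product C X Y L (pr 0) (pr 1)"
    unfolding is_product_def
  proof (intro conjI ballI)
    fix T s t assume "T \<in> Obj C" "s \<in> Hom C T X" "t \<in> Hom C T Y"
    hence "is_cone C ?J ?D (\<lambda>_. undefined) T (\<lambda>v. if v = 0 then s else t)"
      unfolding cone by auto
    with L have "\<exists>!h. h \<in> Hom C T L \<and> (\<forall>v\<in>verts ?J. pr v \<cdot> h = (if v = 0 then s else t))"
      unfolding is_limit_def by blast
    thus "\<exists>!h. h \<in> Hom C T L \<and> pr 0 \<cdot> h = s \<and> pr 1 \<cdot> h = t" by simp
  qed (use assms c in auto)
  thus ?thesis by blast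
qed

lemma ex_equalizer:
  assumes "f \<in> Arr C" "g \<in> Arr C" "Dom C f = Dom C g" "Cod C f = Cod C g"
  shows "\<exists>m. is_equalizer C f g m"
proof -
  let ?J = "\<lparr>verts = {0, 1}, arcs = {0, 1}, tail = \<lambda>_. 0, head = \<lambda>_. 1\<rparr> :: (nat, nat) pre_digraph"
  let ?D = "\<lambda>v::nat. if v = 0 then Dom C f else Cod C f"
  let ?A = "\<lambda>v::nat. if v = 0 then f else g"
  have "fin_digraph ?J" by unfold_locales auto
  moreover have "is_diagram C ?J ?D ?A" using assms by (simp add: is_diagram_def Hom_def)
  ultimately obtain L pr where L: "is_limit C ?J ?D ?A L pr"
    using lims unfolding has_finite_limits_def by blast
  have cone: "is_cone C ?J ?D ?A T t \<longleftrightarrow>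
    T \<in> Obj C \<and> t 0 \<in> Hom C T (Dom C f) \<and> t 1 \<in> Hom C T (Cod C f) \<and> f \<cdot> t 0 = t 1 \<and> g \<cdot> t 0 = t 1" for T t
    by (auto simp: is_cone_def)
  have c: "is_cone C ?J ?D ?A L pr" using L unfolding is_limit_def by blast
  note c' = c[unfolded cone]
  have "is_equalizer C f g (pr 0)"
    unfolding is_equalizer_def
  proof (intro conjI ballI impI)
    fix T s assume s: "T \<in> Obj C" "s \<in> Hom C T (Dom C f)" "f \<cdot> s = g \<cdot> s"
    hence "is_cone C ?J ?D ?A T (\<lambda>v. if v = 0 then s else f \<cdot> s)"
      unfolding cone using comp_arr[of s f] assms(1) by (auto simp: Hom_def)
    with L have "\<exists>!h. h \<in> Hom C T L \<and> (\<forall>v\<in>verts ?J. pr v \<cdot> h = (if v = 0 then s else f \<cdot> s))"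
      unfolding is_limit_def by blast
    hence ex: "\<exists>!h. h \<in> Hom C T L \<and> (\<forall>v\<in>{0,1}. pr v \<cdot> h = (if v = 0 then s else f \<cdot> s))"
      by (simp only: pre_digraph.select_convs)
    \<comment> \<open>The projection to the target of the parallel pair is forced by the one to its
      source, so the limit cone carries no more data than an equaliser.\<close>
    have "pr 1 \<cdot> h = f \<cdot> s" if h: "h \<in> Hom C T L" "pr 0 \<cdot> h = s" for h
    proof -
      have "pr 1 \<cdot> h = (f \<cdot> pr 0) \<cdot> h" using c' by simp
      also have "\<dots> = f \<cdot> pr 0 \<cdot> h" using h(1) c' assms(1) by (intro comp_assoc) (auto simp: Hom_def)
      finally show ?thesis using h by simp
    qed
    hence "\<And>h. (h \<in> Hom C T L \<and> (\<forall>v\<in>{0,1}. pr v \<cdot> h = (if v = 0 then s else f \<cdot> s)))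
      \<longleftrightarrow> (h \<in> Hom C T L \<and> pr 0 \<cdot> h = s)" by auto
    with ex have "\<exists>!h. h \<in> Hom C T L \<and> pr 0 \<cdot> h = s" by simp
    thus "\<exists>!h. h \<in> Hom C T (Dom C (pr 0)) \<and> pr 0 \<cdot> h = s" using c' by (simp add: Hom_def)
  qed (use assms c' in \<open>auto simp: Hom_def\<close>)
  thus ?thesis by blast
qed

lemma ex_pullback:
  assumes "f \<in> Arr C" "g \<in> Arr C" "Cod C f = Cod C g"
  shows "\<exists>p q. is_pullback C f g p q"
proof -
  obtain P p q where P: "is_product C (Dom C f) (Dom C g) P p q"
    using ex_product[of "Dom C f" "Dom C g"] assms by auto
  note D = is_productD[OF P]
  obtain m where m: "is_equalizer C (f \<cdot> p) (g \<cdot> q) m"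
    using ex_equalizer[of "f \<cdot> p" "g \<cdot> q"] D assms by auto
  note M = is_equalizerD[OF m]
  have M6: "Cod C m = P" using M(6) D assms by simp
  have "is_pullback C f g (p \<cdot> m) (q \<cdot> m)"
    unfolding is_pullback_def
  proof (intro conjI ballI impI)
    show "f \<cdot> p \<cdot> m = g \<cdot> q \<cdot> m" using M(7) D M(3) M6 assms by simp
    fix T s t assume st: "T \<in> Obj C" "s \<in> Hom C T (Dom C f)" "t \<in> Hom C T (Dom C g)" "f \<cdot> s = g \<cdot> t"
    note st' = HomD[OF st(2)] HomD[OF st(3)]
    obtain h where h: "h \<in> Arr C" "Dom C h = Dom C s" "Cod C h = P" "p \<cdot> h = s" "q \<cdot> h = t"
      by (rule is_product_fill[OF P, of s t]) (use st' in auto)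
    obtain k where k: "k \<in> Arr C" "Dom C k = Dom C h" "Cod C k = Dom C m" "m \<cdot> k = h"
      by (rule is_equalizer_fill[OF m, of h]) (use h D assms st in auto)
    show "\<exists>!h. h \<in> Hom C T (Dom C (p \<cdot> m)) \<and> (p \<cdot> m) \<cdot> h = s \<and> (q \<cdot> m) \<cdot> h = t"
    proof (rule ex1I[of _ k])
      show "k \<in> Hom C T (Dom C (p \<cdot> m)) \<and> (p \<cdot> m) \<cdot> k = s \<and> (q \<cdot> m) \<cdot> k = t"
        using k h D M6 M(3) st' by (auto simp: Hom_def)
      fix l assume l: "l \<in> Hom C T (Dom C (p \<cdot> m)) \<and> (p \<cdot> m) \<cdot> l = s \<and> (q \<cdot> m) \<cdot> l = t"
      hence l': "l \<in> Arr C" "Dom C l = T" "Cod C l = Dom C m" using D M6 M(3) by (auto simp: Hom_def)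
      have "m \<cdot> l = h"
        by (rule is_product_unique[OF P]) (use l l' h D M6 M(3) st' in auto)
      thus "l = k"
        by (intro monoD[OF is_equalizer_mono[OF m], of l k]) (use l' k h st' in auto)
    qed
  qed (use assms D M(3) M6 in auto)
  thus ?thesis by blast
qed

end

section \<open>Subobjects, their pullbacks and images in f-regular categories\<close>

context f_regular_category
begin

lemma Mon_arr [simp]: "m \<in> Mon C \<Longrightarrow> m \<in> Arr C"
  using Mon_mono unfolding is_mono_def by blast

lemma MonPerp_arr [simp]: "e \<in> MonPerp C \<Longrightarrow> e \<in> Arr C"
  unfolding MonPerp_def by blast

lemmas Mon_cancel = monoD[OF Mon_mono]

lemma is_equalizer_Mon: "is_equalizer C f g m \<Longrightarrow> m \<in> Mon C"
  using regular_mono_Mon unfolding is_regular_mono_def by blast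

lemmas ex_limits = ex_terminal[OF category_axioms finite_limits]
  ex_product[OF category_axioms finite_limits]
  ex_equalizer[OF category_axioms finite_limits]
  ex_pullback[OF category_axioms finite_limits]

lemma subobj_mem:
  "n \<in> subobj C m \<longleftrightarrow> m \<in> Mon C \<and> n \<in> Mon C \<and> Cod C n = Cod C m \<and>
     factors_through C m n \<and> factors_through C n m"
  by (auto simp: subobj_def subobj_equiv_def MonInto_def)

lemma subobj_refl: "m \<in> Mon C \<Longrightarrow> m \<in> subobj C m"
  by (simp add: subobj_mem factors_refl)

lemma carrier_Sub: "S \<in> carrier (Sub C X) \<longleftrightarrow> (\<exists>m \<in> Mon C. Cod C m = X \<and> S = subobj C m)"
  by (auto simp: Sub_def quotient_def MonInto_def subobj_def)

lemma subobj_closed: "m \<in> Mon C \<Longrightarrow> Cod C m = X \<Longrightarrow> subobj C m \<in> carrier (Sub C X)"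
  by (auto simp: carrier_Sub)

lemma subobj_cong: "n \<in> subobj C m \<Longrightarrow> subobj C n = subobj C m"
  unfolding set_eq_iff subobj_mem by (auto intro: factors_trans)

lemma carrierD:
  assumes "S \<in> carrier (Sub C X)" "m \<in> S"
  shows "m \<in> Mon C" "Cod C m = X" "S = subobj C m"
proof -
  obtain n where n: "n \<in> Mon C" "Cod C n = X" "S = subobj C n" using assms(1) by (auto simp: carrier_Sub)
  show "m \<in> Mon C" "Cod C m = X" using assms(2) n by (auto simp: subobj_mem)
  show "S = subobj C m" using subobj_cong[of m n] assms(2) n by simp
qed

lemma carrierE:
  assumes "S \<in> carrier (Sub C X)"
  obtains m where "m \<in> S" "m \<in> Mon C" "Cod C m = X" "S = subobj C m"
  using assms subobj_refl by (auto simp: carrier_Sub)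

lemma lies_in_subobj: "m \<in> Mon C \<Longrightarrow> lies_in C f (subobj C m) \<longleftrightarrow> factors_through C f m"
  unfolding lies_in_def using factors_trans subobj_refl by (auto simp: subobj_mem)

lemma lies_in_rep:
  assumes "S \<in> carrier (Sub C X)" "m \<in> S"
  shows "lies_in C f S \<longleftrightarrow> factors_through C f m"
  using carrierD[OF assms] lies_in_subobj by metis

lemma lies_inD:
  assumes "lies_in C f S" "S \<in> carrier (Sub C X)"
  shows "f \<in> Arr C" "Cod C f = X"
  using assms carrierD[OF assms(2)] unfolding lies_in_def factors_through_def Hom_def by force+

lemma lies_in_comp:
  assumes "lies_in C f S" "S \<in> carrier (Sub C X)" "g \<in> Arr C" "Cod C g = Dom C f"
  shows "lies_in C (f \<cdot> g) S"
  using assms carrierD[OF assms(2)] factors_comp unfolding lies_in_def by (meson Mon_arr)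

lemma Sub_le:
  assumes "S \<in> carrier (Sub C X)" "T \<in> carrier (Sub C X)" "m \<in> S"
  shows "S \<sqsubseteq>\<^bsub>Sub C X\<^esub> T \<longleftrightarrow> lies_in C m T"
proof
  assume "S \<sqsubseteq>\<^bsub>Sub C X\<^esub> T"
  then obtain m' n where "m' \<in> S" "n \<in> T" "factors_through C m' n" by (auto simp: Sub_def)
  moreover have "factors_through C m m'"
    using carrierD(3)[OF assms(1) \<open>m' \<in> S\<close>] assms(3) by (simp add: subobj_mem)
  ultimately show "lies_in C m T"
    unfolding lies_in_def using factors_trans carrierD(1)[OF assms(2)] by (meson Mon_arr)
qed (use assms in \<open>auto simp: Sub_def lies_in_def\<close>)

lemma Sub_leD:
  assumes "S \<sqsubseteq>\<^bsub>Sub C X\<^esub> T" "S \<in> carrier (Sub C X)" "T \<in> carrier (Sub C X)" "lies_in C f S"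
  shows "lies_in C f T"
proof -
  obtain m where m: "m \<in> S" "factors_through C f m" using assms(4) by (auto simp: lies_in_def)
  have "lies_in C m T" using Sub_le[OF assms(2,3) m(1)] assms(1) by simp
  then obtain n where n: "n \<in> T" "factors_through C m n" by (auto simp: lies_in_def)
  have "n \<in> Arr C" using carrierD(1)[OF assms(3) n(1)] by simp
  thus ?thesis using factors_trans[OF m(2) n(2)] n(1) by (auto simp: lies_in_def)
qed

lemma Sub_leI:
  assumes "S \<in> carrier (Sub C X)" "T \<in> carrier (Sub C X)"
    "\<And>f. f \<in> Arr C \<Longrightarrow> Cod C f = X \<Longrightarrow> lies_in C f S \<Longrightarrow> lies_in C f T"
  shows "S \<sqsubseteq>\<^bsub>Sub C X\<^esub> T"
proof -
  obtain m where m: "m \<in> S" "m \<in> Mon C" "Cod C m = X" "S = subobj C m" using assms(1) by (rule carrierE)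
  have "lies_in C m S" unfolding lies_in_def using m(1) factors_refl[of m] m(2) by auto
  thus ?thesis using assms(3) m Sub_le[OF assms(1,2) m(1)] by simp
qed

lemma Sub_eqI:
  assumes "S \<in> carrier (Sub C X)" "T \<in> carrier (Sub C X)"
    "\<And>f. f \<in> Arr C \<Longrightarrow> Cod C f = X \<Longrightarrow> lies_in C f S \<longleftrightarrow> lies_in C f T"
  shows "S = T"
proof -
  obtain m where m: "m \<in> S" "m \<in> Mon C" "Cod C m = X" "S = subobj C m" using assms(1) by (rule carrierE)
  obtain n where n: "n \<in> T" "n \<in> Mon C" "Cod C n = X" "T = subobj C n" using assms(2) by (rule carrierE)
  have "factors_through C m n"
    using assms(3)[of m] m n lies_in_subobj factors_refl by auto
  moreover have "factors_through C n m"
    using assms(3)[of n] m n lies_in_subobj factors_refl by auto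
  ultimately have "n \<in> subobj C m" using m n by (simp add: subobj_mem)
  thus ?thesis using subobj_cong m n by metis
qed

lemma Sub_antisym:
  assumes "S \<in> carrier (Sub C X)" "T \<in> carrier (Sub C X)"
    "S \<sqsubseteq>\<^bsub>Sub C X\<^esub> T" "T \<sqsubseteq>\<^bsub>Sub C X\<^esub> S"
  shows "S = T"
  using assms Sub_leD by (intro Sub_eqI) blast+

lemma Sub_refl: "S \<in> carrier (Sub C X) \<Longrightarrow> S \<sqsubseteq>\<^bsub>Sub C X\<^esub> S"
  by (rule Sub_leI)

lemma Sub_trans:
  assumes "S \<sqsubseteq>\<^bsub>Sub C X\<^esub> T" "T \<sqsubseteq>\<^bsub>Sub C X\<^esub> U"
    "S \<in> carrier (Sub C X)" "T \<in> carrier (Sub C X)" "U \<in> carrier (Sub C X)"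
  shows "S \<sqsubseteq>\<^bsub>Sub C X\<^esub> U"
  using assms Sub_leD by (intro Sub_leI) blast+

text \<open>\<open>pb\<close> collects every pullback of every representative; here this set turns
  out to be a single class. One inclusion compares two pullbacks through their universal properties;
  the other shows that an arrow isomorphic to \<open>p\<close> over its codomain is again a pullback
  of \<open>n\<close>.\<close>

lemma pb_subobj:
  assumes "is_pullback C f n p q" "n \<in> Mon C"
  shows "pb C f (subobj C n) = subobj C p"
proof -
  note D = is_pullbackD[OF assms(1)]
  have p: "p \<in> Mon C" using Mon_pullback assms by blast
  have fac: "factors_through C m p"
    if "n' \<in> subobj C n" "is_pullback C f n' m g" for n' m g
  proof -
    have n': "n' \<in> Mon C" "Cod C n' = Cod C n" "factors_through C n' n"
      using that by (auto simp: subobj_mem)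
    note D' = is_pullbackD[OF that(2)]
    obtain h where h: "h \<in> Arr C" "Dom C h = Dom C n'" "Cod C h = Dom C n" "n' = n \<cdot> h"
      using n'(3) by (rule factors_throughE)
    have *: "f \<cdot> m = n \<cdot> h \<cdot> g"
    proof -
      have "f \<cdot> m = n' \<cdot> g" by (rule D'(9))
      also have "\<dots> = (n \<cdot> h) \<cdot> g" by (subst h(4)) (rule refl)
      also have "\<dots> = n \<cdot> h \<cdot> g" using D(1-8) h(1-3) D'(1-8) by simp
      finally show ?thesis .
    qed
    obtain k where "k \<in> Arr C" "Dom C k = Dom C m" "Cod C k = Dom C p" "p \<cdot> k = m"
      by (rule is_pullback_fill[OF assms(1) _ _ _ _ _ *]) (use D'(1-8) h(1-3) in auto)
    thus ?thesis by (intro factors_throughI[of k]) auto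
  qed
  show ?thesis
  proof (rule Set.set_eqI, rule iffI)
    fix m assume "m \<in> pb C f (subobj C n)"
    then obtain n' g where n': "n' \<in> subobj C n" "is_pullback C f n' m g" by (auto simp: pb_def)
    have n: "n \<in> subobj C n'" "n' \<in> Mon C" using n'(1) by (auto simp: subobj_mem)
    have m: "m \<in> Mon C" using Mon_pullback[OF n'(2)] n by blast
    note D' = is_pullbackD[OF n'(2)]
    have "factors_through C p m"
    proof -
      have nn: "factors_through C n n'" using n by (auto simp: subobj_mem)
      obtain h where h: "h \<in> Arr C" "Dom C h = Dom C n" "Cod C h = Dom C n'" "n = n' \<cdot> h"
        using nn by (rule factors_throughE)
      have *: "f \<cdot> p = n' \<cdot> h \<cdot> q"
      proof -
        have "f \<cdot> p = n \<cdot> q" by (rule D(9))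
        also have "\<dots> = (n' \<cdot> h) \<cdot> q" by (subst h(4)) (rule refl)
        also have "\<dots> = n' \<cdot> h \<cdot> q" using D(1-8) h(1-3) D'(1-8) by simp
        finally show ?thesis .
      qed
      obtain k where "k \<in> Arr C" "Dom C k = Dom C p" "Cod C k = Dom C m" "m \<cdot> k = p"
        by (rule is_pullback_fill[OF n'(2) _ _ _ _ _ *]) (use D(1-8) D'(1-8) h(1-3) in auto)
      thus ?thesis by (intro factors_throughI[of k]) auto
    qed
    thus "m \<in> subobj C p" using fac[OF n'] p m D D' by (simp add: subobj_mem)
  next
    fix m assume "m \<in> subobj C p"
    hence m: "m \<in> Mon C" "Cod C m = Cod C p" "factors_through C m p" "factors_through C p m"
      by (auto simp: subobj_mem)
    obtain h where h: "h \<in> Arr C" "Dom C h = Dom C m" "Cod C h = Dom C p" "m = p \<cdot> h"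
      using m(3) by (rule factors_throughE)
    obtain k where k: "k \<in> Arr C" "Dom C k = Dom C p" "Cod C k = Dom C m" "p = m \<cdot> k"
      using m(4) by (rule factors_throughE)
    have "p \<cdot> h \<cdot> k = p \<cdot> Ident C (Dom C p)"
    proof -
      have "p \<cdot> h \<cdot> k = (p \<cdot> h) \<cdot> k" using D(3) h(1-3) k(1-3) by simp
      also have "\<dots> = p" unfolding h(4)[symmetric] k(4)[symmetric] ..
      finally show ?thesis using D(3) by simp
    qed
    hence hk: "h \<cdot> k = Ident C (Dom C p)"
      by (rule Mon_cancel[OF p, rotated -1]) (use D(3) h(1-3) k(1-3) in auto)
    \<comment> \<open>The universal property of \<open>p\<close> is carried over to \<open>m\<close>
      along the isomorphism \<open>h\<close>, whose inverse is \<open>k\<close>; the second leg is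
      therefore precomposed with \<open>h\<close>.\<close>
    have "is_pullback C f n m (q \<cdot> h)"
      unfolding is_pullback_def
    proof (intro conjI ballI impI)
      show "f \<cdot> m = n \<cdot> q \<cdot> h"
      proof -
        have "f \<cdot> m = (f \<cdot> p) \<cdot> h" unfolding h(4) using D(1-8) h(1-3) by simp
        also have "\<dots> = n \<cdot> q \<cdot> h" unfolding D(9) using D(1-8) h(1-3) by simp
        finally show ?thesis .
      qed
      fix T s t assume st: "T \<in> Obj C" "s \<in> Hom C T (Dom C f)" "t \<in> Hom C T (Dom C n)" "f \<cdot> s = n \<cdot> t"
      note st' = HomD[OF st(2)] HomD[OF st(3)]
      obtain l where l: "l \<in> Arr C" "Dom C l = Dom C s" "Cod C l = Dom C p" "p \<cdot> l = s" "q \<cdot> l = t"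
        by (rule is_pullback_fill[OF assms(1) _ _ _ _ _ st(4)]) (use st' in auto)
      show "\<exists>!h'. h' \<in> Hom C T (Dom C m) \<and> m \<cdot> h' = s \<and> (q \<cdot> h) \<cdot> h' = t"
      proof (rule ex1I[of _ "k \<cdot> l"])
        have "m \<cdot> k \<cdot> l = (m \<cdot> k) \<cdot> l" using m(1) k(1-3) l(1-3) by simp
        also have "\<dots> = s" unfolding k(4)[symmetric] by (rule l(4))
        finally have 1: "m \<cdot> k \<cdot> l = s" .
        have "(q \<cdot> h) \<cdot> k \<cdot> l = q \<cdot> (h \<cdot> k) \<cdot> l"
          using D(1-8) h(1-3) k(1-3) l(1-3) by simp
        also have "\<dots> = t" unfolding hk using l D(3) by simp
        finally have 2: "(q \<cdot> h) \<cdot> k \<cdot> l = t" .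
        show "k \<cdot> l \<in> Hom C T (Dom C m) \<and> m \<cdot> k \<cdot> l = s \<and> (q \<cdot> h) \<cdot> k \<cdot> l = t"
          using 1 2 k(1-3) l(1-3) st' by (auto simp: Hom_def)
        fix h' assume h': "h' \<in> Hom C T (Dom C m) \<and> m \<cdot> h' = s \<and> (q \<cdot> h) \<cdot> h' = t"
        hence a: "h' \<in> Arr C" "Dom C h' = T" "Cod C h' = Dom C m" "m \<cdot> h' = s" by (auto simp: Hom_def)
        show "h' = k \<cdot> l"
          by (rule Mon_cancel[OF m(1)]) (use a 1 k(1-3) l(1-3) st' in auto)
      qed
    qed (use D(1-8) h(1-3) m in auto)
    moreover have "n \<in> subobj C n" using assms(2) by (rule subobj_refl)
    ultimately show "m \<in> pb C f (subobj C n)" by (auto simp: pb_def)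
  qed
qed

lemma pb_closed:
  assumes "f \<in> Arr C" "S \<in> carrier (Sub C (Cod C f))"
  shows "pb C f S \<in> carrier (Sub C (Dom C f))"
proof -
  obtain n where n: "n \<in> S" "n \<in> Mon C" "Cod C n = Cod C f" "S = subobj C n"
    using assms(2) by (rule carrierE)
  obtain p q where p: "is_pullback C f n p q" using ex_limits(4)[of f n] assms n by auto
  show ?thesis unfolding n(4) pb_subobj[OF p n(2)]
    using is_pullbackD[OF p] Mon_pullback[OF p n(2)] by (intro subobj_closed)
qed

text \<open>The universal property of the pullback square, restated so that the square disappears.
  Later arguments about \<open>pb\<close> go through this equivalence and choose no
  pullbacks.\<close>

lemma lies_in_pb:
  assumes "f \<in> Arr C" "S \<in> carrier (Sub C (Cod C f))" "g \<in> Arr C" "Cod C g = Dom C f"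
  shows "lies_in C g (pb C f S) \<longleftrightarrow> lies_in C (f \<cdot> g) S"
proof -
  obtain n where n: "n \<in> S" "n \<in> Mon C" "Cod C n = Cod C f" "S = subobj C n"
    using assms(2) by (rule carrierE)
  obtain p q where p: "is_pullback C f n p q" using ex_limits(4)[of f n] assms n by auto
  note D = is_pullbackD[OF p]
  have "factors_through C g p \<longleftrightarrow> factors_through C (f \<cdot> g) n"
  proof
    assume "factors_through C g p"
    then obtain h where h: "h \<in> Arr C" "Dom C h = Dom C g" "Cod C h = Dom C p" "g = p \<cdot> h"
      by (rule factors_throughE)
    have "f \<cdot> g = (f \<cdot> p) \<cdot> h" unfolding h(4) using D(1-8) h(1-3) by simp
    also have "\<dots> = n \<cdot> q \<cdot> h" unfolding D(9) using D(1-8) h(1-3) by simp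
    finally show "factors_through C (f \<cdot> g) n"
      by (intro factors_throughI[of "q \<cdot> h"]) (use D(1-8) h(1-3) assms in auto)
  next
    assume "factors_through C (f \<cdot> g) n"
    then obtain h where h: "h \<in> Arr C" "Dom C h = Dom C (f \<cdot> g)" "Cod C h = Dom C n" "f \<cdot> g = n \<cdot> h"
      by (rule factors_throughE)
    obtain k where "k \<in> Arr C" "Dom C k = Dom C g" "Cod C k = Dom C p" "p \<cdot> k = g"
      by (rule is_pullback_fill[OF p _ _ _ _ _ h(4)]) (use assms h(1-3) in auto)
    thus "factors_through C g p" by (intro factors_throughI[of k]) auto
  qed
  thus ?thesis unfolding n(4) pb_subobj[OF p n(2)]
    using lies_in_subobj n(2) Mon_pullback[OF p n(2)] by simp
qed

subsection \<open>Images\<close>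

text \<open>The factorisation is chosen, but the class is not: \<open>img_le_iff\<close>
  characterises it as the least subobject in which \<open>f\<close> lies.\<close>

definition img :: "'a \<Rightarrow> 'a set" where
  "img f = subobj C (SOME m. m \<in> Mon C \<and> (\<exists>e \<in> MonPerp C. Cod C e = Dom C m \<and> f = m \<cdot> e))"

lemma imgE:
  assumes "f \<in> Arr C"
  obtains m e where "m \<in> Mon C" "e \<in> MonPerp C" "Cod C e = Dom C m" "f = m \<cdot> e" "img f = subobj C m"
proof -
  define m where "m = (SOME m. m \<in> Mon C \<and> (\<exists>e \<in> MonPerp C. Cod C e = Dom C m \<and> f = m \<cdot> e))"
  have "\<exists>m. m \<in> Mon C \<and> (\<exists>e \<in> MonPerp C. Cod C e = Dom C m \<and> f = m \<cdot> e)"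
    using factorization[OF assms] by blast
  hence "m \<in> Mon C \<and> (\<exists>e \<in> MonPerp C. Cod C e = Dom C m \<and> f = m \<cdot> e)"
    unfolding m_def by (rule someI_ex)
  thus ?thesis using that unfolding img_def m_def[symmetric] by blast
qed

lemma img_closed [simp]:
  assumes "f \<in> Arr C" "Cod C f = X"
  shows "img f \<in> carrier (Sub C X)"
proof -
  obtain m e where m: "m \<in> Mon C" "e \<in> MonPerp C" "Cod C e = Dom C m" "f = m \<cdot> e" "img f = subobj C m"
    using assms(1) by (rule imgE)
  have "Cod C m = X" using assms(2) m(1-3) unfolding m(4) by simp
  thus ?thesis unfolding m(5) using m(1) by (rule subobj_closed[rotated])
qed

lemma perp_fill:
  assumes "e \<in> MonPerp C" "m \<in> Mon C" "u \<in> Arr C" "v \<in> Arr C" "Dom C u = Dom C e" "Cod C u = Dom C m"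
    "Dom C v = Cod C e" "Cod C v = Cod C m" "m \<cdot> u = v \<cdot> e"
  obtains d where "d \<in> Arr C" "Dom C d = Cod C e" "Cod C d = Dom C m" "d \<cdot> e = u" "m \<cdot> d = v"
proof -
  have "orthogonal C e m" using assms(1,2) unfolding MonPerp_def by blast
  moreover have "u \<in> Hom C (Dom C e) (Dom C m)" "v \<in> Hom C (Cod C e) (Cod C m)"
    using assms by (auto simp: Hom_def)
  ultimately have "\<exists>!d. d \<in> Hom C (Cod C e) (Dom C m) \<and> d \<cdot> e = u \<and> m \<cdot> d = v"
    unfolding orthogonal_def using assms(9) by simp
  with that show ?thesis by (auto simp: Hom_def)
qed

text \<open>Arrows of \<open>MonPerp\<close> act as covers: membership in an
  \<open>Mon\<close>-subobject may be tested after composing with one, because the diagonal filler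
  against \<open>m\<close> descends the factorisation to \<open>f\<close>.\<close>

lemma lies_in_perp:
  assumes "e \<in> MonPerp C" "f \<in> Arr C" "Dom C f = Cod C e" "S \<in> carrier (Sub C (Cod C f))"
    "lies_in C (f \<cdot> e) S"
  shows "lies_in C f S"
proof -
  obtain m where m: "m \<in> S" "m \<in> Mon C" "Cod C m = Cod C f" "S = subobj C m"
    using assms(4) by (rule carrierE)
  have "factors_through C (f \<cdot> e) m" using assms(5) m lies_in_subobj by simp
  then obtain h where h: "h \<in> Arr C" "Dom C h = Dom C (f \<cdot> e)" "Cod C h = Dom C m" "f \<cdot> e = m \<cdot> h"
    by (rule factors_throughE)
  obtain d where "d \<in> Arr C" "Dom C d = Cod C e" "Cod C d = Dom C m" "m \<cdot> d = f"
    by (rule perp_fill[OF assms(1) m(2) h(1) assms(2) _ _ _ _ h(4)[symmetric]])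
      (use assms(1-3) h(1-3) m in auto)
  hence "factors_through C f m" using assms by (intro factors_throughI[of d]) auto
  thus ?thesis using lies_in_subobj m by simp
qed

text \<open>Generalised elements lift through \<open>e\<close> after passing to a cover
  \<open>t\<close>, namely the pullback of \<open>e\<close>; stability of \<open>MonPerp\<close>
  under pullback is what makes \<open>t\<close> a cover.\<close>

lemma perp_lift:
  assumes "e \<in> MonPerp C" "f \<in> Arr C" "Cod C f = Cod C e"
  obtains t g where "t \<in> MonPerp C" "g \<in> Arr C" "Cod C t = Dom C f" "Dom C g = Dom C t"
    "Cod C g = Dom C e" "e \<cdot> g = f \<cdot> t"
proof -
  obtain p q where p: "is_pullback C f e p q" using ex_limits(4)[of f e] assms by auto
  show ?thesis using that[of p q] MonPerp_pullback[OF p assms(1)] is_pullbackD[OF p] by simp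
qed

lemma lies_in_img: "f \<in> Arr C \<Longrightarrow> lies_in C f (img f)"
proof (erule imgE)
  fix m e assume m: "m \<in> Mon C" "e \<in> MonPerp C" "Cod C e = Dom C m" "f = m \<cdot> e" "img f = subobj C m"
  have "factors_through C (m \<cdot> e) m" by (rule factors_throughI[of e]) (use m(1-3) in auto)
  thus "lies_in C f (img f)" unfolding m(5) lies_in_subobj[OF m(1)] using m(4) by simp
qed

lemma img_le_iff:
  assumes "f \<in> Arr C" "Cod C f = X" "S \<in> carrier (Sub C X)"
  shows "img f \<sqsubseteq>\<^bsub>Sub C X\<^esub> S \<longleftrightarrow> lies_in C f S"
proof
  assume "img f \<sqsubseteq>\<^bsub>Sub C X\<^esub> S"
  thus "lies_in C f S" using Sub_leD lies_in_img assms img_closed by blast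
next
  assume f: "lies_in C f S"
  obtain m e where m: "m \<in> Mon C" "e \<in> MonPerp C" "Cod C e = Dom C m" "f = m \<cdot> e" "img f = subobj C m"
    using assms(1) by (rule imgE)
  have X: "Cod C m = X" using assms(2) m(1-3) unfolding m(4) by simp
  have "lies_in C (m \<cdot> e) S" using f unfolding m(4) .
  hence "lies_in C m S"
    by (rule lies_in_perp[OF m(2), rotated -1]) (use m(1-3) X assms(3) in auto)
  thus "img f \<sqsubseteq>\<^bsub>Sub C X\<^esub> S"
    using Sub_le[OF subobj_closed[OF m(1) X] assms(3) subobj_refl[OF m(1)]] m(5) by simp
qed

text \<open>With \<open>lies_in_imgI\<close> this is the forcing clause of the existential
  quantifier: to lie in an image is to lift after passing to a cover.\<close>

lemma lies_in_imgE:
  assumes "f \<in> Arr C" "lies_in C g (img f)"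
  obtains t k where "t \<in> MonPerp C" "k \<in> Arr C" "Cod C t = Dom C g" "Dom C k = Dom C t"
    "Cod C k = Dom C f" "g \<cdot> t = f \<cdot> k"
proof -
  obtain m e where m: "m \<in> Mon C" "e \<in> MonPerp C" "Cod C e = Dom C m" "f = m \<cdot> e" "img f = subobj C m"
    using assms(1) by (rule imgE)
  have "factors_through C g m" using assms(2) m lies_in_subobj by simp
  then obtain h where h: "h \<in> Arr C" "Dom C h = Dom C g" "Cod C h = Dom C m" "g = m \<cdot> h"
    by (rule factors_throughE)
  obtain t k where k: "t \<in> MonPerp C" "k \<in> Arr C" "Cod C t = Dom C h" "Dom C k = Dom C t"
    "Cod C k = Dom C e" "e \<cdot> k = h \<cdot> t"
    by (rule perp_lift[OF m(2) h(1)]) (use h(1-3) m(1-3) in auto)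
  have "g \<cdot> t = m \<cdot> h \<cdot> t" unfolding h(4) using m(1) h(1-3) k(1-5) by simp
  also have "\<dots> = f \<cdot> k" unfolding m(4) k(6)[symmetric] using m(1-3) k(1-5) by simp
  finally show ?thesis using that[of t k] k m(1-3) h(2) by (simp add: m(4))
qed

lemma lies_in_imgI:
  assumes "f \<in> Arr C" "g \<in> Arr C" "Cod C g = Cod C f" "t \<in> MonPerp C" "k \<in> Arr C" "Cod C t = Dom C g"
    "Dom C k = Dom C t" "Cod C k = Dom C f" "g \<cdot> t = f \<cdot> k"
  shows "lies_in C g (img f)"
proof -
  have "lies_in C (f \<cdot> k) (img f)"
    by (rule lies_in_comp[OF lies_in_img[OF assms(1)] img_closed[OF assms(1) refl] assms(5,8)])
  thus ?thesis using assms by (intro lies_in_perp[OF assms(4,2)]) auto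
qed

text \<open>In the adjunction both inequalities say that \<open>f \<cdot> m\<close> lies in
  \<open>U\<close>. As \<open>exists_along\<close> is a definite description, antisymmetry of the
  order then identifies it with the image.\<close>

lemma exists_along_eq:
  assumes "f \<in> Arr C" "m \<in> Mon C" "Cod C m = Dom C f"
  shows "exists_along C f (subobj C m) = img (f \<cdot> m)"
proof -
  have fm: "f \<cdot> m \<in> Arr C" "Cod C (f \<cdot> m) = Cod C f" using assms by auto
  have *: "img (f \<cdot> m) \<sqsubseteq>\<^bsub>Sub C (Cod C f)\<^esub> U \<longleftrightarrow> subobj C m \<sqsubseteq>\<^bsub>Sub C (Dom C f)\<^esub> pb C f U"
    if U: "U \<in> carrier (Sub C (Cod C f))" for U
  proof -
    have "subobj C m \<sqsubseteq>\<^bsub>Sub C (Dom C f)\<^esub> pb C f U \<longleftrightarrow> lies_in C m (pb C f U)"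
      by (rule Sub_le[OF subobj_closed[OF assms(2,3)] pb_closed[OF assms(1) U] subobj_refl[OF assms(2)]])
    also have "\<dots> \<longleftrightarrow> lies_in C (f \<cdot> m) U" using assms U by (intro lies_in_pb) auto
    also have "\<dots> \<longleftrightarrow> img (f \<cdot> m) \<sqsubseteq>\<^bsub>Sub C (Cod C f)\<^esub> U"
      using img_le_iff[OF fm U] by simp
    finally show ?thesis by simp
  qed
  show ?thesis unfolding exists_along_def
  proof (rule the_equality)
    fix T assume T: "T \<in> carrier (Sub C (Cod C f)) \<and> (\<forall>U \<in> carrier (Sub C (Cod C f)).
        T \<sqsubseteq>\<^bsub>Sub C (Cod C f)\<^esub> U \<longleftrightarrow> subobj C m \<sqsubseteq>\<^bsub>Sub C (Dom C f)\<^esub> pb C f U)"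
    have i: "img (f \<cdot> m) \<in> carrier (Sub C (Cod C f))" using fm by simp
    show "T = img (f \<cdot> m)"
      using T * i Sub_refl[OF i] Sub_refl[of T "Cod C f"] by (intro Sub_antisym[of _ "Cod C f"]) auto
  qed (use * fm in auto)
qed

lemma is_lub_Sub:
  assumes "A \<subseteq> carrier (Sub C X)"
  shows "is_lub (Sub C X) S A \<longleftrightarrow> S \<in> carrier (Sub C X) \<and> (\<forall>T \<in> A. T \<sqsubseteq>\<^bsub>Sub C X\<^esub> S) \<and>
    (\<forall>U \<in> carrier (Sub C X). (\<forall>T \<in> A. T \<sqsubseteq>\<^bsub>Sub C X\<^esub> U) \<longrightarrow> S \<sqsubseteq>\<^bsub>Sub C X\<^esub> U)"
proof -
  have "Upper (Sub C X) A = {U \<in> carrier (Sub C X). \<forall>T \<in> A. T \<sqsubseteq>\<^bsub>Sub C X\<^esub> U}"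
    using assms unfolding Upper_def by blast
  thus ?thesis by (auto simp: least_def)
qed

end

section \<open>Covers, empty objects and possibility\<close>

lemma preserves_finite_joinsD:
  "preserves_finite_joins L K h \<Longrightarrow> finite A \<Longrightarrow> A \<subseteq> carrier L \<Longrightarrow> is_lub L s A \<Longrightarrow> is_lub K (h s) (h ` A)"
  unfolding preserves_finite_joins_def by simp

context f_regular_category
begin

text \<open>The join of the two subobjects is the whole object. Said through membership, this
  involves neither a chosen join nor a chosen top and transfers directly to generalised
  elements.\<close>

definition cover :: "'a \<Rightarrow> 'a \<Rightarrow> bool" where
  "cover m n \<longleftrightarrow> m \<in> Mon C \<and> n \<in> Mon C \<and> Cod C m = Cod C n \<and>
     (\<forall>T \<in> carrier (Sub C (Cod C m)). lies_in C m T \<longrightarrow> lies_in C n T \<longrightarrow> lies_in C (Ident C (Cod C m)) T)"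

text \<open>Top and bottom of the subobject lattice coincide. In the forcing reading such an object
  is an inconsistent condition, to be avoided by every stage of a generic sequence.\<close>

definition zero :: "'o \<Rightarrow> bool" where
  "zero X \<longleftrightarrow> X \<in> Obj C \<and> (\<forall>T \<in> carrier (Sub C X). lies_in C (Ident C X) T)"

lemma coverD:
  assumes "cover m n"
  shows "m \<in> Mon C" "n \<in> Mon C" "Cod C n = Cod C m"
    "T \<in> carrier (Sub C (Cod C m)) \<Longrightarrow> lies_in C m T \<Longrightarrow> lies_in C n T \<Longrightarrow> lies_in C (Ident C (Cod C m)) T"
  using assms unfolding cover_def by auto

lemma lies_in_ident:
  assumes "lies_in C (Ident C X) S" "S \<in> carrier (Sub C X)" "f \<in> Arr C" "Cod C f = X"
  shows "lies_in C f S"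
proof -
  have X: "X \<in> Obj C" using assms by auto
  have "lies_in C (Ident C X \<cdot> f) S" by (rule lies_in_comp[OF assms(1,2,3)]) (use assms X in auto)
  thus ?thesis using assms by simp
qed

lemma ident_closed: "X \<in> Obj C \<Longrightarrow> subobj C (Ident C X) \<in> carrier (Sub C X)"
  by (intro subobj_closed iso_Mon) (auto simp: is_iso_def Hom_def intro!: bexI[of _ "Ident C X"])

lemma ident_Mon: "X \<in> Obj C \<Longrightarrow> Ident C X \<in> Mon C"
  by (intro iso_Mon) (auto simp: is_iso_def Hom_def intro!: bexI[of _ "Ident C X"])

lemma subobj_le:
  assumes "m \<in> Mon C" "Cod C m = X" "T \<in> carrier (Sub C X)"
  shows "subobj C m \<sqsubseteq>\<^bsub>Sub C X\<^esub> T \<longleftrightarrow> lies_in C m T"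
  by (rule Sub_le[OF subobj_closed[OF assms(1,2)] assms(3) subobj_refl[OF assms(1)]])

lemma is_lub_pair:
  assumes "S \<in> carrier (Sub C X)" "m \<in> Mon C" "n \<in> Mon C" "Cod C m = X" "Cod C n = X"
    "\<And>T. T \<in> carrier (Sub C X) \<Longrightarrow> lies_in C m T \<Longrightarrow> lies_in C n T \<Longrightarrow> S \<sqsubseteq>\<^bsub>Sub C X\<^esub> T"
    "lies_in C m S" "lies_in C n S"
  shows "is_lub (Sub C X) S {subobj C m, subobj C n}"
proof -
  have *: "{subobj C m, subobj C n} \<subseteq> carrier (Sub C X)" using assms subobj_closed by simp
  show ?thesis unfolding is_lub_Sub[OF *] using assms by (simp add: subobj_le)
qed

lemma cover_lub:
  assumes "cover m n"
  shows "is_lub (Sub C (Cod C m)) (subobj C (Ident C (Cod C m))) {subobj C m, subobj C n}"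
proof -
  note D = coverD[OF assms]
  let ?X = "Cod C m"
  have X: "?X \<in> Obj C" using D by simp
  have i: "factors_through C f (Ident C ?X)" if "f \<in> Arr C" "Cod C f = ?X" for f
    by (rule factors_throughI[of f]) (use that X in auto)
  show ?thesis
    by (rule is_lub_pair)
      (use D X ident_closed ident_Mon subobj_le[OF ident_Mon[OF X] _ ] i lies_in_subobj[OF ident_Mon[OF X]] in auto)
qed

lemma coverI:
  assumes "S \<in> carrier (Sub C X)" "T \<in> carrier (Sub C X)" "U \<in> carrier (Sub C X)" "m \<in> S" "n \<in> T"
    "is_lub (Sub C X) U {S, T}" "lies_in C (Ident C X) U" "X \<in> Obj C"
  shows "cover m n"
proof -
  have *: "{S, T} \<subseteq> carrier (Sub C X)" using assms by simp
  note m = carrierD[OF assms(1,4)] and n = carrierD[OF assms(2,5)]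
  show ?thesis unfolding cover_def
  proof (intro conjI ballI impI)
    fix V assume V: "V \<in> carrier (Sub C (Cod C m))" "lies_in C m V" "lies_in C n V"
    have V1: "V \<in> carrier (Sub C X)" using V m by simp
    have "S \<sqsubseteq>\<^bsub>Sub C X\<^esub> V" "T \<sqsubseteq>\<^bsub>Sub C X\<^esub> V"
      using V Sub_le[OF assms(1) V1 assms(4)] Sub_le[OF assms(2) V1 assms(5)] by auto
    hence "U \<sqsubseteq>\<^bsub>Sub C X\<^esub> V" using assms(6) V1 unfolding is_lub_Sub[OF *] by simp
    from Sub_leD[OF this assms(3) V1 assms(7)] show "lies_in C (Ident C (Cod C m)) V" using m by simp
  qed (use m n in auto)
qed

text \<open>Used contraposed: passing to a cover in \<open>MonPerp\<close> keeps an object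
  consistent, and by \<open>zero_cover\<close> at least one half of a binary cover stays consistent.
  This is what lets a sequence be continued.\<close>

lemma zero_perp:
  assumes "e \<in> MonPerp C" "zero (Dom C e)"
  shows "zero (Cod C e)"
  unfolding zero_def
proof (intro conjI ballI)
  fix T assume T: "T \<in> carrier (Sub C (Cod C e))"
  have "lies_in C (Ident C (Dom C e)) (pb C e T)"
    using assms T pb_closed[of e T] unfolding zero_def by simp
  hence "lies_in C (Ident C (Cod C e) \<cdot> e) T" using assms T by (simp add: lies_in_pb)
  thus "lies_in C (Ident C (Cod C e)) T"
    by (rule lies_in_perp[OF assms(1), rotated -1]) (use assms T in auto)
qed (use assms in auto)

lemma zero_cover:
  assumes "cover m n" "zero (Dom C m)" "zero (Dom C n)"
  shows "zero (Cod C m)"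
  unfolding zero_def
proof (intro conjI ballI)
  note D = coverD[OF assms(1)]
  show "Cod C m \<in> Obj C" using D by simp
  fix T assume T: "T \<in> carrier (Sub C (Cod C m))"
  have "lies_in C f T" if "f \<in> Arr C" "zero (Dom C f)" "Cod C f = Cod C m" for f
  proof -
    have T': "T \<in> carrier (Sub C (Cod C f))" using T that by simp
    have "lies_in C (Ident C (Dom C f)) (pb C f T)"
      using that(2) pb_closed[OF that(1) T'] unfolding zero_def by simp
    thus ?thesis using that T' by (simp add: lies_in_pb)
  qed
  thus "lies_in C (Ident C (Cod C m)) T" using D(1-3) assms T by (intro D(4)) auto
qed

lemma img_Mon: "m \<in> Mon C \<Longrightarrow> img m = subobj C m"
proof -
  assume m: "m \<in> Mon C"
  have c: "img m \<in> carrier (Sub C (Cod C m))" "subobj C m \<in> carrier (Sub C (Cod C m))"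
    using m subobj_closed by auto
  have "lies_in C m (subobj C m)" using m lies_in_subobj factors_refl by simp
  hence "img m \<sqsubseteq>\<^bsub>Sub C (Cod C m)\<^esub> subobj C m" using img_le_iff[of m] m c by simp
  moreover have "subobj C m \<sqsubseteq>\<^bsub>Sub C (Cod C m)\<^esub> img m" using subobj_le[OF m refl c(1)] lies_in_img m by simp
  ultimately show ?thesis by (rule Sub_antisym[OF c])
qed

lemma img_perp_le:
  assumes "t \<in> MonPerp C" "f \<in> Arr C" "Cod C t = Dom C f" "Cod C f = X"
  shows "img f \<sqsubseteq>\<^bsub>Sub C X\<^esub> img (f \<cdot> t)"
proof -
  have ft: "f \<cdot> t \<in> Arr C" "Cod C (f \<cdot> t) = X" using assms by auto
  have c: "img (f \<cdot> t) \<in> carrier (Sub C X)" using ft by simp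
  have "lies_in C f (img (f \<cdot> t))"
    by (rule lies_in_perp[OF assms(1,2)]) (use assms c lies_in_img[OF ft(1)] in auto)
  thus ?thesis using img_le_iff[OF assms(2,4) c] by simp
qed

end

context f_coherent_category
begin

lemma ex_bottom:
  assumes "X \<in> Obj C"
  obtains B where "B \<in> carrier (Sub C X)" "is_lub (Sub C X) B {}"
  using finite_joins[OF assms, of "{}"] is_lub_Sub[of "{}" X] by auto

text \<open>Pullback preserves the empty join, so the bottom pulled back along \<open>f\<close> is
  the bottom of \<open>Dom C f\<close>; that \<open>f\<close> lies in the bottom puts the identity
  into it.\<close>

lemma zero_lies_in_bottom:
  assumes "is_lub (Sub C X) B {}" "lies_in C f B"
  shows "zero (Dom C f)"
proof -
  have B: "B \<in> carrier (Sub C X)" using assms(1) is_lub_Sub[of "{}" X] by simp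
  note f = lies_inD[OF assms(2) B]
  have "is_lub (Sub C (Dom C f)) (pb C f B) (pb C f ` {})"
    using preserves_finite_joinsD[OF pb_finite_joins[OF f(1)], of "{}"] assms(1) f(2) by simp
  hence l: "\<And>T. T \<in> carrier (Sub C (Dom C f)) \<Longrightarrow> pb C f B \<sqsubseteq>\<^bsub>Sub C (Dom C f)\<^esub> T"
    using is_lub_Sub[of "{}" "Dom C f"] by simp
  have B': "B \<in> carrier (Sub C (Cod C f))" using B f by simp
  have i: "lies_in C (Ident C (Dom C f)) (pb C f B)" using assms(2) f(1) B' by (simp add: lies_in_pb)
  show ?thesis unfolding zero_def
    using l i Sub_leD pb_closed[OF f(1) B'] f(1) by (metis Dom_Obj)
qed

lemma zero_dom:
  assumes "f \<in> Arr C" "zero (Cod C f)"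
  shows "zero (Dom C f)"
proof -
  have X: "Cod C f \<in> Obj C" using assms by simp
  obtain B where B: "B \<in> carrier (Sub C (Cod C f))" "is_lub (Sub C (Cod C f)) B {}"
    using ex_bottom[OF X] by metis
  have "lies_in C (Ident C (Cod C f)) B" using assms(2) B(1) unfolding zero_def by simp
  hence "lies_in C f B" using lies_in_ident B(1) assms(1) by blast
  thus ?thesis by (rule zero_lies_in_bottom[OF B(2)])
qed

text \<open>Stability of binary joins under pullback. The arrows \<open>g\<close> and
  \<open>h\<close> are the second legs of the two pullback squares: on each half of the new cover,
  \<open>f\<close> is known to lie in the corresponding half of the old one.\<close>

lemma cover_pullback:
  assumes "cover m n" "f \<in> Arr C" "Cod C f = Cod C m"
  obtains s g t h where "cover s t" "g \<in> Arr C" "h \<in> Arr C" "Cod C s = Dom C f"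
    "Dom C g = Dom C s" "Cod C g = Dom C m" "Dom C h = Dom C t" "Cod C h = Dom C n"
    "f \<cdot> s = m \<cdot> g" "f \<cdot> t = n \<cdot> h"
proof -
  note D = coverD[OF assms(1)]
  obtain s g where s: "is_pullback C f m s g" using ex_limits(4)[of f m] D assms by auto
  obtain t h where t: "is_pullback C f n t h" using ex_limits(4)[of f n] D assms by auto
  note S = is_pullbackD[OF s] and T = is_pullbackD[OF t]
  have st: "s \<in> Mon C" "t \<in> Mon C" using Mon_pullback s t D by auto
  have X: "Dom C f \<in> Obj C" "Cod C m \<in> Obj C" using assms D by auto
  have c: "{subobj C m, subobj C n} \<subseteq> carrier (Sub C (Cod C f))"
    using D subobj_closed assms(3) by simp
  have "is_lub (Sub C (Dom C f)) (pb C f (subobj C (Ident C (Cod C m)))) (pb C f ` {subobj C m, subobj C n})"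
    using preserves_finite_joinsD[OF pb_finite_joins[OF assms(2)] _ c] cover_lub[OF assms(1)]
    by (simp add: assms(3))
  hence l: "is_lub (Sub C (Dom C f)) (pb C f (subobj C (Ident C (Cod C m)))) {subobj C s, subobj C t}"
    using pb_subobj[OF s D(1)] pb_subobj[OF t D(2)] by simp
  have i: "subobj C (Ident C (Cod C m)) \<in> carrier (Sub C (Cod C f))"
    using ident_closed X assms(3) by simp
  have "factors_through C f (Ident C (Cod C m))"
    by (rule factors_throughI[of f]) (use assms X in auto)
  hence "lies_in C f (subobj C (Ident C (Cod C m)))" using lies_in_subobj ident_Mon X by simp
  hence i2: "lies_in C (Ident C (Dom C f)) (pb C f (subobj C (Ident C (Cod C m))))"
    using lies_in_pb[OF assms(2) i] X assms(2) by simp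
  have "cover s t"
    by (rule coverI[OF _ _ _ _ _ l i2 X(1)])
      (use st S(7) T(7) subobj_closed subobj_refl pb_closed[OF assms(2) i] in auto)
  thus ?thesis using that[of s t g h] S T by simp
qed

end

section \<open>Complements in Boolean f-coherent categories\<close>

context boolean_f_coherent_category
begin

text \<open>The complement in the form needed for forcing. Its join with \<open>m\<close> is the
  top, which is a cover; its meet with \<open>m\<close> is the bottom, so a generalised element of
  both has an inconsistent domain.\<close>

lemma ex_complement:
  assumes "m \<in> Mon C"
  obtains n where "cover m n"
    "\<And>f g. f \<in> Arr C \<Longrightarrow> g \<in> Arr C \<Longrightarrow> Cod C f = Dom C m \<Longrightarrow> Cod C g = Dom C n \<Longrightarrow> Dom C g = Dom C f \<Longrightarrow>
      m \<cdot> f = n \<cdot> g \<Longrightarrow> zero (Dom C f)"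
proof -
  let ?X = "Cod C m"
  have X: "?X \<in> Obj C" using assms by simp
  interpret B: boolean_lattice "Sub C ?X" by (rule boolean[OF X])
  have m: "subobj C m \<in> carrier (Sub C ?X)" using assms subobj_closed by simp
  obtain y where y: "is_complement (Sub C ?X) (subobj C m) y" using B.complemented[OF m] by blast
  hence y': "y \<in> carrier (Sub C ?X)" unfolding is_complement_def by simp
  obtain n where n: "n \<in> y" "n \<in> Mon C" "Cod C n = ?X" "y = subobj C n" using y' by (rule carrierE)
  have top: "\<top>\<^bsub>Sub C ?X\<^esub> \<in> carrier (Sub C ?X)" by simp
  have bot: "\<bottom>\<^bsub>Sub C ?X\<^esub> \<in> carrier (Sub C ?X)" by simp
  have c: "{subobj C m, y} \<subseteq> carrier (Sub C ?X)" using m y' by simp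
  have lub: "is_lub (Sub C ?X) (\<top>\<^bsub>Sub C ?X\<^esub>) {subobj C m, y}"
  proof -
    have j: "subobj C m \<squnion>\<^bsub>Sub C ?X\<^esub> y = \<top>\<^bsub>Sub C ?X\<^esub>" using y unfolding is_complement_def by simp
    show ?thesis unfolding is_lub_Sub[OF c]
      using B.join_left[OF m y'] B.join_right[OF m y'] B.join_le[OF _ _ m y'] top
      unfolding j by auto
  qed
  have "subobj C (Ident C ?X) \<sqsubseteq>\<^bsub>Sub C ?X\<^esub> \<top>\<^bsub>Sub C ?X\<^esub>"
    using B.top_higher ident_closed[OF X] by simp
  hence "lies_in C (Ident C ?X) (\<top>\<^bsub>Sub C ?X\<^esub>)"
    using subobj_le[OF ident_Mon[OF X] _ top] X by simp
  hence "cover m n"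
    using coverI[OF m y' top _ n(1) lub _ X] assms subobj_refl by blast
  moreover have "zero (Dom C f)" if "f \<in> Arr C" "g \<in> Arr C" "Cod C f = Dom C m" "Cod C g = Dom C n"
    "Dom C g = Dom C f" "m \<cdot> f = n \<cdot> g" for f g
  proof -
    have mf: "m \<cdot> f \<in> Arr C" "Cod C (m \<cdot> f) = ?X" using that(1-5) assms by auto
    have i: "img (m \<cdot> f) \<in> carrier (Sub C ?X)" using mf by simp
    have "factors_through C (m \<cdot> f) m" by (rule factors_throughI[of f]) (use that(1-5) assms in auto)
    hence 1: "img (m \<cdot> f) \<sqsubseteq>\<^bsub>Sub C ?X\<^esub> subobj C m"
      using img_le_iff[OF mf m] lies_in_subobj[OF assms] by simp
    have "factors_through C (m \<cdot> f) n" unfolding that(6)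
      by (rule factors_throughI[of g]) (use that(1-5) n in auto)
    hence 2: "img (m \<cdot> f) \<sqsubseteq>\<^bsub>Sub C ?X\<^esub> y"
      using img_le_iff[OF mf y'] lies_in_subobj[OF n(2)] n(4) by simp
    have "img (m \<cdot> f) \<sqsubseteq>\<^bsub>Sub C ?X\<^esub> \<bottom>\<^bsub>Sub C ?X\<^esub>"
      using B.meet_le[OF 1 2 m y' i] y unfolding is_complement_def by simp
    hence l: "lies_in C (m \<cdot> f) (\<bottom>\<^bsub>Sub C ?X\<^esub>)" using img_le_iff[OF mf bot] by simp
    have "is_lub (Sub C ?X) (\<bottom>\<^bsub>Sub C ?X\<^esub>) {}"
      using is_lub_Sub[of "{}" ?X] B.bottom_lower bot by simp
    from zero_lies_in_bottom[OF this l] show ?thesis using that(1-5) assms by simp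
  qed
  ultimately show ?thesis by (rule that)
qed

end

section \<open>Possibility between generalised elements, and what the modal axioms say about
  it\<close>

context boolean_modal_category
begin

text \<open>
  For generalised elements \<open>v\<close> and \<open>s\<close> of the same object, possibly with different domains:
  \<open>s\<close> can see points of the image of \<open>v\<close>.
\<close>

definition pos :: "'a \<Rightarrow> 'a \<Rightarrow> bool" where
  "pos v s \<longleftrightarrow> v \<in> Arr C \<and> s \<in> Arr C \<and> Cod C s = Cod C v \<and> lies_in C s (Dia C (Cod C v) (img v))"

text \<open>That \<open>S\<close> is below \<open>T\<close> makes \<open>T\<close> the join of the
  two, and this join is preserved.\<close>

lemma Dia_mono:
  assumes "S \<sqsubseteq>\<^bsub>Sub C X\<^esub> T" "S \<in> carrier (Sub C X)" "T \<in> carrier (Sub C X)" "X \<in> Obj C"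
  shows "Dia C X S \<sqsubseteq>\<^bsub>Sub C X\<^esub> Dia C X T"
proof -
  have c: "{S, T} \<subseteq> carrier (Sub C X)" "{Dia C X S, Dia C X T} \<subseteq> carrier (Sub C X)"
    using assms Dia_closed by auto
  have "is_lub (Sub C X) T {S, T}" unfolding is_lub_Sub[OF c(1)] using assms Sub_refl by auto
  from preserves_finite_joinsD[OF Dia_finite_joins[OF assms(4)] _ c(1) this]
  have "is_lub (Sub C X) (Dia C X T) {Dia C X S, Dia C X T}" by simp
  thus ?thesis unfolding is_lub_Sub[OF c(2)] by simp
qed

lemma pos_comp:
  assumes "pos v s" "g \<in> Arr C" "Cod C g = Dom C s"
  shows "pos v (s \<cdot> g)"
  using assms lies_in_comp[of s _ "Cod C v" g] Dia_closed unfolding pos_def by simp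

lemma pos_le:
  assumes "pos v s" "S \<in> carrier (Sub C (Cod C v))" "img v \<sqsubseteq>\<^bsub>Sub C (Cod C v)\<^esub> S"
  shows "lies_in C s (Dia C (Cod C v) S)"
proof -
  have v: "v \<in> Arr C" using assms(1) unfolding pos_def by simp
  have X: "Cod C v \<in> Obj C" and i: "img v \<in> carrier (Sub C (Cod C v))" using v by simp_all
  show ?thesis using Sub_leD[OF Dia_mono[OF assms(3) i assms(2) X] Dia_closed[OF X i] Dia_closed[OF X assms(2)]]
    assms(1) unfolding pos_def by simp
qed

text \<open>Possibility depends on the image of \<open>v\<close> only, and composing with a cover
  does not shrink the image.\<close>

lemma pos_perp:
  assumes "pos v s" "t \<in> MonPerp C" "Cod C t = Dom C v"
  shows "pos (v \<cdot> t) s"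
proof -
  have v: "v \<in> Arr C" "s \<in> Arr C" "Cod C s = Cod C v" using assms(1) unfolding pos_def by auto
  have vt: "v \<cdot> t \<in> Arr C" "Cod C (v \<cdot> t) = Cod C v" using v assms by auto
  have "lies_in C s (Dia C (Cod C v) (img (v \<cdot> t)))"
    by (rule pos_le[OF assms(1) _ img_perp_le[OF assms(2) v(1) assms(3) refl]]) (use vt in simp)
  thus ?thesis unfolding pos_def using v vt by simp
qed

text \<open>The axiom \<open>Dia_pb\<close> on elements: \<open>pb C h S\<close> contains the image
  of \<open>v\<close>, so \<open>s\<close> lies in its \<open>Dia\<close>, which is below the
  pullback of \<open>Dia C (Cod C h) S\<close>.\<close>

lemma pos_sound:
  assumes "pos v s" "h \<in> Arr C" "Dom C h = Cod C v" "S \<in> carrier (Sub C (Cod C h))" "lies_in C (h \<cdot> v) S"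
  shows "lies_in C (h \<cdot> s) (Dia C (Cod C h) S)"
proof -
  have v: "v \<in> Arr C" "s \<in> Arr C" "Cod C s = Cod C v" using assms(1) unfolding pos_def by auto
  have pc: "pb C h S \<in> carrier (Sub C (Cod C v))" using pb_closed[OF assms(2,4)] assms(3) by simp
  have X: "Cod C v \<in> Obj C" "Cod C h \<in> Obj C" using v assms by auto
  have "lies_in C v (pb C h S)" using assms v by (simp add: lies_in_pb)
  hence "img v \<sqsubseteq>\<^bsub>Sub C (Cod C v)\<^esub> pb C h S" using img_le_iff[OF v(1) refl pc] by simp
  from pos_le[OF assms(1) pc this] have 1: "lies_in C s (Dia C (Cod C v) (pb C h S))" .
  have "Dia C (Cod C v) (pb C h S) \<sqsubseteq>\<^bsub>Sub C (Cod C v)\<^esub> pb C h (Dia C (Cod C h) S)"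
    by (rule Dia_pb[OF HomI[OF assms(2,3) refl] assms(4)])
  moreover have "pb C h (Dia C (Cod C h) S) \<in> carrier (Sub C (Cod C v))"
    using pb_closed[OF assms(2) Dia_closed[OF X(2) assms(4)]] assms(3) by simp
  ultimately have "lies_in C s (pb C h (Dia C (Cod C h) S))"
    using Sub_leD[OF _ Dia_closed[OF X(1) pc] _ 1] by blast
  thus ?thesis using lies_in_pb[OF assms(2) Dia_closed[OF X(2) assms(4)] v(2)] v(3) assms(3) by simp
qed

lemma pos_transport:
  assumes "pos v s" "h \<in> Arr C" "Dom C h = Cod C v"
  shows "pos (h \<cdot> v) (h \<cdot> s)"
proof -
  have v: "v \<in> Arr C" "s \<in> Arr C" "Cod C s = Cod C v" using assms(1) unfolding pos_def by auto
  have hv: "h \<cdot> v \<in> Arr C" "Cod C (h \<cdot> v) = Cod C h" using v assms by auto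
  have "lies_in C (h \<cdot> s) (Dia C (Cod C h) (img (h \<cdot> v)))"
    by (rule pos_sound[OF assms]) (use hv lies_in_img in auto)
  thus ?thesis unfolding pos_def using hv v assms by simp
qed

text \<open>The image of an element with inconsistent domain is the bottom, and \<open>Dia\<close>
  preserves the empty join. Hence a new model can become inconsistent only if the old one
  is.\<close>

lemma pos_zero:
  assumes "pos v s" "zero (Dom C v)"
  shows "zero (Dom C s)"
proof -
  have v: "v \<in> Arr C" "s \<in> Arr C" "Cod C s = Cod C v" "lies_in C s (Dia C (Cod C v) (img v))"
    using assms(1) unfolding pos_def by auto
  have X: "Cod C v \<in> Obj C" using v by simp
  have "img v \<sqsubseteq>\<^bsub>Sub C (Cod C v)\<^esub> T" if T: "T \<in> carrier (Sub C (Cod C v))" for T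
  proof -
    have "lies_in C (Ident C (Dom C v)) (pb C v T)"
      using assms(2) pb_closed[OF v(1) T] unfolding zero_def by simp
    hence "lies_in C v T" using lies_in_pb[OF v(1) T] v(1) by simp
    thus ?thesis using img_le_iff[OF v(1) refl T] by simp
  qed
  hence "is_lub (Sub C (Cod C v)) (img v) {}" using is_lub_Sub[of "{}"] v(1) by simp
  hence "is_lub (Sub C (Cod C v)) (Dia C (Cod C v) (img v)) {}"
    using preserves_finite_joinsD[OF Dia_finite_joins[OF X], of "{}"] by simp
  thus ?thesis using v(4) by (rule zero_lies_in_bottom)
qed

lemma pos_Mon: "m \<in> Mon C \<Longrightarrow> lies_in C s (Dia C (Cod C m) (subobj C m)) \<Longrightarrow> pos m s"
  using lies_inD[of s _ "Cod C m"] Dia_closed subobj_closed[OF _ refl] unfolding pos_def by (simp add: img_Mon)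

text \<open>The axiom \<open>Dia_Mon\<close> on elements: possibility inside a subobject is
  possibility in the ambient object. It is applied to the image \<open>T\<close> of
  \<open>i \<cdot> v\<close>. Since \<open>T\<close> lies inside \<open>i\<close>, it is below the
  direct image of its own pullback, so \<open>i \<cdot> s\<close> lies in the \<open>Dia\<close> of
  that direct image; and since \<open>i\<close> is monic, the pullback of \<open>T\<close> is below
  the image of \<open>v\<close>.\<close>

lemma pos_mono:
  assumes "i \<in> Mon C" "v \<in> Arr C" "s \<in> Arr C" "Cod C v = Dom C i" "Cod C s = Dom C i" "pos (i \<cdot> v) (i \<cdot> s)"
  shows "pos v s"
proof -
  let ?A = "Dom C i" and ?X = "Cod C i"
  define T where "T = img (i \<cdot> v)"
  have iv: "i \<cdot> v \<in> Arr C" "Cod C (i \<cdot> v) = ?X" using assms by auto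
  have T: "T \<in> carrier (Sub C ?X)" unfolding T_def using iv by simp
  have A: "?A \<in> Obj C" "?X \<in> Obj C" using assms by auto
  have i: "i \<in> Arr C" using assms by simp
  have p: "pb C i T \<in> carrier (Sub C ?A)" using pb_closed[OF i T] .
  obtain m where m: "m \<in> pb C i T" "m \<in> Mon C" "Cod C m = ?A" "pb C i T = subobj C m"
    using p by (rule carrierE)
  have im: "i \<cdot> m \<in> Arr C" "Cod C (i \<cdot> m) = ?X" using m i by auto
  have ex: "exists_along C i (pb C i T) = img (i \<cdot> m)"
    unfolding m(4) using exists_along_eq[OF i m(2,3)] .
  have E: "img (i \<cdot> m) \<in> carrier (Sub C ?X)" using im by simp
  have v: "lies_in C v (pb C i T)" using lies_in_pb[OF i T assms(2,4)] lies_in_img[OF iv(1)] by (simp add: T_def)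
  have "lies_in C (i \<cdot> v) (img (i \<cdot> m))"
  proof -
    have "factors_through C v m" using v m lies_in_subobj by simp
    then obtain h where h: "h \<in> Arr C" "Dom C h = Dom C v" "Cod C h = Dom C m" "v = m \<cdot> h"
      by (rule factors_throughE)
    have "lies_in C ((i \<cdot> m) \<cdot> h) (img (i \<cdot> m))"
      by (rule lies_in_comp[OF lies_in_img[OF im(1)] E h(1)]) (use h(3) i m in auto)
    thus ?thesis unfolding h(4) using h(1-3) m i by simp
  qed
  hence "T \<sqsubseteq>\<^bsub>Sub C ?X\<^esub> img (i \<cdot> m)" using img_le_iff[OF iv E] by (simp add: T_def)
  hence "lies_in C (i \<cdot> s) (Dia C ?X (img (i \<cdot> m)))"
    using pos_le[OF assms(6)] E iv(2) by (simp add: T_def)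
  hence "lies_in C s (pb C i (Dia C ?X (exists_along C i (pb C i T))))"
    unfolding ex using lies_in_pb[OF i Dia_closed[OF A(2) E] assms(3,5)] by simp
  hence s: "lies_in C s (Dia C ?A (pb C i T))" using Dia_Mon[OF assms(1) HomI[OF i refl refl] T] by simp
  have "pb C i T \<sqsubseteq>\<^bsub>Sub C ?A\<^esub> img v"
  proof (rule Sub_leI[OF p])
    show iv': "img v \<in> carrier (Sub C ?A)" using assms by simp
    fix g assume g: "g \<in> Arr C" "Cod C g = ?A" "lies_in C g (pb C i T)"
    hence "lies_in C (i \<cdot> g) (img (i \<cdot> v))" using lies_in_pb[OF i T g(1,2)] by (simp add: T_def)
    then obtain t k where tk: "t \<in> MonPerp C" "k \<in> Arr C" "Cod C t = Dom C (i \<cdot> g)" "Dom C k = Dom C t"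
      "Cod C k = Dom C (i \<cdot> v)" "(i \<cdot> g) \<cdot> t = (i \<cdot> v) \<cdot> k"
      using lies_in_imgE[OF iv(1)] by metis
    have tk': "Cod C t = Dom C g" "Cod C k = Dom C v" using tk(3,5) g i assms by auto
    have "i \<cdot> g \<cdot> t = i \<cdot> v \<cdot> k" using tk(6) tk(1,2) tk' g(1,2) i assms by simp
    hence "g \<cdot> t = v \<cdot> k"
      by (rule Mon_cancel[OF assms(1), rotated -1]) (use tk(1,2,4) tk' g(1,2) i assms(2-5) in auto)
    thus "lies_in C g (img v)"
      using lies_in_imgI[OF assms(2) g(1) _ tk(1,2) tk'(1) tk(4) tk'(2)] g(2) assms(4) by simp
  qed
  from Sub_leD[OF Dia_mono[OF this p _ A(1)] Dia_closed[OF A(1) p] _ s]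
  have "lies_in C s (Dia C ?A (img v))" using assms Dia_closed[OF A(1), of "img v"] by simp
  thus ?thesis unfolding pos_def using assms by simp
qed

text \<open>Refinement of a span both of whose legs have been found in \<open>m\<close>: the common
  codomain shrinks to the pullback of \<open>m\<close> along \<open>h\<close>, the legs factor
  through it, and possibility survives by \<open>pos_mono\<close>. The domains of the legs stay the
  same.\<close>

lemma pos_restrict:
  assumes "pos v s" "h \<in> Arr C" "Dom C h = Cod C v" "m \<in> Mon C" "Cod C m = Cod C h"
    "factors_through C (h \<cdot> v) m" "factors_through C (h \<cdot> s) m"
  obtains x h' v' s' where "x \<in> Mon C" "Cod C x = Cod C v" "h' \<in> Arr C" "Dom C h' = Dom C x" "Cod C h' = Dom C m"
    "h \<cdot> x = m \<cdot> h'" "pos v' s'" "Cod C v' = Dom C x" "Dom C v' = Dom C v" "Dom C s' = Dom C s"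
    "x \<cdot> v' = v" "x \<cdot> s' = s"
proof -
  have v: "v \<in> Arr C" "s \<in> Arr C" "Cod C s = Cod C v" using assms(1) unfolding pos_def by auto
  obtain x h' where x: "is_pullback C h m x h'" using ex_limits(4)[of h m] assms by auto
  note X = is_pullbackD[OF x]
  have xm: "x \<in> Mon C" using Mon_pullback[OF x assms(4)] .
  have lift: "\<exists>f'. f' \<in> Arr C \<and> Dom C f' = Dom C f \<and> Cod C f' = Dom C x \<and> x \<cdot> f' = f"
    if f: "f \<in> Arr C" "Cod C f = Cod C v" "factors_through C (h \<cdot> f) m" for f
  proof -
    obtain k where k: "k \<in> Arr C" "Dom C k = Dom C (h \<cdot> f)" "Cod C k = Dom C m" "h \<cdot> f = m \<cdot> k"
      using f(3) by (rule factors_throughE)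
    obtain l where "l \<in> Arr C" "Dom C l = Dom C f" "Cod C l = Dom C x" "x \<cdot> l = f"
      by (rule is_pullback_fill[OF x _ _ _ _ _ k(4)]) (use f(1,2) k(1-3) assms(2,3) in auto)
    thus ?thesis by blast
  qed
  obtain v' where v': "v' \<in> Arr C" "Dom C v' = Dom C v" "Cod C v' = Dom C x" "x \<cdot> v' = v"
    using lift[OF v(1) refl assms(6)] by blast
  obtain s' where s': "s' \<in> Arr C" "Dom C s' = Dom C s" "Cod C s' = Dom C x" "x \<cdot> s' = s"
    using lift[OF v(2,3) assms(7)] by blast
  have "pos v' s'" by (rule pos_mono[OF xm v'(1) s'(1) v'(3) s'(3)]) (simp add: v'(4) s'(4) assms(1))
  thus ?thesis using that[of x h' v' s'] xm X assms v' s' by simp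
qed

text \<open>A cover of the domain of \<open>v\<close> splits its image into a join.
  \<open>Dia\<close> and pullback along \<open>s\<close> preserve this join, which yields a cover of
  the domain of \<open>s\<close> with matching halves. So a case distinction about the new point
  becomes one about the old point.\<close>

lemma pos_cover:
  assumes "pos v s" "cover a b" "Cod C a = Dom C v"
  obtains m n where "cover m n" "Cod C m = Dom C s" "pos (v \<cdot> a) (s \<cdot> m)" "pos (v \<cdot> b) (s \<cdot> n)"
proof -
  note D = coverD[OF assms(2)]
  have v: "v \<in> Arr C" "s \<in> Arr C" "Cod C s = Cod C v" "lies_in C s (Dia C (Cod C v) (img v))"
    using assms(1) unfolding pos_def by auto
  let ?X = "Cod C v"
  have X: "?X \<in> Obj C" using v by simp
  have va: "v \<cdot> a \<in> Arr C" "Cod C (v \<cdot> a) = ?X" "v \<cdot> b \<in> Arr C" "Cod C (v \<cdot> b) = ?X"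
    using v D(1-3) assms(3) by auto
  have c: "img v \<in> carrier (Sub C ?X)" "img (v \<cdot> a) \<in> carrier (Sub C ?X)" "img (v \<cdot> b) \<in> carrier (Sub C ?X)"
    using v va by auto
  hence c2: "{img (v \<cdot> a), img (v \<cdot> b)} \<subseteq> carrier (Sub C ?X)" by simp
  have "is_lub (Sub C ?X) (img v) {img (v \<cdot> a), img (v \<cdot> b)}"
  proof -
    have "lies_in C (v \<cdot> a) (img v)" "lies_in C (v \<cdot> b) (img v)"
      using lies_in_comp[OF lies_in_img[OF v(1)] c(1)] D(1-3) assms(3) by auto
    moreover have "lies_in C v U"
      if U: "U \<in> carrier (Sub C ?X)" "lies_in C (v \<cdot> a) U" "lies_in C (v \<cdot> b) U" for U
    proof -
      have "pb C v U \<in> carrier (Sub C (Cod C a))" using pb_closed[OF v(1) U(1)] assms(3) by simp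
      moreover have "lies_in C a (pb C v U)" "lies_in C b (pb C v U)"
        using lies_in_pb[OF v(1) U(1)] U D(1-3) assms(3) by auto
      ultimately have "lies_in C (Ident C (Cod C a)) (pb C v U)" by (rule D(4))
      thus ?thesis using lies_in_pb[OF v(1) U(1)] v assms(3) by simp
    qed
    ultimately show ?thesis unfolding is_lub_Sub[OF c2] using c va v by (simp add: img_le_iff)
  qed
  from preserves_finite_joinsD[OF Dia_finite_joins[OF X] _ c2 this]
  have l1: "is_lub (Sub C ?X) (Dia C ?X (img v)) {Dia C ?X (img (v \<cdot> a)), Dia C ?X (img (v \<cdot> b))}" by simp
  have d: "Dia C ?X (img v) \<in> carrier (Sub C (Cod C s))" "Dia C ?X (img (v \<cdot> a)) \<in> carrier (Sub C (Cod C s))"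
    "Dia C ?X (img (v \<cdot> b)) \<in> carrier (Sub C (Cod C s))" using c Dia_closed X v by auto
  hence d2: "{Dia C ?X (img (v \<cdot> a)), Dia C ?X (img (v \<cdot> b))} \<subseteq> carrier (Sub C (Cod C s))" by simp
  from preserves_finite_joinsD[OF pb_finite_joins[OF v(2)] _ d2] l1
  have l2: "is_lub (Sub C (Dom C s)) (pb C s (Dia C ?X (img v)))
    {pb C s (Dia C ?X (img (v \<cdot> a))), pb C s (Dia C ?X (img (v \<cdot> b)))}" using v(3) by simp
  obtain m where m: "m \<in> pb C s (Dia C ?X (img (v \<cdot> a)))" "m \<in> Mon C" "Cod C m = Dom C s"
    "pb C s (Dia C ?X (img (v \<cdot> a))) = subobj C m" using pb_closed[OF v(2) d(2)] by (rule carrierE)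
  obtain n where n: "n \<in> pb C s (Dia C ?X (img (v \<cdot> b)))" "n \<in> Mon C" "Cod C n = Dom C s"
    "pb C s (Dia C ?X (img (v \<cdot> b))) = subobj C n" using pb_closed[OF v(2) d(3)] by (rule carrierE)
  have "lies_in C (Ident C (Dom C s)) (pb C s (Dia C ?X (img v)))"
    using lies_in_pb[OF v(2) d(1)] v by simp
  hence "cover m n"
    using coverI[OF pb_closed[OF v(2) d(2)] pb_closed[OF v(2) d(3)] pb_closed[OF v(2) d(1)] m(1) n(1) l2] v(2)
    by simp
  moreover have "lies_in C (s \<cdot> m) (Dia C ?X (img (v \<cdot> a)))"
    using lies_in_pb[OF v(2) d(2), of m] m lies_in_subobj[OF m(2), of m] factors_refl by simp
  moreover have "lies_in C (s \<cdot> n) (Dia C ?X (img (v \<cdot> b)))"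
    using lies_in_pb[OF v(2) d(3), of n] n lies_in_subobj[OF n(2), of n] factors_refl by simp
  ultimately show ?thesis using that[of m n] m n va v unfolding pos_def by simp
qed

end

context boolean_modal_category_with_quotients
begin

text \<open>The quotient axiom is used with the object of the span as parameter \<open>Z\<close> and
  with the image of the graph \<open>g\<close> of \<open>h\<close>, restricted to \<open>v\<close>,
  as \<open>S\<close>. It lifts the old leg to the product with \<open>Dom C q\<close> after a cover
  \<open>e\<close>; the new leg lifts as the pullback \<open>w\<close>. The result lives on the
  pullback of \<open>q\<close> and \<open>h\<close>, whose projections are \<open>h'\<close> and
  \<open>x\<close>.\<close>

lemma pos_quotient:
  assumes "pos v s" "q \<in> Quo C" "h \<in> Arr C" "Dom C h = Cod C v" "Cod C h = Cod C q"
  obtains x h' t v' e s' where "x \<in> Arr C" "Cod C x = Cod C v" "h' \<in> Arr C" "Dom C h' = Dom C x"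
    "Cod C h' = Dom C q" "q \<cdot> h' = h \<cdot> x" "t \<in> Arr C" "Cod C t = Dom C v" "Dom C v' = Dom C t"
    "Cod C v' = Dom C x" "x \<cdot> v' = v \<cdot> t" "e \<in> MonPerp C" "Cod C e = Dom C s" "Dom C s' = Dom C e"
    "x \<cdot> s' = s \<cdot> e" "pos v' s'"
proof -
  have v: "v \<in> Arr C" "s \<in> Arr C" "Cod C s = Cod C v" using assms(1) unfolding pos_def by auto
  have q: "q \<in> Arr C" using assms(2) Quo_MonPerp by auto
  let ?X = "Cod C v"
  have ob: "?X \<in> Obj C" "Dom C q \<in> Obj C" "Cod C q \<in> Obj C" using v q by auto
  obtain P p1 p2 where P: "is_product C (Dom C q) ?X P p1 p2" using ex_limits(2)[OF ob(2,1)] by blast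
  obtain P' p1' p2' where P': "is_product C (Cod C q) ?X P' p1' p2'" using ex_limits(2)[OF ob(3,1)] by blast
  note D = is_productD[OF P] and D' = is_productD[OF P']
  obtain k where k: "k \<in> Arr C" "Dom C k = P" "Cod C k = P'" "p1' \<cdot> k = q \<cdot> p1" "p2' \<cdot> k = p2"
    by (rule is_product_fill[OF P', of "q \<cdot> p1" p2]) (use D q in auto)
  \<comment> \<open>The graph of \<open>h\<close>, a point of the second factor of the product with \<open>q\<close>.\<close>
  obtain g where g: "g \<in> Arr C" "Dom C g = ?X" "Cod C g = P'" "p1' \<cdot> g = h" "p2' \<cdot> g = Ident C ?X"
    by (rule is_product_fill[OF P', of h "Ident C ?X"]) (use assms ob in auto)
  have gv: "g \<cdot> v \<in> Arr C" "Cod C (g \<cdot> v) = P'" using g v by auto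
  define S where "S = img (g \<cdot> v)"
  have S: "S \<in> carrier (Sub C P')" "S \<in> carrier (Sub C (Cod C k))" unfolding S_def using gv k by auto
  define T where "T = pb C k S"
  have T: "T \<in> carrier (Sub C P)" unfolding T_def using pb_closed[OF k(1) S(2)] k(2) by simp
  have DT: "Dia C P T \<in> carrier (Sub C P)" using Dia_closed D T by simp
  obtain n where n: "n \<in> Dia C P T" "n \<in> Mon C" "Cod C n = P" "Dia C P T = subobj C n"
    using DT by (rule carrierE)
  have kn: "k \<cdot> n \<in> Arr C" "Cod C (k \<cdot> n) = P'" using k n by auto
  have ex: "exists_along C k (Dia C P T) = img (k \<cdot> n)"
    unfolding n(4) using exists_along_eq[OF k(1) n(2)] n(3) k(2) by simp
  have "Dia C P' S \<sqsubseteq>\<^bsub>Sub C P'\<^esub> img (k \<cdot> n)"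
    using Quo_Dia[OF assms(2) HomI[OF q refl refl] P P' HomI[OF k(1-3)] k(4,5) S(1)] unfolding T_def[symmetric] ex .
  moreover have "lies_in C (g \<cdot> s) (Dia C P' S)"
    using pos_transport[OF assms(1) g(1,2)] gv(2) unfolding pos_def S_def by simp
  ultimately have "lies_in C (g \<cdot> s) (img (k \<cdot> n))"
    using Sub_leD Dia_closed D'(7) S(1) kn by (meson img_closed)
  then obtain e l where e: "e \<in> MonPerp C" "l \<in> Arr C" "Cod C e = Dom C (g \<cdot> s)" "Dom C l = Dom C e"
    "Cod C l = Dom C (k \<cdot> n)" "(g \<cdot> s) \<cdot> e = (k \<cdot> n) \<cdot> l"
    using lies_in_imgE[OF kn(1)] by metis
  have e3: "Cod C e = Dom C s" "Cod C l = Dom C n" using e(3,5) g v k n by auto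
  define r where "r = n \<cdot> l"
  have r: "r \<in> Arr C" "Dom C r = Dom C e" "Cod C r = P" unfolding r_def using n e(2,4) e3 by auto
  have ks: "k \<cdot> r = g \<cdot> s \<cdot> e"
    using e(6) e(1,2) e3 g(1-3) v k(1-3) n(1-3) unfolding r_def by simp
  obtain t w where w: "is_pullback C (g \<cdot> v) k t w" using ex_limits(4)[of "g \<cdot> v" k] gv k by auto
  note W = is_pullbackD[OF w]
  have W': "Cod C t = Dom C v" "Cod C w = P" using W(7,8) g v k by auto
  have kw: "k \<cdot> w = g \<cdot> v \<cdot> t" using W(9) W(3) W' g(1-3) v by simp
  have proj: "q \<cdot> p1 \<cdot> f = h \<cdot> a \<and> p2 \<cdot> f = a"
    if f: "f \<in> Arr C" "Cod C f = P" "a \<in> Arr C" "Cod C a = ?X" "k \<cdot> f = g \<cdot> a" for f a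
  proof
    have "q \<cdot> p1 \<cdot> f = (q \<cdot> p1) \<cdot> f" using q D f by simp
    also have "\<dots> = p1' \<cdot> k \<cdot> f" unfolding k(4)[symmetric] using D' k(1-3) f(1-4) by simp
    also have "\<dots> = (p1' \<cdot> g) \<cdot> a" unfolding f(5) using D' g(1-3) f(1-4) by simp
    finally show "q \<cdot> p1 \<cdot> f = h \<cdot> a" unfolding g(4) .
    have "p2 \<cdot> f = p2' \<cdot> k \<cdot> f" unfolding k(5)[symmetric] using D' k(1-3) f(1-4) by simp
    also have "\<dots> = (p2' \<cdot> g) \<cdot> a" unfolding f(5) using D' g(1-3) f(1-4) by simp
    finally show "p2 \<cdot> f = a" unfolding g(5) using f by simp
  qed
  have pr: "q \<cdot> p1 \<cdot> r = h \<cdot> s \<cdot> e" "p2 \<cdot> r = s \<cdot> e"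
    using proj[of r "s \<cdot> e"] r v e(1) e3 ks by auto
  have pw: "q \<cdot> p1 \<cdot> w = h \<cdot> v \<cdot> t" "p2 \<cdot> w = v \<cdot> t"
    using proj[of w "v \<cdot> t"] W(3,4) W' v kw by auto
  have "pos w r"
  proof -
    have wA: "w \<in> Arr C" by (rule W(4))
    have iw: "img w \<in> carrier (Sub C P)" using wA W' by simp
    \<comment> \<open>Stability of images under pullback: the pullback along \<open>k\<close> of the
      image of \<open>g \<cdot> v\<close> is below the image of the pulled-back arrow
      \<open>w\<close>.\<close>
    have "T \<sqsubseteq>\<^bsub>Sub C P\<^esub> img w"
    proof (rule Sub_leI[OF T iw])
      fix f assume f: "f \<in> Arr C" "Cod C f = P" "lies_in C f T"
      hence "lies_in C (k \<cdot> f) (img (g \<cdot> v))"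
        using lies_in_pb[OF k(1) S(2) f(1)] k(2) by (simp add: T_def S_def)
      then obtain a b where a: "a \<in> MonPerp C" "b \<in> Arr C" "Cod C a = Dom C (k \<cdot> f)" "Dom C b = Dom C a"
        "Cod C b = Dom C (g \<cdot> v)" "(k \<cdot> f) \<cdot> a = (g \<cdot> v) \<cdot> b"
        using lies_in_imgE[OF gv(1)] by metis
      have a3: "Cod C a = Dom C f" "Cod C b = Dom C v" using a(3,5) f k g v by auto
      have eq: "(g \<cdot> v) \<cdot> b = k \<cdot> f \<cdot> a" using a(6) a(1) a3 f(1,2) k(1-3) by simp
      obtain c where c: "c \<in> Arr C" "Dom C c = Dom C b" "Cod C c = Dom C t" "w \<cdot> c = f \<cdot> a"
        by (rule is_pullback_fill[OF w _ _ _ _ _ eq]) (use a(1-5) a3 f(1,2) k(1-3) gv g v in auto)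
      show "lies_in C f (img w)"
        by (rule lies_in_imgI[OF wA f(1) _ a(1) c(1) a3(1) _ _ c(4)[symmetric]])
          (use c(2,3) a(4) W' f(2) W(6) in auto)
    qed
    hence "Dia C P T \<sqsubseteq>\<^bsub>Sub C P\<^esub> Dia C P (img w)" using Dia_mono T iw D by simp
    moreover have "lies_in C r (Dia C P T)" unfolding n(4) lies_in_subobj[OF n(2)] r_def
      by (rule factors_throughI[of l]) (use e(2) e3 n in auto)
    ultimately have "lies_in C r (Dia C P (img w))"
      using Sub_leD DT Dia_closed[OF D(7) iw] by blast
    thus ?thesis unfolding pos_def using r wA W' by simp
  qed
  \<comment> \<open>The equaliser cuts the pullback of \<open>q\<close> and \<open>h\<close> out of
    the product. Both legs factor through it, and \<open>pos_mono\<close> takes possibility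
    along.\<close>
  obtain i where i: "is_equalizer C (q \<cdot> p1) (h \<cdot> p2) i"
    using ex_limits(3)[of "q \<cdot> p1" "h \<cdot> p2"] q D assms by auto
  note I = is_equalizerD[OF i]
  have iM: "i \<in> Mon C" using is_equalizer_Mon[OF i] .
  have I6: "Cod C i = P" using I(6) q D by simp
  have wv: "(q \<cdot> p1) \<cdot> w = (h \<cdot> p2) \<cdot> w" using pw q D assms(3,4) W(4) W' by simp
  have rv: "(q \<cdot> p1) \<cdot> r = (h \<cdot> p2) \<cdot> r" using pr q D assms(3,4) r by simp
  obtain v' where v': "v' \<in> Arr C" "Dom C v' = Dom C w" "Cod C v' = Dom C i" "i \<cdot> v' = w"
    by (rule is_equalizer_fill[OF i W(4) _ wv]) (use W' q D in auto)
  obtain s' where s': "s' \<in> Arr C" "Dom C s' = Dom C r" "Cod C s' = Dom C i" "i \<cdot> s' = r"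
    by (rule is_equalizer_fill[OF i r(1) _ rv]) (use r q D in auto)
  have ps: "pos v' s'" by (rule pos_mono[OF iM v'(1) s'(1) v'(3) s'(3)]) (simp add: v'(4) s'(4) \<open>pos w r\<close>)
  show ?thesis
  proof (rule that[of "p2 \<cdot> i" "p1 \<cdot> i" t v' e s'])
    show "q \<cdot> p1 \<cdot> i = h \<cdot> p2 \<cdot> i" using I(7) I(3) I6 q D assms(3,4) by simp
    show "(p2 \<cdot> i) \<cdot> v' = v \<cdot> t" using D I(3) I6 v' pw by simp
    show "(p2 \<cdot> i) \<cdot> s' = s \<cdot> e" using D I(3) I6 s' pr by simp
  qed (use D I(3) I6 v' s' W W' r e(1) e3 ps in auto)
qed

end

section \<open>Skolem closure and generic sequences\<close>

text \<open>The downward Loewenheim-Skolem argument: close under one chosen list of witnesses for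
  each list of parameters, omega times. Lists give conditions of all arities a common type, and a
  finite list of parameters already occurs at one finite step.\<close>

lemma skolem_closure:
  fixes Ps :: "('a list \<Rightarrow> 'a list \<Rightarrow> bool) set"
  assumes "countable Ps" "countable B" "B \<subseteq> U" "\<And>P xs ys. P \<in> Ps \<Longrightarrow> P xs ys \<Longrightarrow> set ys \<subseteq> U"
  shows "\<exists>A. countable A \<and> B \<subseteq> A \<and> A \<subseteq> U \<and>
    (\<forall>P \<in> Ps. \<forall>xs ys. set xs \<subseteq> A \<longrightarrow> P xs ys \<longrightarrow> (\<exists>ys. set ys \<subseteq> A \<and> P xs ys))"
proof -
  define wit where "wit P xs = (if \<exists>ys. P xs ys then set (SOME ys. P xs ys) else {})"
    for P :: "'a list \<Rightarrow> 'a list \<Rightarrow> bool" and xs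
  have wit: "\<exists>ys. P xs ys \<and> wit P xs = set ys" if "P xs ys" for P xs ys
    using that someI[of "P xs" ys] unfolding wit_def by auto
  define step where "step A = A \<union> (\<Union>P \<in> Ps. \<Union>xs \<in> lists A. wit P xs)" for A
  define S where "S n = (step ^^ n) B" for n
  have S0: "S 0 = B" and SS: "S (Suc n) = step (S n)" for n by (simp_all add: S_def)
  have cn: "countable (S n)" for n
  proof (induction n)
    case (Suc n)
    have "countable (wit P xs)" for P xs unfolding wit_def by (simp add: countable_finite)
    thus ?case unfolding SS step_def using Suc assms(1) by auto
  qed (use assms in \<open>simp add: S0\<close>)
  have sub: "S n \<subseteq> U" for n
  proof (induction n)
    case (Suc n)
    have "wit P xs \<subseteq> U" if "P \<in> Ps" for P xs
    proof (cases "\<exists>ys. P xs ys")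
      case True
      thus ?thesis using wit[of P xs] assms(4)[OF that] by metis
    qed (simp add: wit_def)
    thus ?case unfolding SS step_def using Suc by auto
  qed (use assms in \<open>simp add: S0\<close>)
  have mono: "S n \<subseteq> S m" if "n \<le> m" for n m
    using lift_Suc_mono_le[of S n m] that by (auto simp: SS step_def)
  show ?thesis
  proof (intro exI[of _ "\<Union>n. S n"] conjI ballI allI impI)
    fix P xs ys assume P: "P \<in> Ps" "set xs \<subseteq> (\<Union>n. S n)" "P xs ys"
    have "\<exists>n. set xs \<subseteq> S n"
      using P(2)
    proof (induction xs)
      case (Cons x xs)
      then obtain n m where "set xs \<subseteq> S n" "x \<in> S m" by auto
      hence "set (x # xs) \<subseteq> S (max n m)" using mono[of n "max n m"] mono[of m "max n m"] by auto
      thus ?case by blast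
    qed simp
    then obtain n where n: "set xs \<subseteq> S n" ..
    obtain zs where zs: "P xs zs" "wit P xs = set zs" using wit[of P xs ys] P(3) by blast
    have "wit P xs \<subseteq> S (Suc n)" unfolding SS step_def using P(1) n by auto
    thus "\<exists>ys. set ys \<subseteq> (\<Union>n. S n) \<and> P xs ys" using zs by blast
  qed (use cn sub S0 in auto)
qed

text \<open>Carries \<open>j\<close> from stage \<open>n\<close> to stage \<open>m\<close> through
  the transitions in between; at \<open>m = n\<close>, and by default below, it does
  nothing.\<close>

primrec transport :: "('t \<Rightarrow> 'j \<Rightarrow> 'j) \<Rightarrow> (nat \<Rightarrow> 't) \<Rightarrow> nat \<Rightarrow> nat \<Rightarrow> 'j \<Rightarrow> 'j" where
  "transport act t n 0 j = j"
| "transport act t n (Suc m) j = (if Suc m \<le> n then j else act (t m) (transport act t n m j))"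

lemma transport_refl [simp]: "transport act t n n j = j"
  by (cases n) auto

text \<open>
  Rasiowa--Sikorski: a request born at stage \<open>n\<close> is transported along the transitions until
  the enumeration of all requests reaches it.
\<close>

lemma generic_sequence:
  fixes step :: "'s \<Rightarrow> 't \<Rightarrow> 's \<Rightarrow> bool" and J :: "'s \<Rightarrow> 'j set"
  assumes init: "s0 \<in> St"
    and cnt: "\<And>s. s \<in> St \<Longrightarrow> countable (J s)"
    and pres: "\<And>s t s' j. s \<in> St \<Longrightarrow> step s t s' \<Longrightarrow> j \<in> J s \<Longrightarrow> act t j \<in> J s'"
    and triv: "\<And>s. s \<in> St \<Longrightarrow> \<exists>t s'. step s t s' \<and> s' \<in> St"
    and prog: "\<And>s j. s \<in> St \<Longrightarrow> j \<in> J s \<Longrightarrow> \<exists>t s'. step s t s' \<and> s' \<in> St \<and> solved s' (act t j)"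
  obtains s t where "s 0 = s0" "\<And>n. s n \<in> St" "\<And>n. step (s n) (t n) (s (Suc n))"
    "\<And>n j. j \<in> J (s n) \<Longrightarrow> \<exists>m \<ge> n. solved (s m) (transport act t n m j)"
proof -
  define enum where "enum s i = (if i \<in> to_nat_on (J s) ` J s then Some (from_nat_into (J s) i) else None)" for s i
  have enum1: "j \<in> J s" if "s \<in> St" "enum s i = Some j" for s i j
    using that unfolding enum_def by (auto split: if_splits simp: cnt)
  have enum2: "\<exists>i. enum s i = Some j" if "s \<in> St" "j \<in> J s" for s j
    using that cnt by (intro exI[of _ "to_nat_on (J s) j"]) (auto simp: enum_def)
  \<comment> \<open>The second component is a table of pending requests: entry \<open>k\<close>,
    \<open>i\<close> is the \<open>i\<close>-th request born at stage \<open>k\<close>, already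
    transported to the present stage. Rows of later stages are still empty.\<close>
  define P where "P n x \<longleftrightarrow> fst x \<in> St \<and> (\<forall>k i j. snd x k i = Some j \<longrightarrow> j \<in> J (fst x)) \<and>
    (n = 0 \<longrightarrow> fst x = s0 \<and> snd x = (\<lambda>k. if k = 0 then enum s0 else (\<lambda>_. None)))"
    for n :: nat and x :: "'s \<times> (nat \<Rightarrow> nat \<Rightarrow> 'j option)"
  \<comment> \<open>Step \<open>n\<close> treats the table entry whose coordinates are coded by
    \<open>n\<close>, transports all rows and appends the row of requests born at the new
    stage.\<close>
  define Q where "Q n x y \<longleftrightarrow> (\<exists>t. step (fst x) t (fst y) \<and>
    snd y = (\<lambda>k. if k = Suc n then enum (fst y) else map_option (act t) \<circ> snd x k) \<and>
    (\<forall>j. snd x (fst (prod_decode n)) (snd (prod_decode n)) = Some j \<longrightarrow> solved (fst y) (act t j)))"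
    for n :: nat and x y :: "'s \<times> (nat \<Rightarrow> nat \<Rightarrow> 'j option)"
  have "\<exists>x. P 0 x"
    by (rule exI[of _ "(s0, \<lambda>k. if k = 0 then enum s0 else (\<lambda>_. None))"])
      (use enum1 init in \<open>auto simp: P_def split: if_splits\<close>)
  moreover have "\<exists>y. P (Suc n) y \<and> Q n x y" if x: "P n x" for x n
  proof -
    have St: "fst x \<in> St" using x by (simp add: P_def)
    have "\<exists>t s'. step (fst x) t s' \<and> s' \<in> St \<and>
      (\<forall>j. snd x (fst (prod_decode n)) (snd (prod_decode n)) = Some j \<longrightarrow> solved s' (act t j))"
    proof (cases "snd x (fst (prod_decode n)) (snd (prod_decode n))")
      case None
      thus ?thesis using triv[OF St] by auto
    next
      case (Some j)
      hence "j \<in> J (fst x)" using x by (simp add: P_def)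
      from prog[OF St this] show ?thesis using Some by auto
    qed
    then obtain t s' where t: "step (fst x) t s'" "s' \<in> St"
      "\<forall>j. snd x (fst (prod_decode n)) (snd (prod_decode n)) = Some j \<longrightarrow> solved s' (act t j)" by blast
    define y where "y = (s', \<lambda>k. if k = Suc n then enum s' else map_option (act t) \<circ> snd x k)"
    have "P (Suc n) y" using x t enum1 pres[OF St t(1)] unfolding P_def y_def by (auto split: if_splits)
    moreover have "Q n x y" unfolding Q_def y_def fst_conv snd_conv using t by blast
    ultimately show ?thesis by blast
  qed
  ultimately obtain f where f: "\<And>n. P n (f n)" "\<And>n. Q n (f n) (f (Suc n))"
    using dependent_nat_choice[of P Q] by metis
  define s where "s n = fst (f n)" for n
  define p where "p n = snd (f n)" for n
  have "\<forall>n. \<exists>t. step (s n) t (s (Suc n)) \<and>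
    p (Suc n) = (\<lambda>k. if k = Suc n then enum (s (Suc n)) else map_option (act t) \<circ> p n k) \<and>
    (\<forall>j. p n (fst (prod_decode n)) (snd (prod_decode n)) = Some j \<longrightarrow> solved (s (Suc n)) (act t j))"
    using f(2) unfolding Q_def s_def p_def by blast
  then obtain t where t: "\<And>n. step (s n) (t n) (s (Suc n))"
    "\<And>n. p (Suc n) = (\<lambda>k. if k = Suc n then enum (s (Suc n)) else map_option (act (t n)) \<circ> p n k)"
    "\<And>n j. p n (fst (prod_decode n)) (snd (prod_decode n)) = Some j \<Longrightarrow> solved (s (Suc n)) (act (t n) j)"
    by metis
  have St: "s n \<in> St" for n using f(1)[of n] by (simp add: P_def s_def)
  have p0: "s 0 = s0" "p 0 = (\<lambda>k. if k = 0 then enum s0 else (\<lambda>_. None))"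
    using f(1)[of 0] by (simp_all add: P_def s_def p_def)
  have inv: "p m n i = map_option (transport act t n m) (enum (s n) i)" if "n \<le> m" for n m i
    using that
  proof (induction m)
    case 0
    thus ?case by (simp add: p0 option.map_ident)
  next
    case (Suc m)
    show ?case
    proof (cases "n = Suc m")
      case True
      thus ?thesis by (simp add: t(2) option.map_ident)
    next
      case False
      hence "n \<le> m" using Suc.prems by simp
      thus ?thesis using Suc.IH False by (simp add: t(2) option.map_comp o_def)
    qed
  qed
  have "\<exists>m \<ge> n. solved (s m) (transport act t n m j)" if j: "j \<in> J (s n)" for n j
  proof -
    obtain i where i: "enum (s n) i = Some j" using enum2[OF St j] by blast
    define m where "m = prod_encode (n, i)"
    \<comment> \<open>The pair of birth and index is treated at its own code, which is at least the
      birth; so the entry is present when its turn comes.\<close>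
    have nm: "n \<le> m" unfolding m_def by (rule le_prod_encode_1)
    have "p m (fst (prod_decode m)) (snd (prod_decode m)) = Some (transport act t n m j)"
      using inv[OF nm, of i] i by (simp add: m_def)
    from t(3)[OF this] have "solved (s (Suc m)) (transport act t n (Suc m) j)" using nm by simp
    thus ?thesis using nm by (intro exI[of _ "Suc m"]) simp
  qed
  with p0(1) St t(1) show ?thesis by (intro that[of s t]) auto
qed

section \<open>Kripke models of a fragment\<close>

text \<open>
  A model is a pair of its object part and its arrow part; an accessibility relation between two
  models is a family of relations between their values.
\<close>

context boolean_modal_category_with_quotients
begin

text \<open>A flat functor to sets, tested on the arrows of \<open>A\<close>, that makes arrows of
  \<open>MonPerp\<close> surjective and covers jointly surjective. For products and equalisers only
  existence of a preimage is demanded; over all of \<open>Arr C\<close>, uniqueness follows from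
  existence (\<open>flat_mono_inj\<close>, \<open>flat_limit\<close>).\<close>

definition model :: "'a set \<Rightarrow> ('o \<Rightarrow> 'e set) \<times> ('a \<Rightarrow> 'e \<Rightarrow> 'e) \<Rightarrow> bool" where
  "model A M \<longleftrightarrow>
    (\<forall>f \<in> A. \<forall>x \<in> fst M (Dom C f). snd M f x \<in> fst M (Cod C f)) \<and>
    (\<forall>X \<in> Obj C. Ident C X \<in> A \<longrightarrow> (\<forall>x \<in> fst M X. snd M (Ident C X) x = x)) \<and>
    (\<forall>f \<in> A. \<forall>g \<in> A. Cod C f = Dom C g \<longrightarrow> g \<cdot> f \<in> A \<longrightarrow>
      (\<forall>x \<in> fst M (Dom C f). snd M (g \<cdot> f) x = snd M g (snd M f x))) \<and>
    (\<forall>T. is_terminal C T \<longrightarrow> Ident C T \<in> A \<longrightarrow> fst M T \<noteq> {}) \<and>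
    (\<forall>X Y P p q. is_product C X Y P p q \<longrightarrow> p \<in> A \<longrightarrow> q \<in> A \<longrightarrow>
      (\<forall>x \<in> fst M X. \<forall>y \<in> fst M Y. \<exists>z \<in> fst M P. snd M p z = x \<and> snd M q z = y)) \<and>
    (\<forall>f g m. is_equalizer C f g m \<longrightarrow> f \<in> A \<longrightarrow> g \<in> A \<longrightarrow> m \<in> A \<longrightarrow>
      (\<forall>x \<in> fst M (Dom C f). snd M f x = snd M g x \<longrightarrow> (\<exists>z \<in> fst M (Dom C m). snd M m z = x))) \<and>
    (\<forall>e \<in> MonPerp C. e \<in> A \<longrightarrow> (\<forall>y \<in> fst M (Cod C e). \<exists>x \<in> fst M (Dom C e). snd M e x = y)) \<and>
    (\<forall>m n. cover m n \<longrightarrow> m \<in> A \<longrightarrow> n \<in> A \<longrightarrow> (\<forall>x \<in> fst M (Cod C m).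
      (\<exists>y \<in> fst M (Dom C m). snd M m y = x) \<or> (\<exists>y \<in> fst M (Dom C n). snd M n y = x))) \<and>
    (\<forall>X. zero X \<longrightarrow> Ident C X \<in> A \<longrightarrow> fst M X = {})"

text \<open>The relation is one more flat functor, whose points are the related pairs: hence the
  clauses for terminal objects and products. The clause for \<open>Mon\<close> makes relations on
  subobjects induced ones and also yields equalisers (\<open>flat_accessibility\<close>). The last
  clause is one half of the meaning of \<open>Dia\<close>; existence of successors, the other half,
  is in \<open>kripke\<close>.\<close>

definition accessibility ::
  "'a set \<Rightarrow> ('o \<Rightarrow> 'e set) \<times> ('a \<Rightarrow> 'e \<Rightarrow> 'e) \<Rightarrow> ('o \<Rightarrow> 'e set) \<times> ('a \<Rightarrow> 'e \<Rightarrow> 'e) \<Rightarrow>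
   ('o \<Rightarrow> ('e \<times> 'e) set) \<Rightarrow> bool" where
  "accessibility A M M' R \<longleftrightarrow>
    (\<forall>X. R X \<subseteq> fst M X \<times> fst M' X) \<and>
    (\<forall>f \<in> A. \<forall>x y. (x, y) \<in> R (Dom C f) \<longrightarrow> (snd M f x, snd M' f y) \<in> R (Cod C f)) \<and>
    (\<forall>T. is_terminal C T \<longrightarrow> Ident C T \<in> A \<longrightarrow> R T \<noteq> {}) \<and>
    (\<forall>X Y P p q. is_product C X Y P p q \<longrightarrow> p \<in> A \<longrightarrow> q \<in> A \<longrightarrow>
      (\<forall>x y x' y'. (x, y) \<in> R X \<longrightarrow> (x', y') \<in> R Y \<longrightarrow> (\<exists>z w. (z, w) \<in> R P \<and>
        snd M p z = x \<and> snd M q z = x' \<and> snd M' p w = y \<and> snd M' q w = y'))) \<and>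
    (\<forall>m \<in> Mon C. m \<in> A \<longrightarrow> (\<forall>x \<in> fst M (Dom C m). \<forall>y \<in> fst M' (Dom C m).
      (snd M m x, snd M' m y) \<in> R (Cod C m) \<longrightarrow> (x, y) \<in> R (Dom C m))) \<and>
    (\<forall>q \<in> Quo C. q \<in> A \<longrightarrow> (\<forall>x y. (x, y) \<in> R (Cod C q) \<longrightarrow>
      (\<exists>x' y'. (x', y') \<in> R (Dom C q) \<and> snd M q x' = x \<and> snd M' q y' = y))) \<and>
    (\<forall>m \<in> Mon C. \<forall>n \<in> Dia C (Cod C m) (subobj C m). m \<in> A \<longrightarrow> n \<in> A \<longrightarrow>
      (\<forall>x. \<forall>y \<in> fst M' (Dom C m). (x, snd M' m y) \<in> R (Cod C m) \<longrightarrow>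
        (\<exists>z \<in> fst M (Dom C n). snd M n z = x)))"

text \<open>Beyond well-formedness there are two existence demands: every point of a
  \<open>Dia\<close> has a successor witnessing it, and the models jointly separate subobjects. The
  former gives preservation of \<open>Dia\<close>, the latter conservativity.\<close>

definition kripke ::
  "'a set \<Rightarrow> (('o \<Rightarrow> 'e set) \<times> ('a \<Rightarrow> 'e \<Rightarrow> 'e)) set \<Rightarrow>
   ((('o \<Rightarrow> 'e set) \<times> ('a \<Rightarrow> 'e \<Rightarrow> 'e)) \<times> (('o \<Rightarrow> 'e set) \<times> ('a \<Rightarrow> 'e \<Rightarrow> 'e)) \<times> ('o \<Rightarrow> ('e \<times> 'e) set)) set \<Rightarrow> bool" where
  "kripke A N K \<longleftrightarrow>
    (\<forall>M \<in> N. model A M) \<and>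
    (\<forall>(M, M', R) \<in> K. M \<in> N \<and> M' \<in> N \<and> accessibility A M M' R) \<and>
    (\<forall>M \<in> N. \<forall>m \<in> Mon C. \<forall>n \<in> Dia C (Cod C m) (subobj C m). m \<in> A \<longrightarrow> n \<in> A \<longrightarrow>
      (\<forall>x \<in> fst M (Dom C n). \<exists>M' R. (M, M', R) \<in> K \<and>
        (\<exists>y \<in> fst M' (Dom C m). (snd M n x, snd M' m y) \<in> R (Cod C m)))) \<and>
    (\<forall>m \<in> Mon C. \<forall>n \<in> Mon C. m \<in> A \<longrightarrow> n \<in> A \<longrightarrow> Cod C n = Cod C m \<longrightarrow> \<not> factors_through C m n \<longrightarrow>
      (\<exists>M \<in> N. \<exists>x \<in> fst M (Dom C m). \<forall>y \<in> fst M (Dom C n). snd M n y \<noteq> snd M m x))"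

end

section \<open>Countable fragments\<close>

text \<open>Closure under one witness for each refinement lemma above, so that generic sequences can
  be built inside \<open>A\<close>. An object belongs to the fragment when its identity does. Limits
  and covers are those of \<open>C\<close>; only arrows of \<open>A\<close> are asked to factor or
  to be pulled back.\<close>

locale fragment = boolean_modal_category_with_quotients C
  for C :: "('o, 'a, 'x) modal_category_with_quotients_scheme" +
  fixes A :: "'a set"
  assumes countable_A: "countable A"
    and A_arr: "A \<subseteq> Arr C"
    and A_ident: "f \<in> A \<Longrightarrow> Ident C (Dom C f) \<in> A" "f \<in> A \<Longrightarrow> Ident C (Cod C f) \<in> A"
    and A_comp: "f \<in> A \<Longrightarrow> g \<in> A \<Longrightarrow> Cod C f = Dom C g \<Longrightarrow> g \<cdot> f \<in> A"
    and A_factor: "f \<in> A \<Longrightarrow> g \<in> A \<Longrightarrow> factors_through C f g \<Longrightarrow>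
      \<exists>h \<in> A. Dom C h = Dom C f \<and> Cod C h = Dom C g \<and> g \<cdot> h = f"
    and A_terminal: "is_terminal C T \<Longrightarrow> Ident C T \<in> A \<Longrightarrow> f \<in> A \<Longrightarrow> \<exists>h \<in> A. Dom C h = Dom C f \<and> Cod C h = T"
    and A_product: "is_product C X Y P p q \<Longrightarrow> p \<in> A \<Longrightarrow> q \<in> A \<Longrightarrow> f \<in> A \<Longrightarrow> g \<in> A \<Longrightarrow>
      Dom C f = Dom C g \<Longrightarrow> Cod C f = X \<Longrightarrow> Cod C g = Y \<Longrightarrow>
      \<exists>h \<in> A. Dom C h = Dom C f \<and> Cod C h = P \<and> p \<cdot> h = f \<and> q \<cdot> h = g"
    and A_perp: "e \<in> MonPerp C \<Longrightarrow> e \<in> A \<Longrightarrow> f \<in> A \<Longrightarrow> Cod C f = Cod C e \<Longrightarrow>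
      \<exists>t \<in> A. \<exists>g \<in> A. t \<in> MonPerp C \<and> Cod C t = Dom C f \<and> Dom C g = Dom C t \<and>
        Cod C g = Dom C e \<and> e \<cdot> g = f \<cdot> t"
    and A_cover: "cover m n \<Longrightarrow> m \<in> A \<Longrightarrow> n \<in> A \<Longrightarrow> f \<in> A \<Longrightarrow> Cod C f = Cod C m \<Longrightarrow>
      \<exists>s \<in> A. \<exists>g \<in> A. \<exists>t \<in> A. \<exists>h \<in> A. cover s t \<and> Cod C s = Dom C f \<and> Dom C g = Dom C s \<and>
        Cod C g = Dom C m \<and> Dom C h = Dom C t \<and> Cod C h = Dom C n \<and> f \<cdot> s = m \<cdot> g \<and> f \<cdot> t = n \<cdot> h"
    and A_complement: "m \<in> Mon C \<Longrightarrow> m \<in> A \<Longrightarrow> \<exists>n \<in> A. cover m n \<and>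
      (\<forall>f g. f \<in> Arr C \<longrightarrow> g \<in> Arr C \<longrightarrow> Cod C f = Dom C m \<longrightarrow> Cod C g = Dom C n \<longrightarrow> Dom C g = Dom C f \<longrightarrow>
        m \<cdot> f = n \<cdot> g \<longrightarrow> zero (Dom C f))"
    and A_pos_restrict: "pos v s \<Longrightarrow> v \<in> A \<Longrightarrow> s \<in> A \<Longrightarrow> h \<in> A \<Longrightarrow> Dom C h = Cod C v \<Longrightarrow> m \<in> Mon C \<Longrightarrow> m \<in> A \<Longrightarrow>
      Cod C m = Cod C h \<Longrightarrow> factors_through C (h \<cdot> v) m \<Longrightarrow> factors_through C (h \<cdot> s) m \<Longrightarrow>
      \<exists>x \<in> A. \<exists>h' \<in> A. \<exists>v' \<in> A. \<exists>s' \<in> A. Cod C x = Cod C v \<and> Dom C h' = Dom C x \<and> Cod C h' = Dom C m \<and>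
        h \<cdot> x = m \<cdot> h' \<and> pos v' s' \<and> Cod C v' = Dom C x \<and> Dom C v' = Dom C v \<and> Dom C s' = Dom C s \<and>
        x \<cdot> v' = v \<and> x \<cdot> s' = s"
    and A_pos_cover: "pos v s \<Longrightarrow> v \<in> A \<Longrightarrow> s \<in> A \<Longrightarrow> cover a b \<Longrightarrow> a \<in> A \<Longrightarrow> b \<in> A \<Longrightarrow> Cod C a = Dom C v \<Longrightarrow>
      \<exists>m \<in> A. \<exists>n \<in> A. cover m n \<and> Cod C m = Dom C s \<and> pos (v \<cdot> a) (s \<cdot> m) \<and> pos (v \<cdot> b) (s \<cdot> n)"
    and A_pos_quotient: "pos v s \<Longrightarrow> v \<in> A \<Longrightarrow> s \<in> A \<Longrightarrow> q \<in> Quo C \<Longrightarrow> q \<in> A \<Longrightarrow> h \<in> A \<Longrightarrow>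
      Dom C h = Cod C v \<Longrightarrow> Cod C h = Cod C q \<Longrightarrow>
      \<exists>x \<in> A. \<exists>h' \<in> A. \<exists>t \<in> A. \<exists>v' \<in> A. \<exists>e \<in> A. \<exists>s' \<in> A. Cod C x = Cod C v \<and> Dom C h' = Dom C x \<and>
        Cod C h' = Dom C q \<and> q \<cdot> h' = h \<cdot> x \<and> Cod C t = Dom C v \<and> Dom C v' = Dom C t \<and>
        Cod C v' = Dom C x \<and> x \<cdot> v' = v \<cdot> t \<and> e \<in> MonPerp C \<and> Cod C e = Dom C s \<and> Dom C s' = Dom C e \<and>
        x \<cdot> s' = s \<cdot> e \<and> pos v' s'"

text \<open>Each closure condition becomes a relation between a list of parameters and a list of
  witnesses, as \<open>skolem_closure\<close> requires. Conditions on parameters alone, such as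
  being a product, mostly stay outside the relation: they produce some witness in \<open>C\<close>,
  and then one in \<open>A\<close> satisfies the same relation.\<close>

lemma (in boolean_modal_category_with_quotients) ex_fragment:
  assumes "countable B" "B \<subseteq> Arr C"
  shows "\<exists>A. B \<subseteq> A \<and> fragment C A"
proof -
  define P1 where "P1 = (\<lambda>xs ys. \<exists>f \<in> Arr C. xs = [f] \<and> ys = [Ident C (Dom C f), Ident C (Cod C f)])"
  define P2 where "P2 = (\<lambda>xs ys. \<exists>f g. f \<in> Arr C \<and> g \<in> Arr C \<and> Cod C f = Dom C g \<and> xs = [f, g] \<and> ys = [g \<cdot> f])"
  define P3 where "P3 = (\<lambda>xs ys. \<exists>f g h. h \<in> Arr C \<and> Dom C h = Dom C f \<and> Cod C h = Dom C g \<and> g \<cdot> h = f \<and>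
    xs = [f, g] \<and> ys = [h])"
  define P4 where "P4 = (\<lambda>xs ys. \<exists>T f h. h \<in> Arr C \<and> Dom C h = Dom C f \<and> Cod C h = T \<and> is_terminal C T \<and>
    xs = [Ident C T, f] \<and> ys = [h])"
  define P5 where "P5 = (\<lambda>xs ys. \<exists>p q f g h. h \<in> Arr C \<and> Dom C h = Dom C f \<and> Cod C h = Dom C p \<and>
    p \<cdot> h = f \<and> q \<cdot> h = g \<and> xs = [p, q, f, g] \<and> ys = [h])"
  define P6 where "P6 = (\<lambda>xs ys. \<exists>e f t g. t \<in> MonPerp C \<and> g \<in> Arr C \<and> Cod C t = Dom C f \<and> Dom C g = Dom C t \<and>
    Cod C g = Dom C e \<and> e \<cdot> g = f \<cdot> t \<and> xs = [e, f] \<and> ys = [t, g])"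
  define P7 where "P7 = (\<lambda>xs ys. \<exists>m n f s g t h. cover s t \<and> g \<in> Arr C \<and> h \<in> Arr C \<and> Cod C s = Dom C f \<and>
    Dom C g = Dom C s \<and> Cod C g = Dom C m \<and> Dom C h = Dom C t \<and> Cod C h = Dom C n \<and> f \<cdot> s = m \<cdot> g \<and> f \<cdot> t = n \<cdot> h \<and>
    xs = [m, n, f] \<and> ys = [s, g, t, h])"
  define P8 where "P8 = (\<lambda>xs ys. \<exists>m n. cover m n \<and>
      (\<forall>f g. f \<in> Arr C \<longrightarrow> g \<in> Arr C \<longrightarrow> Cod C f = Dom C m \<longrightarrow> Cod C g = Dom C n \<longrightarrow> Dom C g = Dom C f \<longrightarrow>
        m \<cdot> f = n \<cdot> g \<longrightarrow> zero (Dom C f)) \<and> xs = [m] \<and> ys = [n])"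
  define P9 where "P9 = (\<lambda>xs ys. \<exists>v s h m x h' v' s'. x \<in> Arr C \<and> h' \<in> Arr C \<and>
        Cod C x = Cod C v \<and> Dom C h' = Dom C x \<and> Cod C h' = Dom C m \<and>
        h \<cdot> x = m \<cdot> h' \<and> pos v' s' \<and> Cod C v' = Dom C x \<and> Dom C v' = Dom C v \<and> Dom C s' = Dom C s \<and>
        x \<cdot> v' = v \<and> x \<cdot> s' = s \<and> xs = [v, s, h, m] \<and> ys = [x, h', v', s'])"
  define P10 where "P10 = (\<lambda>xs ys. \<exists>v s a b m n. cover m n \<and> Cod C m = Dom C s \<and>
    pos (v \<cdot> a) (s \<cdot> m) \<and> pos (v \<cdot> b) (s \<cdot> n) \<and> xs = [v, s, a, b] \<and> ys = [m, n])"
  define P11 where "P11 = (\<lambda>xs ys. \<exists>v s q h x h' t v' e s'. x \<in> Arr C \<and> h' \<in> Arr C \<and> t \<in> Arr C \<and>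
        Cod C x = Cod C v \<and> Dom C h' = Dom C x \<and>
        Cod C h' = Dom C q \<and> q \<cdot> h' = h \<cdot> x \<and> Cod C t = Dom C v \<and> Dom C v' = Dom C t \<and>
        Cod C v' = Dom C x \<and> x \<cdot> v' = v \<cdot> t \<and> e \<in> MonPerp C \<and> Cod C e = Dom C s \<and> Dom C s' = Dom C e \<and>
        x \<cdot> s' = s \<cdot> e \<and> pos v' s' \<and> xs = [v, s, q, h] \<and> ys = [x, h', t, v', e, s'])"
  have cov: "s \<in> Arr C" "t \<in> Arr C" if "cover s t" for s t using coverD[OF that] by simp_all
  note defs = P1_def P2_def P3_def P4_def P5_def P6_def P7_def P8_def P9_def P10_def P11_def
  have "\<exists>A. countable A \<and> B \<subseteq> A \<and> A \<subseteq> Arr C \<and>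
    (\<forall>P \<in> {P1, P2, P3, P4, P5, P6, P7, P8, P9, P10, P11}. \<forall>xs ys. set xs \<subseteq> A \<longrightarrow> P xs ys \<longrightarrow> (\<exists>ys. set ys \<subseteq> A \<and> P xs ys))"
  proof (rule skolem_closure)
    fix P xs ys assume "P \<in> {P1, P2, P3, P4, P5, P6, P7, P8, P9, P10, P11}" "P xs ys"
    thus "set ys \<subseteq> Arr C"
      by (auto simp: defs pos_def intro: cov)
  qed (use assms in auto)
  then obtain A where A: "countable A" "B \<subseteq> A" "A \<subseteq> Arr C" and
    cl: "\<And>P xs ys. P \<in> {P1, P2, P3, P4, P5, P6, P7, P8, P9, P10, P11} \<Longrightarrow> set xs \<subseteq> A \<Longrightarrow> P xs ys \<Longrightarrow>
      \<exists>ys. set ys \<subseteq> A \<and> P xs ys" by metis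
  have arr: "f \<in> Arr C" if "f \<in> A" for f using that A by blast
  have "fragment C A"
  proof unfold_locales
    show "countable A" "A \<subseteq> Arr C" by (fact A)+
  next
    fix f assume f: "f \<in> A"
    have "P1 [f] [Ident C (Dom C f), Ident C (Cod C f)]" using arr[OF f] by (simp add: P1_def)
    from cl[of P1, OF _ _ this] f show "Ident C (Dom C f) \<in> A" "Ident C (Cod C f) \<in> A" by (auto simp: P1_def)
  next
    fix f g assume f: "f \<in> A" "g \<in> A" "Cod C f = Dom C g"
    have "P2 [f, g] [g \<cdot> f]" using arr f by (simp add: P2_def)
    from cl[of P2, OF _ _ this] f show "g \<cdot> f \<in> A" by (auto simp: P2_def)
  next
    fix f g assume f: "f \<in> A" "g \<in> A" "factors_through C f g"
    obtain h where "h \<in> Arr C" "Dom C h = Dom C f" "Cod C h = Dom C g" "f = g \<cdot> h"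
      using f(3) by (rule factors_throughE)
    hence "P3 [f, g] [h]" by (simp add: P3_def)
    from cl[of P3, OF _ _ this] f show "\<exists>h \<in> A. Dom C h = Dom C f \<and> Cod C h = Dom C g \<and> g \<cdot> h = f"
      by (auto simp: P3_def)
  next
    fix T f assume f: "is_terminal C T" "Ident C T \<in> A" "f \<in> A"
    have "Dom C f \<in> Obj C" using arr f by simp
    then obtain h where "h \<in> Hom C (Dom C f) T" using f(1) unfolding is_terminal_def by blast
    hence "P4 [Ident C T, f] [h]" using f(1) by (auto simp add: P4_def Hom_def)
    from cl[of P4, OF _ _ this] f
    obtain ys T' where ys: "set ys \<subseteq> A" "\<exists>h. h \<in> Arr C \<and> Dom C h = Dom C f \<and> Cod C h = T' \<and> ys = [h]"
      "Ident C T = Ident C T'" "is_terminal C T'" by (auto simp: P4_def)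
    \<comment> \<open>The parameter list carries the arrow \<open>Ident C T\<close> instead of the
      object, which is recovered as its domain.\<close>
    have "T' = T" using ys(3,4) f(1) ident_arr(2) unfolding is_terminal_def by metis
    thus "\<exists>h \<in> A. Dom C h = Dom C f \<and> Cod C h = T" using ys by auto
  next
    fix X Y P p q f g assume f: "is_product C X Y P p q" "p \<in> A" "q \<in> A" "f \<in> A" "g \<in> A"
      "Dom C f = Dom C g" "Cod C f = X" "Cod C g = Y"
    obtain h where "h \<in> Arr C" "Dom C h = Dom C f" "Cod C h = P" "p \<cdot> h = f" "q \<cdot> h = g"
      using is_product_fill[OF f(1) arr[OF f(4)] arr[OF f(5)] f(6-8)] by blast
    hence "P5 [p, q, f, g] [h]" using is_productD[OF f(1)] by (simp add: P5_def)
    from cl[of P5, OF _ _ this] f show "\<exists>h \<in> A. Dom C h = Dom C f \<and> Cod C h = P \<and> p \<cdot> h = f \<and> q \<cdot> h = g"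
      using is_productD(3)[OF f(1)] by (auto simp: P5_def)
  next
    fix e f assume f: "e \<in> MonPerp C" "e \<in> A" "f \<in> A" "Cod C f = Cod C e"
    obtain t g where "t \<in> MonPerp C" "g \<in> Arr C" "Cod C t = Dom C f" "Dom C g = Dom C t"
      "Cod C g = Dom C e" "e \<cdot> g = f \<cdot> t" by (rule perp_lift[OF f(1) arr[OF f(3)] f(4)])
    hence "P6 [e, f] [t, g]" by (simp add: P6_def)
    from cl[of P6, OF _ _ this] f show "\<exists>t \<in> A. \<exists>g \<in> A. t \<in> MonPerp C \<and> Cod C t = Dom C f \<and> Dom C g = Dom C t \<and>
        Cod C g = Dom C e \<and> e \<cdot> g = f \<cdot> t" by (fastforce simp: P6_def)
  next
    fix m n f assume f: "cover m n" "m \<in> A" "n \<in> A" "f \<in> A" "Cod C f = Cod C m"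
    obtain s g t h where "cover s t" "g \<in> Arr C" "h \<in> Arr C" "Cod C s = Dom C f"
      "Dom C g = Dom C s" "Cod C g = Dom C m" "Dom C h = Dom C t" "Cod C h = Dom C n"
      "f \<cdot> s = m \<cdot> g" "f \<cdot> t = n \<cdot> h" by (rule cover_pullback[OF f(1) arr[OF f(4)] f(5)])
    hence "P7 [m, n, f] [s, g, t, h]" by (simp add: P7_def)
    from cl[of P7, OF _ _ this] f show "\<exists>s \<in> A. \<exists>g \<in> A. \<exists>t \<in> A. \<exists>h \<in> A. cover s t \<and> Cod C s = Dom C f \<and> Dom C g = Dom C s \<and>
        Cod C g = Dom C m \<and> Dom C h = Dom C t \<and> Cod C h = Dom C n \<and> f \<cdot> s = m \<cdot> g \<and> f \<cdot> t = n \<cdot> h"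
      by (fastforce simp: P7_def)
  next
    fix m assume m: "m \<in> Mon C" "m \<in> A"
    obtain n where "cover m n" "\<And>f g. f \<in> Arr C \<Longrightarrow> g \<in> Arr C \<Longrightarrow> Cod C f = Dom C m \<Longrightarrow> Cod C g = Dom C n \<Longrightarrow>
      Dom C g = Dom C f \<Longrightarrow> m \<cdot> f = n \<cdot> g \<Longrightarrow> zero (Dom C f)" using ex_complement[OF m(1)] by blast
    hence "P8 [m] [n]" by (simp add: P8_def)
    from cl[of P8, OF _ _ this] m obtain ys where "set ys \<subseteq> A" "P8 [m] ys" by auto
    thus "\<exists>n \<in> A. cover m n \<and>
      (\<forall>f g. f \<in> Arr C \<longrightarrow> g \<in> Arr C \<longrightarrow> Cod C f = Dom C m \<longrightarrow> Cod C g = Dom C n \<longrightarrow> Dom C g = Dom C f \<longrightarrow>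
        m \<cdot> f = n \<cdot> g \<longrightarrow> zero (Dom C f))" unfolding P8_def by auto
  next
    fix v s h m assume a: "pos v s" "v \<in> A" "s \<in> A" "h \<in> A" "Dom C h = Cod C v" "m \<in> Mon C" "m \<in> A"
      "Cod C m = Cod C h" "factors_through C (h \<cdot> v) m" "factors_through C (h \<cdot> s) m"
    obtain x h' v' s' where "x \<in> Mon C" "Cod C x = Cod C v" "h' \<in> Arr C" "Dom C h' = Dom C x" "Cod C h' = Dom C m"
      "h \<cdot> x = m \<cdot> h'" "pos v' s'" "Cod C v' = Dom C x" "Dom C v' = Dom C v" "Dom C s' = Dom C s"
      "x \<cdot> v' = v" "x \<cdot> s' = s" by (rule pos_restrict[OF a(1) arr[OF a(4)] a(5,6,8-10)])
    hence "P9 [v, s, h, m] [x, h', v', s']" by (simp add: P9_def)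
    from cl[of P9, OF _ _ this] a obtain ys where "set ys \<subseteq> A" "P9 [v, s, h, m] ys" by auto
    thus "\<exists>x \<in> A. \<exists>h' \<in> A. \<exists>v' \<in> A. \<exists>s' \<in> A. Cod C x = Cod C v \<and> Dom C h' = Dom C x \<and> Cod C h' = Dom C m \<and>
        h \<cdot> x = m \<cdot> h' \<and> pos v' s' \<and> Cod C v' = Dom C x \<and> Dom C v' = Dom C v \<and> Dom C s' = Dom C s \<and>
        x \<cdot> v' = v \<and> x \<cdot> s' = s" unfolding P9_def by (elim exE conjE) (rule bexI, rule bexI, rule bexI, rule bexI, auto)
  next
    fix v s a b assume a: "pos v s" "v \<in> A" "s \<in> A" "cover a b" "a \<in> A" "b \<in> A" "Cod C a = Dom C v"
    obtain m n where "cover m n" "Cod C m = Dom C s" "pos (v \<cdot> a) (s \<cdot> m)" "pos (v \<cdot> b) (s \<cdot> n)"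
      by (rule pos_cover[OF a(1,4,7)])
    hence "P10 [v, s, a, b] [m, n]" by (simp add: P10_def)
    from cl[of P10, OF _ _ this] a obtain ys where "set ys \<subseteq> A" "P10 [v, s, a, b] ys" by auto
    thus "\<exists>m \<in> A. \<exists>n \<in> A. cover m n \<and> Cod C m = Dom C s \<and> pos (v \<cdot> a) (s \<cdot> m) \<and> pos (v \<cdot> b) (s \<cdot> n)"
      unfolding P10_def by (elim exE conjE) (rule bexI, rule bexI, auto)
  next
    fix v s q h assume a: "pos v s" "v \<in> A" "s \<in> A" "q \<in> Quo C" "q \<in> A" "h \<in> A"
      "Dom C h = Cod C v" "Cod C h = Cod C q"
    obtain x h' t v' e s' where "x \<in> Arr C" "Cod C x = Cod C v" "h' \<in> Arr C" "Dom C h' = Dom C x"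
      "Cod C h' = Dom C q" "q \<cdot> h' = h \<cdot> x" "t \<in> Arr C" "Cod C t = Dom C v" "Dom C v' = Dom C t"
      "Cod C v' = Dom C x" "x \<cdot> v' = v \<cdot> t" "e \<in> MonPerp C" "Cod C e = Dom C s" "Dom C s' = Dom C e"
      "x \<cdot> s' = s \<cdot> e" "pos v' s'" by (rule pos_quotient[OF a(1,4) arr[OF a(6)] a(7,8)])
    hence "P11 [v, s, q, h] [x, h', t, v', e, s']" by (simp add: P11_def)
    from cl[of P11, OF _ _ this] a obtain ys where "set ys \<subseteq> A" "P11 [v, s, q, h] ys" by auto
    then obtain x h' t v' e s' where w: "x \<in> A" "h' \<in> A" "t \<in> A" "v' \<in> A" "e \<in> A" "s' \<in> A"
      "Cod C x = Cod C v \<and> Dom C h' = Dom C x \<and>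
        Cod C h' = Dom C q \<and> q \<cdot> h' = h \<cdot> x \<and> Cod C t = Dom C v \<and> Dom C v' = Dom C t \<and>
        Cod C v' = Dom C x \<and> x \<cdot> v' = v \<cdot> t \<and> e \<in> MonPerp C \<and> Cod C e = Dom C s \<and> Dom C s' = Dom C e \<and>
        x \<cdot> s' = s \<cdot> e \<and> pos v' s'" unfolding P11_def by auto
    show "\<exists>x \<in> A. \<exists>h' \<in> A. \<exists>t \<in> A. \<exists>v' \<in> A. \<exists>e \<in> A. \<exists>s' \<in> A. Cod C x = Cod C v \<and> Dom C h' = Dom C x \<and>
        Cod C h' = Dom C q \<and> q \<cdot> h' = h \<cdot> x \<and> Cod C t = Dom C v \<and> Dom C v' = Dom C t \<and>
        Cod C v' = Dom C x \<and> x \<cdot> v' = v \<cdot> t \<and> e \<in> MonPerp C \<and> Cod C e = Dom C s \<and> Dom C s' = Dom C e \<and>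
        x \<cdot> s' = s \<cdot> e \<and> pos v' s'"
      by (rule bexI[of _ x], rule bexI[of _ h'], rule bexI[of _ t], rule bexI[of _ v'],
        rule bexI[of _ e], rule bexI[of _ s'], rule w(7)) (rule w)+
  qed
  with A(2) show ?thesis by blast
qed

section \<open>Models from generic sequences\<close>

text \<open>\<open>Lift\<close> and \<open>Split\<close> concern a single model,
  \<open>Quotient_Lift\<close> and \<open>Restrict\<close> the relation between two. One type serves
  the construction of a first model and that of an accessible one.\<close>

datatype 'a request = Lift 'a 'a | Split 'a 'a 'a | Quotient_Lift 'a 'a | Restrict 'a 'a

context fragment
begin

text \<open>The stages of \<open>w\<close> are the objects \<open>Cod C (w n)\<close>, and
  \<open>w n\<close> leads from stage \<open>Suc n\<close> back to stage \<open>n\<close>. For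
  \<open>n \<le> k\<close> the value is the composite from stage \<open>k\<close> to stage
  \<open>n\<close>; the identity is the right value at \<open>k = n\<close> and a default
  below.\<close>

primrec tr :: "(nat \<Rightarrow> 'a) \<Rightarrow> nat \<Rightarrow> nat \<Rightarrow> 'a" where
  "tr w n 0 = Ident C (Cod C (w 0))"
| "tr w n (Suc k) = (if Suc k \<le> n then Ident C (Cod C (w (Suc k))) else tr w n k \<cdot> w k)"

definition sequence :: "(nat \<Rightarrow> 'a) \<Rightarrow> bool" where
  "sequence w \<longleftrightarrow> (\<forall>n. w n \<in> A \<and> Dom C (w n) = Cod C (w (Suc n)))"

text \<open>
  The colimit along \<open>w\<close> of the functors represented by the objects \<open>Cod C (w n)\<close>. A pair \<open>(m, g)\<close>
  stands for \<open>g\<close> at stage \<open>m\<close>; two pairs are identified when their restrictions to a later stage agree.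
\<close>

definition germ :: "(nat \<Rightarrow> 'a) \<Rightarrow> nat \<Rightarrow> 'a \<Rightarrow> (nat \<times> 'a) set" where
  "germ w n f = {(m, g). g \<in> A \<and> Dom C g = Cod C (w m) \<and>
     (\<exists>k \<ge> n. m \<le> k \<and> f \<cdot> tr w n k = g \<cdot> tr w m k)}"

text \<open>The action is computed on a chosen member of the class; \<open>germs_act\<close> shows
  that every representative gives the same result.\<close>

definition germs :: "(nat \<Rightarrow> 'a) \<Rightarrow> ('o \<Rightarrow> (nat \<times> 'a) set set) \<times> ('a \<Rightarrow> (nat \<times> 'a) set \<Rightarrow> (nat \<times> 'a) set)" where
  "germs w = (\<lambda>X. {germ w n f | n f. f \<in> A \<and> Dom C f = Cod C (w n) \<and> Cod C f = X},
     \<lambda>h x. case (SOME p. p \<in> x) of (n, f) \<Rightarrow> germ w n (h \<cdot> f))"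

definition generic :: "(nat \<Rightarrow> 'a) \<Rightarrow> bool" where
  "generic w \<longleftrightarrow> sequence w \<and> (\<forall>n. \<not> zero (Cod C (w n))) \<and>
    (\<forall>n e f. e \<in> MonPerp C \<longrightarrow> e \<in> A \<longrightarrow> f \<in> A \<longrightarrow> Dom C f = Cod C (w n) \<longrightarrow> Cod C f = Cod C e \<longrightarrow>
      (\<exists>m \<ge> n. \<exists>g \<in> A. Dom C g = Cod C (w m) \<and> Cod C g = Dom C e \<and> e \<cdot> g = f \<cdot> tr w n m)) \<and>
    (\<forall>n a b f. cover a b \<longrightarrow> a \<in> A \<longrightarrow> b \<in> A \<longrightarrow> f \<in> A \<longrightarrow> Dom C f = Cod C (w n) \<longrightarrow> Cod C f = Cod C a \<longrightarrow>
      (\<exists>m \<ge> n. \<exists>g \<in> A. Dom C g = Cod C (w m) \<and>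
        (Cod C g = Dom C a \<and> a \<cdot> g = f \<cdot> tr w n m \<or> Cod C g = Dom C b \<and> b \<cdot> g = f \<cdot> tr w n m)))"

section \<open>Stages, transitions and germs along a sequence\<close>

lemma arr [simp]: "f \<in> A \<Longrightarrow> f \<in> Arr C"
  using A_arr by blast

lemma sequenceD:
  assumes "sequence w"
  shows "w n \<in> A" "Dom C (w n) = Cod C (w (Suc n))"
  using assms unfolding sequence_def by auto

lemma tr_refl: "tr w n n = Ident C (Cod C (w n))"
  by (cases n) auto

lemma tr:
  assumes "sequence w" "n \<le> k"
  shows "tr w n k \<in> A" "Dom C (tr w n k) = Cod C (w k)" "Cod C (tr w n k) = Cod C (w n)"
proof -
  have "tr w n k \<in> A \<and> Dom C (tr w n k) = Cod C (w k) \<and> Cod C (tr w n k) = Cod C (w n)"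
    using assms(2)
  proof (induction k)
    case 0
    thus ?case using sequenceD[OF assms(1)] A_ident by simp
  next
    case (Suc k)
    show ?case
    proof (cases "n = Suc k")
      case True
      thus ?thesis using tr_refl[of w n] sequenceD(1)[OF assms(1), of n] A_ident by simp
    next
      case False
      hence "n \<le> k" using Suc.prems by simp
      thus ?thesis using Suc.IH False sequenceD[OF assms(1), of k] A_comp by simp
    qed
  qed
  thus "tr w n k \<in> A" "Dom C (tr w n k) = Cod C (w k)" "Cod C (tr w n k) = Cod C (w n)" by auto
qed

lemma tr_Suc: "n \<le> k \<Longrightarrow> tr w n (Suc k) = tr w n k \<cdot> w k"
  by simp

lemma tr_trans:
  assumes "sequence w" "n \<le> k" "k \<le> l"
  shows "tr w n k \<cdot> tr w k l = tr w n l"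
  using assms(3)
proof (induction l)
  case 0
  thus ?case using assms tr[OF assms(1), of 0 0] by simp
next
  case (Suc l)
  show ?case
  proof (cases "k = Suc l")
    case True
    thus ?thesis using tr[OF assms(1,2)] tr_refl[of w k] by simp
  next
    case False
    hence l: "k \<le> l" using Suc.prems by simp
    have "tr w n k \<cdot> tr w k l \<cdot> w l = (tr w n k \<cdot> tr w k l) \<cdot> w l"
      using tr[OF assms(1,2)] tr[OF assms(1) l] sequenceD[OF assms(1), of l] by simp
    thus ?thesis unfolding tr_Suc[OF l] tr_Suc[OF order.trans[OF assms(2) l]] using Suc.IH[OF l] by simp
  qed
qed

lemma tr_trans_comp:
  assumes "sequence w" "n \<le> k" "k \<le> l" "f \<in> A" "Dom C f = Cod C (w n)"
  shows "(f \<cdot> tr w n k) \<cdot> tr w k l = f \<cdot> tr w n l"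
  using tr_trans[OF assms(1-3)] tr[OF assms(1,2)] tr[OF assms(1,3)] assms(4,5) by simp

lemma germ_mem:
  assumes "sequence w" "f \<in> A" "Dom C f = Cod C (w n)"
  shows "(n, f) \<in> germ w n f"
  using assms unfolding germ_def by auto

lemma germ_eq:
  assumes "sequence w" "f \<in> A" "Dom C f = Cod C (w n)" "g \<in> A" "Dom C g = Cod C (w m)"
  shows "germ w n f = germ w m g \<longleftrightarrow> (\<exists>k \<ge> n. m \<le> k \<and> f \<cdot> tr w n k = g \<cdot> tr w m k)"
proof
  assume "germ w n f = germ w m g"
  hence "(m, g) \<in> germ w n f" using germ_mem[OF assms(1,4,5)] by simp
  thus "\<exists>k \<ge> n. m \<le> k \<and> f \<cdot> tr w n k = g \<cdot> tr w m k" unfolding germ_def by simp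
next
  have sub: "germ w m g \<subseteq> germ w n f"
    if fg: "f \<in> A" "Dom C f = Cod C (w n)" "g \<in> A" "Dom C g = Cod C (w m)" "n \<le> k" "m \<le> k"
      "f \<cdot> tr w n k = g \<cdot> tr w m k" for n f m g k
  proof
    fix p assume "p \<in> germ w m g"
    then obtain l h j where h: "p = (l, h)" "h \<in> A" "Dom C h = Cod C (w l)" "m \<le> j" "l \<le> j"
      "g \<cdot> tr w m j = h \<cdot> tr w l j" unfolding germ_def by auto
    let ?i = "max k j"
    have "f \<cdot> tr w n ?i = (f \<cdot> tr w n k) \<cdot> tr w k ?i" by (rule tr_trans_comp[OF assms(1), symmetric]) (use fg in auto)
    also have "\<dots> = g \<cdot> tr w m ?i" unfolding fg(7) by (rule tr_trans_comp[OF assms(1)]) (use fg in auto)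
    also have "\<dots> = (g \<cdot> tr w m j) \<cdot> tr w j ?i" by (rule tr_trans_comp[OF assms(1), symmetric]) (use fg h in auto)
    also have "\<dots> = h \<cdot> tr w l ?i" unfolding h(6) by (rule tr_trans_comp[OF assms(1)]) (use h in auto)
    finally have "f \<cdot> tr w n ?i = h \<cdot> tr w l ?i" .
    moreover have "n \<le> ?i" "l \<le> ?i" using fg h by auto
    ultimately show "p \<in> germ w n f" unfolding germ_def using h(1-3) by blast
  qed
  assume "\<exists>k \<ge> n. m \<le> k \<and> f \<cdot> tr w n k = g \<cdot> tr w m k"
  then obtain k where "n \<le> k" "m \<le> k" "f \<cdot> tr w n k = g \<cdot> tr w m k" by blast
  thus "germ w n f = germ w m g"
    using sub[of f n g m k] sub[of g m f n k] assms by auto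
qed

lemma germ_tr:
  assumes "sequence w" "f \<in> A" "Dom C f = Cod C (w n)" "n \<le> k"
  shows "germ w k (f \<cdot> tr w n k) = germ w n f"
proof -
  note t = tr[OF assms(1,4)]
  have "f \<cdot> tr w n k \<in> A" "Dom C (f \<cdot> tr w n k) = Cod C (w k)" using A_comp t assms by auto
  moreover have "(f \<cdot> tr w n k) \<cdot> tr w k k = f \<cdot> tr w n k"
    using tr_trans_comp[OF assms(1,4) order.refl assms(2,3)] .
  ultimately show ?thesis using germ_eq[OF assms(1) _ _ assms(2,3), of _ k] assms(4) by blast
qed

lemma germsI: "f \<in> A \<Longrightarrow> Dom C f = Cod C (w n) \<Longrightarrow> Cod C f = X \<Longrightarrow> germ w n f \<in> fst (germs w) X"
  unfolding germs_def by auto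

lemma germsE:
  assumes "x \<in> fst (germs w) X"
  obtains n f where "f \<in> A" "Dom C f = Cod C (w n)" "Cod C f = X" "x = germ w n f"
  using assms unfolding germs_def by auto

lemma germs_act:
  assumes "sequence w" "f \<in> A" "Dom C f = Cod C (w n)" "h \<in> A" "Cod C f = Dom C h"
  shows "snd (germs w) h (germ w n f) = germ w n (h \<cdot> f)"
proof -
  define p where "p = (SOME p. p \<in> germ w n f)"
  have "p \<in> germ w n f" unfolding p_def using germ_mem[OF assms(1-3)] by (rule someI)
  then obtain m g k where g: "p = (m, g)" "g \<in> A" "Dom C g = Cod C (w m)" "n \<le> k" "m \<le> k"
    "f \<cdot> tr w n k = g \<cdot> tr w m k" unfolding germ_def by auto
  note t = tr[OF assms(1) g(4)] tr[OF assms(1) g(5)]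
  have c: "Cod C g = Dom C h"
  proof -
    have "Cod C g = Cod C (g \<cdot> tr w m k)" using t g(2,3) by simp
    also have "\<dots> = Cod C f" unfolding g(6)[symmetric] using t assms by simp
    finally show ?thesis using assms(5) by simp
  qed
  have "(h \<cdot> f) \<cdot> tr w n k = h \<cdot> f \<cdot> tr w n k" using t assms by simp
  also have "\<dots> = (h \<cdot> g) \<cdot> tr w m k" unfolding g(6) using t g(2,3) assms(4) c by simp
  finally have eq: "(h \<cdot> f) \<cdot> tr w n k = (h \<cdot> g) \<cdot> tr w m k" .
  have hf: "h \<cdot> f \<in> A" "Dom C (h \<cdot> f) = Cod C (w n)" "h \<cdot> g \<in> A" "Dom C (h \<cdot> g) = Cod C (w m)"
    using A_comp assms c g(2,3) by auto
  have "germ w n (h \<cdot> f) = germ w m (h \<cdot> g)" using germ_eq[OF assms(1) hf] eq g(4,5) by blast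
  thus ?thesis unfolding germs_def snd_conv p_def[symmetric] g(1) by simp
qed

lemma genericD:
  assumes "generic w"
  shows "sequence w" "\<not> zero (Cod C (w n))"
    "e \<in> MonPerp C \<Longrightarrow> e \<in> A \<Longrightarrow> f \<in> A \<Longrightarrow> Dom C f = Cod C (w n) \<Longrightarrow> Cod C f = Cod C e \<Longrightarrow>
      \<exists>m \<ge> n. \<exists>g \<in> A. Dom C g = Cod C (w m) \<and> Cod C g = Dom C e \<and> e \<cdot> g = f \<cdot> tr w n m"
    "cover a b \<Longrightarrow> a \<in> A \<Longrightarrow> b \<in> A \<Longrightarrow> f \<in> A \<Longrightarrow> Dom C f = Cod C (w n) \<Longrightarrow> Cod C f = Cod C a \<Longrightarrow>
      \<exists>m \<ge> n. \<exists>g \<in> A. Dom C g = Cod C (w m) \<and>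
        (Cod C g = Dom C a \<and> a \<cdot> g = f \<cdot> tr w n m \<or> Cod C g = Dom C b \<and> b \<cdot> g = f \<cdot> tr w n m)"
proof -
  note d = assms[unfolded generic_def]
  show "sequence w" "\<not> zero (Cod C (w n))" using d by auto
  show "\<exists>m \<ge> n. \<exists>g \<in> A. Dom C g = Cod C (w m) \<and> Cod C g = Dom C e \<and> e \<cdot> g = f \<cdot> tr w n m"
    if "e \<in> MonPerp C" "e \<in> A" "f \<in> A" "Dom C f = Cod C (w n)" "Cod C f = Cod C e"
    using d that by metis
  show "\<exists>m \<ge> n. \<exists>g \<in> A. Dom C g = Cod C (w m) \<and>
        (Cod C g = Dom C a \<and> a \<cdot> g = f \<cdot> tr w n m \<or> Cod C g = Dom C b \<and> b \<cdot> g = f \<cdot> tr w n m)"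
    if "cover a b" "a \<in> A" "b \<in> A" "f \<in> A" "Dom C f = Cod C (w n)" "Cod C f = Cod C a"
    using d that by metis
qed

lemma germs_lift:
  assumes "sequence w" "f \<in> A" "Dom C f = Cod C (w n)" "n \<le> m" "g \<in> A" "Dom C g = Cod C (w m)"
    "h \<in> A" "Cod C g = Dom C h" "h \<cdot> g = f \<cdot> tr w n m"
  shows "germ w m g \<in> fst (germs w) (Dom C h)" "snd (germs w) h (germ w m g) = germ w n f"
  using germsI[of g w m, OF assms(5,6,8)] germs_act[OF assms(1,5,6,7,8)] germ_tr[OF assms(1-4)] assms(9) by simp_all

text \<open>A filtered colimit of representables is flat: finitely many germs live at a common
  stage, where \<open>A_product\<close> or \<open>A_factor\<close> supplies the preimage.
  Surjectivity along \<open>MonPerp\<close> and the decision of covers are the genericity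
  conditions, and an inconsistent object has no germs because \<open>zero_dom\<close> would make a
  stage inconsistent.\<close>

lemma germs_model:
  assumes "generic w"
  shows "model A (germs w)"
  unfolding model_def
proof (intro conjI ballI allI impI)
  note G = genericD[OF assms]
  note S = G(1)
  show "snd (germs w) f x \<in> fst (germs w) (Cod C f)" if "f \<in> A" "x \<in> fst (germs w) (Dom C f)" for f x
    using that(2)
  proof (rule germsE)
    fix n g assume g: "g \<in> A" "Dom C g = Cod C (w n)" "Cod C g = Dom C f" "x = germ w n g"
    show ?thesis unfolding g(4) germs_act[OF S g(1,2) that(1) g(3)]
      by (rule germsI) (use A_comp that g(1-3) in auto)
  qed
  show "snd (germs w) (Ident C X) x = x" if "X \<in> Obj C" "Ident C X \<in> A" "x \<in> fst (germs w) X" for X x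
    using that(3) by (rule germsE) (use that germs_act[OF S _ _ that(2)] in auto)
  show "snd (germs w) (g \<cdot> f) x = snd (germs w) g (snd (germs w) f x)"
    if gf: "f \<in> A" "g \<in> A" "Cod C f = Dom C g" "g \<cdot> f \<in> A" "x \<in> fst (germs w) (Dom C f)" for f g x
    using gf(5)
  proof (rule germsE)
    fix n h assume h: "h \<in> A" "Dom C h = Cod C (w n)" "Cod C h = Dom C f" "x = germ w n h"
    have fh: "f \<cdot> h \<in> A" "Dom C (f \<cdot> h) = Cod C (w n)" "Cod C (f \<cdot> h) = Dom C g" using gf h(1-3) A_comp by auto
    have "snd (germs w) (g \<cdot> f) x = germ w n ((g \<cdot> f) \<cdot> h)" unfolding h(4)
      by (rule germs_act[OF S h(1,2) gf(4)]) (use gf h(3) in simp)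
    also have "\<dots> = germ w n (g \<cdot> f \<cdot> h)" using gf(1-4) h(1-3) by simp
    also have "\<dots> = snd (germs w) g (snd (germs w) f x)"
      unfolding h(4) germs_act[OF S h(1,2) gf(1) h(3)] germs_act[OF S fh(1,2) gf(2) fh(3)] ..
    finally show ?thesis .
  qed
  show "fst (germs w) T \<noteq> {}" if T: "is_terminal C T" "Ident C T \<in> A" for T
  proof -
    have i: "Ident C (Cod C (w 0)) \<in> A" using A_ident sequenceD[OF S] by simp
    obtain h where "h \<in> A" "Dom C h = Dom C (Ident C (Cod C (w 0)))" "Cod C h = T"
      using A_terminal[OF T i] by blast
    thus ?thesis using germsI[of h w 0 T] sequenceD[OF S] by auto
  qed
  show "\<exists>z \<in> fst (germs w) P. snd (germs w) p z = x \<and> snd (germs w) q z = y"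
    if P: "is_product C X Y P p q" "p \<in> A" "q \<in> A" "x \<in> fst (germs w) X" "y \<in> fst (germs w) Y" for X Y P p q x y
  proof -
    obtain n f where f: "f \<in> A" "Dom C f = Cod C (w n)" "Cod C f = X" "x = germ w n f" using P(4) by (rule germsE)
    obtain m g where g: "g \<in> A" "Dom C g = Cod C (w m)" "Cod C g = Y" "y = germ w m g" using P(5) by (rule germsE)
    define k where "k = max n m"
    have k: "n \<le> k" "m \<le> k" unfolding k_def by auto
    note t = tr[OF S k(1)] tr[OF S k(2)]
    have "f \<cdot> tr w n k \<in> A" "g \<cdot> tr w m k \<in> A" using A_comp t f(1-3) g(1-3) by auto
    then obtain h where h: "h \<in> A" "Dom C h = Dom C (f \<cdot> tr w n k)" "Cod C h = P" "p \<cdot> h = f \<cdot> tr w n k"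
      "q \<cdot> h = g \<cdot> tr w m k" using A_product[OF P(1-3), of "f \<cdot> tr w n k" "g \<cdot> tr w m k"] t f(1-3) g(1-3) by auto
    have h2: "Dom C h = Cod C (w k)" using h(2) t f by simp
    note D = is_productD[OF P(1)]
    show ?thesis
      using germs_lift[OF S f(1,2) k(1) h(1) h2 P(2)] germs_lift[OF S g(1,2) k(2) h(1) h2 P(3)] h(3-5) D(3,4)
      unfolding f(4) g(4) by auto
  qed
  show "\<exists>z \<in> fst (germs w) (Dom C m). snd (germs w) m z = x"
    if e: "is_equalizer C f g m" "f \<in> A" "g \<in> A" "m \<in> A" "x \<in> fst (germs w) (Dom C f)"
      "snd (germs w) f x = snd (germs w) g x" for f g m x
  proof -
    obtain n h where h: "h \<in> A" "Dom C h = Cod C (w n)" "Cod C h = Dom C f" "x = germ w n h" using e(5) by (rule germsE)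
    note D = is_equalizerD[OF e(1)]
    have fh: "f \<cdot> h \<in> A" "Dom C (f \<cdot> h) = Cod C (w n)" "g \<cdot> h \<in> A" "Dom C (g \<cdot> h) = Cod C (w n)"
      using A_comp e h(1-3) D by auto
    have hg: "Cod C h = Dom C g" using h(3) D by simp
    have "germ w n (f \<cdot> h) = germ w n (g \<cdot> h)"
      using e(6) unfolding h(4) germs_act[OF S h(1,2) e(2) h(3)] germs_act[OF S h(1,2) e(3) hg] .
    then obtain k where k: "n \<le> k" "(f \<cdot> h) \<cdot> tr w n k = (g \<cdot> h) \<cdot> tr w n k"
      using germ_eq[OF S fh] by blast
    note t = tr[OF S k(1)]
    have ht: "h \<cdot> tr w n k \<in> A" "Dom C (h \<cdot> tr w n k) = Cod C (w k)" "Cod C (h \<cdot> tr w n k) = Dom C f"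
      using A_comp t h(1-3) by auto
    have "f \<cdot> h \<cdot> tr w n k = g \<cdot> h \<cdot> tr w n k"
      using k(2) t h(1,2) e(2,3) h(3) hg by simp
    then obtain l where "l \<in> Arr C" "Dom C l = Dom C (h \<cdot> tr w n k)" "Cod C l = Dom C m" "m \<cdot> l = h \<cdot> tr w n k"
      using is_equalizer_fill[OF e(1) arr[OF ht(1)] ht(3)] by blast
    hence "factors_through C (h \<cdot> tr w n k) m" by (intro factors_throughI[of l]) auto
    then obtain l where l: "l \<in> A" "Dom C l = Dom C (h \<cdot> tr w n k)" "Cod C l = Dom C m" "m \<cdot> l = h \<cdot> tr w n k"
      using A_factor[OF ht(1) e(4)] by blast
    show ?thesis using germs_lift[OF S h(1,2) k(1) l(1) _ e(4) l(3,4)] l(2) ht(2) unfolding h(4) by auto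
  qed
  show "\<exists>x \<in> fst (germs w) (Dom C e). snd (germs w) e x = y"
    if e: "e \<in> MonPerp C" "e \<in> A" "y \<in> fst (germs w) (Cod C e)" for e y
  proof -
    obtain n f where f: "f \<in> A" "Dom C f = Cod C (w n)" "Cod C f = Cod C e" "y = germ w n f" using e(3) by (rule germsE)
    obtain m g where g: "n \<le> m" "g \<in> A" "Dom C g = Cod C (w m)" "Cod C g = Dom C e" "e \<cdot> g = f \<cdot> tr w n m"
      using G(3)[OF e(1,2) f(1-3)] by blast
    show ?thesis using germs_lift[OF S f(1,2) g(1-3) e(2) g(4,5)] unfolding f(4) by blast
  qed
  show "(\<exists>y \<in> fst (germs w) (Dom C m). snd (germs w) m y = x) \<or> (\<exists>y \<in> fst (germs w) (Dom C n). snd (germs w) n y = x)"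
    if e: "cover m n" "m \<in> A" "n \<in> A" "x \<in> fst (germs w) (Cod C m)" for m n x
  proof -
    obtain i f where f: "f \<in> A" "Dom C f = Cod C (w i)" "Cod C f = Cod C m" "x = germ w i f" using e(4) by (rule germsE)
    obtain k g where g: "i \<le> k" "g \<in> A" "Dom C g = Cod C (w k)"
      "Cod C g = Dom C m \<and> m \<cdot> g = f \<cdot> tr w i k \<or> Cod C g = Dom C n \<and> n \<cdot> g = f \<cdot> tr w i k"
      using G(4)[OF e(1-3) f(1-3)] by blast
    from g(4) show ?thesis
    proof (elim disjE conjE)
      assume a: "Cod C g = Dom C m" "m \<cdot> g = f \<cdot> tr w i k"
      show ?thesis using germs_lift[OF S f(1,2) g(1-3) e(2) a] unfolding f(4) by blast
    next
      assume a: "Cod C g = Dom C n" "n \<cdot> g = f \<cdot> tr w i k"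
      show ?thesis using germs_lift[OF S f(1,2) g(1-3) e(3) a] unfolding f(4) by blast
    qed
  qed
  show "fst (germs w) X = {}" if "zero X" "Ident C X \<in> A" for X
  proof (rule ccontr)
    assume "fst (germs w) X \<noteq> {}"
    then obtain x where x: "x \<in> fst (germs w) X" by blast
    obtain n f where f: "f \<in> A" "Dom C f = Cod C (w n)" "Cod C f = X" using x by (rule germsE)
    have "zero (Dom C f)" using zero_dom[of f] f that by simp
    thus False using G(2)[of n] f by simp
  qed
qed

text \<open>A request about the new model is a map out of the domain of the new leg and is
  restricted along \<open>t\<close>; a request about the relation is a map out of the common
  codomain of the span and is restricted along \<open>x\<close>.\<close>

primrec pull :: "'a \<Rightarrow> 'a \<Rightarrow> 'a request \<Rightarrow> 'a request" where
  "pull x t (Lift e f) = Lift e (f \<cdot> t)"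
| "pull x t (Split a b f) = Split a b (f \<cdot> t)"
| "pull x t (Quotient_Lift q h) = Quotient_Lift q (h \<cdot> x)"
| "pull x t (Restrict m h) = Restrict m (h \<cdot> x)"

lemma transport_pull:
  assumes "sequence x" "sequence t" "n \<le> m"
  shows "f \<in> A \<Longrightarrow> Dom C f = Cod C (t n) \<Longrightarrow> transport (\<lambda>(x, t). pull x t) (\<lambda>i. (x i, t i)) n m (Lift e f) = Lift e (f \<cdot> tr t n m)"
    "f \<in> A \<Longrightarrow> Dom C f = Cod C (t n) \<Longrightarrow> transport (\<lambda>(x, t). pull x t) (\<lambda>i. (x i, t i)) n m (Split a b f) = Split a b (f \<cdot> tr t n m)"
    "h \<in> A \<Longrightarrow> Dom C h = Cod C (x n) \<Longrightarrow> transport (\<lambda>(x, t). pull x t) (\<lambda>i. (x i, t i)) n m (Quotient_Lift q h) = Quotient_Lift q (h \<cdot> tr x n m)"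
    "h \<in> A \<Longrightarrow> Dom C h = Cod C (x n) \<Longrightarrow> transport (\<lambda>(x, t). pull x t) (\<lambda>i. (x i, t i)) n m (Restrict a h) = Restrict a (h \<cdot> tr x n m)"
proof -
  have step: "(f \<cdot> tr w n m) \<cdot> w m = f \<cdot> tr w n (Suc m)"
    if "sequence w" "f \<in> A" "Dom C f = Cod C (w n)" "n \<le> m" for w f m
    using tr[OF that(1,4)] sequenceD[OF that(1), of m] that by simp
  have refl: "f \<cdot> tr w n n = f" if "sequence w" "f \<in> A" "Dom C f = Cod C (w n)" for w f
    using that by (simp add: tr_refl)
  show "f \<in> A \<Longrightarrow> Dom C f = Cod C (t n) \<Longrightarrow> transport (\<lambda>(x, t). pull x t) (\<lambda>i. (x i, t i)) n m (Lift e f) = Lift e (f \<cdot> tr t n m)"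
    using assms(3) by (induction m rule: dec_induct) (use step[OF assms(2)] refl[OF assms(2)] in \<open>auto simp del: tr.simps comp_assoc\<close>)
  show "f \<in> A \<Longrightarrow> Dom C f = Cod C (t n) \<Longrightarrow> transport (\<lambda>(x, t). pull x t) (\<lambda>i. (x i, t i)) n m (Split a b f) = Split a b (f \<cdot> tr t n m)"
    using assms(3) by (induction m rule: dec_induct) (use step[OF assms(2)] refl[OF assms(2)] in \<open>auto simp del: tr.simps comp_assoc\<close>)
  show "h \<in> A \<Longrightarrow> Dom C h = Cod C (x n) \<Longrightarrow> transport (\<lambda>(x, t). pull x t) (\<lambda>i. (x i, t i)) n m (Quotient_Lift q h) = Quotient_Lift q (h \<cdot> tr x n m)"
    using assms(3) by (induction m rule: dec_induct) (use step[OF assms(1)] refl[OF assms(1)] in \<open>auto simp del: tr.simps comp_assoc\<close>)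
  show "h \<in> A \<Longrightarrow> Dom C h = Cod C (x n) \<Longrightarrow> transport (\<lambda>(x, t). pull x t) (\<lambda>i. (x i, t i)) n m (Restrict a h) = Restrict a (h \<cdot> tr x n m)"
    using assms(3) by (induction m rule: dec_induct) (use step[OF assms(1)] refl[OF assms(1)] in \<open>auto simp del: tr.simps comp_assoc\<close>)
qed

lemma countable_requests: "countable {r. set_request r \<subseteq> A}"
proof -
  have "{r. set_request r \<subseteq> A} \<subseteq> (\<lambda>(e, f). Lift e f) ` (A \<times> A) \<union> (\<lambda>(a, b, f). Split a b f) ` (A \<times> A \<times> A) \<union>
    (\<lambda>(e, f). Quotient_Lift e f) ` (A \<times> A) \<union> (\<lambda>(e, f). Restrict e f) ` (A \<times> A)" (is "_ \<subseteq> ?U")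
  proof
    fix r assume "r \<in> {r. set_request r \<subseteq> A}"
    thus "r \<in> ?U" by (cases r) (auto simp: image_iff)
  qed
  moreover have "countable ?U" using countable_A by (intro countable_Un countable_image countable_SIGMA)
  ultimately show ?thesis by (rule countable_subset)
qed

text \<open>Conditions are the consistent objects of the fragment. A lifting request is met by
  moving to a cover in \<open>MonPerp\<close>, a splitting request by moving to a consistent half of
  a cover.\<close>

lemma ex_generic:
  assumes "Ident C W \<in> A" "W \<in> Obj C" "\<not> zero W"
  obtains w where "generic w" "Cod C (w 0) = W"
proof -
  define St where "St = {W. Ident C W \<in> A \<and> W \<in> Obj C \<and> \<not> zero W}"
  \<comment> \<open>Only one chain of arrows is built here. Its arrow is put into both components of
    the transition, so that \<open>pull\<close> and \<open>transport_pull\<close> apply.\<close>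
  define step where "step V xt V' \<longleftrightarrow> fst xt = snd xt \<and> snd xt \<in> A \<and> Dom C (snd xt) = V' \<and> Cod C (snd xt) = V" for V V' xt
  define J where "J V = {Lift e f | e f. e \<in> MonPerp C \<and> e \<in> A \<and> f \<in> A \<and> Dom C f = V \<and> Cod C f = Cod C e} \<union>
    {Split a b f | a b f. cover a b \<and> a \<in> A \<and> b \<in> A \<and> f \<in> A \<and> Dom C f = V \<and> Cod C f = Cod C a}" for V
  define solved where "solved V r = (case r of
      Lift e f \<Rightarrow> \<exists>g \<in> A. Dom C g = V \<and> Cod C g = Dom C e \<and> e \<cdot> g = f
    | Split a b f \<Rightarrow> \<exists>g \<in> A. Dom C g = V \<and> (Cod C g = Dom C a \<and> a \<cdot> g = f \<or> Cod C g = Dom C b \<and> b \<cdot> g = f)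
    | _ \<Rightarrow> True)" for V r
  have "\<exists>s t. s 0 = W \<and> (\<forall>n. s n \<in> St) \<and> (\<forall>n. step (s n) (t n) (s (Suc n))) \<and>
    (\<forall>n. \<forall>j \<in> J (s n). \<exists>m \<ge> n. solved (s m) (transport (\<lambda>(x, t). pull x t) t n m j))"
  proof (rule generic_sequence[of W St J step "\<lambda>(x, t). pull x t" solved])
    show "W \<in> St" using assms unfolding St_def by simp
    show "countable (J V)" if "V \<in> St" for V
      by (rule countable_subset[OF _ countable_requests]) (auto simp: J_def)
    show "(\<lambda>(x, t). pull x t) xt j \<in> J V'" if "step V xt V'" "j \<in> J V" for V xt V' j
      using that A_comp unfolding step_def J_def by (auto simp: split_beta)
    show "\<exists>t V'. step V t V' \<and> V' \<in> St" if "V \<in> St" for V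
      by (rule exI[of _ "(Ident C V, Ident C V)"], rule exI[of _ V]) (use that in \<open>auto simp: step_def St_def\<close>)
    show "\<exists>t V'. step V t V' \<and> V' \<in> St \<and> solved V' ((\<lambda>(x, t). pull x t) t j)" if V: "V \<in> St" and j: "j \<in> J V" for V j
      using j unfolding J_def
    proof (elim UnE CollectE exE conjE)
      fix e f assume e: "j = Lift e f" "e \<in> MonPerp C" "e \<in> A" "f \<in> A" "Dom C f = V" "Cod C f = Cod C e"
      obtain t g where t: "t \<in> A" "g \<in> A" "t \<in> MonPerp C" "Cod C t = Dom C f" "Dom C g = Dom C t"
        "Cod C g = Dom C e" "e \<cdot> g = f \<cdot> t" using A_perp[OF e(2-4,6)] by blast
      have "\<not> zero (Dom C t)" using zero_perp[OF t(3)] V t(4) e(5) unfolding St_def by auto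
      hence "step V (t, t) (Dom C t)" "Dom C t \<in> St" "solved (Dom C t) (pull t t j)"
        using t e A_ident unfolding step_def St_def solved_def by auto
      thus ?thesis by (intro exI[of _ "(t, t)"] exI[of _ "Dom C t"]) simp
    next
      fix a b f assume e: "j = Split a b f" "cover a b" "a \<in> A" "b \<in> A" "f \<in> A" "Dom C f = V" "Cod C f = Cod C a"
      obtain s g t h where t: "s \<in> A" "g \<in> A" "t \<in> A" "h \<in> A" "cover s t" "Cod C s = Dom C f"
        "Dom C g = Dom C s" "Cod C g = Dom C a" "Dom C h = Dom C t" "Cod C h = Dom C b" "f \<cdot> s = a \<cdot> g" "f \<cdot> t = b \<cdot> h"
        using A_cover[OF e(2-5,7)] by blast
      \<comment> \<open>Were both halves inconsistent, their union, the present condition, would be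
        so too.\<close>
      have "\<not> zero (Dom C s) \<or> \<not> zero (Dom C t)" using zero_cover[OF t(5)] V t(6) e(6) unfolding St_def by auto
      thus ?thesis
      proof
        assume "\<not> zero (Dom C s)"
        hence "step V (s, s) (Dom C s)" "Dom C s \<in> St" "solved (Dom C s) (pull s s j)"
          using t e A_ident unfolding step_def St_def solved_def by auto
        thus ?thesis by (intro exI[of _ "(s, s)"] exI[of _ "Dom C s"]) simp
      next
        assume "\<not> zero (Dom C t)"
        hence "step V (t, t) (Dom C t)" "Dom C t \<in> St" "solved (Dom C t) (pull t t j)"
          using t e A_ident coverD(3)[OF t(5)] unfolding step_def St_def solved_def by auto
        thus ?thesis by (intro exI[of _ "(t, t)"] exI[of _ "Dom C t"]) simp
      qed
    qed
  qed blast
  then obtain s t where st: "s 0 = W" "\<And>n. s n \<in> St" "\<And>n. step (s n) (t n) (s (Suc n))"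
    "\<And>n j. j \<in> J (s n) \<Longrightarrow> \<exists>m \<ge> n. solved (s m) (transport (\<lambda>(x, t). pull x t) t n m j)" by metis
  define w where "w n = snd (t n)" for n
  have t: "t = (\<lambda>i. (w i, w i))" using st(3) unfolding step_def w_def by (simp add: fun_eq_iff prod_eq_iff)
  have w: "w n \<in> A" "Cod C (w n) = s n" "Dom C (w n) = s (Suc n)" for n
    using st(3)[of n] unfolding step_def w_def by auto
  have seq: "sequence w" unfolding sequence_def using w by simp
  have "generic w" unfolding generic_def
  proof (intro conjI allI impI)
    show "\<not> zero (Cod C (w n))" for n using st(2)[of n] w(2) unfolding St_def by simp
    fix n
    show "\<exists>m \<ge> n. \<exists>g \<in> A. Dom C g = Cod C (w m) \<and> Cod C g = Dom C e \<and> e \<cdot> g = f \<cdot> tr w n m"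
      if e: "e \<in> MonPerp C" "e \<in> A" "f \<in> A" "Dom C f = Cod C (w n)" "Cod C f = Cod C e" for e f
    proof -
      have "Lift e f \<in> J (s n)" using e w(2) unfolding J_def by simp
      from st(4)[OF this] obtain m where m: "n \<le> m" "solved (s m) (transport (\<lambda>(x, t). pull x t) t n m (Lift e f))" by blast
      thus ?thesis unfolding t transport_pull(1)[OF seq seq m(1) e(3,4)] solved_def using w(2) by auto
    qed
    show "\<exists>m \<ge> n. \<exists>g \<in> A. Dom C g = Cod C (w m) \<and>
        (Cod C g = Dom C a \<and> a \<cdot> g = f \<cdot> tr w n m \<or> Cod C g = Dom C b \<and> b \<cdot> g = f \<cdot> tr w n m)"
      if e: "cover a b" "a \<in> A" "b \<in> A" "f \<in> A" "Dom C f = Cod C (w n)" "Cod C f = Cod C a" for a b f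
    proof -
      have "Split a b f \<in> J (s n)" using e w(2) unfolding J_def by simp
      from st(4)[OF this] obtain m where m: "n \<le> m" "solved (s m) (transport (\<lambda>(x, t). pull x t) t n m (Split a b f))" by blast
      thus ?thesis unfolding t transport_pull(2)[OF seq seq m(1) e(4,5)] solved_def using w(2) by auto
    qed
  qed (rule seq)
  thus ?thesis using that w(2)[of 0] st(1) by simp
qed

end

section \<open>Accessible models\<close>

context fragment
begin

text \<open>Two representatives with equal values under \<open>m\<close> agree after
  \<open>m\<close> at some later stage, where \<open>m\<close> can be cancelled.\<close>

lemma germs_Mon_inj:
  assumes "sequence w" "m \<in> Mon C" "m \<in> A" "x \<in> fst (germs w) (Dom C m)" "y \<in> fst (germs w) (Dom C m)"
    "snd (germs w) m x = snd (germs w) m y"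
  shows "x = y"
proof -
  obtain i f where f: "f \<in> A" "Dom C f = Cod C (w i)" "Cod C f = Dom C m" "x = germ w i f" using assms(4) by (rule germsE)
  obtain j g where g: "g \<in> A" "Dom C g = Cod C (w j)" "Cod C g = Dom C m" "y = germ w j g" using assms(5) by (rule germsE)
  have mf: "m \<cdot> f \<in> A" "Dom C (m \<cdot> f) = Cod C (w i)" "m \<cdot> g \<in> A" "Dom C (m \<cdot> g) = Cod C (w j)"
    using A_comp assms(3) f g by auto
  have "germ w i (m \<cdot> f) = germ w j (m \<cdot> g)"
    using assms(6) unfolding f(4) g(4) germs_act[OF assms(1) f(1,2) assms(3) f(3)]
      germs_act[OF assms(1) g(1,2) assms(3) g(3)] .
  then obtain k where k: "i \<le> k" "j \<le> k" "(m \<cdot> f) \<cdot> tr w i k = (m \<cdot> g) \<cdot> tr w j k"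
    using germ_eq[OF assms(1) mf] by blast
  note t = tr[OF assms(1) k(1)] tr[OF assms(1) k(2)]
  have "m \<cdot> f \<cdot> tr w i k = m \<cdot> g \<cdot> tr w j k" using k(3) t f(1-3) g(1-3) assms(3) by simp
  hence "f \<cdot> tr w i k = g \<cdot> tr w j k"
    by (rule Mon_cancel[OF assms(2), rotated -1]) (use t f(1-3) g(1-3) in auto)
  thus ?thesis unfolding f(4) g(4) using germ_eq[OF assms(1) f(1,2) g(1,2)] k by blast
qed

definition disjoint_cover :: "'a \<Rightarrow> 'a \<Rightarrow> bool" where
  "disjoint_cover m n \<longleftrightarrow> cover m n \<and>
    (\<forall>f g. f \<in> Arr C \<longrightarrow> g \<in> Arr C \<longrightarrow> Cod C f = Dom C m \<longrightarrow> Cod C g = Dom C n \<longrightarrow> Dom C g = Dom C f \<longrightarrow>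
        m \<cdot> f = n \<cdot> g \<longrightarrow> zero (Dom C f))"

text \<open>
  Finite approximations to a model accessible from the one of \<open>w\<close>: the new model is
  generated by a point of \<open>Dom C v\<close>, and the point \<open>s\<close> at stage \<open>n\<close> of the old model is to be
  related to the image of it under \<open>v\<close>. The second disjunct in \<open>solved\<close> for \<open>Restrict\<close> says that
  the old point will never lie in \<open>m\<close>; in the third, the new one never will.
\<close>

definition states :: "(nat \<Rightarrow> 'a) \<Rightarrow> ('a \<times> nat \<times> 'a) set" where
  "states w = {(v, n, s). v \<in> A \<and> s \<in> A \<and> Dom C s = Cod C (w n) \<and> pos v s}"

text \<open>Three things move at once: the common codomain along \<open>x\<close>, the new leg along
  \<open>t\<close>, and the old leg along the sequence of the old model. The last offers no choice
  except how far to go.\<close>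

definition refine :: "(nat \<Rightarrow> 'a) \<Rightarrow> 'a \<times> nat \<times> 'a \<Rightarrow> 'a \<times> 'a \<Rightarrow> 'a \<times> nat \<times> 'a \<Rightarrow> bool" where
  "refine w = (\<lambda>(v, n, s) (x, t) (v', n', s'). x \<in> A \<and> t \<in> A \<and> Cod C x = Cod C v \<and> Dom C x = Cod C v' \<and>
    Cod C t = Dom C v \<and> Dom C t = Dom C v' \<and> n \<le> n' \<and> x \<cdot> v' = v \<cdot> t \<and> x \<cdot> s' = s \<cdot> tr w n n')"

definition requests :: "'a \<times> nat \<times> 'a \<Rightarrow> 'a request set" where
  "requests = (\<lambda>(v, n, s).
    {Lift e f | e f. e \<in> MonPerp C \<and> e \<in> A \<and> f \<in> A \<and> Dom C f = Dom C v \<and> Cod C f = Cod C e} \<union>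
    {Split a b f | a b f. cover a b \<and> a \<in> A \<and> b \<in> A \<and> f \<in> A \<and> Dom C f = Dom C v \<and> Cod C f = Cod C a} \<union>
    {Quotient_Lift q h | q h. q \<in> Quo C \<and> q \<in> A \<and> h \<in> A \<and> Dom C h = Cod C v \<and> Cod C h = Cod C q} \<union>
    {Restrict m h | m h. m \<in> Mon C \<and> m \<in> A \<and> h \<in> A \<and> Dom C h = Cod C v \<and> Cod C h = Cod C m})"

definition solved :: "(nat \<Rightarrow> 'a) \<Rightarrow> 'a \<times> nat \<times> 'a \<Rightarrow> 'a request \<Rightarrow> bool" where
  "solved w = (\<lambda>(v, n, s) r. case r of
      Lift e f \<Rightarrow> \<exists>g \<in> A. Dom C g = Dom C v \<and> Cod C g = Dom C e \<and> e \<cdot> g = f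
    | Split a b f \<Rightarrow> \<exists>g \<in> A. Dom C g = Dom C v \<and> (Cod C g = Dom C a \<and> a \<cdot> g = f \<or> Cod C g = Dom C b \<and> b \<cdot> g = f)
    | Quotient_Lift q h \<Rightarrow> \<exists>g \<in> A. Dom C g = Cod C v \<and> Cod C g = Dom C q \<and> q \<cdot> g = h
    | Restrict m h \<Rightarrow> (\<exists>g \<in> A. Dom C g = Cod C v \<and> Cod C g = Dom C m \<and> m \<cdot> g = h) \<or>
        \<not> (\<exists>k \<ge> n. \<exists>g \<in> A. Dom C g = Cod C (w k) \<and> Cod C g = Dom C m \<and> m \<cdot> g = (h \<cdot> s) \<cdot> tr w n k) \<or>
        (\<exists>m' \<in> A. disjoint_cover m m' \<and> (\<exists>g \<in> A. Dom C g = Dom C v \<and> Cod C g = Dom C m' \<and> m' \<cdot> g = h \<cdot> v)))"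

lemma statesD:
  assumes "(v, n, s) \<in> states w"
  shows "v \<in> A" "s \<in> A" "Dom C s = Cod C (w n)" "pos v s" "Cod C s = Cod C v"
  using assms unfolding states_def pos_def by auto

lemma states_advance:
  assumes "(v, n, s) \<in> states w" "n \<le> k" "sequence w"
  shows "(v, k, s \<cdot> tr w n k) \<in> states w"
proof -
  note S = statesD[OF assms(1)] and t = tr[OF assms(3,2)]
  show ?thesis unfolding states_def using S t A_comp pos_comp[OF S(4), of "tr w n k"] by auto
qed

text \<open>The old model makes the choice: \<open>A_pos_cover\<close> turns the cover below the new
  leg into a cover \<open>p\<close>, \<open>q\<close> below the old one, genericity of
  \<open>w\<close> places the old point in one of these halves at a later stage, and the new leg
  takes the matching half.\<close>

lemma states_split:
  assumes "(v, n, s) \<in> states w" "generic w" "cover a b" "a \<in> A" "b \<in> A" "f \<in> A" "Dom C f = Dom C v" "Cod C f = Cod C a"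
  shows "\<exists>t \<in> A. \<exists>k \<ge> n. Cod C t = Dom C v \<and> (v \<cdot> t, k, s \<cdot> tr w n k) \<in> states w \<and>
    (\<exists>g \<in> A. Dom C g = Dom C t \<and> (Cod C g = Dom C a \<and> a \<cdot> g = f \<cdot> t \<or> Cod C g = Dom C b \<and> b \<cdot> g = f \<cdot> t))"
proof -
  note S = statesD[OF assms(1)] and G = genericD[OF assms(2)]
  obtain c g d h where c: "c \<in> A" "g \<in> A" "d \<in> A" "h \<in> A" "cover c d" "Cod C c = Dom C f"
    "Dom C g = Dom C c" "Cod C g = Dom C a" "Dom C h = Dom C d" "Cod C h = Dom C b" "f \<cdot> c = a \<cdot> g" "f \<cdot> d = b \<cdot> h"
    using A_cover[OF assms(3-6,8)] by blast
  have cv: "Cod C c = Dom C v" "Cod C d = Dom C v" using c(6) assms(7) coverD(3)[OF c(5)] by auto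
  obtain p q where p: "p \<in> A" "q \<in> A" "cover p q" "Cod C p = Dom C s" "pos (v \<cdot> c) (s \<cdot> p)" "pos (v \<cdot> d) (s \<cdot> q)"
    using A_pos_cover[OF S(4,1,2) c(5,1,3) cv(1)] by blast
  have i: "Ident C (Cod C (w n)) \<in> A" "Cod C (w n) \<in> Obj C" using A_ident sequenceD[OF G(1), of n] by auto
  have q4: "Cod C q = Dom C s" using coverD(3)[OF p(3)] p(4) by simp
  obtain k r where k: "n \<le> k" "r \<in> A" "Dom C r = Cod C (w k)"
    "Cod C r = Dom C p \<and> p \<cdot> r = Ident C (Cod C (w n)) \<cdot> tr w n k \<or>
     Cod C r = Dom C q \<and> q \<cdot> r = Ident C (Cod C (w n)) \<cdot> tr w n k"
    using G(4)[OF p(3,1,2) i(1), of n] i(2) p(4) S(3) by auto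
  note t = tr[OF G(1) k(1)]
  have k': "Cod C r = Dom C p \<and> p \<cdot> r = tr w n k \<or> Cod C r = Dom C q \<and> q \<cdot> r = tr w n k"
    using k(4) t by simp
  have st: "(v \<cdot> e, k, s \<cdot> tr w n k) \<in> states w"
    if "e \<in> A" "Cod C e = Dom C v" "pos (v \<cdot> e) (s \<cdot> u)" "u \<in> A" "Cod C u = Dom C s" "Cod C r = Dom C u" "u \<cdot> r = tr w n k" for e u
  proof -
    have "(s \<cdot> u) \<cdot> r = s \<cdot> tr w n k" using that S k(2) unfolding that(7)[symmetric] by simp
    moreover have "pos (v \<cdot> e) ((s \<cdot> u) \<cdot> r)" using pos_comp[OF that(3)] k(2) that(4-6) S(2) by simp
    ultimately show ?thesis unfolding states_def using A_comp S t that(1,2) k(1) by auto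
  qed
  from k' show ?thesis
  proof (elim disjE conjE)
    assume r: "Cod C r = Dom C p" "p \<cdot> r = tr w n k"
    show ?thesis using st[OF c(1) cv(1) p(5,1,4) r] c k(1) cv by (intro bexI[of _ c] exI[of _ k]) auto
  next
    assume r: "Cod C r = Dom C q" "q \<cdot> r = tr w n k"
    show ?thesis using st[OF c(3) cv(2) p(6,2) q4 r] c k(1) cv by (intro bexI[of _ d] exI[of _ k]) auto
  qed
qed

lemma refine_split:
  assumes "(v, n, s) \<in> states w" "n \<le> k" "t \<in> A" "Cod C t = Dom C v" "sequence w"
  shows "refine w (v, n, s) (Ident C (Cod C v), t) (v \<cdot> t, k, s \<cdot> tr w n k)"
proof -
  note S = statesD[OF assms(1)] and t = tr[OF assms(5,2)]
  show ?thesis unfolding refine_def using S t assms A_ident[OF S(1)] by auto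
qed

lemma states_progress:
  assumes "\<sigma> \<in> states w" "generic w" "r \<in> requests \<sigma>"
  shows "\<exists>xt \<tau>. refine w \<sigma> xt \<tau> \<and> \<tau> \<in> states w \<and> solved w \<tau> ((\<lambda>(x, t). pull x t) xt r)"
proof -
  obtain v n s where \<sigma>: "\<sigma> = (v, n, s)" by (metis prod_cases3)
  note st = assms(1)[unfolded \<sigma>] and G = genericD[OF assms(2)]
  note S = statesD[OF st]
  have "r \<in> requests (v, n, s)" using assms(3) unfolding \<sigma> .
  thus ?thesis unfolding requests_def split_conv
  proof (elim UnE CollectE exE conjE)
    fix e f assume e: "r = Lift e f" "e \<in> MonPerp C" "e \<in> A" "f \<in> A" "Dom C f = Dom C v" "Cod C f = Cod C e"
    obtain t g where t: "t \<in> A" "g \<in> A" "t \<in> MonPerp C" "Cod C t = Dom C f" "Dom C g = Dom C t"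
        "Cod C g = Dom C e" "e \<cdot> g = f \<cdot> t" using A_perp[OF e(2-4,6)] by blast
    have tv: "Cod C t = Dom C v" using t(4) e(5) by simp
    \<comment> \<open>A cover below the new leg does not shrink its image, so the old leg can stay
      where it is.\<close>
    have "(v \<cdot> t, n, s) \<in> states w"
      using pos_perp[OF S(4) t(3) tv] S A_comp t(1) tv unfolding states_def by simp
    moreover have "refine w (v, n, s) (Ident C (Cod C v), t) (v \<cdot> t, n, s)"
      using refine_split[OF st order.refl t(1) tv G(1)] S by (simp add: tr_refl)
    moreover have "solved w (v \<cdot> t, n, s) ((\<lambda>(x, t). pull x t) (Ident C (Cod C v), t) r)"
      unfolding solved_def e(1) using t tv S by auto
    ultimately show ?thesis unfolding \<sigma> by blast
  next
    fix a b f assume e: "r = Split a b f" "cover a b" "a \<in> A" "b \<in> A" "f \<in> A" "Dom C f = Dom C v" "Cod C f = Cod C a"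
    obtain t k where t: "t \<in> A" "n \<le> k" "Cod C t = Dom C v" "(v \<cdot> t, k, s \<cdot> tr w n k) \<in> states w"
      "\<exists>g \<in> A. Dom C g = Dom C t \<and> (Cod C g = Dom C a \<and> a \<cdot> g = f \<cdot> t \<or> Cod C g = Dom C b \<and> b \<cdot> g = f \<cdot> t)"
      using states_split[OF st assms(2) e(2-7)] by blast
    have "solved w (v \<cdot> t, k, s \<cdot> tr w n k) ((\<lambda>(x, t). pull x t) (Ident C (Cod C v), t) r)"
      unfolding solved_def e(1) using t S by auto
    with refine_split[OF st t(2,1,3) G(1)] t(4) show ?thesis unfolding \<sigma> by blast
  next
    fix q h assume q: "r = Quotient_Lift q h" "q \<in> Quo C" "q \<in> A" "h \<in> A" "Dom C h = Cod C v" "Cod C h = Cod C q"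
    obtain x h' t v' e s' where x: "x \<in> A" "h' \<in> A" "t \<in> A" "v' \<in> A" "e \<in> A" "s' \<in> A"
      "Cod C x = Cod C v" "Dom C h' = Dom C x"
      "Cod C h' = Dom C q" "q \<cdot> h' = h \<cdot> x" "Cod C t = Dom C v" "Dom C v' = Dom C t"
      "Cod C v' = Dom C x" "x \<cdot> v' = v \<cdot> t" "e \<in> MonPerp C" "Cod C e = Dom C s" "Dom C s' = Dom C e"
      "x \<cdot> s' = s \<cdot> e" "pos v' s'" using A_pos_quotient[OF S(4,1,2) q(2-6)] by blast
    have i: "Ident C (Cod C (w n)) \<in> A" "Cod C (w n) \<in> Obj C" using A_ident sequenceD[OF G(1), of n] by auto
    \<comment> \<open>The quotient axiom lifts the old leg only after the cover \<open>e\<close>.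
      Genericity of \<open>w\<close> provides a later stage at which the old point itself lifts
      through \<open>e\<close>.\<close>
    obtain k g where k: "n \<le> k" "g \<in> A" "Dom C g = Cod C (w k)" "Cod C g = Dom C e"
      "e \<cdot> g = Ident C (Cod C (w n)) \<cdot> tr w n k"
      using G(3)[OF x(15,5) i(1), of n] i(2) x(16) S(3) by auto
    note t = tr[OF G(1) k(1)]
    have eg: "e \<cdot> g = tr w n k" using k(5) t by simp
    have cs: "Cod C s' = Dom C x" using x(19,13) unfolding pos_def by simp
    have sg: "s' \<cdot> g \<in> A" "Dom C (s' \<cdot> g) = Cod C (w k)" "Cod C (s' \<cdot> g) = Dom C x"
      using A_comp x(6,17) k(2-4) cs by auto
    have "(v', k, s' \<cdot> g) \<in> states w" unfolding states_def using x(4) sg pos_comp[OF x(19)] x(17) k by simp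
    moreover have "refine w (v, n, s) (x, t) (v', k, s' \<cdot> g)"
    proof -
      have "x \<cdot> s' \<cdot> g = (x \<cdot> s') \<cdot> g" using x(1,6,17) cs k(2-4) by simp
      also have "\<dots> = s \<cdot> tr w n k" unfolding x(18) eg[symmetric] using S(2) x(5,16) k(2-4) by simp
      finally show ?thesis unfolding refine_def using x(1,3,7,11-14) k(1) by simp
    qed
    moreover have "solved w (v', k, s' \<cdot> g) ((\<lambda>(x, t). pull x t) (x, t) r)"
      unfolding solved_def q(1) using x(2,8-10,13) by auto
    ultimately show ?thesis unfolding \<sigma> by blast
  next
    fix m h assume m: "r = Restrict m h" "m \<in> Mon C" "m \<in> A" "h \<in> A" "Dom C h = Cod C v" "Cod C h = Cod C m"
    have hs: "h \<cdot> s \<in> A" "Dom C (h \<cdot> s) = Cod C (w n)" "h \<cdot> v \<in> A" "Dom C (h \<cdot> v) = Dom C v" "Cod C (h \<cdot> v) = Cod C m"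
      using A_comp m S by auto
    show ?thesis
    \<comment> \<open>If the old point never enters \<open>m\<close>, the request is settled with no
      change of state. Otherwise the old leg waits until it has entered, and the new point is
      decided between \<open>m\<close> and its complement: in the complement the request is settled
      negatively, and in \<open>m\<close> both legs lie in \<open>m\<close>, so the whole span can
      be restricted.\<close>
    proof (cases "\<exists>k \<ge> n. \<exists>g \<in> A. Dom C g = Cod C (w k) \<and> Cod C g = Dom C m \<and> m \<cdot> g = (h \<cdot> s) \<cdot> tr w n k")
      case False
      have "refine w (v, n, s) (Ident C (Cod C v), Ident C (Dom C v)) (v, n, s)"
        using refine_split[OF st order.refl, of "Ident C (Dom C v)"] S A_ident G(1) by (simp add: tr_refl)
      moreover have "solved w (v, n, s) ((\<lambda>(x, t). pull x t) (Ident C (Cod C v), Ident C (Dom C v)) r)"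
        using False m(4,5) S unfolding solved_def m(1) by simp
      ultimately show ?thesis using st unfolding \<sigma> by blast
    next
      case True
      then obtain k g where k: "n \<le> k" "g \<in> A" "Dom C g = Cod C (w k)" "Cod C g = Dom C m" "m \<cdot> g = (h \<cdot> s) \<cdot> tr w n k"
        by blast
      obtain m' where m': "m' \<in> A" "disjoint_cover m m'" using A_complement[OF m(2,3)] unfolding disjoint_cover_def by blast
      note st' = states_advance[OF st k(1) G(1)]
      have c: "cover m m'" using m'(2) unfolding disjoint_cover_def by simp
      obtain t l where t: "t \<in> A" "k \<le> l" "Cod C t = Dom C v" "(v \<cdot> t, l, (s \<cdot> tr w n k) \<cdot> tr w k l) \<in> states w"
        "\<exists>g \<in> A. Dom C g = Dom C t \<and> (Cod C g = Dom C m \<and> m \<cdot> g = (h \<cdot> v) \<cdot> t \<or> Cod C g = Dom C m' \<and> m' \<cdot> g = (h \<cdot> v) \<cdot> t)"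
        using states_split[OF st' assms(2) c m(3) m'(1) hs(3-5)] by blast
      have nl: "n \<le> l" using k t by simp
      have sl: "(v \<cdot> t, l, s \<cdot> tr w n l) \<in> states w" using t(4) tr_trans_comp[OF G(1) k(1) t(2) S(2,3)] by simp
      note SL = statesD[OF sl]
      note rf = refine_split[OF st nl t(1,3) G(1)]
      have hvt: "(h \<cdot> v) \<cdot> t = h \<cdot> v \<cdot> t" using m(4,5) S t(1,3) by simp
      from t(5) obtain g' where g': "g' \<in> A" "Dom C g' = Dom C t"
        "Cod C g' = Dom C m \<and> m \<cdot> g' = h \<cdot> v \<cdot> t \<or> Cod C g' = Dom C m' \<and> m' \<cdot> g' = h \<cdot> v \<cdot> t" unfolding hvt by blast
      from g'(3) show ?thesis
      proof (elim disjE conjE)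
        assume a: "Cod C g' = Dom C m'" "m' \<cdot> g' = h \<cdot> v \<cdot> t"
        have "solved w (v \<cdot> t, l, s \<cdot> tr w n l) ((\<lambda>(x, t). pull x t) (Ident C (Cod C v), t) r)"
          unfolding solved_def m(1) using m'(1,2) g'(1,2) a t(1,3) S m(4,5) by auto
        thus ?thesis using rf sl unfolding \<sigma> by blast
      next
        assume a: "Cod C g' = Dom C m" "m \<cdot> g' = h \<cdot> v \<cdot> t"
        have f1: "factors_through C (h \<cdot> v \<cdot> t) m"
          by (rule factors_throughI[of g']) (use a g' m(4,5) S t(1,3) in auto)
        note tk = tr[OF G(1) t(2)] and tn = tr[OF G(1) nl]
        have "m \<cdot> g \<cdot> tr w k l = (m \<cdot> g) \<cdot> tr w k l" using m(3) k(2-4) tk by simp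
        also have "\<dots> = (h \<cdot> s) \<cdot> tr w n l" unfolding k(5) by (rule tr_trans_comp[OF G(1) k(1) t(2) hs(1,2)])
        also have "\<dots> = h \<cdot> s \<cdot> tr w n l" using m(4,5) S tn by simp
        finally have eq: "m \<cdot> g \<cdot> tr w k l = h \<cdot> s \<cdot> tr w n l" .
        have f2: "factors_through C (h \<cdot> s \<cdot> tr w n l) m"
          by (rule factors_throughI[of "g \<cdot> tr w k l"]) (use eq k(2-4) tk tn m(4,5) S in auto)
        have hv: "Dom C h = Cod C (v \<cdot> t)" using m(5) S t(1,3) by simp
        obtain x h' v' s' where x: "x \<in> A" "h' \<in> A" "v' \<in> A" "s' \<in> A" "Cod C x = Cod C (v \<cdot> t)" "Dom C h' = Dom C x"
          "Cod C h' = Dom C m" "h \<cdot> x = m \<cdot> h'" "pos v' s'" "Cod C v' = Dom C x" "Dom C v' = Dom C (v \<cdot> t)"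
          "Dom C s' = Dom C (s \<cdot> tr w n l)" "x \<cdot> v' = v \<cdot> t" "x \<cdot> s' = s \<cdot> tr w n l"
          using A_pos_restrict[OF SL(4,1,2) m(4) hv m(2,3) m(6)[symmetric] f1 f2] by blast
        have "(v', l, s') \<in> states w" unfolding states_def using x(3,4,9,12) SL(3) by simp
        moreover have "refine w (v, n, s) (x, t) (v', l, s')"
          unfolding refine_def using x(1,5,10,11,13,14) t(1,3) S nl by simp
        moreover have "solved w (v', l, s') ((\<lambda>(x, t). pull x t) (x, t) r)"
          unfolding solved_def m(1) using x(2,6-8,10) by auto
        ultimately show ?thesis unfolding \<sigma> by blast
      qed
    qed
  qed
qed

lemma requests_pull:
  assumes "\<sigma> \<in> states w" "refine w \<sigma> xt \<tau>" "r \<in> requests \<sigma>"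
  shows "(\<lambda>(x, t). pull x t) xt r \<in> requests \<tau>"
proof -
  obtain v n s v' n' s' x t where e: "\<sigma> = (v, n, s)" "\<tau> = (v', n', s')" "xt = (x, t)" by (metis prod_cases3 surj_pair)
  show ?thesis using assms(2,3) A_comp unfolding e requests_def refine_def split_conv
    by (elim UnE CollectE exE conjE) auto
qed

end

section \<open>Successors and separating points among the models of germs\<close>

context fragment
begin

lemma disjoint_coverD:
  assumes "disjoint_cover m n" "f \<in> Arr C" "g \<in> Arr C" "Cod C f = Dom C m" "Cod C g = Dom C n"
    "Dom C g = Dom C f" "m \<cdot> f = n \<cdot> g"
  shows "zero (Dom C f)"
  using assms unfolding disjoint_cover_def by blast

text \<open>A chain of spans meeting all requests gives two sequences: the arrows \<open>t\<close>
  between domains of the new legs generate the new model, and the arrows \<open>X\<close> between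
  the common codomains carry the relation. The chain starts with \<open>m\<close> as new leg, so
  that the generating point is mapped into \<open>m\<close> by construction.\<close>

lemma ex_accessible:
  assumes w: "generic w" and m: "m \<in> Mon C" "m \<in> A" and n: "n \<in> Dia C (Cod C m) (subobj C m)" "n \<in> A"
    and x: "x \<in> fst (germs w) (Dom C n)"
  shows "\<exists>t R. generic t \<and> accessibility A (germs w) (germs t) R \<and>
    (\<exists>y \<in> fst (germs t) (Dom C m). (snd (germs w) n x, snd (germs t) m y) \<in> R (Cod C m))"
proof -
  note G = genericD[OF w]
  note Sw = G(1)
  have DS: "Dia C (Cod C m) (subobj C m) \<in> carrier (Sub C (Cod C m))"
    using m by (intro Dia_closed subobj_closed) auto
  note nD = carrierD[OF DS n(1)]
  obtain i f where f: "f \<in> A" "Dom C f = Cod C (w i)" "Cod C f = Dom C n" "x = germ w i f" using x by (rule germsE)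
  have nf: "n \<cdot> f \<in> A" "Dom C (n \<cdot> f) = Cod C (w i)" "Cod C (n \<cdot> f) = Cod C m" using A_comp f n nD by auto
  have "lies_in C (n \<cdot> f) (Dia C (Cod C m) (subobj C m))"
  proof -
    have "factors_through C (n \<cdot> f) n" by (rule factors_throughI[of f]) (use f n nD in auto)
    thus ?thesis using lies_in_rep[OF DS n(1)] by simp
  qed
  \<comment> \<open>The first span: its new leg is \<open>m\<close>, its old leg represents the
    given point. It is possible precisely because that point lies in the \<open>Dia\<close> of
    \<open>m\<close>.\<close>
  hence init: "(m, i, n \<cdot> f) \<in> states w" unfolding states_def using pos_Mon[OF m(1)] nf m(2) by simp
  have triv: "\<exists>t s'. refine w s t s' \<and> s' \<in> states w" if s: "s \<in> states w" for s
  proof -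
    obtain v n u where e: "s = (v, n, u)" by (metis prod_cases3)
    note S = statesD[OF s[unfolded e]]
    have "refine w (v, n, u) (Ident C (Cod C v), Ident C (Dom C v)) (v, n, u)"
      using refine_split[OF s[unfolded e] order.refl, of "Ident C (Dom C v)"] S A_ident Sw by (simp add: tr_refl)
    thus ?thesis using s unfolding e by blast
  qed
  have "\<exists>s t. s 0 = (m, i, n \<cdot> f) \<and> (\<forall>n. s n \<in> states w) \<and> (\<forall>n. refine w (s n) (t n) (s (Suc n))) \<and>
    (\<forall>n. \<forall>j \<in> requests (s n). \<exists>l \<ge> n. solved w (s l) (transport (\<lambda>(x, t). pull x t) t n l j))"
  proof (rule generic_sequence[of "(m, i, n \<cdot> f)" "states w" requests "refine w" "\<lambda>(x, t). pull x t" "solved w"])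
    show "countable (requests s)" if "s \<in> states w" for s
      by (rule countable_subset[OF _ countable_requests]) (auto simp: requests_def)
    show "\<exists>t s'. refine w s t s' \<and> s' \<in> states w \<and> solved w s' ((\<lambda>(x, t). pull x t) t j)"
      if "s \<in> states w" "j \<in> requests s" for s j
      using states_progress[OF that(1) w that(2)] .
  qed (use init triv requests_pull in blast)+
  then obtain \<sigma> \<tau> where st: "\<sigma> 0 = (m, i, n \<cdot> f)" "\<And>n. \<sigma> n \<in> states w" "\<And>n. refine w (\<sigma> n) (\<tau> n) (\<sigma> (Suc n))"
    "\<And>n j. j \<in> requests (\<sigma> n) \<Longrightarrow> \<exists>l \<ge> n. solved w (\<sigma> l) (transport (\<lambda>(x, t). pull x t) \<tau> n l j)" by metis
  define v where "v k = fst (\<sigma> k)" for k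
  define N where "N k = fst (snd (\<sigma> k))" for k
  define s where "s k = snd (snd (\<sigma> k))" for k
  define X where "X k = fst (\<tau> k)" for k
  define t where "t k = snd (\<tau> k)" for k
  have \<sigma>: "\<sigma> k = (v k, N k, s k)" for k by (simp add: v_def N_def s_def)
  have \<tau>: "\<tau> = (\<lambda>k. (X k, t k))" by (simp add: X_def t_def fun_eq_iff)
  have S: "v k \<in> A" "s k \<in> A" "Dom C (s k) = Cod C (w (N k))" "pos (v k) (s k)" "Cod C (s k) = Cod C (v k)" for k
    using statesD[OF st(2)[of k, unfolded \<sigma>]] by auto
  have r: "X k \<in> A" "t k \<in> A" "Cod C (X k) = Cod C (v k)" "Dom C (X k) = Cod C (v (Suc k))"
    "Cod C (t k) = Dom C (v k)" "Dom C (t k) = Dom C (v (Suc k))" "N k \<le> N (Suc k)"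
    "X k \<cdot> v (Suc k) = v k \<cdot> t k" "X k \<cdot> s (Suc k) = s k \<cdot> tr w (N k) (N (Suc k))" for k
    using st(3)[of k] unfolding \<sigma> \<tau> refine_def by auto
  have seq: "sequence X" "sequence t" unfolding sequence_def using r by auto
  have Nmono: "N k \<le> N l" if "k \<le> l" for k l using lift_Suc_mono_le[of N] r(7) that by blast
  \<comment> \<open>Both legs commute with the transitions of their sequences. The old model is
    traversed at the varying speed \<open>N\<close>.\<close>
  have move: "tr X k l \<cdot> v l = v k \<cdot> tr t k l \<and> tr X k l \<cdot> s l = s k \<cdot> tr w (N k) (N l)" if "k \<le> l" for k l
    using that
  proof (induction l rule: dec_induct)
    case base
    show ?case using S[of k] r[of k] by (simp add: tr_refl)
  next
    case (step l)
    note tX = tr[OF seq(1) step(1)] and tt = tr[OF seq(2) step(1)] and tw = tr[OF Sw Nmono[OF step(1)]]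
    note tw' = tr[OF Sw r(7)[of l]]
    have "tr X k (Suc l) \<cdot> v (Suc l) = tr X k l \<cdot> X l \<cdot> v (Suc l)"
      unfolding tr_Suc[OF step(1)] using tX r[of l] S(1)[of "Suc l"] by simp
    also have "\<dots> = (tr X k l \<cdot> v l) \<cdot> t l" unfolding r(8) using tX r[of l] S(1)[of l] by simp
    also have "\<dots> = v k \<cdot> tr t k (Suc l)" unfolding tr_Suc[OF step(1)] conjunct1[OF step(3)]
      using tt r[of l] r[of k] S(1)[of k] by simp
    finally have 1: "tr X k (Suc l) \<cdot> v (Suc l) = v k \<cdot> tr t k (Suc l)" .
    have "tr X k (Suc l) \<cdot> s (Suc l) = tr X k l \<cdot> X l \<cdot> s (Suc l)"
      unfolding tr_Suc[OF step(1)] using tX r(1,3,4)[of l] S(2,5)[of "Suc l"] by simp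
    also have "\<dots> = (tr X k l \<cdot> s l) \<cdot> tr w (N l) (N (Suc l))" unfolding r(9) using tX r(1,3,4)[of l] S(2,3,5)[of l] tw' by simp
    also have "\<dots> = s k \<cdot> tr w (N k) (N l) \<cdot> tr w (N l) (N (Suc l))" unfolding conjunct2[OF step(3)]
      using tw tw' S(2,3)[of k] by simp
    also have "\<dots> = s k \<cdot> tr w (N k) (N (Suc l))" using tr_trans[OF Sw Nmono[OF step(1)] r(7)] by simp
    finally show ?case using 1 by simp
  qed
  have gt: "generic t" unfolding generic_def
  proof (intro conjI allI impI)
    show "sequence t" by (rule seq)
    \<comment> \<open>Consistency of the new stages is inherited from the old model by
      \<open>pos_zero\<close>.\<close>
    show "\<not> zero (Cod C (t k))" for k using pos_zero[OF S(4)[of k]] S(3)[of k] r(5)[of k] G(2)[of "N k"] by auto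
    fix k
    show "\<exists>l \<ge> k. \<exists>g \<in> A. Dom C g = Cod C (t l) \<and> Cod C g = Dom C e \<and> e \<cdot> g = f \<cdot> tr t k l"
      if e: "e \<in> MonPerp C" "e \<in> A" "f \<in> A" "Dom C f = Cod C (t k)" "Cod C f = Cod C e" for e f
    proof -
      have "Lift e f \<in> requests (\<sigma> k)" using e r(5)[of k] unfolding \<sigma> requests_def by simp
      from st(4)[OF this] obtain l where l: "k \<le> l" "solved w (\<sigma> l) (transport (\<lambda>(x, t). pull x t) \<tau> k l (Lift e f))" by blast
      have "\<exists>g \<in> A. Dom C g = Cod C (t l) \<and> Cod C g = Dom C e \<and> e \<cdot> g = f \<cdot> tr t k l"
        using l(2) unfolding \<tau> transport_pull(1)[OF seq l(1) e(3,4)] \<sigma> solved_def by (simp add: r(5))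
      with l(1) show ?thesis by blast
    qed
    show "\<exists>l \<ge> k. \<exists>g \<in> A. Dom C g = Cod C (t l) \<and>
        (Cod C g = Dom C a \<and> a \<cdot> g = f \<cdot> tr t k l \<or> Cod C g = Dom C b \<and> b \<cdot> g = f \<cdot> tr t k l)"
      if e: "cover a b" "a \<in> A" "b \<in> A" "f \<in> A" "Dom C f = Cod C (t k)" "Cod C f = Cod C a" for a b f
    proof -
      have "Split a b f \<in> requests (\<sigma> k)" using e r(5)[of k] unfolding \<sigma> requests_def by simp
      from st(4)[OF this] obtain l where l: "k \<le> l" "solved w (\<sigma> l) (transport (\<lambda>(x, t). pull x t) \<tau> k l (Split a b f))" by blast
      have "\<exists>g \<in> A. Dom C g = Cod C (t l) \<and>
        (Cod C g = Dom C a \<and> a \<cdot> g = f \<cdot> tr t k l \<or> Cod C g = Dom C b \<and> b \<cdot> g = f \<cdot> tr t k l)"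
        using l(2) unfolding \<tau> transport_pull(2)[OF seq l(1) e(4,5)] \<sigma> solved_def by (simp add: r(5))
      with l(1) show ?thesis by blast
    qed
  qed
  note Gt = genericD[OF gt]
  \<comment> \<open>The colimit of the functors represented by the codomains of the spans, mapped to
    both models: \<open>h\<close> at stage \<open>k\<close> relates the germs of its composites with
    the two legs.\<close>
  define R where "R Z = {(germ w (N k) (h \<cdot> s k), germ t k (h \<cdot> v k)) | k h. h \<in> A \<and> Dom C h = Cod C (v k) \<and> Cod C h = Z}" for Z
  have hs: "h \<cdot> s k \<in> A" "Dom C (h \<cdot> s k) = Cod C (w (N k))" "Cod C (h \<cdot> s k) = Cod C h"
    "h \<cdot> v k \<in> A" "Dom C (h \<cdot> v k) = Cod C (t k)" "Cod C (h \<cdot> v k) = Cod C h"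
    if "h \<in> A" "Dom C h = Cod C (v k)" for h k
    using A_comp that S[of k] r(5)[of k] by auto
  have RI: "(germ w (N k) (h \<cdot> s k), germ t k (h \<cdot> v k)) \<in> R (Cod C h)" if "h \<in> A" "Dom C h = Cod C (v k)" for h k
    unfolding R_def using that by blast
  have RE: "\<exists>k h. h \<in> A \<and> Dom C h = Cod C (v k) \<and> Cod C h = Z \<and> a = germ w (N k) (h \<cdot> s k) \<and> b = germ t k (h \<cdot> v k)"
    if "(a, b) \<in> R Z" for a b Z
    using that unfolding R_def by blast
  \<comment> \<open>Restriction along the chain \<open>X\<close> names the same related pair at a
    later stage, so that two related pairs can be brought to a common stage.\<close>
  have later: "h \<cdot> tr X k l \<in> A \<and> Dom C (h \<cdot> tr X k l) = Cod C (v l) \<and> Cod C (h \<cdot> tr X k l) = Cod C h \<and>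
      germ w (N l) ((h \<cdot> tr X k l) \<cdot> s l) = germ w (N k) (h \<cdot> s k) \<and>
      germ t l ((h \<cdot> tr X k l) \<cdot> v l) = germ t k (h \<cdot> v k)"
    and later_comp: "(h \<cdot> tr X k l) \<cdot> v l = (h \<cdot> v k) \<cdot> tr t k l"
    if h: "h \<in> A" "Dom C h = Cod C (v k)" "k \<le> l" for h k l
  proof -
    note tX = tr[OF seq(1) h(3)] and tt = tr[OF seq(2) h(3)] and tw = tr[OF Sw Nmono[OF h(3)]]
    note H = hs[OF h(1,2)]
    have tXv: "Cod C (tr X k l) = Cod C (v k)" "Dom C (tr X k l) = Cod C (v l)" using tX r(3) by auto
    have "(h \<cdot> tr X k l) \<cdot> v l = h \<cdot> tr X k l \<cdot> v l" using tX(1) tXv h S(1)[of l] by simp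
    also have "\<dots> = (h \<cdot> v k) \<cdot> tr t k l" unfolding conjunct1[OF move[OF h(3)]] using tt h S(1)[of k] r(5)[of k] by simp
    finally have 1: "(h \<cdot> tr X k l) \<cdot> v l = (h \<cdot> v k) \<cdot> tr t k l" .
    have "(h \<cdot> tr X k l) \<cdot> s l = h \<cdot> tr X k l \<cdot> s l" using tX(1) tXv h S(2,5)[of l] by simp
    also have "\<dots> = (h \<cdot> s k) \<cdot> tr w (N k) (N l)" unfolding conjunct2[OF move[OF h(3)]] using tw h S(2,3,5)[of k] by simp
    finally have 2: "(h \<cdot> tr X k l) \<cdot> s l = (h \<cdot> s k) \<cdot> tr w (N k) (N l)" .
    show "(h \<cdot> tr X k l) \<cdot> v l = (h \<cdot> v k) \<cdot> tr t k l" by (rule 1)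
    show "h \<cdot> tr X k l \<in> A \<and> Dom C (h \<cdot> tr X k l) = Cod C (v l) \<and> Cod C (h \<cdot> tr X k l) = Cod C h \<and>
      germ w (N l) ((h \<cdot> tr X k l) \<cdot> s l) = germ w (N k) (h \<cdot> s k) \<and>
      germ t l ((h \<cdot> tr X k l) \<cdot> v l) = germ t k (h \<cdot> v k)"
      unfolding 1 2 germ_tr[OF Sw H(1,2) Nmono[OF h(3)]] germ_tr[OF seq(2) H(4,5) h(3)]
      using A_comp tX(1) tXv h by simp
  qed
  have "accessibility A (germs w) (germs t) R" unfolding accessibility_def
  proof (intro conjI allI ballI impI)
    show "R Z \<subseteq> fst (germs w) Z \<times> fst (germs t) Z" for Z
    proof
      fix p assume "p \<in> R Z"
      then obtain k h where h: "h \<in> A" "Dom C h = Cod C (v k)" "Cod C h = Z"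
        "p = (germ w (N k) (h \<cdot> s k), germ t k (h \<cdot> v k))" unfolding R_def by blast
      note H = hs[OF h(1,2)]
      show "p \<in> fst (germs w) Z \<times> fst (germs t) Z" unfolding h(4)
        using germsI[of _ w "N k", OF H(1,2)] germsI[of _ t k, OF H(4,5)] H(3,6) h(3) by simp
    qed
    show "(snd (germs w) g a, snd (germs t) g b) \<in> R (Cod C g)" if g: "g \<in> A" "(a, b) \<in> R (Dom C g)" for g a b
    proof -
      obtain k h where h: "h \<in> A" "Dom C h = Cod C (v k)" "Cod C h = Dom C g" "a = germ w (N k) (h \<cdot> s k)" "b = germ t k (h \<cdot> v k)"
        using RE[OF g(2)] by blast
      note H = hs[OF h(1,2)]
      have "snd (germs w) g a = germ w (N k) ((g \<cdot> h) \<cdot> s k)" unfolding h(4)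
        using germs_act[OF Sw H(1,2) g(1)] H(3) h(1-3) g(1) S[of k] by simp
      moreover have "snd (germs t) g b = germ t k ((g \<cdot> h) \<cdot> v k)" unfolding h(5)
        using germs_act[OF seq(2) H(4,5) g(1)] H(6) h(1-3) g(1) S[of k] by simp
      ultimately show ?thesis using RI[of "g \<cdot> h" k] A_comp h(1-3) g(1) by simp
    qed
    show "R T \<noteq> {}" if T: "is_terminal C T" "Ident C T \<in> A" for T
    proof -
      have i: "Ident C (Cod C (v 0)) \<in> A" using A_ident S(1) by simp
      obtain h where h: "h \<in> A" "Dom C h = Dom C (Ident C (Cod C (v 0)))" "Cod C h = T"
        using A_terminal[OF T i] by blast
      have "Dom C h = Cod C (v 0)" using h(2) S(1)[of 0] by simp
      from RI[OF h(1) this] h(3) show ?thesis by auto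
    qed
    show "\<exists>z z'. (z, z') \<in> R P \<and> snd (germs w) p z = a \<and> snd (germs w) q z = a' \<and>
        snd (germs t) p z' = b \<and> snd (germs t) q z' = b'"
      if P: "is_product C Y Z P p q" "p \<in> A" "q \<in> A" "(a, b) \<in> R Y" "(a', b') \<in> R Z" for Y Z P p q a b a' b'
    proof -
      obtain k h where h: "h \<in> A" "Dom C h = Cod C (v k)" "Cod C h = Y" "a = germ w (N k) (h \<cdot> s k)" "b = germ t k (h \<cdot> v k)"
        using RE[OF P(4)] by blast
      obtain k' h' where h': "h' \<in> A" "Dom C h' = Cod C (v k')" "Cod C h' = Z" "a' = germ w (N k') (h' \<cdot> s k')"
        "b' = germ t k' (h' \<cdot> v k')" using RE[OF P(5)] by blast
      define l where "l = max k k'"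
      have l: "k \<le> l" "k' \<le> l" unfolding l_def by auto
      note L = later[OF h(1,2) l(1)] and L' = later[OF h'(1,2) l(2)]
      obtain g where g: "g \<in> A" "Dom C g = Dom C (h \<cdot> tr X k l)" "Cod C g = P" "p \<cdot> g = h \<cdot> tr X k l" "q \<cdot> g = h' \<cdot> tr X k' l"
        using A_product[OF P(1-3), of "h \<cdot> tr X k l" "h' \<cdot> tr X k' l"] L L' h(3) h'(3) by auto
      have gl: "Dom C g = Cod C (v l)" using g(2) L by simp
      note H = hs[OF g(1) gl]
      note D = is_productD[OF P(1)]
      have pg: "Cod C g = Dom C p" "Cod C g = Dom C q" using g(3) D by auto
      have as: "p \<cdot> g \<cdot> s l = (p \<cdot> g) \<cdot> s l" "q \<cdot> g \<cdot> s l = (q \<cdot> g) \<cdot> s l"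
        "p \<cdot> g \<cdot> v l = (p \<cdot> g) \<cdot> v l" "q \<cdot> g \<cdot> v l = (q \<cdot> g) \<cdot> v l"
        using P(2,3) g(1) gl pg S[of l] by simp_all
      show ?thesis
      proof (intro exI conjI)
        show "(germ w (N l) (g \<cdot> s l), germ t l (g \<cdot> v l)) \<in> R P" using RI[OF g(1) gl] g(3) by simp
        show "snd (germs w) p (germ w (N l) (g \<cdot> s l)) = a"
          using germs_act[OF Sw H(1,2) P(2)] H(3) pg(1) L unfolding h(4) as g(4) by simp
        show "snd (germs w) q (germ w (N l) (g \<cdot> s l)) = a'"
          using germs_act[OF Sw H(1,2) P(3)] H(3) pg(2) L' unfolding h'(4) as g(5) by simp
        show "snd (germs t) p (germ t l (g \<cdot> v l)) = b"
          using germs_act[OF seq(2) H(4,5) P(2)] H(6) pg(1) L unfolding h(5) as g(4) by simp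
        show "snd (germs t) q (germ t l (g \<cdot> v l)) = b'"
          using germs_act[OF seq(2) H(4,5) P(3)] H(6) pg(2) L' unfolding h'(5) as g(5) by simp
      qed
    qed
    show "(a, b) \<in> R (Dom C d)"
      if d: "d \<in> Mon C" "d \<in> A" "a \<in> fst (germs w) (Dom C d)" "b \<in> fst (germs t) (Dom C d)"
        "(snd (germs w) d a, snd (germs t) d b) \<in> R (Cod C d)" for d a b
    proof -
      obtain k h where h: "h \<in> A" "Dom C h = Cod C (v k)" "Cod C h = Cod C d"
        "snd (germs w) d a = germ w (N k) (h \<cdot> s k)" "snd (germs t) d b = germ t k (h \<cdot> v k)"
        using RE[OF d(5)] by blast
      have "Restrict d h \<in> requests (\<sigma> k)" using d h unfolding \<sigma> requests_def by simp
      from st(4)[OF this] obtain l where l: "k \<le> l" "solved w (\<sigma> l) (transport (\<lambda>(x, t). pull x t) \<tau> k l (Restrict d h))" by blast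
      have hX: "Dom C h = Cod C (X k)" using h(2) r(3) by simp
      define h' where "h' = h \<cdot> tr X k l"
      note L = later[OF h(1,2) l(1), folded h'_def]
      have h': "h' \<in> A" "Dom C h' = Cod C (v l)" "Cod C h' = Cod C d" using L h(3) by auto
      have ea: "snd (germs w) d a = germ w (N l) (h' \<cdot> s l)" and eb: "snd (germs t) d b = germ t l (h' \<cdot> v l)"
        using L h(4,5) by auto
      note H = hs[OF h'(1,2)]
      obtain i' f' where f': "f' \<in> A" "Dom C f' = Cod C (w i')" "Cod C f' = Dom C d" "a = germ w i' f'" using d(3) by (rule germsE)
      obtain j g where g: "g \<in> A" "Dom C g = Cod C (t j)" "Cod C g = Dom C d" "b = germ t j g" using d(4) by (rule germsE)
      have df: "d \<cdot> f' \<in> A" "Dom C (d \<cdot> f') = Cod C (w i')" "d \<cdot> g \<in> A" "Dom C (d \<cdot> g) = Cod C (t j)"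
        using A_comp d(2) f' g by auto
      \<comment> \<open>Of the three outcomes the second is excluded because the old point is a
        value of \<open>d\<close>, and the third because the new one is: a common element of
        \<open>d\<close> and its complement would make a stage of \<open>t\<close> inconsistent. So
        the span itself has moved into \<open>d\<close>.\<close>
      have s: "(\<exists>g \<in> A. Dom C g = Cod C (v l) \<and> Cod C g = Dom C d \<and> d \<cdot> g = h') \<or>
        \<not> (\<exists>k \<ge> N l. \<exists>g \<in> A. Dom C g = Cod C (w k) \<and> Cod C g = Dom C d \<and> d \<cdot> g = (h' \<cdot> s l) \<cdot> tr w (N l) k) \<or>
        (\<exists>m' \<in> A. disjoint_cover d m' \<and> (\<exists>g \<in> A. Dom C g = Dom C (v l) \<and> Cod C g = Dom C m' \<and> m' \<cdot> g = h' \<cdot> v l))"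
        using l(2) unfolding \<tau> transport_pull(4)[OF seq l(1) h(1) hX] \<sigma> solved_def h'_def[symmetric] by simp
      moreover have "\<exists>k \<ge> N l. \<exists>g \<in> A. Dom C g = Cod C (w k) \<and> Cod C g = Dom C d \<and> d \<cdot> g = (h' \<cdot> s l) \<cdot> tr w (N l) k"
      proof -
        have "germ w i' (d \<cdot> f') = germ w (N l) (h' \<cdot> s l)"
          using ea unfolding f'(4) germs_act[OF Sw f'(1,2) d(2) f'(3)] .
        then obtain e where e: "i' \<le> e" "N l \<le> e" "(d \<cdot> f') \<cdot> tr w i' e = (h' \<cdot> s l) \<cdot> tr w (N l) e"
          using germ_eq[OF Sw df(1,2) H(1,2)] by blast
        note te = tr[OF Sw e(1)]
        have "d \<cdot> f' \<cdot> tr w i' e = (h' \<cdot> s l) \<cdot> tr w (N l) e" using e(3) te f' d(2) by simp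
        thus ?thesis using e(2) te f' A_comp[OF te(1) f'(1)] by (intro exI[of _ e] conjI bexI[of _ "f' \<cdot> tr w i' e"]) auto
      qed
      moreover have False if m': "m' \<in> A" "disjoint_cover d m'" "g' \<in> A" "Dom C g' = Dom C (v l)" "Cod C g' = Dom C m'"
        "m' \<cdot> g' = h' \<cdot> v l" for m' g'
      proof -
        have "germ t j (d \<cdot> g) = germ t l (h' \<cdot> v l)"
          using eb unfolding g(4) germs_act[OF seq(2) g(1,2) d(2) g(3)] .
        then obtain e where e: "j \<le> e" "l \<le> e" "(d \<cdot> g) \<cdot> tr t j e = (h' \<cdot> v l) \<cdot> tr t l e"
          using germ_eq[OF seq(2) df(3,4) H(4,5)] by blast
        note te = tr[OF seq(2) e(1)] and te' = tr[OF seq(2) e(2)]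
        have "d \<cdot> g \<cdot> tr t j e = (d \<cdot> g) \<cdot> tr t j e" using te g d(2) by simp
        also have "\<dots> = m' \<cdot> g' \<cdot> tr t l e" unfolding e(3) m'(6)[symmetric] using te' m'(1,3-5) r(5)[of l] by simp
        finally have "d \<cdot> g \<cdot> tr t j e = m' \<cdot> g' \<cdot> tr t l e" .
        hence "zero (Dom C (g \<cdot> tr t j e))"
          by (rule disjoint_coverD[OF m'(2), rotated -1]) (use te te' g m'(1,3-5) r(5)[of l] in auto)
        thus False using te g Gt(2)[of e] by simp
      qed
      ultimately obtain g' where g': "g' \<in> A" "Dom C g' = Cod C (v l)" "Cod C g' = Dom C d" "d \<cdot> g' = h'" by blast
      note H' = hs[OF g'(1,2)]
      have "d \<cdot> g' \<cdot> s l = h' \<cdot> s l" "d \<cdot> g' \<cdot> v l = h' \<cdot> v l"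
        unfolding g'(4)[symmetric] using d(2) g'(1-3) S[of l] by simp_all
      hence "snd (germs w) d (germ w (N l) (g' \<cdot> s l)) = snd (germs w) d a" "snd (germs t) d (germ t l (g' \<cdot> v l)) = snd (germs t) d b"
        using germs_act[OF Sw H'(1,2) d(2)] germs_act[OF seq(2) H'(4,5) d(2)] H'(3,6) g'(3) ea eb by simp_all
      \<comment> \<open>The lift through \<open>d\<close> gives a related pair with the same values
        under \<open>d\<close> as \<open>a\<close> and \<open>b\<close>; since \<open>d\<close> acts
        injectively on both models, it is that pair.\<close>
      hence "germ w (N l) (g' \<cdot> s l) = a" "germ t l (g' \<cdot> v l) = b"
        using germs_Mon_inj[OF Sw d(1,2) germsI[of _ w "N l", OF H'(1,2)] d(3)] germs_Mon_inj[OF seq(2) d(1,2) germsI[of _ t l, OF H'(4,5)] d(4)]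
          H'(3,6) g'(3) by simp_all
      thus ?thesis using RI[OF g'(1,2)] g'(3) by simp
    qed
    show "\<exists>a' b'. (a', b') \<in> R (Dom C q) \<and> snd (germs w) q a' = a \<and> snd (germs t) q b' = b"
      if q: "q \<in> Quo C" "q \<in> A" "(a, b) \<in> R (Cod C q)" for q a b
    proof -
      obtain k h where h: "h \<in> A" "Dom C h = Cod C (v k)" "Cod C h = Cod C q"
        "a = germ w (N k) (h \<cdot> s k)" "b = germ t k (h \<cdot> v k)"
        using RE[OF q(3)] by blast
      have "Quotient_Lift q h \<in> requests (\<sigma> k)" using q h unfolding \<sigma> requests_def by simp
      from st(4)[OF this] obtain l where l: "k \<le> l" "solved w (\<sigma> l) (transport (\<lambda>(x, t). pull x t) \<tau> k l (Quotient_Lift q h))" by blast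
      have hX: "Dom C h = Cod C (X k)" using h(2) r(3) by simp
      note L = later[OF h(1,2) l(1)]
      obtain g where g: "g \<in> A" "Dom C g = Cod C (v l)" "Cod C g = Dom C q" "q \<cdot> g = h \<cdot> tr X k l"
        using l(2) unfolding \<tau> transport_pull(3)[OF seq l(1) h(1) hX] \<sigma> solved_def by auto
      note H = hs[OF g(1,2)]
      have as: "q \<cdot> g \<cdot> s l = (q \<cdot> g) \<cdot> s l" "q \<cdot> g \<cdot> v l = (q \<cdot> g) \<cdot> v l" using q(2) g(1-3) S[of l] by simp_all
      show ?thesis
      proof (intro exI conjI)
        show "(germ w (N l) (g \<cdot> s l), germ t l (g \<cdot> v l)) \<in> R (Dom C q)" using RI[OF g(1,2)] g(3) by simp
        show "snd (germs w) q (germ w (N l) (g \<cdot> s l)) = a"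
          using germs_act[OF Sw H(1,2) q(2)] H(3) g(3) L unfolding h(4) as g(4) by simp
        show "snd (germs t) q (germ t l (g \<cdot> v l)) = b"
          using germs_act[OF seq(2) H(4,5) q(2)] H(6) g(3) L unfolding h(5) as g(4) by simp
      qed
    qed
    show "\<exists>z \<in> fst (germs w) (Dom C e). snd (germs w) e z = a"
      if d: "d \<in> Mon C" "e \<in> Dia C (Cod C d) (subobj C d)" "d \<in> A" "e \<in> A" "b \<in> fst (germs t) (Dom C d)"
        "(a, snd (germs t) d b) \<in> R (Cod C d)" for d e a b
    proof -
      obtain k h where h: "h \<in> A" "Dom C h = Cod C (v k)" "Cod C h = Cod C d"
        "a = germ w (N k) (h \<cdot> s k)" "snd (germs t) d b = germ t k (h \<cdot> v k)"
        using RE[OF d(6)] by blast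
      obtain j g where g: "g \<in> A" "Dom C g = Cod C (t j)" "Cod C g = Dom C d" "b = germ t j g" using d(5) by (rule germsE)
      have dg: "d \<cdot> g \<in> A" "Dom C (d \<cdot> g) = Cod C (t j)" using A_comp d g by auto
      note H = hs[OF h(1,2)]
      have "germ t j (d \<cdot> g) = germ t k (h \<cdot> v k)"
          using h(5) unfolding g(4) germs_act[OF seq(2) g(1,2) d(3) g(3)] .
      then obtain l where l: "j \<le> l" "k \<le> l" "(d \<cdot> g) \<cdot> tr t j l = (h \<cdot> v k) \<cdot> tr t k l"
        using germ_eq[OF seq(2) dg H(4,5)] by blast
      define h' where "h' = h \<cdot> tr X k l"
      note L = later[OF h(1,2) l(2), folded h'_def]
      have h': "h' \<in> A" "Dom C h' = Cod C (v l)" "Cod C h' = Cod C d" using L h(3) by auto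
      note H' = hs[OF h'(1,2)]
      note te = tr[OF seq(2) l(1)]
      \<comment> \<open>At a stage where the two representatives of the value agree, the composite
        of \<open>h'\<close> with the new leg lies in \<open>d\<close>; then
        \<open>pos_sound\<close> puts its composite with the old leg into the \<open>Dia\<close> of
        \<open>d\<close>.\<close>
      have "h' \<cdot> v l = d \<cdot> g \<cdot> tr t j l"
        using later_comp[OF h(1,2) l(2), folded h'_def] l(3) te g d(3) by simp
      hence "factors_through C (h' \<cdot> v l) d" by (intro factors_throughI[of "g \<cdot> tr t j l"]) (use te g H' r(5)[of l] in auto)
      hence "lies_in C (h' \<cdot> v l) (subobj C d)" using lies_in_subobj[OF d(1)] by simp
      moreover have c: "subobj C d \<in> carrier (Sub C (Cod C h'))" using subobj_closed[OF d(1)] h'(3) by simp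
      ultimately have "lies_in C (h' \<cdot> s l) (Dia C (Cod C h') (subobj C d))"
        using pos_sound[OF S(4)[of l] arr[OF h'(1)] h'(2)] by blast
      moreover have DD: "Dia C (Cod C h') (subobj C d) \<in> carrier (Sub C (Cod C h'))" using Dia_closed c h'(1) by simp
      ultimately have "factors_through C (h' \<cdot> s l) e" using lies_in_rep[OF DD] d(2) h'(3) by simp
      then obtain g' where g': "g' \<in> A" "Dom C g' = Dom C (h' \<cdot> s l)" "Cod C g' = Dom C e" "e \<cdot> g' = h' \<cdot> s l"
        using A_factor[OF H'(1) d(4)] by blast
      have gw: "Dom C g' = Cod C (w (N l))" using g'(2) H'(2) by simp
      have "snd (germs w) e (germ w (N l) g') = a"
        using germs_act[OF Sw g'(1) gw d(4) g'(3)] g'(4) L h(4) by simp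
      thus ?thesis using germsI[of g' w "N l", OF g'(1) gw g'(3)] by blast
    qed
  qed
  moreover have "\<exists>y \<in> fst (germs t) (Dom C m). (snd (germs w) n x, snd (germs t) m y) \<in> R (Cod C m)"
  proof -
    have 0: "v 0 = m" "N 0 = i" "s 0 = n \<cdot> f" using st(1) unfolding v_def N_def s_def by auto
    have im: "Ident C (Cod C m) \<in> A" "Dom C (Ident C (Cod C m)) = Cod C (v 0)" "Cod C (Ident C (Cod C m)) = Cod C m"
      using A_ident m 0 by auto
    have id: "Ident C (Dom C m) \<in> A" "Dom C (Ident C (Dom C m)) = Cod C (t 0)" "Cod C (Ident C (Dom C m)) = Dom C m"
      using A_ident m 0 r(5)[of 0] by auto
    have "snd (germs w) n x = germ w i (n \<cdot> f)" unfolding f(4) by (rule germs_act[OF Sw f(1,2) n(2) f(3)])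
    moreover have "snd (germs t) m (germ t 0 (Ident C (Dom C m))) = germ t 0 m"
      using germs_act[OF seq(2) id(1,2) m(2) id(3)] m by simp
    moreover have "(germ w i (n \<cdot> f), germ t 0 m) \<in> R (Cod C m)"
    proof -
      have "Ident C (Cod C m) \<cdot> s 0 = n \<cdot> f" "Ident C (Cod C m) \<cdot> v 0 = m" using 0 nf m by auto
      thus ?thesis using RI[OF im(1,2)] im(3) 0(2) by simp
    qed
    ultimately show ?thesis using germsI[of _ t 0, OF id] by (intro bexI[of _ "germ t 0 (Ident C (Dom C m))"]) auto
  qed
  ultimately show ?thesis using gt by blast
qed

text \<open>The generic sequence starts at the part \<open>t\<close> of \<open>m\<close> that falls
  into the complement of \<open>n\<close>. Its germ is mapped by \<open>m\<close> outside
  \<open>n\<close> for good, since a later coincidence with a value of \<open>n\<close> would make a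
  stage inconsistent.\<close>

lemma ex_separating:
  assumes "m \<in> Mon C" "n \<in> Mon C" "m \<in> A" "n \<in> A" "Cod C n = Cod C m" "\<not> factors_through C m n"
  shows "\<exists>w. generic w \<and> (\<exists>x \<in> fst (germs w) (Dom C m). \<forall>y \<in> fst (germs w) (Dom C n). snd (germs w) n y \<noteq> snd (germs w) m x)"
proof -
  obtain n' where n': "n' \<in> A" "disjoint_cover n n'" using A_complement[OF assms(2,4)] unfolding disjoint_cover_def by blast
  have c: "cover n n'" using n'(2) unfolding disjoint_cover_def by simp
  obtain s g t h where s: "s \<in> A" "g \<in> A" "t \<in> A" "h \<in> A" "cover s t" "Cod C s = Dom C m"
    "Dom C g = Dom C s" "Cod C g = Dom C n" "Dom C h = Dom C t" "Cod C h = Dom C n'" "m \<cdot> s = n \<cdot> g" "m \<cdot> t = n' \<cdot> h"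
    using A_cover[OF c assms(4) n'(1) assms(3) assms(5)[symmetric]] by blast
  note D = coverD[OF s(5)]
  have ct: "Cod C t = Dom C m" using D(3) s(6) by simp
  \<comment> \<open>If the part outside \<open>n\<close> were inconsistent, it would lie in every
    subobject, in particular in the pullback of \<open>n\<close> along \<open>m\<close>. The other
    half \<open>s\<close> lies there anyway, so the cover would force \<open>m\<close> to factor
    through \<open>n\<close>.\<close>
  have nz: "\<not> zero (Dom C t)"
  proof
    assume z: "zero (Dom C t)"
    have sc: "subobj C n \<in> carrier (Sub C (Cod C m))" using subobj_closed assms by simp
    have pc: "pb C m (subobj C n) \<in> carrier (Sub C (Cod C s))" using pb_closed[of m "subobj C n"] sc assms s(6) by simp
    have "factors_through C (m \<cdot> s) n" unfolding s(11) by (rule factors_throughI[of g]) (use s(2,7,8) assms in auto)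
    hence 1: "lies_in C s (pb C m (subobj C n))"
      using lies_in_pb[of m "subobj C n" s] sc assms s(1,6) lies_in_subobj by simp
    have pct: "pb C m (subobj C n) \<in> carrier (Sub C (Cod C t))" using pc D(3) by simp
    have "pb C t (pb C m (subobj C n)) \<in> carrier (Sub C (Dom C t))" using pb_closed[of t] pct s(3) by simp
    hence "lies_in C (Ident C (Dom C t)) (pb C t (pb C m (subobj C n)))" using z unfolding zero_def by blast
    hence 2: "lies_in C t (pb C m (subobj C n))" using lies_in_pb[OF arr[OF s(3)] pct] s(3) by simp
    have "lies_in C (Ident C (Dom C m)) (pb C m (subobj C n))" using D(4)[OF pc 1 2] s(6) by simp
    hence "lies_in C m (subobj C n)" using lies_in_pb[of m "subobj C n"] sc assms by simp
    thus False using lies_in_subobj assms by simp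
  qed
  obtain w where w: "generic w" "Cod C (w 0) = Dom C t"
    using ex_generic[of "Dom C t"] nz A_ident s(3) by auto
  note S = genericD(1)[OF w(1)]
  have t: "Dom C t = Cod C (w 0)" using w(2) by simp
  have mt: "m \<cdot> t \<in> A" "Dom C (m \<cdot> t) = Cod C (w 0)" using A_comp s(3) assms ct t by auto
  have "snd (germs w) n y \<noteq> snd (germs w) m (germ w 0 t)" if y: "y \<in> fst (germs w) (Dom C n)" for y
  proof
    assume e: "snd (germs w) n y = snd (germs w) m (germ w 0 t)"
    obtain i f where f: "f \<in> A" "Dom C f = Cod C (w i)" "Cod C f = Dom C n" "y = germ w i f" using y by (rule germsE)
    have nf: "n \<cdot> f \<in> A" "Dom C (n \<cdot> f) = Cod C (w i)" using A_comp f assms by auto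
    have "germ w i (n \<cdot> f) = germ w 0 (m \<cdot> t)"
      using e unfolding f(4) germs_act[OF S f(1,2) assms(4) f(3)] germs_act[OF S s(3) t assms(3) ct] .
    then obtain k where k: "i \<le> k" "(n \<cdot> f) \<cdot> tr w i k = (m \<cdot> t) \<cdot> tr w 0 k" using germ_eq[OF S nf mt] by blast
    note ti = tr[OF S k(1)] and t0 = tr[OF S, of 0 k]
    have "n \<cdot> f \<cdot> tr w i k = (n \<cdot> f) \<cdot> tr w i k" using ti f assms(4) by simp
    also have "\<dots> = n' \<cdot> h \<cdot> tr w 0 k" unfolding k(2) s(12) using t0 s(4,9,10) t n'(1) by simp
    finally have "n \<cdot> f \<cdot> tr w i k = n' \<cdot> h \<cdot> tr w 0 k" .
    hence "zero (Dom C (f \<cdot> tr w i k))"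
      by (rule disjoint_coverD[OF n'(2), rotated -1]) (use ti t0 f s(4,9,10) t in auto)
    thus False using ti f genericD(2)[OF w(1), of k] by simp
  qed
  thus ?thesis using w(1) germsI[of t w 0, OF s(3) t ct] by blast
qed

lemma kripke_germs:
  "kripke A {germs w | w. generic w}
    {(germs w, germs t, R) | w t R. generic w \<and> generic t \<and> accessibility A (germs w) (germs t) R}"
  unfolding kripke_def
proof (intro conjI ballI allI impI)
  show "model A M" if "M \<in> {germs w | w. generic w}" for M using that germs_model by blast
  show "case e of (M, M', R) \<Rightarrow> M \<in> {germs w | w. generic w} \<and> M' \<in> {germs w | w. generic w} \<and> accessibility A M M' R"
    if "e \<in> {(germs w, germs t, R) | w t R. generic w \<and> generic t \<and> accessibility A (germs w) (germs t) R}" for e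
    using that by auto
  show "\<exists>M' R. (M, M', R) \<in> {(germs w, germs t, R) | w t R. generic w \<and> generic t \<and> accessibility A (germs w) (germs t) R} \<and>
        (\<exists>y \<in> fst M' (Dom C m). (snd M n x, snd M' m y) \<in> R (Cod C m))"
    if a: "M \<in> {germs w | w. generic w}" "m \<in> Mon C" "n \<in> Dia C (Cod C m) (subobj C m)" "m \<in> A" "n \<in> A" "x \<in> fst M (Dom C n)"
    for M m n x
  proof -
    obtain w where w: "generic w" "M = germs w" using a(1) by blast
    show ?thesis using ex_accessible[OF w(1) a(2,4,3,5), of x] a(6) w unfolding w(2) by blast
  qed
  show "\<exists>M \<in> {germs w | w. generic w}. \<exists>x \<in> fst M (Dom C m). \<forall>y \<in> fst M (Dom C n). snd M n y \<noteq> snd M m x"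
    if "m \<in> Mon C" "n \<in> Mon C" "m \<in> A" "n \<in> A" "Cod C n = Cod C m" "\<not> factors_through C m n" for m n
    using ex_separating[OF that] by blast
qed

end

section \<open>Ultraproducts of Kripke models\<close>

text \<open>Zorn's lemma on the proper filters below \<open>F\<close>, where going up means passing
  to a finer filter, which is a smaller one in the order of filters. Chains are bounded by their
  infimum.\<close>

lemma ex_ultrafilter:
  fixes F :: "'i filter"
  assumes "F \<noteq> bot"
  shows "\<exists>U \<le> F. U \<noteq> bot \<and> (\<forall>P. eventually P U \<or> eventually (\<lambda>i. \<not> P i) U)"
proof -
  define S where "S = {G. G \<noteq> bot \<and> G \<le> F}"
  define r where "r = {(G, H). G \<in> S \<and> H \<in> S \<and> H \<le> G}"
  have fld: "Field r = S" unfolding r_def Field_def by auto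
  have "Partial_order r"
    unfolding partial_order_on_def preorder_on_def refl_on_def trans_def antisym_def fld
    unfolding r_def by auto
  moreover have "\<exists>u \<in> Field r. \<forall>a \<in> Ch. (a, u) \<in> r" if Ch: "Ch \<in> Chains r" for Ch
  proof (cases "Ch = {}")
    case True
    thus ?thesis unfolding fld S_def using assms by auto
  next
    case False
    have sub: "Ch \<subseteq> S" using Ch unfolding Chains_def r_def by auto
    \<comment> \<open>A finite nonempty part of a chain has a minimum, which is a proper filter; so
      no finite infimum is trivial, and neither is that of the whole chain.\<close>
    have least: "\<exists>m \<in> X. \<forall>x \<in> X. m \<le> x" if "finite X" "X \<noteq> {}" "X \<subseteq> Ch" for X
      using that
    proof (induction X rule: finite_ne_induct)
      case (insert x X)
      then obtain m where m: "m \<in> X" "\<forall>x \<in> X. m \<le> x" by auto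
      hence "(m, x) \<in> r \<or> (x, m) \<in> r" using insert.prems Ch unfolding Chains_def by blast
      hence "x \<le> m \<or> m \<le> x" unfolding r_def by auto
      thus ?case
      proof
        assume "x \<le> m"
        thus ?case using m by (intro bexI[of _ x]) (auto intro: order.trans)
      next
        assume "m \<le> x"
        thus ?case using m by (intro bexI[of _ m]) auto
      qed
    qed auto
    have "Inf Ch \<noteq> bot"
    proof (rule Inf_filter_not_bot)
      fix X assume X: "X \<subseteq> Ch" "finite X"
      show "Inf X \<noteq> bot"
      proof (cases "X = {}")
        case True
        show ?thesis
        proof
          assume "Inf X = bot"
          hence t: "(bot :: 'i filter) = Orderings.top_class.top" using True by simp
          have "F \<le> bot" unfolding t by simp
          thus False using assms bot.extremum_unique[of F] by blast
        qed
      next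
        case False
        obtain m where m: "m \<in> X" "\<forall>x \<in> X. m \<le> x" using least[OF X(2) False X(1)] by blast
        hence "m \<le> Inf X" by (simp add: Inf_greatest)
        moreover have "m \<noteq> bot" using m(1) X(1) sub unfolding S_def by auto
        ultimately show ?thesis using bot.extremum_unique[of m] by auto
      qed
    qed
    moreover have "Inf Ch \<le> F"
    proof -
      obtain G where "G \<in> Ch" "G \<le> F" using False sub unfolding S_def by auto
      thus ?thesis by (rule Inf_lower2)
    qed
    ultimately have "Inf Ch \<in> S" unfolding S_def by simp
    thus ?thesis unfolding fld using sub by (intro bexI[of _ "Inf Ch"]) (auto simp: r_def Inf_lower)
  qed
  ultimately obtain U where U: "U \<in> Field r" "\<And>G. G \<in> Field r \<Longrightarrow> (U, G) \<in> r \<Longrightarrow> G = U"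
    using Zorns_po_lemma[of r] by metis
  have US: "U \<noteq> bot" "U \<le> F" using U(1) unfolding fld S_def by auto
  have "eventually P U" if np: "\<not> eventually (\<lambda>i. \<not> P i) U" for P
  proof -
    \<comment> \<open>Adjoining the set of \<open>P\<close> keeps the filter proper as long as the
      negation is not already eventual; maximality then says that nothing was added.\<close>
    let ?V = "inf U (principal {i. P i})"
    have "?V \<noteq> bot" using np by (simp add: trivial_limit_def eventually_inf_principal)
    moreover have "?V \<le> U" "?V \<le> F" using le_infI1[OF US(2)] by simp_all
    ultimately have V: "?V \<in> S" "(U, ?V) \<in> r" using US unfolding S_def r_def by simp_all
    hence "?V = U" using U(2)[OF _ V(2)] fld by simp
    moreover have "eventually P ?V" by (simp add: eventually_inf_principal)
    ultimately show ?thesis by simp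
  qed
  thus ?thesis using US by blast
qed

text \<open>The existential step of Los's theorem: witnesses are chosen coordinatewise, with
  arbitrary values where there are none.\<close>

lemma eventually_choice:
  assumes "eventually (\<lambda>i. \<exists>z. P i z) U"
  shows "\<exists>z. eventually (\<lambda>i. P i (z i)) U"
  by (rule exI[of _ "\<lambda>i. SOME z. P i z"], rule eventually_mono[OF assms]) (rule someI_ex)

context boolean_modal_category_with_quotients
begin

lemma modelD:
  assumes "model A M"
  shows "f \<in> A \<Longrightarrow> x \<in> fst M (Dom C f) \<Longrightarrow> snd M f x \<in> fst M (Cod C f)"
    "X \<in> Obj C \<Longrightarrow> Ident C X \<in> A \<Longrightarrow> x \<in> fst M X \<Longrightarrow> snd M (Ident C X) x = x"
    "f \<in> A \<Longrightarrow> g \<in> A \<Longrightarrow> Cod C f = Dom C g \<Longrightarrow> g \<cdot> f \<in> A \<Longrightarrow> x \<in> fst M (Dom C f) \<Longrightarrow>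
      snd M (g \<cdot> f) x = snd M g (snd M f x)"
    "is_terminal C T \<Longrightarrow> Ident C T \<in> A \<Longrightarrow> fst M T \<noteq> {}"
    "is_product C X Y P p q \<Longrightarrow> p \<in> A \<Longrightarrow> q \<in> A \<Longrightarrow> x \<in> fst M X \<Longrightarrow> y \<in> fst M Y \<Longrightarrow>
      \<exists>z. z \<in> fst M P \<and> snd M p z = x \<and> snd M q z = y"
    "is_equalizer C f g m \<Longrightarrow> f \<in> A \<Longrightarrow> g \<in> A \<Longrightarrow> m \<in> A \<Longrightarrow> x \<in> fst M (Dom C f) \<Longrightarrow>
      snd M f x = snd M g x \<Longrightarrow> \<exists>z. z \<in> fst M (Dom C m) \<and> snd M m z = x"
    "e \<in> MonPerp C \<Longrightarrow> e \<in> A \<Longrightarrow> y \<in> fst M (Cod C e) \<Longrightarrow> \<exists>x. x \<in> fst M (Dom C e) \<and> snd M e x = y"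
    "cover m n \<Longrightarrow> m \<in> A \<Longrightarrow> n \<in> A \<Longrightarrow> x \<in> fst M (Cod C m) \<Longrightarrow>
      (\<exists>y. y \<in> fst M (Dom C m) \<and> snd M m y = x) \<or> (\<exists>y. y \<in> fst M (Dom C n) \<and> snd M n y = x)"
    "zero X \<Longrightarrow> Ident C X \<in> A \<Longrightarrow> fst M X = {}"
proof -
  note d = assms[unfolded model_def]
  show "f \<in> A \<Longrightarrow> x \<in> fst M (Dom C f) \<Longrightarrow> snd M f x \<in> fst M (Cod C f)"
    using d[THEN conjunct1] by blast
  show "X \<in> Obj C \<Longrightarrow> Ident C X \<in> A \<Longrightarrow> x \<in> fst M X \<Longrightarrow> snd M (Ident C X) x = x"
    using d[THEN conjunct2, THEN conjunct1] by blast
  show "f \<in> A \<Longrightarrow> g \<in> A \<Longrightarrow> Cod C f = Dom C g \<Longrightarrow> g \<cdot> f \<in> A \<Longrightarrow> x \<in> fst M (Dom C f) \<Longrightarrow>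
      snd M (g \<cdot> f) x = snd M g (snd M f x)"
    using d[THEN conjunct2, THEN conjunct2, THEN conjunct1] by blast
  show "is_terminal C T \<Longrightarrow> Ident C T \<in> A \<Longrightarrow> fst M T \<noteq> {}"
    using d[THEN conjunct2, THEN conjunct2, THEN conjunct2, THEN conjunct1] by blast
  show "is_product C X Y P p q \<Longrightarrow> p \<in> A \<Longrightarrow> q \<in> A \<Longrightarrow> x \<in> fst M X \<Longrightarrow> y \<in> fst M Y \<Longrightarrow>
      \<exists>z. z \<in> fst M P \<and> snd M p z = x \<and> snd M q z = y"
    using d[THEN conjunct2, THEN conjunct2, THEN conjunct2, THEN conjunct2, THEN conjunct1] by blast
  show "is_equalizer C f g m \<Longrightarrow> f \<in> A \<Longrightarrow> g \<in> A \<Longrightarrow> m \<in> A \<Longrightarrow> x \<in> fst M (Dom C f) \<Longrightarrow>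
      snd M f x = snd M g x \<Longrightarrow> \<exists>z. z \<in> fst M (Dom C m) \<and> snd M m z = x"
    using d[THEN conjunct2, THEN conjunct2, THEN conjunct2, THEN conjunct2, THEN conjunct2, THEN conjunct1] by blast
  show "e \<in> MonPerp C \<Longrightarrow> e \<in> A \<Longrightarrow> y \<in> fst M (Cod C e) \<Longrightarrow> \<exists>x. x \<in> fst M (Dom C e) \<and> snd M e x = y"
    using d[THEN conjunct2, THEN conjunct2, THEN conjunct2, THEN conjunct2, THEN conjunct2, THEN conjunct2, THEN conjunct1] by blast
  show "cover m n \<Longrightarrow> m \<in> A \<Longrightarrow> n \<in> A \<Longrightarrow> x \<in> fst M (Cod C m) \<Longrightarrow>
      (\<exists>y. y \<in> fst M (Dom C m) \<and> snd M m y = x) \<or> (\<exists>y. y \<in> fst M (Dom C n) \<and> snd M n y = x)"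
    using d[THEN conjunct2, THEN conjunct2, THEN conjunct2, THEN conjunct2, THEN conjunct2, THEN conjunct2, THEN conjunct2, THEN conjunct1] by blast
  show "zero X \<Longrightarrow> Ident C X \<in> A \<Longrightarrow> fst M X = {}"
    using d[THEN conjunct2, THEN conjunct2, THEN conjunct2, THEN conjunct2, THEN conjunct2, THEN conjunct2, THEN conjunct2, THEN conjunct2] by blast
qed

lemma accessibilityD:
  assumes "accessibility A M M' R"
  shows "R X \<subseteq> fst M X \<times> fst M' X"
    "f \<in> A \<Longrightarrow> (x, y) \<in> R (Dom C f) \<Longrightarrow> (snd M f x, snd M' f y) \<in> R (Cod C f)"
    "is_terminal C T \<Longrightarrow> Ident C T \<in> A \<Longrightarrow> R T \<noteq> {}"
    "is_product C X Y P p q \<Longrightarrow> p \<in> A \<Longrightarrow> q \<in> A \<Longrightarrow> (x, y) \<in> R X \<Longrightarrow> (x', y') \<in> R Y \<Longrightarrow>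
      \<exists>z w. (z, w) \<in> R P \<and> snd M p z = x \<and> snd M q z = x' \<and> snd M' p w = y \<and> snd M' q w = y'"
    "m \<in> Mon C \<Longrightarrow> m \<in> A \<Longrightarrow> x \<in> fst M (Dom C m) \<Longrightarrow> y \<in> fst M' (Dom C m) \<Longrightarrow>
      (snd M m x, snd M' m y) \<in> R (Cod C m) \<Longrightarrow> (x, y) \<in> R (Dom C m)"
    "q \<in> Quo C \<Longrightarrow> q \<in> A \<Longrightarrow> (x, y) \<in> R (Cod C q) \<Longrightarrow>
      \<exists>x' y'. (x', y') \<in> R (Dom C q) \<and> snd M q x' = x \<and> snd M' q y' = y"
    "m \<in> Mon C \<Longrightarrow> n \<in> Dia C (Cod C m) (subobj C m) \<Longrightarrow> m \<in> A \<Longrightarrow> n \<in> A \<Longrightarrow> y \<in> fst M' (Dom C m) \<Longrightarrow>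
      (x, snd M' m y) \<in> R (Cod C m) \<Longrightarrow> \<exists>z. z \<in> fst M (Dom C n) \<and> snd M n z = x"
proof -
  note d = assms[unfolded accessibility_def]
  show "R X \<subseteq> fst M X \<times> fst M' X"
    using d[THEN conjunct1] by blast
  show "f \<in> A \<Longrightarrow> (x, y) \<in> R (Dom C f) \<Longrightarrow> (snd M f x, snd M' f y) \<in> R (Cod C f)"
    using d[THEN conjunct2, THEN conjunct1] by blast
  show "is_terminal C T \<Longrightarrow> Ident C T \<in> A \<Longrightarrow> R T \<noteq> {}"
    using d[THEN conjunct2, THEN conjunct2, THEN conjunct1] by blast
  show "is_product C X Y P p q \<Longrightarrow> p \<in> A \<Longrightarrow> q \<in> A \<Longrightarrow> (x, y) \<in> R X \<Longrightarrow> (x', y') \<in> R Y \<Longrightarrow>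
      \<exists>z w. (z, w) \<in> R P \<and> snd M p z = x \<and> snd M q z = x' \<and> snd M' p w = y \<and> snd M' q w = y'"
    using d[THEN conjunct2, THEN conjunct2, THEN conjunct2, THEN conjunct1] by blast
  show "m \<in> Mon C \<Longrightarrow> m \<in> A \<Longrightarrow> x \<in> fst M (Dom C m) \<Longrightarrow> y \<in> fst M' (Dom C m) \<Longrightarrow>
      (snd M m x, snd M' m y) \<in> R (Cod C m) \<Longrightarrow> (x, y) \<in> R (Dom C m)"
    using d[THEN conjunct2, THEN conjunct2, THEN conjunct2, THEN conjunct2, THEN conjunct1] by blast
  show "q \<in> Quo C \<Longrightarrow> q \<in> A \<Longrightarrow> (x, y) \<in> R (Cod C q) \<Longrightarrow>
      \<exists>x' y'. (x', y') \<in> R (Dom C q) \<and> snd M q x' = x \<and> snd M' q y' = y"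
    using d[THEN conjunct2, THEN conjunct2, THEN conjunct2, THEN conjunct2, THEN conjunct2, THEN conjunct1] by blast
  show "m \<in> Mon C \<Longrightarrow> n \<in> Dia C (Cod C m) (subobj C m) \<Longrightarrow> m \<in> A \<Longrightarrow> n \<in> A \<Longrightarrow> y \<in> fst M' (Dom C m) \<Longrightarrow>
      (x, snd M' m y) \<in> R (Cod C m) \<Longrightarrow> \<exists>z. z \<in> fst M (Dom C n) \<and> snd M n z = x"
    using d[THEN conjunct2, THEN conjunct2, THEN conjunct2, THEN conjunct2, THEN conjunct2, THEN conjunct2] by blast
qed

lemma kripkeD:
  assumes "kripke A N K"
  shows "M \<in> N \<Longrightarrow> model A M"
    "(M, M', R) \<in> K \<Longrightarrow> M \<in> N \<and> M' \<in> N \<and> accessibility A M M' R"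
    "M \<in> N \<Longrightarrow> m \<in> Mon C \<Longrightarrow> n \<in> Dia C (Cod C m) (subobj C m) \<Longrightarrow> m \<in> A \<Longrightarrow> n \<in> A \<Longrightarrow> x \<in> fst M (Dom C n) \<Longrightarrow>
      \<exists>M' R y. (M, M', R) \<in> K \<and> y \<in> fst M' (Dom C m) \<and> (snd M n x, snd M' m y) \<in> R (Cod C m)"
    "m \<in> Mon C \<Longrightarrow> n \<in> Mon C \<Longrightarrow> m \<in> A \<Longrightarrow> n \<in> A \<Longrightarrow> Cod C n = Cod C m \<Longrightarrow> \<not> factors_through C m n \<Longrightarrow>
      \<exists>M x. M \<in> N \<and> x \<in> fst M (Dom C m) \<and> (\<forall>y. y \<in> fst M (Dom C n) \<longrightarrow> snd M n y \<noteq> snd M m x)"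
proof -
  note d = assms[unfolded kripke_def]
  show "M \<in> N \<Longrightarrow> model A M"
    using d[THEN conjunct1] by blast
  show "(M, M', R) \<in> K \<Longrightarrow> M \<in> N \<and> M' \<in> N \<and> accessibility A M M' R"
    using d[THEN conjunct2, THEN conjunct1] by fast
  show "M \<in> N \<Longrightarrow> m \<in> Mon C \<Longrightarrow> n \<in> Dia C (Cod C m) (subobj C m) \<Longrightarrow> m \<in> A \<Longrightarrow> n \<in> A \<Longrightarrow> x \<in> fst M (Dom C n) \<Longrightarrow>
      \<exists>M' R y. (M, M', R) \<in> K \<and> y \<in> fst M' (Dom C m) \<and> (snd M n x, snd M' m y) \<in> R (Cod C m)"
    using d[THEN conjunct2, THEN conjunct2, THEN conjunct1] by blast
  show "m \<in> Mon C \<Longrightarrow> n \<in> Mon C \<Longrightarrow> m \<in> A \<Longrightarrow> n \<in> A \<Longrightarrow> Cod C n = Cod C m \<Longrightarrow> \<not> factors_through C m n \<Longrightarrow>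
      \<exists>M x. M \<in> N \<and> x \<in> fst M (Dom C m) \<and> (\<forall>y. y \<in> fst M (Dom C n) \<longrightarrow> snd M n y \<noteq> snd M m x)"
    using d[THEN conjunct2, THEN conjunct2, THEN conjunct2] by blast
qed

end

section \<open>Families modulo an ultrafilter, coded as single elements\<close>

locale ultraproduct =
  fixes U :: "'i filter" and emb :: "('i \<Rightarrow> 'e) \<Rightarrow> 'u"
  assumes inj_emb: "inj emb" and nontrivial: "U \<noteq> bot"
    and ultra: "eventually P U \<or> eventually (\<lambda>i. \<not> P i) U"
begin

text \<open>A class of families is coded by one of its members. \<open>SOME\<close> is applied to a
  predicate that depends on the class of \<open>x\<close> only, so eventually equal families receive
  the same code, and \<open>emb\<close> turns it into an element of the target type.\<close>

definition cl :: "('i \<Rightarrow> 'e) \<Rightarrow> 'u" where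
  "cl x = emb (SOME y. \<forall>\<^sub>F i in U. x i = y i)"

definition pt :: "'u \<Rightarrow> 'i \<Rightarrow> 'e" where
  "pt = inv emb"

definition umodel :: "('i \<Rightarrow> ('o \<Rightarrow> 'e set) \<times> ('a \<Rightarrow> 'e \<Rightarrow> 'e)) \<Rightarrow> ('o \<Rightarrow> 'u set) \<times> ('a \<Rightarrow> 'u \<Rightarrow> 'u)" where
  "umodel M = (\<lambda>X. {cl x | x. \<forall>\<^sub>F i in U. x i \<in> fst (M i) X}, \<lambda>f u. cl (\<lambda>i. snd (M i) f (pt u i)))"

definition urel :: "('i \<Rightarrow> 'o \<Rightarrow> ('e \<times> 'e) set) \<Rightarrow> 'o \<Rightarrow> ('u \<times> 'u) set" where
  "urel R X = {(cl x, cl y) | x y. \<forall>\<^sub>F i in U. (x i, y i) \<in> R i X}"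

lemma cl_eq: "cl x = cl y \<longleftrightarrow> (\<forall>\<^sub>F i in U. x i = y i)"
proof
  have rep: "\<forall>\<^sub>F i in U. x i = (SOME y. \<forall>\<^sub>F i in U. x i = y i) i" for x :: "'i \<Rightarrow> 'e"
    by (rule someI[of "\<lambda>y. \<forall>\<^sub>F i in U. x i = y i" x]) simp
  {
    assume "cl x = cl y"
    hence e: "(SOME z. \<forall>\<^sub>F i in U. x i = z i) = (SOME z. \<forall>\<^sub>F i in U. y i = z i)"
      unfolding cl_def using inj_emb by (simp add: inj_eq)
    show "\<forall>\<^sub>F i in U. x i = y i"
      using rep[of x] rep[of y] unfolding e by eventually_elim simp
  next
    assume xy: "\<forall>\<^sub>F i in U. x i = y i"
    have "(\<forall>\<^sub>F i in U. x i = z i) \<longleftrightarrow> (\<forall>\<^sub>F i in U. y i = z i)" for z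
    proof
      assume "\<forall>\<^sub>F i in U. x i = z i"
      with xy show "\<forall>\<^sub>F i in U. y i = z i" by eventually_elim simp
    next
      assume "\<forall>\<^sub>F i in U. y i = z i"
      with xy show "\<forall>\<^sub>F i in U. x i = z i" by eventually_elim simp
    qed
    thus "cl x = cl y" unfolding cl_def by simp
  }
qed

lemma pt_cl: "\<forall>\<^sub>F i in U. pt (cl x) i = x i"
proof -
  have "\<forall>\<^sub>F i in U. x i = (SOME y. \<forall>\<^sub>F i in U. x i = y i) i"
    by (rule someI[of "\<lambda>y. \<forall>\<^sub>F i in U. x i = y i" x]) simp
  thus ?thesis unfolding pt_def cl_def inv_f_f[OF inj_emb] by (simp add: eq_commute)
qed

lemma umodel_mem: "cl x \<in> fst (umodel M) X \<longleftrightarrow> (\<forall>\<^sub>F i in U. x i \<in> fst (M i) X)"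
proof
  assume "cl x \<in> fst (umodel M) X"
  then obtain y where y: "\<forall>\<^sub>F i in U. x i = y i" "\<forall>\<^sub>F i in U. y i \<in> fst (M i) X"
    unfolding umodel_def by (auto simp: cl_eq)
  show "\<forall>\<^sub>F i in U. x i \<in> fst (M i) X" using y by eventually_elim simp
qed (auto simp: umodel_def)

lemma umodelE:
  assumes "u \<in> fst (umodel M) X"
  obtains x where "u = cl x" "\<forall>\<^sub>F i in U. x i \<in> fst (M i) X"
  using assms unfolding umodel_def by auto

lemma umodel_act: "snd (umodel M) f (cl x) = cl (\<lambda>i. snd (M i) f (x i))"
proof -
  have "\<forall>\<^sub>F i in U. snd (M i) f (pt (cl x) i) = snd (M i) f (x i)"
    using pt_cl[of x] by eventually_elim simp
  thus ?thesis unfolding umodel_def by (simp add: cl_eq)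
qed

lemma urel_mem: "(cl x, cl y) \<in> urel R X \<longleftrightarrow> (\<forall>\<^sub>F i in U. (x i, y i) \<in> R i X)"
proof
  assume "(cl x, cl y) \<in> urel R X"
  then obtain x' y' where y: "\<forall>\<^sub>F i in U. x i = x' i" "\<forall>\<^sub>F i in U. y i = y' i" "\<forall>\<^sub>F i in U. (x' i, y' i) \<in> R i X"
    unfolding urel_def by (auto simp: cl_eq)
  show "\<forall>\<^sub>F i in U. (x i, y i) \<in> R i X" using y by eventually_elim simp
qed (auto simp: urel_def)

lemma urelE:
  assumes "(u, v) \<in> urel R X"
  obtains x y where "u = cl x" "v = cl y" "\<forall>\<^sub>F i in U. (x i, y i) \<in> R i X"
  using assms unfolding urel_def by auto

end

locale kripke_ultraproduct = boolean_modal_category_with_quotients C + ultraproduct U emb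
  for C :: "('o, 'a, 'x) modal_category_with_quotients_scheme"
    and U :: "'i filter" and emb :: "('i \<Rightarrow> 'e) \<Rightarrow> 'u" +
  fixes A :: "'i \<Rightarrow> 'a set"
  assumes exhaust: "f \<in> Arr C \<Longrightarrow> \<forall>\<^sub>F i in U. f \<in> A i"
begin

lemma exhaust_simps [simp]: "m \<in> Mon C \<Longrightarrow> \<forall>\<^sub>F i in U. m \<in> A i" "e \<in> MonPerp C \<Longrightarrow> \<forall>\<^sub>F i in U. e \<in> A i"
  by (simp_all add: exhaust)

text \<open>Los's theorem for the clauses of \<open>model\<close>. An arrow of \<open>C\<close>
  belongs to almost every fragment, so each coordinate satisfies the clause in question eventually,
  even though no single fragment need contain all arrows.\<close>

lemma model_umodel:
  assumes "\<forall>\<^sub>F i in U. model (A i) (M i)"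
  shows "model (Arr C) (umodel M)"
  unfolding model_def
proof (intro conjI ballI allI impI)
  note m = assms
  show "snd (umodel M) f u \<in> fst (umodel M) (Cod C f)" if f: "f \<in> Arr C" "u \<in> fst (umodel M) (Dom C f)" for f u
    using f(2)
  proof (rule umodelE)
    fix x assume x: "u = cl x" "\<forall>\<^sub>F i in U. x i \<in> fst (M i) (Dom C f)"
    show ?thesis unfolding x(1) umodel_act umodel_mem using m x(2) exhaust[OF f(1)] by eventually_elim (rule modelD(1))
  qed
  show "snd (umodel M) (Ident C X) u = u" if X: "X \<in> Obj C" "Ident C X \<in> Arr C" "u \<in> fst (umodel M) X" for X u
    using X(3)
  proof (rule umodelE)
    fix x assume x: "u = cl x" "\<forall>\<^sub>F i in U. x i \<in> fst (M i) X"
    show ?thesis unfolding x(1) umodel_act cl_eq using m x(2) exhaust[OF X(2)] by eventually_elim (rule modelD(2)[OF _ X(1)])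
  qed
  show "snd (umodel M) (g \<cdot> f) u = snd (umodel M) g (snd (umodel M) f u)"
    if f: "f \<in> Arr C" "g \<in> Arr C" "Cod C f = Dom C g" "g \<cdot> f \<in> Arr C" "u \<in> fst (umodel M) (Dom C f)" for f g u
    using f(5)
  proof (rule umodelE)
    fix x assume x: "u = cl x" "\<forall>\<^sub>F i in U. x i \<in> fst (M i) (Dom C f)"
    show ?thesis unfolding x(1) umodel_act cl_eq
      using m x(2) exhaust[OF f(1)] exhaust[OF f(2)] exhaust[OF f(4)]
      by eventually_elim (rule modelD(3)[OF _ _ _ f(3)])
  qed
  show "fst (umodel M) T \<noteq> {}" if T: "is_terminal C T" "Ident C T \<in> Arr C" for T
  proof -
    have "\<forall>\<^sub>F i in U. \<exists>z. z \<in> fst (M i) T" using m exhaust[OF T(2)]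
      by eventually_elim (unfold ex_in_conv, rule modelD(4)[OF _ T(1)])
    from eventually_choice[OF this] obtain z where "\<forall>\<^sub>F i in U. z i \<in> fst (M i) T" ..
    hence "cl z \<in> fst (umodel M) T" unfolding umodel_mem .
    thus ?thesis by blast
  qed
  show "\<exists>z \<in> fst (umodel M) P. snd (umodel M) p z = u \<and> snd (umodel M) q z = v"
    if P: "is_product C X Y P p q" "p \<in> Arr C" "q \<in> Arr C" "u \<in> fst (umodel M) X" "v \<in> fst (umodel M) Y" for X Y P p q u v
  proof -
    obtain x where x: "u = cl x" "\<forall>\<^sub>F i in U. x i \<in> fst (M i) X" using P(4) by (rule umodelE)
    obtain y where y: "v = cl y" "\<forall>\<^sub>F i in U. y i \<in> fst (M i) Y" using P(5) by (rule umodelE)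
    have "\<forall>\<^sub>F i in U. \<exists>z. z \<in> fst (M i) P \<and> snd (M i) p z = x i \<and> snd (M i) q z = y i"
      using m x(2) y(2) exhaust[OF P(2)] exhaust[OF P(3)]
      by eventually_elim (rule modelD(5)[OF _ P(1)])
    from eventually_choice[OF this] obtain z where "\<forall>\<^sub>F i in U. z i \<in> fst (M i) P \<and> snd (M i) p (z i) = x i \<and> snd (M i) q (z i) = y i" ..
    thus ?thesis unfolding x(1) y(1)
      by (intro bexI[of _ "cl z"]) (simp_all add: umodel_act cl_eq umodel_mem eventually_conj_iff)
  qed
  show "\<exists>z \<in> fst (umodel M) (Dom C e). snd (umodel M) e z = u"
    if e: "is_equalizer C f g e" "f \<in> Arr C" "g \<in> Arr C" "e \<in> Arr C" "u \<in> fst (umodel M) (Dom C f)"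
      "snd (umodel M) f u = snd (umodel M) g u" for f g e u
  proof -
    obtain x where x: "u = cl x" "\<forall>\<^sub>F i in U. x i \<in> fst (M i) (Dom C f)" using e(5) by (rule umodelE)
    have eq: "\<forall>\<^sub>F i in U. snd (M i) f (x i) = snd (M i) g (x i)" using e(6) unfolding x(1) umodel_act cl_eq .
    have "\<forall>\<^sub>F i in U. \<exists>z. z \<in> fst (M i) (Dom C e) \<and> snd (M i) e z = x i"
      using m x(2) eq exhaust[OF e(2)] exhaust[OF e(3)] exhaust[OF e(4)]
      by eventually_elim (rule modelD(6)[OF _ e(1)])
    from eventually_choice[OF this] obtain z where "\<forall>\<^sub>F i in U. z i \<in> fst (M i) (Dom C e) \<and> snd (M i) e (z i) = x i" ..
    thus ?thesis unfolding x(1)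
      by (intro bexI[of _ "cl z"]) (simp_all add: umodel_act cl_eq umodel_mem eventually_conj_iff)
  qed
  show "\<exists>z \<in> fst (umodel M) (Dom C e). snd (umodel M) e z = u"
    if e: "e \<in> MonPerp C" "e \<in> Arr C" "u \<in> fst (umodel M) (Cod C e)" for e u
  proof -
    obtain x where x: "u = cl x" "\<forall>\<^sub>F i in U. x i \<in> fst (M i) (Cod C e)" using e(3) by (rule umodelE)
    have "\<forall>\<^sub>F i in U. \<exists>z. z \<in> fst (M i) (Dom C e) \<and> snd (M i) e z = x i"
      using m x(2) exhaust[OF e(2)]
      by eventually_elim (rule modelD(7)[OF _ e(1)])
    from eventually_choice[OF this] obtain z where "\<forall>\<^sub>F i in U. z i \<in> fst (M i) (Dom C e) \<and> snd (M i) e (z i) = x i" ..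
    thus ?thesis unfolding x(1)
      by (intro bexI[of _ "cl z"]) (simp_all add: umodel_act cl_eq umodel_mem eventually_conj_iff)
  qed
  show "(\<exists>y \<in> fst (umodel M) (Dom C a). snd (umodel M) a y = u) \<or> (\<exists>y \<in> fst (umodel M) (Dom C b). snd (umodel M) b y = u)"
    if e: "cover a b" "a \<in> Arr C" "b \<in> Arr C" "u \<in> fst (umodel M) (Cod C a)" for a b u
  proof -
    obtain x where x: "u = cl x" "\<forall>\<^sub>F i in U. x i \<in> fst (M i) (Cod C a)" using e(4) by (rule umodelE)
    have in_range: "\<exists>y \<in> fst (umodel M) (Dom C c). snd (umodel M) c y = u"
      if h: "\<forall>\<^sub>F i in U. \<exists>y. y \<in> fst (M i) (Dom C c) \<and> snd (M i) c y = x i" for c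
    proof -
      obtain y where "\<forall>\<^sub>F i in U. y i \<in> fst (M i) (Dom C c) \<and> snd (M i) c (y i) = x i"
        using eventually_choice[OF h] ..
      thus ?thesis unfolding x(1)
        by (intro bexI[of _ "cl y"]) (simp_all add: umodel_act cl_eq umodel_mem eventually_conj_iff)
    qed
    have or: "\<forall>\<^sub>F i in U. (\<exists>y. y \<in> fst (M i) (Dom C a) \<and> snd (M i) a y = x i) \<or>
      (\<exists>y. y \<in> fst (M i) (Dom C b) \<and> snd (M i) b y = x i)"
      using m x(2) exhaust[OF e(2)] exhaust[OF e(3)]
      by eventually_elim (rule modelD(8)[OF _ e(1)])
    \<comment> \<open>The disjunction is the place where the filter has to be an ultrafilter: if the
      first half does not contain the point eventually, then the second does.\<close>
    show ?thesis
    proof (cases "\<forall>\<^sub>F i in U. \<exists>y. y \<in> fst (M i) (Dom C a) \<and> snd (M i) a y = x i")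
      case True
      thus ?thesis using in_range by blast
    next
      case False
      hence "\<forall>\<^sub>F i in U. \<not> (\<exists>y. y \<in> fst (M i) (Dom C a) \<and> snd (M i) a y = x i)" using ultra by blast
      with or have "\<forall>\<^sub>F i in U. \<exists>y. y \<in> fst (M i) (Dom C b) \<and> snd (M i) b y = x i"
        by eventually_elim blast
      thus ?thesis using in_range by blast
    qed
  qed
  show "fst (umodel M) X = {}" if X: "zero X" "Ident C X \<in> Arr C" for X
  proof (rule ccontr)
    assume "fst (umodel M) X \<noteq> {}"
    then obtain u where "u \<in> fst (umodel M) X" by blast
    then obtain x where x: "\<forall>\<^sub>F i in U. x i \<in> fst (M i) X" by (rule umodelE)
    have "\<forall>\<^sub>F i in U. False" using m x exhaust[OF X(2)]
      by eventually_elim (drule (1) modelD(9)[OF _ X(1)], simp)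
    thus False using nontrivial by (simp add: trivial_limit_def)
  qed
qed

lemma accessibility_urel:
  assumes "\<forall>\<^sub>F i in U. accessibility (A i) (M i) (M' i) (R i)"
  shows "accessibility (Arr C) (umodel M) (umodel M') (urel R)"
  unfolding accessibility_def
proof (intro conjI allI ballI impI)
  note a = assms
  show "urel R X \<subseteq> fst (umodel M) X \<times> fst (umodel M') X" for X
  proof
    fix p assume "p \<in> urel R X"
    then obtain x y where p: "p = (cl x, cl y)" "\<forall>\<^sub>F i in U. (x i, y i) \<in> R i X" unfolding urel_def by blast
    have "\<forall>\<^sub>F i in U. x i \<in> fst (M i) X" using a p(2) by eventually_elim (drule accessibilityD(1)[where X = X], blast)
    moreover have "\<forall>\<^sub>F i in U. y i \<in> fst (M' i) X" using a p(2) by eventually_elim (drule accessibilityD(1)[where X = X], blast)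
    ultimately show "p \<in> fst (umodel M) X \<times> fst (umodel M') X" unfolding p(1) by (simp add: umodel_mem)
  qed
  show "(snd (umodel M) f u, snd (umodel M') f v) \<in> urel R (Cod C f)"
    if f: "f \<in> Arr C" "(u, v) \<in> urel R (Dom C f)" for f u v
  proof -
    obtain x y where x: "u = cl x" "v = cl y" "\<forall>\<^sub>F i in U. (x i, y i) \<in> R i (Dom C f)" using f(2) by (rule urelE)
    show ?thesis unfolding x(1,2) umodel_act urel_mem using a x(3) exhaust[OF f(1)]
      by eventually_elim (rule accessibilityD(2))
  qed
  show "urel R T \<noteq> {}" if T: "is_terminal C T" "Ident C T \<in> Arr C" for T
  proof -
    have "\<forall>\<^sub>F i in U. \<exists>z. z \<in> R i T" using a exhaust[OF T(2)]
      by eventually_elim (unfold ex_in_conv, rule accessibilityD(3)[OF _ T(1)])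
    from eventually_choice[OF this] obtain z where "\<forall>\<^sub>F i in U. z i \<in> R i T" ..
    hence "(cl (\<lambda>i. fst (z i)), cl (\<lambda>i. snd (z i))) \<in> urel R T" unfolding urel_mem by simp
    thus ?thesis by blast
  qed
  show "\<exists>z z'. (z, z') \<in> urel R P \<and> snd (umodel M) p z = u \<and> snd (umodel M) q z = u' \<and>
        snd (umodel M') p z' = v \<and> snd (umodel M') q z' = v'"
    if P: "is_product C X Y P p q" "p \<in> Arr C" "q \<in> Arr C" "(u, v) \<in> urel R X" "(u', v') \<in> urel R Y" for X Y P p q u v u' v'
  proof -
    obtain x y where x: "u = cl x" "v = cl y" "\<forall>\<^sub>F i in U. (x i, y i) \<in> R i X" using P(4) by (rule urelE)
    obtain x' y' where x': "u' = cl x'" "v' = cl y'" "\<forall>\<^sub>F i in U. (x' i, y' i) \<in> R i Y" using P(5) by (rule urelE)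
    have "\<forall>\<^sub>F i in U. \<exists>z. z \<in> R i P \<and> snd (M i) p (fst z) = x i \<and> snd (M i) q (fst z) = x' i \<and>
      snd (M' i) p (snd z) = y i \<and> snd (M' i) q (snd z) = y' i"
      using a x(3) x'(3) exhaust[OF P(2)] exhaust[OF P(3)]
      by eventually_elim (drule (4) accessibilityD(4)[OF _ P(1)], force)
    from eventually_choice[OF this] obtain z where "\<forall>\<^sub>F i in U. z i \<in> R i P \<and> snd (M i) p (fst (z i)) = x i \<and> snd (M i) q (fst (z i)) = x' i \<and>
      snd (M' i) p (snd (z i)) = y i \<and> snd (M' i) q (snd (z i)) = y' i" ..
    thus ?thesis unfolding x(1,2) x'(1,2)
      by (intro exI[of _ "cl (\<lambda>i. fst (z i))"] exI[of _ "cl (\<lambda>i. snd (z i))"])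
        (simp_all add: umodel_act cl_eq urel_mem eventually_conj_iff)
  qed
  show "(u, v) \<in> urel R (Dom C d)"
    if d: "d \<in> Mon C" "d \<in> Arr C" "u \<in> fst (umodel M) (Dom C d)" "v \<in> fst (umodel M') (Dom C d)"
      "(snd (umodel M) d u, snd (umodel M') d v) \<in> urel R (Cod C d)" for d u v
  proof -
    obtain x where x: "u = cl x" "\<forall>\<^sub>F i in U. x i \<in> fst (M i) (Dom C d)" using d(3) by (rule umodelE)
    obtain y where y: "v = cl y" "\<forall>\<^sub>F i in U. y i \<in> fst (M' i) (Dom C d)" using d(4) by (rule umodelE)
    have xy: "\<forall>\<^sub>F i in U. (snd (M i) d (x i), snd (M' i) d (y i)) \<in> R i (Cod C d)"
      using d(5) unfolding x(1) y(1) umodel_act urel_mem .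
    show ?thesis unfolding x(1) y(1) urel_mem using a x(2) y(2) xy exhaust[OF d(2)]
      by eventually_elim (rule accessibilityD(5)[OF _ d(1)])
  qed
  show "\<exists>u' v'. (u', v') \<in> urel R (Dom C q) \<and> snd (umodel M) q u' = u \<and> snd (umodel M') q v' = v"
    if q: "q \<in> Quo C" "q \<in> Arr C" "(u, v) \<in> urel R (Cod C q)" for q u v
  proof -
    obtain x y where x: "u = cl x" "v = cl y" "\<forall>\<^sub>F i in U. (x i, y i) \<in> R i (Cod C q)" using q(3) by (rule urelE)
    have "\<forall>\<^sub>F i in U. \<exists>z. z \<in> R i (Dom C q) \<and> snd (M i) q (fst z) = x i \<and> snd (M' i) q (snd z) = y i"
      using a x(3) exhaust[OF q(2)]
      by eventually_elim (drule (2) accessibilityD(6)[OF _ q(1)], force)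
    from eventually_choice[OF this] obtain z where "\<forall>\<^sub>F i in U. z i \<in> R i (Dom C q) \<and> snd (M i) q (fst (z i)) = x i \<and> snd (M' i) q (snd (z i)) = y i" ..
    thus ?thesis unfolding x(1,2)
      by (intro exI[of _ "cl (\<lambda>i. fst (z i))"] exI[of _ "cl (\<lambda>i. snd (z i))"])
        (simp_all add: umodel_act cl_eq urel_mem eventually_conj_iff)
  qed
  show "\<exists>z \<in> fst (umodel M) (Dom C n). snd (umodel M) n z = u"
    if d: "m \<in> Mon C" "n \<in> Dia C (Cod C m) (subobj C m)" "m \<in> Arr C" "n \<in> Arr C" "v \<in> fst (umodel M') (Dom C m)"
      "(u, snd (umodel M') m v) \<in> urel R (Cod C m)" for m n u v
  proof -
    obtain y where y: "v = cl y" "\<forall>\<^sub>F i in U. y i \<in> fst (M' i) (Dom C m)" using d(5) by (rule umodelE)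
    obtain x y' where x: "u = cl x" "snd (umodel M') m v = cl y'" using d(6) by (rule urelE)
    have xy: "\<forall>\<^sub>F i in U. (x i, snd (M' i) m (y i)) \<in> R i (Cod C m)"
      using d(6) unfolding x(1) y(1) umodel_act urel_mem .
    have "\<forall>\<^sub>F i in U. \<exists>z. z \<in> fst (M i) (Dom C n) \<and> snd (M i) n z = x i"
      using a y(2) xy exhaust[OF d(3)] exhaust[OF d(4)]
      by eventually_elim (rule accessibilityD(7)[OF _ d(1,2)])
    from eventually_choice[OF this] obtain z where "\<forall>\<^sub>F i in U. z i \<in> fst (M i) (Dom C n) \<and> snd (M i) n (z i) = x i" ..
    thus ?thesis unfolding x(1)
      by (intro bexI[of _ "cl z"]) (simp_all add: umodel_act cl_eq umodel_mem eventually_conj_iff)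
  qed
qed

text \<open>Nodes are the ultraproducts of all families of nodes, and likewise for edges. Hence a
  successor or a separating model found in each coordinate is again part of the structure.\<close>

lemma kripke_ultraproduct:
  assumes "\<forall>\<^sub>F i in U. kripke (A i) (N i) (K i)"
  shows "kripke (Arr C) {umodel M | M. \<forall>\<^sub>F i in U. M i \<in> N i}
    {(umodel M, umodel M', urel R) | M M' R. \<forall>\<^sub>F i in U. (M i, M' i, R i) \<in> K i}" (is "kripke _ ?N ?K")
  unfolding kripke_def
proof (intro conjI ballI allI impI)
  note k = assms
  show "model (Arr C) W" if "W \<in> ?N" for W
  proof -
    obtain M where M: "W = umodel M" "\<forall>\<^sub>F i in U. M i \<in> N i" using \<open>W \<in> ?N\<close> by blast
    have "\<forall>\<^sub>F i in U. model (A i) (M i)" using k M(2) by eventually_elim (rule kripkeD(1))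
    thus ?thesis unfolding M(1) by (rule model_umodel)
  qed
  show "case e of (W, W', R) \<Rightarrow> W \<in> ?N \<and> W' \<in> ?N \<and> accessibility (Arr C) W W' R" if "e \<in> ?K" for e
  proof -
    obtain M M' R where M: "e = (umodel M, umodel M', urel R)" "\<forall>\<^sub>F i in U. (M i, M' i, R i) \<in> K i"
      using \<open>e \<in> ?K\<close> by blast
    have "\<forall>\<^sub>F i in U. M i \<in> N i \<and> M' i \<in> N i \<and> accessibility (A i) (M i) (M' i) (R i)"
      using k M(2) by eventually_elim (rule kripkeD(2))
    hence "\<forall>\<^sub>F i in U. M i \<in> N i" "\<forall>\<^sub>F i in U. M' i \<in> N i" "\<forall>\<^sub>F i in U. accessibility (A i) (M i) (M' i) (R i)"
      by (simp_all add: eventually_conj_iff)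
    thus ?thesis unfolding M(1) using accessibility_urel by blast
  qed
  show "\<exists>W' R. (W, W', R) \<in> ?K \<and> (\<exists>v \<in> fst W' (Dom C m). (snd W n u, snd W' m v) \<in> R (Cod C m))"
    if a: "W \<in> ?N" "m \<in> Mon C" "n \<in> Dia C (Cod C m) (subobj C m)" "m \<in> Arr C" "n \<in> Arr C" "u \<in> fst W (Dom C n)"
    for W m n u
  proof -
    obtain M where M: "W = umodel M" "\<forall>\<^sub>F i in U. M i \<in> N i" using a(1) by blast
    obtain x where x: "u = cl x" "\<forall>\<^sub>F i in U. x i \<in> fst (M i) (Dom C n)" using a(6) unfolding M(1) by (rule umodelE)
    have "\<forall>\<^sub>F i in U. \<exists>z. (M i, fst z, fst (snd z)) \<in> K i \<and> snd (snd z) \<in> fst (fst z) (Dom C m) \<and>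
      (snd (M i) n (x i), snd (fst z) m (snd (snd z))) \<in> fst (snd z) (Cod C m)"
      using k M(2) x(2) exhaust[OF a(4)] exhaust[OF a(5)]
      by eventually_elim (drule (4) kripkeD(3)[OF _ _ a(2,3)], force)
    from eventually_choice[OF this] obtain z where z: "\<forall>\<^sub>F i in U. (M i, fst (z i), fst (snd (z i))) \<in> K i \<and> snd (snd (z i)) \<in> fst (fst (z i)) (Dom C m) \<and>
      (snd (M i) n (x i), snd (fst (z i)) m (snd (snd (z i)))) \<in> fst (snd (z i)) (Cod C m)" ..
    let ?W' = "umodel (\<lambda>i. fst (z i))" and ?R = "urel (\<lambda>i. fst (snd (z i)))" and ?v = "cl (\<lambda>i. snd (snd (z i)))"
    have "(W, ?W', ?R) \<in> ?K" unfolding M(1) using z by (auto simp: eventually_conj_iff)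
    moreover have "?v \<in> fst ?W' (Dom C m)" using z by (simp add: umodel_mem eventually_conj_iff)
    moreover have "(snd W n u, snd ?W' m ?v) \<in> ?R (Cod C m)"
      unfolding M(1) x(1) umodel_act urel_mem using z by (simp add: eventually_conj_iff)
    ultimately show ?thesis by blast
  qed
  show "\<exists>W \<in> ?N. \<exists>u \<in> fst W (Dom C m). \<forall>v \<in> fst W (Dom C n). snd W n v \<noteq> snd W m u"
    if a: "m \<in> Mon C" "n \<in> Mon C" "m \<in> Arr C" "n \<in> Arr C" "Cod C n = Cod C m" "\<not> factors_through C m n" for m n
  proof -
    have "\<forall>\<^sub>F i in U. \<exists>z. fst z \<in> N i \<and> snd z \<in> fst (fst z) (Dom C m) \<and>
      (\<forall>y \<in> fst (fst z) (Dom C n). snd (fst z) n y \<noteq> snd (fst z) m (snd z))"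
      using k exhaust[OF a(3)] exhaust[OF a(4)]
      by eventually_elim (drule (2) kripkeD(4)[OF _ a(1,2) _ _ a(5,6)], force)
    from eventually_choice[OF this] obtain z where z: "\<forall>\<^sub>F i in U. fst (z i) \<in> N i \<and> snd (z i) \<in> fst (fst (z i)) (Dom C m) \<and>
      (\<forall>y \<in> fst (fst (z i)) (Dom C n). snd (fst (z i)) n y \<noteq> snd (fst (z i)) m (snd (z i)))" ..
    let ?W = "umodel (\<lambda>i. fst (z i))" and ?u = "cl (\<lambda>i. snd (z i))"
    have "?W \<in> ?N" using z by (auto simp: eventually_conj_iff)
    moreover have "?u \<in> fst ?W (Dom C m)" using z by (simp add: umodel_mem eventually_conj_iff)
    moreover have "snd ?W n v \<noteq> snd ?W m ?u" if "v \<in> fst ?W (Dom C n)" for v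
    proof
      assume eq: "snd ?W n v = snd ?W m ?u"
      obtain y where y: "v = cl y" "\<forall>\<^sub>F i in U. y i \<in> fst (fst (z i)) (Dom C n)" using \<open>v \<in> _\<close> by (rule umodelE)
      have "\<forall>\<^sub>F i in U. snd (fst (z i)) n (y i) = snd (fst (z i)) m (snd (z i))"
        using eq unfolding y(1) umodel_act cl_eq .
      hence "\<forall>\<^sub>F i in U. False" using z y(2) by eventually_elim blast
      thus False using nontrivial by (simp add: trivial_limit_def)
    qed
    ultimately show ?thesis by blast
  qed
qed

end

context boolean_modal_category_with_quotients
begin

text \<open>Coordinates are finite sets \<open>i\<close> of arrows, each with a countable fragment
  containing it; an ultrafilter below \<open>finite_subsets_at_top\<close> puts every arrow into
  almost all fragments. A point is thus a class of functions from sets of arrows to germs, which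
  explains the type of \<open>emb\<close>.\<close>

theorem ex_kripke:
  fixes emb :: "('a set \<Rightarrow> (nat \<times> 'a) set) \<Rightarrow> 'u"
  assumes "inj emb"
  shows "\<exists>(N :: (('o \<Rightarrow> 'u set) \<times> ('a \<Rightarrow> 'u \<Rightarrow> 'u)) set) K. kripke (Arr C) N K"
proof -
  have "finite_subsets_at_top (Arr C) \<noteq> bot" by simp
  from ex_ultrafilter[OF this] obtain U :: "'a set filter" where U: "U \<le> finite_subsets_at_top (Arr C)" "U \<noteq> bot"
    "\<And>P. eventually P U \<or> eventually (\<lambda>i. \<not> P i) U" by blast
  \<comment> \<open>Meaningful at finite sets of arrows only; the ultrafilter concentrates on
    these.\<close>
  define A where "A i = (SOME A. i \<subseteq> A \<and> fragment C A)" for i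
  have A: "i \<subseteq> A i \<and> fragment C (A i)" if "finite i" "i \<subseteq> Arr C" for i
    unfolding A_def by (rule someI_ex[OF ex_fragment]) (use that countable_finite in auto)
  have ev: "\<forall>\<^sub>F i in U. finite i \<and> i \<subseteq> Arr C"
    by (rule filter_leD[OF U(1)]) (auto simp: eventually_finite_subsets_at_top)
  have "\<exists>(N :: (('o \<Rightarrow> (nat \<times> 'a) set set) \<times> ('a \<Rightarrow> (nat \<times> 'a) set \<Rightarrow> (nat \<times> 'a) set)) set) K. kripke (A i) N K"
    if "finite i" "i \<subseteq> Arr C" for i
    using fragment.kripke_germs[OF conjunct2[OF A[OF that]]] by blast
  hence "\<forall>\<^sub>F i in U. \<exists>z. kripke (A i) (fst z :: (('o \<Rightarrow> (nat \<times> 'a) set set) \<times> ('a \<Rightarrow> (nat \<times> 'a) set \<Rightarrow> (nat \<times> 'a) set)) set) (snd z)"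
    using ev by (auto elim!: eventually_mono)
  from eventually_choice[OF this] obtain z where z: "\<forall>\<^sub>F i in U. kripke (A i)
    (fst (z i) :: (('o \<Rightarrow> (nat \<times> 'a) set set) \<times> ('a \<Rightarrow> (nat \<times> 'a) set \<Rightarrow> (nat \<times> 'a) set)) set) (snd (z i))" by blast
  interpret kripke_ultraproduct C U emb A
  proof unfold_locales
    fix f assume "f \<in> Arr C"
    hence "\<forall>\<^sub>F i in finite_subsets_at_top (Arr C). f \<in> i"
      unfolding eventually_finite_subsets_at_top by (intro exI[of _ "{f}"]) auto
    from filter_leD[OF U(1) this] ev show "\<forall>\<^sub>F i in U. f \<in> A i" by eventually_elim (use A in blast)
  qed (use assms U in auto)
  show ?thesis using kripke_ultraproduct[OF z] by blast
qed

end

section \<open>Relational structures over a graph\<close>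

lemma ex_inj_pair:
  assumes "infinite (UNIV :: 'u set)"
  shows "\<exists>f :: 'u \<times> 'u \<Rightarrow> 'u. inj f"
proof -
  obtain f :: "'u \<times> 'u \<Rightarrow> 'u" where "bij_betw f (UNIV \<times> UNIV) UNIV"
    using card_of_Times_same_infinite[OF assms, unfolded card_of_ordIso[symmetric]] by blast
  thus ?thesis using bij_betw_imp_inj_on by fastforce
qed

text \<open>Limits and disjoint unions must have their points in the same type \<open>'u\<close> as
  the given objects. Infinity of this type allows pairs, and so finite tuples and tags, to be coded
  in it.\<close>

locale relational = wf_digraph G
  for G :: "('v, 'e) pre_digraph" and univ :: "'u itself" +
  assumes inf: "infinite (UNIV :: 'u set)"
begin

abbreviation R :: "(('v, 'e, 'u) rel_object, ('v, 'e, 'u) rel_arrow) modal_category_with_quotients" where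
  "R \<equiv> Rel G"

abbreviation objs :: "('v, 'e, 'u) rel_object set" where "objs \<equiv> rel_objects G"
abbreviation arrs :: "('v, 'e, 'u) rel_arrow set" where "arrs \<equiv> rel_arrows G"

lemma Rel_simps [simp]: "Obj R = objs" "Arr R = arrs" "Dom R = source_obj" "Cod R = target_obj"
  "Ident R = rel_ident" "Comp R = rel_comp" "Mon R = rel_mon G" "Dia R = rel_dia G" "Quo R = rel_quo G"
  by (simp_all add: Rel_def)

section \<open>Relational structures and their arrows, elementwise\<close>

lemma objD:
  assumes "X \<in> objs"
  shows "a \<notin> verts G \<Longrightarrow> node_set X a = {}" "k \<notin> arcs G \<Longrightarrow> edge_rel X k = {}"
    "(s, t) \<in> edge_rel X k \<Longrightarrow> k \<in> arcs G \<and> s \<in> node_set X (tail G k) \<and> t \<in> node_set X (head G k)"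
proof -
  show "a \<notin> verts G \<Longrightarrow> node_set X a = {}" and k: "k \<notin> arcs G \<Longrightarrow> edge_rel X k = {}"
    using assms unfolding rel_objects_def by blast+
  show "k \<in> arcs G \<and> s \<in> node_set X (tail G k) \<and> t \<in> node_set X (head G k)" if "(s, t) \<in> edge_rel X k"
    using assms k that unfolding rel_objects_def by blast
qed

lemma objI:
  assumes "\<And>a x. x \<in> node_set X a \<Longrightarrow> a \<in> verts G"
    "\<And>k s t. (s, t) \<in> edge_rel X k \<Longrightarrow> k \<in> arcs G \<and> s \<in> node_set X (tail G k) \<and> t \<in> node_set X (head G k)"
  shows "X \<in> objs"
  using assms unfolding rel_objects_def by fast

lemma arrD:
  assumes "f \<in> arrs"
  shows "source_obj f \<in> objs" "target_obj f \<in> objs"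
    "x \<in> node_set (source_obj f) a \<Longrightarrow> component f a x \<in> node_set (target_obj f) a"
    "(s, t) \<in> edge_rel (source_obj f) k \<Longrightarrow>
      (component f (tail G k) s, component f (head G k) t) \<in> edge_rel (target_obj f) k"
proof -
  have 1: "source_obj f \<in> objs" using assms unfolding rel_arrows_def by simp
  thus "source_obj f \<in> objs" .
  show "target_obj f \<in> objs" using assms unfolding rel_arrows_def by simp
  show "x \<in> node_set (source_obj f) a \<Longrightarrow> component f a x \<in> node_set (target_obj f) a"
    using assms unfolding rel_arrows_def by blast
  show "(component f (tail G k) s, component f (head G k) t) \<in> edge_rel (target_obj f) k"
    if "(s, t) \<in> edge_rel (source_obj f) k"
    using assms objD(3)[OF 1 that] that unfolding rel_arrows_def by fast
qed

definition mk :: "('v, 'e, 'u) rel_object \<Rightarrow> ('v, 'e, 'u) rel_object \<Rightarrow> ('v \<Rightarrow> 'u \<Rightarrow> 'u) \<Rightarrow> ('v, 'e, 'u) rel_arrow" where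
  "mk X Y c = \<lparr>source_obj = X, target_obj = Y, component = (\<lambda>a. restrict (c a) (node_set X a))\<rparr>"

lemma mk_simps [simp]: "source_obj (mk X Y c) = X" "target_obj (mk X Y c) = Y"
  "x \<in> node_set X a \<Longrightarrow> component (mk X Y c) a x = c a x"
  by (simp_all add: mk_def)

lemma mk_arr:
  assumes "X \<in> objs" "Y \<in> objs" "\<And>a x. x \<in> node_set X a \<Longrightarrow> c a x \<in> node_set Y a"
    "\<And>k s t. (s, t) \<in> edge_rel X k \<Longrightarrow> (c (tail G k) s, c (head G k) t) \<in> edge_rel Y k"
  shows "mk X Y c \<in> arrs"
  unfolding rel_arrows_def
proof (intro CollectI conjI allI ballI)
  show "component (mk X Y c) a \<in> node_set (source_obj (mk X Y c)) a \<rightarrow>\<^sub>E node_set (target_obj (mk X Y c)) a" for a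
    using assms(3) by (auto simp: mk_def)
  show "case p of (s, t) \<Rightarrow> (component (mk X Y c) (tail G k) s, component (mk X Y c) (head G k) t) \<in> edge_rel (target_obj (mk X Y c)) k"
    if "k \<in> arcs G" "p \<in> edge_rel (source_obj (mk X Y c)) k" for k p
    using that objD(3)[OF assms(1)] assms(4) by (cases p) simp
qed (use assms in auto)

lemma arr_ext:
  assumes "f \<in> arrs" "g \<in> arrs" "source_obj f = source_obj g" "target_obj f = target_obj g"
    "\<And>a x. x \<in> node_set (source_obj f) a \<Longrightarrow> component f a x = component g a x"
  shows "f = g"
proof -
  have "component f a = component g a" for a
    by (rule extensionalityI[of _ "node_set (source_obj f) a"])
      (use assms in \<open>auto simp: rel_arrows_def PiE_def\<close>)
  thus ?thesis using assms(3,4) by (intro rel_arrow.equality) auto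
qed

lemma comp_simps [simp]: "source_obj (rel_comp g f) = source_obj f" "target_obj (rel_comp g f) = target_obj g"
  "x \<in> node_set (source_obj f) a \<Longrightarrow> component (rel_comp g f) a x = component g a (component f a x)"
  by (simp_all add: rel_comp_def compose_def)

lemma ident_simps [simp]: "source_obj (rel_ident X) = X" "target_obj (rel_ident X) = X"
  "x \<in> node_set X a \<Longrightarrow> component (rel_ident X) a x = x"
  by (simp_all add: rel_ident_def)

lemma comp_closed:
  assumes "f \<in> arrs" "g \<in> arrs" "target_obj f = source_obj g"
  shows "rel_comp g f \<in> arrs"
proof -
  have "rel_comp g f = mk (source_obj f) (target_obj g) (\<lambda>a x. component g a (component f a x))"
    by (simp add: rel_comp_def mk_def compose_def restrict_def)
  also have "\<dots> \<in> arrs" using arrD[OF assms(1)] arrD[OF assms(2)] assms(3) by (intro mk_arr) auto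
  finally show ?thesis .
qed

lemma ident_closed: "X \<in> objs \<Longrightarrow> rel_ident X \<in> arrs"
proof -
  assume "X \<in> objs"
  moreover have "rel_ident X = mk X X (\<lambda>a x. x)" by (simp add: rel_ident_def mk_def restrict_def)
  ultimately show ?thesis by (auto intro: mk_arr)
qed

lemma Hom_iff: "f \<in> Hom R X Y \<longleftrightarrow> f \<in> arrs \<and> source_obj f = X \<and> target_obj f = Y"
  by (simp add: Hom_def)

lemma category_R: "category R"
proof (unfold_locales, goal_cases)
  case (5 f X Y)
  hence "f \<in> arrs" "source_obj f = X" by (auto simp: Hom_iff)
  thus ?case using arrD(1)[of f] arrD(3)[of f] ident_closed comp_closed
    by (intro arr_ext) auto
next
  case (6 f X Y)
  hence "f \<in> arrs" "target_obj f = Y" by (auto simp: Hom_iff)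
  thus ?case using arrD(2)[of f] arrD(3)[of f] ident_closed comp_closed
    by (intro arr_ext) auto
next
  case (7 f W X g Y h Z)
  hence "f \<in> arrs" "g \<in> arrs" "h \<in> arrs" "target_obj f = source_obj g" "target_obj g = source_obj h" by (auto simp: Hom_iff)
  thus ?case using arrD(3)[of f] comp_closed[of f g] comp_closed[of g h] comp_closed[of f "rel_comp h g"]
      comp_closed[of "rel_comp g f" h] by (intro arr_ext) auto
qed (auto simp: Hom_iff arrD ident_closed comp_closed)

sublocale rel: category R by (rule category_R)

subsection \<open>Limits\<close>

definition pair_code :: "'u \<times> 'u \<Rightarrow> 'u" where
  "pair_code = (SOME f. inj f)"

lemma pair_code: "inj pair_code"
  unfolding pair_code_def using someI_ex[OF ex_inj_pair[OF inf]] .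

text \<open>Two distinct elements: with \<open>u1\<close> they are the ends of the generic edge
  \<open>edg\<close> and the tags of a disjoint union.\<close>

definition u0 :: 'u where "u0 = (SOME x. True)"
definition u1 :: 'u where "u1 = (SOME x. x \<noteq> u0)"

lemma u01: "u1 \<noteq> u0"
proof -
  have "\<exists>x. x \<noteq> u0" using inf by (metis UNIV_eq_I finite.emptyI finite.insertI insertI1 singletonI)
  thus ?thesis unfolding u1_def by (rule someI_ex)
qed

primrec list_code :: "'u list \<Rightarrow> 'u" where
  "list_code [] = u0"
| "list_code (x # xs) = pair_code (x, list_code xs)"

lemma list_code: "length xs = length ys \<Longrightarrow> list_code xs = list_code ys \<longleftrightarrow> xs = ys"
  by (induction xs ys rule: list_induct2) (auto simp: inj_eq[OF pair_code])

text \<open>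
  Elements and related pairs are represented by arrows from a point at a node and from an edge
  with distinct ends, so universal properties in \<open>R\<close> can be read off elementwise.
\<close>

definition pnt :: "'v \<Rightarrow> ('v, 'e, 'u) rel_object" where
  "pnt a = \<lparr>node_set = (\<lambda>b. if b = a then {u0} else {}), edge_rel = (\<lambda>k. {})\<rparr>"

definition edg :: "'e \<Rightarrow> ('v, 'e, 'u) rel_object" where
  "edg k = \<lparr>node_set = (\<lambda>b. (if b = tail G k then {u0} else {}) \<union> (if b = head G k then {u1} else {})),
     edge_rel = (\<lambda>l. if l = k then {(u0, u1)} else {})\<rparr>"

definition pt_arr :: "'v \<Rightarrow> ('v, 'e, 'u) rel_object \<Rightarrow> 'u \<Rightarrow> ('v, 'e, 'u) rel_arrow" where
  "pt_arr a X x = mk (pnt a) X (\<lambda>_ _. x)"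

definition ed_arr :: "'e \<Rightarrow> ('v, 'e, 'u) rel_object \<Rightarrow> 'u \<Rightarrow> 'u \<Rightarrow> ('v, 'e, 'u) rel_arrow" where
  "ed_arr k X s t = mk (edg k) X (\<lambda>_ y. if y = u0 then s else t)"

lemma pnt_obj: "a \<in> verts G \<Longrightarrow> pnt a \<in> objs"
  by (rule objI) (auto simp: pnt_def split: if_splits)

lemma edg_obj: "k \<in> arcs G \<Longrightarrow> edg k \<in> objs"
  by (rule objI) (auto simp: edg_def split: if_splits)

lemma pt_arr: "X \<in> objs \<Longrightarrow> x \<in> node_set X a \<Longrightarrow> pt_arr a X x \<in> arrs"
  unfolding pt_arr_def using objD(1)[of X a] pnt_obj[of a]
  by (intro mk_arr) (auto simp: pnt_def split: if_splits)

lemma ed_arr: "X \<in> objs \<Longrightarrow> (s, t) \<in> edge_rel X k \<Longrightarrow> ed_arr k X s t \<in> arrs"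
  unfolding ed_arr_def using objD(3)[of X s t k] edg_obj[of k] u01
  by (intro mk_arr) (auto simp: edg_def split: if_splits)

lemma pt_arr_simps [simp]: "source_obj (pt_arr a X x) = pnt a" "target_obj (pt_arr a X x) = X"
  "component (pt_arr a X x) a u0 = x" "u0 \<in> node_set (pnt a) a"
  by (simp_all add: pt_arr_def pnt_def mk_def)

lemma ed_arr_simps [simp]: "source_obj (ed_arr k X s t) = edg k" "target_obj (ed_arr k X s t) = X"
  "component (ed_arr k X s t) (tail G k) u0 = s" "component (ed_arr k X s t) (head G k) u1 = t"
  "u0 \<in> node_set (edg k) (tail G k)" "u1 \<in> node_set (edg k) (head G k)" "(u0, u1) \<in> edge_rel (edg k) k"
  using u01 by (simp_all add: ed_arr_def edg_def mk_def)

lemma arr_comp_pt: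
  assumes "f \<in> arrs" "x \<in> node_set (source_obj f) a"
  shows "rel_comp f (pt_arr a (source_obj f) x) = pt_arr a (target_obj f) (component f a x)"
proof (rule arr_ext)
  note A = arrD[OF assms(1)]
  show "rel_comp f (pt_arr a (source_obj f) x) \<in> arrs" using comp_closed pt_arr A assms by simp
  show "pt_arr a (target_obj f) (component f a x) \<in> arrs" using pt_arr A assms by simp
  fix b y assume "y \<in> node_set (source_obj (rel_comp f (pt_arr a (source_obj f) x))) b"
  hence "b = a" "y = u0" by (auto simp: pnt_def split: if_splits)
  thus "component (rel_comp f (pt_arr a (source_obj f) x)) b y = component (pt_arr a (target_obj f) (component f a x)) b y"
    by simp
qed auto

lemma arr_comp_ed:
  assumes "f \<in> arrs" "(s, t) \<in> edge_rel (source_obj f) k"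
  shows "rel_comp f (ed_arr k (source_obj f) s t) =
    ed_arr k (target_obj f) (component f (tail G k) s) (component f (head G k) t)"
proof (rule arr_ext)
  note A = arrD[OF assms(1)]
  show "rel_comp f (ed_arr k (source_obj f) s t) \<in> arrs" using comp_closed ed_arr A assms by simp
  show "ed_arr k (target_obj f) (component f (tail G k) s) (component f (head G k) t) \<in> arrs"
    using ed_arr A assms by simp
  fix b y assume "y \<in> node_set (source_obj (rel_comp f (ed_arr k (source_obj f) s t))) b"
  hence "b = tail G k \<and> y = u0 \<or> b = head G k \<and> y = u1" by (auto simp: edg_def split: if_splits)
  thus "component (rel_comp f (ed_arr k (source_obj f) s t)) b y =
    component (ed_arr k (target_obj f) (component f (tail G k) s) (component f (head G k) t)) b y"
    by auto
qed auto

lemma pt_arr_eq: "pt_arr a X x = pt_arr a X y \<longleftrightarrow> x = y"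
  by (metis pt_arr_simps(3))

lemma mono_inj:
  assumes "is_mono R m" "x \<in> node_set (source_obj m) a" "y \<in> node_set (source_obj m) a"
    "component m a x = component m a y"
  shows "x = y"
proof -
  have m: "m \<in> arrs" using assms(1) unfolding is_mono_def by simp
  have "pt_arr a (source_obj m) x = pt_arr a (source_obj m) y"
    by (rule rel.monoD[OF assms(1)])
      (use assms m arrD(1)[OF m] pt_arr in \<open>auto simp: arr_comp_pt\<close>)
  thus ?thesis by (simp add: pt_arr_eq)
qed

lemma pullback_point:
  assumes "is_pullback R f g p q" "s \<in> node_set (source_obj f) a" "t \<in> node_set (source_obj g) a"
    "component f a s = component g a t"
  shows "\<exists>z \<in> node_set (source_obj p) a. component p a z = s \<and> component q a z = t"
proof -
  note D = rel.is_pullbackD[OF assms(1), simplified]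
  note o = arrD(1)[OF D(1)] arrD(1)[OF D(2)]
  have eq: "rel_comp f (pt_arr a (source_obj f) s) = rel_comp g (pt_arr a (source_obj g) t)"
    using arr_comp_pt[OF D(1) assms(2)] arr_comp_pt[OF D(2) assms(3)] assms(4) D(5) by simp
  obtain h where h: "h \<in> arrs" "source_obj h = pnt a" "target_obj h = source_obj p"
    "rel_comp p h = pt_arr a (source_obj f) s" "rel_comp q h = pt_arr a (source_obj g) t"
    by (rule rel.is_pullback_fill[OF assms(1), simplified, of "pt_arr a (source_obj f) s" "pt_arr a (source_obj g) t"])
      (use eq pt_arr o assms(2,3) in auto)
  have u: "u0 \<in> node_set (source_obj h) a" using h(2) by simp
  have "component p a (component h a u0) = component (rel_comp p h) a u0" using u by simp
  also have "\<dots> = s" unfolding h(4) by simp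
  finally have 1: "component p a (component h a u0) = s" .
  have "component q a (component h a u0) = component (rel_comp q h) a u0" using u by simp
  also have "\<dots> = t" unfolding h(5) by simp
  finally show ?thesis using 1 arrD(3)[OF h(1) u] h(3) by auto
qed

lemma pullback_unique:
  assumes "is_pullback R f g p q" "z \<in> node_set (source_obj p) a" "w \<in> node_set (source_obj p) a"
    "component p a z = component p a w" "component q a z = component q a w"
  shows "z = w"
proof -
  note D = rel.is_pullbackD[OF assms(1), simplified]
  have "pt_arr a (source_obj p) z = pt_arr a (source_obj p) w"
    by (rule rel.is_pullback_unique[OF assms(1)])
      (use assms D(3,4,6) arrD(1)[OF D(3)] pt_arr arr_comp_pt[OF D(3)] arr_comp_pt[OF D(4)] in auto)
  thus ?thesis by (simp add: pt_arr_eq)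
qed

text \<open>The relation on a pullback is as large as the legs permit: a pair related under both
  legs is a commuting pair of arrows from \<open>edg k\<close>, and the ends of its factorisation
  are \<open>z\<close> and \<open>w\<close> by uniqueness of points.\<close>

lemma pullback_edge:
  assumes "is_pullback R f g p q" "z \<in> node_set (source_obj p) (tail G k)" "w \<in> node_set (source_obj p) (head G k)"
    "(component p (tail G k) z, component p (head G k) w) \<in> edge_rel (source_obj f) k"
    "(component q (tail G k) z, component q (head G k) w) \<in> edge_rel (source_obj g) k"
  shows "(z, w) \<in> edge_rel (source_obj p) k"
proof -
  note D = rel.is_pullbackD[OF assms(1), simplified]
  note o = arrD(1)[OF D(1)] arrD(1)[OF D(2)]
  let ?s = "ed_arr k (source_obj f) (component p (tail G k) z) (component p (head G k) w)"
  let ?t = "ed_arr k (source_obj g) (component q (tail G k) z) (component q (head G k) w)"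
  have c: "component f a (component p a z) = component g a (component q a z)" if "z \<in> node_set (source_obj p) a" for a z
  proof -
    have "component (rel_comp f p) a z = component (rel_comp g q) a z" unfolding D(9) ..
    thus ?thesis using that D(6) by simp
  qed
  have eq: "rel_comp f ?s = rel_comp g ?t"
    using arr_comp_ed[OF D(1) assms(4)] arr_comp_ed[OF D(2) assms(5)] c[OF assms(2)] c[OF assms(3)] D(5) by simp
  obtain h where h: "h \<in> arrs" "source_obj h = edg k" "target_obj h = source_obj p" "rel_comp p h = ?s" "rel_comp q h = ?t"
    by (rule rel.is_pullback_fill[OF assms(1), simplified, of ?s ?t]) (use eq ed_arr o assms(4,5) in auto)
  have u: "u0 \<in> node_set (source_obj h) (tail G k)" "u1 \<in> node_set (source_obj h) (head G k)" using h(2) by simp_all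
  have pz: "component p (tail G k) (component h (tail G k) u0) = component p (tail G k) z"
    "component q (tail G k) (component h (tail G k) u0) = component q (tail G k) z"
    "component p (head G k) (component h (head G k) u1) = component p (head G k) w"
    "component q (head G k) (component h (head G k) u1) = component q (head G k) w"
    using arg_cong[OF h(4), of "\<lambda>f. component f (tail G k) u0"] arg_cong[OF h(5), of "\<lambda>f. component f (tail G k) u0"]
      arg_cong[OF h(4), of "\<lambda>f. component f (head G k) u1"] arg_cong[OF h(5), of "\<lambda>f. component f (head G k) u1"] u by simp_all
  have "component h (tail G k) u0 = z" "component h (head G k) u1 = w"
    using pullback_unique[OF assms(1) _ assms(2) pz(1,2)] pullback_unique[OF assms(1) _ assms(3) pz(3,4)]
      arrD(3)[OF h(1) u(1)] arrD(3)[OF h(1) u(2)] h(3) by simp_all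
  thus ?thesis using arrD(4)[OF h(1), of u0 u1 k] h(2,3) by simp
qed

text \<open>The converse of the three preceding pullback lemmas: joint bijectivity onto the matching
  pairs and joint reflection of edges make the square universal. It is needed to recognise kernel
  pairs.\<close>

lemma pullbackI:
  assumes "f \<in> arrs" "g \<in> arrs" "p \<in> arrs" "q \<in> arrs" "target_obj f = target_obj g" "source_obj q = source_obj p"
    "target_obj p = source_obj f" "target_obj q = source_obj g"
    "\<And>a z. z \<in> node_set (source_obj p) a \<Longrightarrow> component f a (component p a z) = component g a (component q a z)"
    "\<And>a s t. s \<in> node_set (source_obj f) a \<Longrightarrow> t \<in> node_set (source_obj g) a \<Longrightarrow> component f a s = component g a t \<Longrightarrow>
      \<exists>z \<in> node_set (source_obj p) a. component p a z = s \<and> component q a z = t"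
    "\<And>a z w. z \<in> node_set (source_obj p) a \<Longrightarrow> w \<in> node_set (source_obj p) a \<Longrightarrow>
      component p a z = component p a w \<Longrightarrow> component q a z = component q a w \<Longrightarrow> z = w"
    "\<And>k z w. z \<in> node_set (source_obj p) (tail G k) \<Longrightarrow> w \<in> node_set (source_obj p) (head G k) \<Longrightarrow>
      (component p (tail G k) z, component p (head G k) w) \<in> edge_rel (source_obj f) k \<Longrightarrow>
      (component q (tail G k) z, component q (head G k) w) \<in> edge_rel (source_obj g) k \<Longrightarrow>
      (z, w) \<in> edge_rel (source_obj p) k"
  shows "is_pullback R f g p q"
  unfolding is_pullback_def
proof (intro conjI ballI impI)
  show "Comp R f p = Comp R g q"
    by (simp, rule arr_ext) (use assms(1-9) comp_closed in auto)
  fix T s t assume T: "T \<in> Obj R" "s \<in> Hom R T (Dom R f)" "t \<in> Hom R T (Dom R g)" "Comp R f s = Comp R g t"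
  hence st: "s \<in> arrs" "source_obj s = T" "target_obj s = source_obj f" "t \<in> arrs" "source_obj t = T" "target_obj t = source_obj g"
    by (auto simp: Hom_iff)
  have e: "component f a (component s a x) = component g a (component t a x)" if "x \<in> node_set T a" for a x
    using arg_cong[OF T(4), of "\<lambda>f. component f a x"] that st by simp
  define c where "c a x = (SOME z. z \<in> node_set (source_obj p) a \<and> component p a z = component s a x \<and> component q a z = component t a x)" for a x
  have c: "c a x \<in> node_set (source_obj p) a \<and> component p a (c a x) = component s a x \<and> component q a (c a x) = component t a x"
    if "x \<in> node_set T a" for a x
    unfolding c_def
  proof (rule someI_ex)
    have "component s a x \<in> node_set (source_obj f) a" "component t a x \<in> node_set (source_obj g) a"
      using arrD(3)[OF st(1), of x a] arrD(3)[OF st(4), of x a] st that by simp_all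
    from assms(10)[OF this e[OF that]]
    show "\<exists>z. z \<in> node_set (source_obj p) a \<and> component p a z = component s a x \<and> component q a z = component t a x"
      by blast
  qed
  let ?h = "mk T (source_obj p) c"
  have h: "?h \<in> arrs"
  proof (rule mk_arr)
    fix k x y assume xy: "(x, y) \<in> edge_rel T k"
    have "x \<in> node_set T (tail G k)" "y \<in> node_set T (head G k)" using objD(3)[OF _ xy] T by auto
    with c arrD(4)[OF st(1), of x y k] arrD(4)[OF st(4), of x y k] xy st
    show "(c (tail G k) x, c (head G k) y) \<in> edge_rel (source_obj p) k" by (intro assms(12)) auto
  qed (use T c arrD(1)[OF assms(3)] in auto)
  show "\<exists>!h. h \<in> Hom R T (Dom R p) \<and> Comp R p h = s \<and> Comp R q h = t"
  proof (rule ex1I[of _ ?h])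
    have "rel_comp p ?h = s" by (rule arr_ext) (use c st h comp_closed assms in auto)
    moreover have "rel_comp q ?h = t" by (rule arr_ext) (use c st h comp_closed assms in auto)
    ultimately show "?h \<in> Hom R T (Dom R p) \<and> Comp R p ?h = s \<and> Comp R q ?h = t"
      using h by (simp add: Hom_iff)
    fix l assume l: "l \<in> Hom R T (Dom R p) \<and> Comp R p l = s \<and> Comp R q l = t"
    hence l': "l \<in> arrs" "source_obj l = T" "target_obj l = source_obj p" "rel_comp p l = s" "rel_comp q l = t"
      by (auto simp: Hom_iff)
    show "l = ?h"
    proof (rule arr_ext)
      fix a x assume "x \<in> node_set (source_obj l) a"
      hence x: "x \<in> node_set T a" "x \<in> node_set (source_obj l) a" using l' by auto
      have "component p a (component l a x) = component s a x" "component q a (component l a x) = component t a x"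
        using comp_simps(3)[OF x(2), of p] comp_simps(3)[OF x(2), of q] l'(4,5) by simp_all
      thus "component l a x = component ?h a x"
        using assms(11)[of "component l a x" a "c a x"] c[OF x(1)] arrD(3)[OF l'(1) x(2)] l'(3) x(1) by simp
    qed (use l' h in auto)
  qed
qed (use assms in auto)

lemma product_point:
  assumes "is_product R X Y P p q" "s \<in> node_set X a" "t \<in> node_set Y a"
  shows "\<exists>z \<in> node_set P a. component p a z = s \<and> component q a z = t"
proof -
  note D = rel.is_productD[OF assms(1), simplified]
  obtain h where h: "h \<in> arrs" "source_obj h = pnt a" "target_obj h = P" "rel_comp p h = pt_arr a X s" "rel_comp q h = pt_arr a Y t"
    by (rule rel.is_product_fill[OF assms(1), simplified, of "pt_arr a X s" "pt_arr a Y t"])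
      (use pt_arr D assms(2,3) in auto)
  have u: "u0 \<in> node_set (source_obj h) a" using h(2) by simp
  have "component p a (component h a u0) = s" "component q a (component h a u0) = t"
    using comp_simps(3)[OF u, of p] comp_simps(3)[OF u, of q] h(4,5) by simp_all
  thus ?thesis using arrD(3)[OF h(1) u] h(3) by auto
qed

lemma product_unique:
  assumes "is_product R X Y P p q" "z \<in> node_set P a" "w \<in> node_set P a"
    "component p a z = component p a w" "component q a z = component q a w"
  shows "z = w"
proof -
  note D = rel.is_productD[OF assms(1), simplified]
  have "pt_arr a P z = pt_arr a P w"
    by (rule rel.is_product_unique[OF assms(1)])
      (use assms D pt_arr arr_comp_pt[OF D(1)] arr_comp_pt[OF D(2)] in auto)
  thus ?thesis by (simp add: pt_arr_eq)
qed

lemma product_edge: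
  assumes "is_product R X Y P p q" "z \<in> node_set P (tail G k)" "w \<in> node_set P (head G k)"
    "(component p (tail G k) z, component p (head G k) w) \<in> edge_rel X k"
    "(component q (tail G k) z, component q (head G k) w) \<in> edge_rel Y k"
  shows "(z, w) \<in> edge_rel P k"
proof -
  note D = rel.is_productD[OF assms(1), simplified]
  let ?s = "ed_arr k X (component p (tail G k) z) (component p (head G k) w)"
  let ?t = "ed_arr k Y (component q (tail G k) z) (component q (head G k) w)"
  obtain h where h: "h \<in> arrs" "source_obj h = edg k" "target_obj h = P" "rel_comp p h = ?s" "rel_comp q h = ?t"
    by (rule rel.is_product_fill[OF assms(1), simplified, of ?s ?t]) (use ed_arr D assms(4,5) in auto)
  have u: "u0 \<in> node_set (source_obj h) (tail G k)" "u1 \<in> node_set (source_obj h) (head G k)" using h(2) by simp_all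
  have pz: "component p (tail G k) (component h (tail G k) u0) = component p (tail G k) z"
    "component q (tail G k) (component h (tail G k) u0) = component q (tail G k) z"
    "component p (head G k) (component h (head G k) u1) = component p (head G k) w"
    "component q (head G k) (component h (head G k) u1) = component q (head G k) w"
    using arg_cong[OF h(4), of "\<lambda>f. component f (tail G k) u0"] arg_cong[OF h(5), of "\<lambda>f. component f (tail G k) u0"]
      arg_cong[OF h(4), of "\<lambda>f. component f (head G k) u1"] arg_cong[OF h(5), of "\<lambda>f. component f (head G k) u1"] u by simp_all
  have "component h (tail G k) u0 = z" "component h (head G k) u1 = w"
    using product_unique[OF assms(1) _ assms(2) pz(1,2)] product_unique[OF assms(1) _ assms(3) pz(3,4)]
      arrD(3)[OF h(1) u(1)] arrD(3)[OF h(1) u(2)] h(3) by simp_all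
  thus ?thesis using arrD(4)[OF h(1), of u0 u1 k] h(2,3) by simp
qed

text \<open>Compatible families have a unique preimage and edges are reflected jointly. Nodes and
  edges are restricted to the graph because of diagrams with no vertices: there every family is
  compatible, while a structure is empty off the graph.\<close>

lemma limitI:
  assumes "is_cone R J DO DA L pr"
    "\<And>a \<phi>. \<lbrakk>\<And>v. v \<in> verts J \<Longrightarrow> \<phi> v \<in> node_set (DO v) a;
        \<And>e. e \<in> arcs J \<Longrightarrow> component (DA e) a (\<phi> (tail J e)) = \<phi> (head J e); a \<in> verts G\<rbrakk> \<Longrightarrow>
      \<exists>z \<in> node_set L a. \<forall>v \<in> verts J. component (pr v) a z = \<phi> v"
    "\<And>a z w. z \<in> node_set L a \<Longrightarrow> w \<in> node_set L a \<Longrightarrow>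
      (\<And>v. v \<in> verts J \<Longrightarrow> component (pr v) a z = component (pr v) a w) \<Longrightarrow> z = w"
    "\<And>k z w. k \<in> arcs G \<Longrightarrow> z \<in> node_set L (tail G k) \<Longrightarrow> w \<in> node_set L (head G k) \<Longrightarrow>
      (\<And>v. v \<in> verts J \<Longrightarrow> (component (pr v) (tail G k) z, component (pr v) (head G k) w) \<in> edge_rel (DO v) k) \<Longrightarrow>
      (z, w) \<in> edge_rel L k"
    and wf: "wf_digraph J"
  shows "is_limit R J DO DA L pr"
  unfolding is_limit_def
proof (intro conjI allI impI)
  have L: "L \<in> objs" and pr: "pr v \<in> arrs" "source_obj (pr v) = L" "target_obj (pr v) = DO v" if "v \<in> verts J" for v
    using assms(1) that unfolding is_cone_def by (auto simp: Hom_iff)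
  have LO: "L \<in> objs" using assms(1) unfolding is_cone_def by auto
  fix T t assume T: "is_cone R J DO DA T t"
  hence TO: "T \<in> objs" and te: "\<And>e. e \<in> arcs J \<Longrightarrow> rel_comp (DA e) (t (tail J e)) = t (head J e)"
    unfolding is_cone_def by auto
  have t: "t v \<in> arrs" "source_obj (t v) = T" "target_obj (t v) = DO v" if "v \<in> verts J" for v
    using T that unfolding is_cone_def by (auto simp: Hom_iff)
  define c where "c a x = (SOME z. z \<in> node_set L a \<and> (\<forall>v \<in> verts J. component (pr v) a z = component (t v) a x))" for a x
  have c: "c a x \<in> node_set L a \<and> (\<forall>v \<in> verts J. component (pr v) a (c a x) = component (t v) a x)"
    if x: "x \<in> node_set T a" for a x
    unfolding c_def
  proof (rule someI_ex)
    have "\<exists>z \<in> node_set L a. \<forall>v \<in> verts J. component (pr v) a z = component (t v) a x"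
    proof (rule assms(2))
      show "component (t v) a x \<in> node_set (DO v) a" if "v \<in> verts J" for v
        using arrD(3)[OF t(1)[OF that], of x a] t[OF that] x by simp
      show "component (DA e) a (component (t (tail J e)) a x) = component (t (head J e)) a x" if "e \<in> arcs J" for e
      proof -
        have "tail J e \<in> verts J" using wf that by (simp add: wf_digraph_def)
        thus ?thesis using comp_simps(3)[of x "t (tail J e)" a "DA e"] te[OF that] t x by simp
      qed
      show "a \<in> verts G" using objD(1)[OF TO] x by blast
    qed
    thus "\<exists>z. z \<in> node_set L a \<and> (\<forall>v \<in> verts J. component (pr v) a z = component (t v) a x)" by blast
  qed
  let ?h = "mk T L c"
  have h: "?h \<in> arrs"
  proof (rule mk_arr[OF TO LO])
    show "c a x \<in> node_set L a" if "x \<in> node_set T a" for a x using c[OF that] by simp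
    fix k x y assume xy: "(x, y) \<in> edge_rel T k"
    note xy' = objD(3)[OF TO xy]
    show "(c (tail G k) x, c (head G k) y) \<in> edge_rel L k"
    proof (rule assms(4))
      fix v assume v: "v \<in> verts J"
      show "(component (pr v) (tail G k) (c (tail G k) x), component (pr v) (head G k) (c (head G k) y)) \<in> edge_rel (DO v) k"
        using c[of x "tail G k"] c[of y "head G k"] xy' v arrD(4)[OF t(1)[OF v], of x y k] t[OF v] xy by simp
    qed (use c xy' in auto)
  qed
  show "\<exists>!h. h \<in> Hom R T L \<and> (\<forall>v \<in> verts J. Comp R (pr v) h = t v)"
  proof (rule ex1I[of _ ?h])
    have "rel_comp (pr v) ?h = t v" if "v \<in> verts J" for v
      by (rule arr_ext) (use c that h pr t comp_closed in auto)
    thus "?h \<in> Hom R T L \<and> (\<forall>v \<in> verts J. Comp R (pr v) ?h = t v)" using h by (simp add: Hom_iff)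
    fix l assume "l \<in> Hom R T L \<and> (\<forall>v \<in> verts J. Comp R (pr v) l = t v)"
    hence l: "l \<in> arrs" "source_obj l = T" "target_obj l = L" "\<And>v. v \<in> verts J \<Longrightarrow> rel_comp (pr v) l = t v"
      by (auto simp: Hom_iff)
    show "l = ?h"
    proof (rule arr_ext)
      fix a x assume x: "x \<in> node_set (source_obj l) a"
      have "component (pr v) a (component l a x) = component (t v) a x" if "v \<in> verts J" for v
        using comp_simps(3)[OF x, of "pr v"] l(4)[OF that] by simp
      thus "component l a x = component ?h a x"
        using assms(3)[of "component l a x" a "c a x"] c[of x a] arrD(3)[OF l(1) x] l x by simp
    qed (use l h in auto)
  qed
qed (rule assms(1))

text \<open>The points of the limit at a node are codes of the compatible families there. Listing
  the finitely many vertices in a fixed order turns a family into a list.\<close>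

lemma has_finite_limits_R: "has_finite_limits R"
  unfolding has_finite_limits_def
proof (intro allI impI)
  fix J :: "(nat, nat) pre_digraph" and DO :: "nat \<Rightarrow> ('v, 'e, 'u) rel_object" and DA
  assume a: "fin_digraph J \<and> is_diagram R J DO DA"
  interpret J: fin_digraph J using a by simp
  have DO: "\<And>v. v \<in> verts J \<Longrightarrow> DO v \<in> objs" and
    DA: "\<And>e. e \<in> arcs J \<Longrightarrow> DA e \<in> arrs \<and> source_obj (DA e) = DO (tail J e) \<and> target_obj (DA e) = DO (head J e)"
    using a unfolding is_diagram_def by (auto simp: Hom_iff)
  define vs where "vs = sorted_list_of_set (verts J)"
  have vs: "set vs = verts J" unfolding vs_def by simp
  define code where "code \<phi> = list_code (map \<phi> vs)" for \<phi>
  have code: "code \<phi> = code \<psi> \<longleftrightarrow> (\<forall>v \<in> verts J. \<phi> v = \<psi> v)" for \<phi> \<psi>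
    unfolding code_def using list_code[of "map \<phi> vs" "map \<psi> vs"] vs by simp
  define fam where "fam a \<phi> \<longleftrightarrow> a \<in> verts G \<and> (\<forall>v \<in> verts J. \<phi> v \<in> node_set (DO v) a) \<and>
    (\<forall>e \<in> arcs J. component (DA e) a (\<phi> (tail J e)) = \<phi> (head J e))" for a \<phi>
  \<comment> \<open>A code determines its family on the vertices of the diagram only, so the chosen
    preimage may differ from the original elsewhere.\<close>
  define dec where "dec y = (SOME \<phi>. code \<phi> = y)" for y
  have dec: "dec (code \<phi>) v = \<phi> v" if "v \<in> verts J" for \<phi> v
  proof -
    have "code (dec (code \<phi>)) = code \<phi>" unfolding dec_def by (rule someI[of _ \<phi>]) simp
    thus ?thesis using code that by blast
  qed
  have fam_dec: "fam a (dec (code \<phi>))" if "fam a \<phi>" for a \<phi>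
    using that dec unfolding fam_def by auto
  define L where "L = \<lparr>node_set = (\<lambda>a. {code \<phi> | \<phi>. fam a \<phi>}),
    edge_rel = (\<lambda>k. {(code \<phi>, code \<psi>) | \<phi> \<psi>. k \<in> arcs G \<and> fam (tail G k) \<phi> \<and> fam (head G k) \<psi> \<and>
      (\<forall>v \<in> verts J. (\<phi> v, \<psi> v) \<in> edge_rel (DO v) k)})\<rparr>"
  have L: "L \<in> objs" by (rule objI) (auto simp: L_def fam_def)
  define pr where "pr v = mk L (DO v) (\<lambda>a y. dec y v)" for v
  have pr: "pr v \<in> arrs" if "v \<in> verts J" for v
    unfolding pr_def using L DO[OF that] that by (intro mk_arr) (auto simp: L_def dec fam_def)
  have prc: "component (pr v) a (code \<phi>) = \<phi> v" if "fam a \<phi>" "v \<in> verts J" for a \<phi> v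
    using that dec unfolding pr_def by (subst mk_simps) (auto simp: L_def)
  have "is_limit R J DO DA L pr"
  proof (rule limitI)
    show "is_cone R J DO DA L pr"
      unfolding is_cone_def
    proof (intro conjI ballI)
      show "pr v \<in> Hom R L (DO v)" if "v \<in> verts J" for v using pr[OF that] by (simp add: Hom_iff pr_def)
      show "Comp R (DA e) (pr (tail J e)) = pr (head J e)" if e: "e \<in> arcs J" for e
      proof (simp, rule arr_ext)
        note v = J.tail_in_verts[OF e] J.head_in_verts[OF e]
        show "rel_comp (DA e) (pr (tail J e)) \<in> arrs" using comp_closed pr v DA[OF e] by (simp add: pr_def)
        fix a y assume "y \<in> node_set (source_obj (rel_comp (DA e) (pr (tail J e)))) a"
        then obtain \<phi> where p: "y = code \<phi>" "fam a \<phi>" by (auto simp: pr_def L_def)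
        have "code \<phi> \<in> node_set (source_obj (pr (tail J e))) a" using p by (auto simp: pr_def L_def)
        thus "component (rel_comp (DA e) (pr (tail J e))) a y = component (pr (head J e)) a y"
          using prc[OF p(2)] v p e unfolding fam_def by simp
      qed (use pr J.head_in_verts[OF e] DA[OF e] in \<open>auto simp: pr_def\<close>)
    qed (use L in simp)
    show "\<exists>z \<in> node_set L a. \<forall>v \<in> verts J. component (pr v) a z = \<phi> v"
      if "\<And>v. v \<in> verts J \<Longrightarrow> \<phi> v \<in> node_set (DO v) a"
        "\<And>e. e \<in> arcs J \<Longrightarrow> component (DA e) a (\<phi> (tail J e)) = \<phi> (head J e)" "a \<in> verts G" for a \<phi>
    proof -
      have "fam a \<phi>" using that unfolding fam_def by blast
      thus ?thesis using prc by (intro bexI[of _ "code \<phi>"]) (auto simp: L_def)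
    qed
    show "z = w" if zw: "z \<in> node_set L a" "w \<in> node_set L a"
      "\<And>v. v \<in> verts J \<Longrightarrow> component (pr v) a z = component (pr v) a w" for a z w
    proof -
      obtain \<phi> \<psi> where p: "z = code \<phi>" "fam a \<phi>" "w = code \<psi>" "fam a \<psi>" using zw(1,2) by (auto simp: L_def)
      show ?thesis using zw(3) prc p code by simp
    qed
    show "(z, w) \<in> edge_rel L k" if zw: "k \<in> arcs G" "z \<in> node_set L (tail G k)" "w \<in> node_set L (head G k)"
      "\<And>v. v \<in> verts J \<Longrightarrow> (component (pr v) (tail G k) z, component (pr v) (head G k) w) \<in> edge_rel (DO v) k" for k z w
    proof -
      obtain \<phi> \<psi> where p: "z = code \<phi>" "fam (tail G k) \<phi>" "w = code \<psi>" "fam (head G k) \<psi>" using zw(2,3) by (auto simp: L_def)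
      have "\<forall>v \<in> verts J. (\<phi> v, \<psi> v) \<in> edge_rel (DO v) k" using zw(4) prc p by simp
      thus ?thesis using p zw(1) unfolding L_def by auto
    qed
  qed unfold_locales
  thus "\<exists>L pr. is_limit R J DO DA L pr" by blast
qed

end

context relational
begin

subsection \<open>Subobjects of relational structures\<close>

lemma monD:
  assumes "m \<in> rel_mon G"
  shows "m \<in> arrs"
    "x \<in> node_set (source_obj m) a \<Longrightarrow> y \<in> node_set (source_obj m) a \<Longrightarrow> component m a x = component m a y \<Longrightarrow> x = y"
    "s \<in> node_set (source_obj m) (tail G k) \<Longrightarrow> t \<in> node_set (source_obj m) (head G k) \<Longrightarrow>
      (component m (tail G k) s, component m (head G k) t) \<in> edge_rel (target_obj m) k \<Longrightarrow> (s, t) \<in> edge_rel (source_obj m) k"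
proof -
  show m: "m \<in> arrs" using assms by (simp add: rel_mon_def)
  note A = arrD[OF m]
  show "x = y" if "x \<in> node_set (source_obj m) a" "y \<in> node_set (source_obj m) a" "component m a x = component m a y"
  proof -
    have "a \<in> verts G" using objD(1)[OF A(1)] that(1) by blast
    thus ?thesis using assms that unfolding rel_mon_def inj_on_def by blast
  qed
  show "(s, t) \<in> edge_rel (source_obj m) k" if "s \<in> node_set (source_obj m) (tail G k)" "t \<in> node_set (source_obj m) (head G k)"
      "(component m (tail G k) s, component m (head G k) t) \<in> edge_rel (target_obj m) k"
  proof -
    have "k \<in> arcs G" using objD(3)[OF A(2) that(3)] by blast
    thus ?thesis using assms that unfolding rel_mon_def by blast
  qed
qed

lemma monI:
  assumes "m \<in> arrs"
    "\<And>a x y. x \<in> node_set (source_obj m) a \<Longrightarrow> y \<in> node_set (source_obj m) a \<Longrightarrow> component m a x = component m a y \<Longrightarrow> x = y"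
    "\<And>k s t. s \<in> node_set (source_obj m) (tail G k) \<Longrightarrow> t \<in> node_set (source_obj m) (head G k) \<Longrightarrow>
      (component m (tail G k) s, component m (head G k) t) \<in> edge_rel (target_obj m) k \<Longrightarrow> (s, t) \<in> edge_rel (source_obj m) k"
  shows "m \<in> rel_mon G"
  unfolding rel_mon_def using assms arrD(4)[OF assms(1)] by (auto simp: inj_on_def)

definition sub :: "('v, 'e, 'u) rel_object \<Rightarrow> ('v \<Rightarrow> 'u set) \<Rightarrow> ('v, 'e, 'u) rel_object" where
  "sub X B = \<lparr>node_set = B, edge_rel = (\<lambda>k. {(s, t) \<in> edge_rel X k. s \<in> B (tail G k) \<and> t \<in> B (head G k)})\<rparr>"

definition incl :: "('v, 'e, 'u) rel_object \<Rightarrow> ('v \<Rightarrow> 'u set) \<Rightarrow> ('v, 'e, 'u) rel_arrow" where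
  "incl X B = mk (sub X B) X (\<lambda>a x. x)"

text \<open>The subobject with extent \<open>B\<close>. By \<open>carrier_sub_of\<close> and
  \<open>sub_of_inj\<close> every subobject has exactly one extent, so subobjects become families of
  subsets, and pullback, image, joins and \<open>rel_dia\<close> become operations on these.\<close>

definition sub_of :: "('v, 'e, 'u) rel_object \<Rightarrow> ('v \<Rightarrow> 'u set) \<Rightarrow> ('v, 'e, 'u) rel_arrow set" where
  "sub_of X B = {n \<in> rel_mon G. target_obj n = X \<and> rel_image n = B}"

lemma sub_obj:
  assumes "X \<in> objs" "\<And>a. B a \<subseteq> node_set X a"
  shows "sub X B \<in> objs"
  by (rule objI) (use assms objD[OF assms(1)] in \<open>fastforce simp: sub_def\<close>)+

lemma incl:
  assumes "X \<in> objs" "\<And>a. B a \<subseteq> node_set X a"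
  shows "incl X B \<in> rel_mon G" "source_obj (incl X B) = sub X B" "target_obj (incl X B) = X" "rel_image (incl X B) = B"
    "incl X B \<in> sub_of X B" "x \<in> B a \<Longrightarrow> component (incl X B) a x = x"
proof -
  have 1: "incl X B \<in> arrs" unfolding incl_def
    using sub_obj[OF assms] assms by (intro mk_arr) (auto simp: sub_def)
  show m: "incl X B \<in> rel_mon G" by (rule monI[OF 1]) (auto simp: incl_def sub_def)
  show s: "source_obj (incl X B) = sub X B" "target_obj (incl X B) = X" by (simp_all add: incl_def)
  show i: "rel_image (incl X B) = B" by (rule ext) (auto simp: rel_image_def incl_def sub_def)
  show "incl X B \<in> sub_of X B" using m s i by (simp add: sub_of_def)
  show "component (incl X B) a x = x" if "x \<in> B a" using that by (simp add: incl_def sub_def)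
qed

lemma image_sub: "f \<in> arrs \<Longrightarrow> rel_image f a \<subseteq> node_set (target_obj f) a"
  unfolding rel_image_def using arrD(3) by blast

text \<open>Inclusion of images yields the factorisation pointwise; it preserves edges because
  \<open>n\<close> carries the induced relation and so reflects them.\<close>

lemma factors_iff:
  assumes "f \<in> arrs" "n \<in> rel_mon G" "target_obj f = target_obj n"
  shows "factors_through R f n \<longleftrightarrow> (\<forall>a. rel_image f a \<subseteq> rel_image n a)"
proof
  assume "factors_through R f n"
  then obtain h where h: "h \<in> arrs" "source_obj h = source_obj f" "target_obj h = source_obj n" "f = rel_comp n h"
    by (rule rel.factors_throughE) simp
  show "\<forall>a. rel_image f a \<subseteq> rel_image n a"
  proof (intro allI subsetI)
    fix a y assume "y \<in> rel_image f a"
    then obtain x where x: "x \<in> node_set (source_obj h) a" "y = component f a x" using h(2) by (auto simp: rel_image_def)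
    thus "y \<in> rel_image n a" using arrD(3)[OF h(1) x(1)] h(3) unfolding h(4) rel_image_def by simp
  qed
next
  assume im: "\<forall>a. rel_image f a \<subseteq> rel_image n a"
  note n = monD[OF assms(2)]
  define c where "c a x = (SOME z. z \<in> node_set (source_obj n) a \<and> component n a z = component f a x)" for a x
  have c: "c a x \<in> node_set (source_obj n) a \<and> component n a (c a x) = component f a x" if "x \<in> node_set (source_obj f) a" for a x
    unfolding c_def
  proof (rule someI_ex)
    have "component f a x \<in> rel_image n a" using im that unfolding rel_image_def by blast
    thus "\<exists>z. z \<in> node_set (source_obj n) a \<and> component n a z = component f a x" unfolding rel_image_def by auto
  qed
  let ?h = "mk (source_obj f) (source_obj n) c"
  have h: "?h \<in> arrs"
  proof (rule mk_arr)
    fix k s t assume st: "(s, t) \<in> edge_rel (source_obj f) k"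
    note st' = objD(3)[OF arrD(1)[OF assms(1)] st]
    show "(c (tail G k) s, c (head G k) t) \<in> edge_rel (source_obj n) k"
      by (rule n(3)) (use c st' arrD(4)[OF assms(1) st] assms(3) in auto)
  qed (use c arrD[OF assms(1)] arrD[OF n(1)] in auto)
  have "rel_comp n ?h = f"
    by (rule arr_ext) (use comp_closed[OF h n(1)] assms c in auto)
  thus "factors_through R f n" by (intro rel.factors_throughI[of ?h]) (use h in auto)
qed

text \<open>With \<open>perp_surj\<close>: \<open>MonPerp\<close> consists of the componentwise
  surjections, with no lifting of edges, which distinguishes it from \<open>rel_quo\<close>.
  Surjectivity makes the image of \<open>v\<close> agree with values of \<open>m\<close>, and
  \<open>factors_iff\<close> supplies the diagonal.\<close>

lemma surj_perp:
  assumes "e \<in> arrs" "\<And>a. node_set (target_obj e) a \<subseteq> rel_image e a"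
  shows "e \<in> MonPerp R"
  unfolding MonPerp_def orthogonal_def
proof (intro CollectI conjI ballI impI)
  fix m u v assume m: "m \<in> Mon R" and u: "u \<in> Hom R (Dom R e) (Dom R m)" and v: "v \<in> Hom R (Cod R e) (Cod R m)"
    and eq: "Comp R m u = Comp R v e"
  have m': "m \<in> rel_mon G" "m \<in> arrs" using m monD(1) by auto
  have u': "u \<in> arrs" "source_obj u = source_obj e" "target_obj u = source_obj m"
    and v': "v \<in> arrs" "source_obj v = target_obj e" "target_obj v = target_obj m" using u v by (auto simp: Hom_iff)
  have "\<forall>a. rel_image v a \<subseteq> rel_image m a"
  proof (intro allI subsetI)
    fix a y assume "y \<in> rel_image v a"
    then obtain x where x: "x \<in> node_set (target_obj e) a" "y = component v a x" using v'(2) by (auto simp: rel_image_def)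
    then obtain z where z: "z \<in> node_set (source_obj e) a" "x = component e a z" using assms(2)[of a] by (auto simp: rel_image_def)
    have "component m a (component u a z) = y"
      using arg_cong[OF eq, of "\<lambda>f. component f a z"] z x(2) u'(2) by simp
    thus "y \<in> rel_image m a" using arrD(3)[OF u'(1), of z a] z(1) u' unfolding rel_image_def by force
  qed
  hence "factors_through R v m" using factors_iff[OF v'(1) m'(1) v'(3)] by simp
  then obtain d where d0: "d \<in> arrs" "source_obj d = source_obj v" "target_obj d = source_obj m" "v = rel_comp m d"
    by (rule rel.factors_throughE) simp
  have d: "d \<in> arrs" "source_obj d = target_obj e" "target_obj d = source_obj m" "rel_comp m d = v"
    using d0(1,3) d0(2)[unfolded v'(2)] d0(4)[symmetric] by auto
  have inj: "f = g" if "f \<in> arrs" "g \<in> arrs" "source_obj f = source_obj g" "target_obj f = source_obj m"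
    "target_obj g = source_obj m" "rel_comp m f = rel_comp m g" for f g
  proof (rule arr_ext)
    fix a x assume x: "x \<in> node_set (source_obj f) a"
    have "component m a (component f a x) = component m a (component g a x)"
      using arg_cong[OF that(6), of "\<lambda>f. component f a x"] x that(3) by simp
    thus "component f a x = component g a x"
      using monD(2)[OF m'(1)] arrD(3)[OF that(1) x] arrD(3)[OF that(2), of x a] x that by simp
  qed (use that in auto)
  show "\<exists>!d. d \<in> Hom R (Cod R e) (Dom R m) \<and> Comp R d e = u \<and> Comp R m d = v"
  proof (rule ex1I[of _ d])
    have "rel_comp d e = u"
    proof (rule inj)
      show "rel_comp m (rel_comp d e) = rel_comp m u"
      proof -
        have "rel_comp m (rel_comp d e) = rel_comp (rel_comp m d) e"
          using rel.comp_assoc[of e d m, simplified] assms(1) d(1-3) m' by simp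
        thus ?thesis using eq d(4) by simp
      qed
    qed (use comp_closed[OF assms(1) d(1)] d u' v' in auto)
    thus "d \<in> Hom R (Cod R e) (Dom R m) \<and> Comp R d e = u \<and> Comp R m d = v"
      using d by (simp add: Hom_iff)
    fix d' assume "d' \<in> Hom R (Cod R e) (Dom R m) \<and> Comp R d' e = u \<and> Comp R m d' = v"
    hence d': "d' \<in> arrs" "source_obj d' = target_obj e" "target_obj d' = source_obj m" "rel_comp m d' = v"
      by (auto simp: Hom_iff)
    show "d' = d" by (rule inj) (use d d' in auto)
  qed
qed (use assms in simp)

lemma image_factorization:
  assumes "f \<in> arrs"
  obtains m e where "m \<in> rel_mon G" "e \<in> arrs" "target_obj e = source_obj m" "f = rel_comp m e"
    "rel_image m = rel_image f" "\<And>a. node_set (target_obj e) a \<subseteq> rel_image e a" "target_obj m = target_obj f"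
proof -
  note A = arrD[OF assms]
  note i = incl[OF A(2) image_sub[OF assms]]
  have "factors_through R f (incl (target_obj f) (rel_image f))"
    using factors_iff[OF assms i(1)] i(3,4) by simp
  then obtain e where e: "e \<in> arrs" "source_obj e = source_obj f" "target_obj e = source_obj (incl (target_obj f) (rel_image f))"
    "f = rel_comp (incl (target_obj f) (rel_image f)) e" by (rule rel.factors_throughE) simp
  have "node_set (target_obj e) a \<subseteq> rel_image e a" for a
  proof
    fix y assume "y \<in> node_set (target_obj e) a"
    hence "y \<in> rel_image f a" using e(3) i(2) by (simp add: sub_def)
    then obtain x where x: "x \<in> node_set (source_obj e) a" "y = component f a x" using e(2) by (auto simp: rel_image_def)
    have "component e a x \<in> rel_image f a" using arrD(3)[OF e(1) x(1)] e(3) i(2) by (simp add: sub_def)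
    hence "component (incl (target_obj f) (rel_image f)) a (component e a x) = component e a x" by (rule i(6))
    moreover have "component f a x = component (incl (target_obj f) (rel_image f)) a (component e a x)"
      using arg_cong[OF e(4), of "\<lambda>f. component f a x"] x(1) by simp
    ultimately show "y \<in> rel_image e a" using x unfolding rel_image_def by auto
  qed
  thus ?thesis using that[OF i(1) e(1,3,4) i(4) _ i(3)] by blast
qed

text \<open>Orthogonality is applied to the image inclusion of \<open>e\<close> itself, with the
  identity as lower side of the square: the diagonal is a section of the inclusion, so the image is
  everything.\<close>

lemma perp_surj:
  assumes "e \<in> MonPerp R"
  shows "e \<in> arrs" "node_set (target_obj e) a = rel_image e a"
proof -
  show e: "e \<in> arrs" using assms by (simp add: MonPerp_def)
  obtain m f where m: "m \<in> rel_mon G" "f \<in> arrs" "target_obj f = source_obj m" "e = rel_comp m f" "rel_image m = rel_image e"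
    "target_obj m = target_obj e" using image_factorization[OF e] by metis
  have sf: "source_obj f = source_obj e" using m(4) by (metis comp_simps(1))
  note T = arrD(2)[OF e]
  have "orthogonal R e m" using assms m(1) by (simp add: MonPerp_def)
  moreover have "f \<in> Hom R (Dom R e) (Dom R m)" "rel_ident (target_obj e) \<in> Hom R (Cod R e) (Cod R m)"
    using m sf ident_closed[OF T] by (auto simp: Hom_iff)
  moreover have "Comp R m f = Comp R (rel_ident (target_obj e)) e"
    using rel.ident_comp[of e "target_obj e"] e m(4) by simp
  ultimately obtain d where d: "d \<in> Hom R (Cod R e) (Dom R m)" "Comp R m d = rel_ident (target_obj e)"
    unfolding orthogonal_def by blast
  have "node_set (target_obj e) a \<subseteq> rel_image m a"
  proof
    fix y assume y: "y \<in> node_set (target_obj e) a"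
    have d': "d \<in> arrs" "source_obj d = target_obj e" "target_obj d = source_obj m" using d(1) by (auto simp: Hom_iff)
    have "component m a (component d a y) = y"
      using arg_cong[OF d(2), of "\<lambda>f. component f a y"] y d' by simp
    thus "y \<in> rel_image m a" using arrD(3)[OF d'(1), of y a] y d' unfolding rel_image_def by force
  qed
  thus "node_set (target_obj e) a = rel_image e a" using m(5) image_sub[OF e, of a] by auto
qed

lemma f_regular_R: "f_regular_category R"
proof (unfold_locales, goal_cases)
  case 1 show ?case by (rule has_finite_limits_R)
next
  case (2 m)
  hence m: "m \<in> rel_mon G" "m \<in> arrs" using monD(1) by auto
  show ?case unfolding is_mono_def
  proof (intro conjI ballI impI)
    fix T f g assume fg: "f \<in> Hom R T (Dom R m)" "g \<in> Hom R T (Dom R m)" "Comp R m f = Comp R m g"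
    hence f: "f \<in> arrs" "g \<in> arrs" "source_obj f = T" "source_obj g = T" "target_obj f = source_obj m" "target_obj g = source_obj m"
      by (auto simp: Hom_iff)
    show "f = g"
    proof (rule arr_ext)
      fix a x assume x: "x \<in> node_set (source_obj f) a"
      have "component m a (component f a x) = component m a (component g a x)"
        using arg_cong[OF fg(3), of "\<lambda>f. component f a x"] x f by simp
      thus "component f a x = component g a x"
        using monD(2)[OF m(1)] arrD(3)[OF f(1) x] arrD(3)[OF f(2), of x a] x f by simp
    qed (use f in auto)
  qed (use m in simp)
next
  case (3 m)
  then obtain g where g: "m \<in> arrs" "g \<in> arrs" "source_obj g = target_obj m" "target_obj g = source_obj m"
    "rel_comp g m = rel_ident (source_obj m)" by (auto simp: is_iso_def Hom_iff)
  have gm: "component g a (component m a x) = x" if "x \<in> node_set (source_obj m) a" for a x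
    using arg_cong[OF g(5), of "\<lambda>f. component f a x"] that by simp
  have "m \<in> rel_mon G"
  proof (rule monI[OF g(1)])
    show "x = y" if "x \<in> node_set (source_obj m) a" "y \<in> node_set (source_obj m) a" "component m a x = component m a y" for a x y
    proof -
      have "x = component g a (component m a x)" using gm[OF that(1)] ..
      also have "\<dots> = y" unfolding that(3) by (rule gm[OF that(2)])
      finally show ?thesis .
    qed
    show "(s, t) \<in> edge_rel (source_obj m) k" if "s \<in> node_set (source_obj m) (tail G k)" "t \<in> node_set (source_obj m) (head G k)"
      "(component m (tail G k) s, component m (head G k) t) \<in> edge_rel (target_obj m) k" for k s t
    proof -
      have "(component g (tail G k) (component m (tail G k) s), component g (head G k) (component m (head G k) t))
        \<in> edge_rel (target_obj g) k"
        by (rule arrD(4)[OF g(2)]) (simp add: g(3) that(3))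
      thus ?thesis unfolding gm[OF that(1)] gm[OF that(2)] g(4) .
    qed
  qed
  thus ?case by simp
next
  case (4 m)
  then obtain f g where e: "is_equalizer R f g m" by (auto simp: is_regular_mono_def)
  note D = rel.is_equalizerD[OF e, simplified]
  have "m \<in> rel_mon G"
  proof (rule monI[OF D(3)])
    show inj: "x = y" if "x \<in> node_set (source_obj m) a" "y \<in> node_set (source_obj m) a" "component m a x = component m a y" for a x y
      using mono_inj[OF rel.is_equalizer_mono[OF e]] that by blast
    have fg: "component f a (component m a x) = component g a (component m a x)" if "x \<in> node_set (source_obj m) a" for a x
      using arg_cong[OF D(7), of "\<lambda>f. component f a x"] that by simp
    show "(s, t) \<in> edge_rel (source_obj m) k" if st: "s \<in> node_set (source_obj m) (tail G k)" "t \<in> node_set (source_obj m) (head G k)"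
      "(component m (tail G k) s, component m (head G k) t) \<in> edge_rel (target_obj m) k" for k s t
    proof -
      \<comment> \<open>A related pair in the target is an arrow from the generic edge. As its ends
        come from the equaliser, this arrow equalises \<open>f\<close> and \<open>g\<close>, so it
        factors through \<open>m\<close> and the pair is already related in the source.\<close>
      let ?x = "ed_arr k (target_obj m) (component m (tail G k) s) (component m (head G k) t)"
      have x: "?x \<in> arrs" using ed_arr st(3) arrD(2)[OF D(3)] by simp
      have e2: "(component m (tail G k) s, component m (head G k) t) \<in> edge_rel (source_obj f) k"
        "(component m (tail G k) s, component m (head G k) t) \<in> edge_rel (source_obj g) k" using st(3) D by auto
      have "rel_comp f ?x = rel_comp g ?x"
        using arr_comp_ed[OF D(1) e2(1)] arr_comp_ed[OF D(2) e2(2)] D(4-6) fg[OF st(1)] fg[OF st(2)] by simp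
      then obtain h where h: "h \<in> arrs" "source_obj h = edg k" "target_obj h = source_obj m" "rel_comp m h = ?x"
        using rel.is_equalizer_fill[OF e, simplified, OF x] D(6) by auto
      have u: "u0 \<in> node_set (source_obj h) (tail G k)" "u1 \<in> node_set (source_obj h) (head G k)" using h(2) by simp_all
      have "component m (tail G k) (component h (tail G k) u0) = component m (tail G k) s"
        "component m (head G k) (component h (head G k) u1) = component m (head G k) t"
        using arg_cong[OF h(4), of "\<lambda>f. component f (tail G k) u0"] arg_cong[OF h(4), of "\<lambda>f. component f (head G k) u1"] u by simp_all
      hence "component h (tail G k) u0 = s" "component h (head G k) u1 = t"
        using inj st arrD(3)[OF h(1) u(1)] arrD(3)[OF h(1) u(2)] h(3) by simp_all
      thus ?thesis using arrD(4)[OF h(1), of u0 u1 k] h(2,3) by simp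
    qed
  qed
  thus ?case by simp
next
  case (5 m n)
  hence m: "m \<in> rel_mon G" "n \<in> rel_mon G" "target_obj n = source_obj m" by auto
  note M = monD[OF m(1)] and N = monD[OF m(2)]
  have "rel_comp m n \<in> rel_mon G"
  proof (rule monI)
    show "rel_comp m n \<in> arrs" using comp_closed M N m by simp
    show "x = y" if "x \<in> node_set (source_obj (rel_comp m n)) a" "y \<in> node_set (source_obj (rel_comp m n)) a"
      "component (rel_comp m n) a x = component (rel_comp m n) a y" for a x y
      using that N(2)[of x a y] M(2)[of "component n a x" a "component n a y"] arrD(3)[OF N(1)] m(3) by simp
    show "(s, t) \<in> edge_rel (source_obj (rel_comp m n)) k"
      if "s \<in> node_set (source_obj (rel_comp m n)) (tail G k)" "t \<in> node_set (source_obj (rel_comp m n)) (head G k)"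
      "(component (rel_comp m n) (tail G k) s, component (rel_comp m n) (head G k) t) \<in> edge_rel (target_obj (rel_comp m n)) k" for k s t
      using that N(3)[of s k t] M(3)[of "component n (tail G k) s" k "component n (head G k) t"] arrD(3)[OF N(1)] m(3) by simp
  qed
  thus ?case by simp
next
  case (6 f m m' f')
  note p = 6(1) and D = rel.is_pullbackD[OF 6(1), simplified]
  have m: "m \<in> rel_mon G" using 6(2) by simp
  note M = monD[OF m]
  have c: "component f a (component m' a x) = component m a (component f' a x)" if "x \<in> node_set (source_obj m') a" for a x
    using arg_cong[OF D(9), of "\<lambda>f. component f a x"] that D(6) by simp
  have f': "component f' a x \<in> node_set (source_obj m) a" if "x \<in> node_set (source_obj m') a" for a x
    using arrD(3)[OF D(4), of x a] that D(6,8) by simp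
  have "m' \<in> rel_mon G"
  proof (rule monI[OF D(3)])
    show "x = y" if "x \<in> node_set (source_obj m') a" "y \<in> node_set (source_obj m') a" "component m' a x = component m' a y" for a x y
    proof -
      have "component m a (component f' a x) = component m a (component f' a y)"
        unfolding c[OF that(1), symmetric] c[OF that(2), symmetric] that(3) ..
      hence "component f' a x = component f' a y" by (rule M(2)[OF f'[OF that(1)] f'[OF that(2)]])
      thus ?thesis by (rule pullback_unique[OF p that])
    qed
    show "(s, t) \<in> edge_rel (source_obj m') k" if st: "s \<in> node_set (source_obj m') (tail G k)" "t \<in> node_set (source_obj m') (head G k)"
      "(component m' (tail G k) s, component m' (head G k) t) \<in> edge_rel (target_obj m') k" for k s t
    proof (rule pullback_edge[OF p st(1,2)])
      show e: "(component m' (tail G k) s, component m' (head G k) t) \<in> edge_rel (source_obj f) k" using st(3) D(7) by simp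
      show "(component f' (tail G k) s, component f' (head G k) t) \<in> edge_rel (source_obj m) k"
        by (rule M(3)[OF f'[OF st(1)] f'[OF st(2)]])
          (use arrD(4)[OF D(1) e] c[OF st(1)] c[OF st(2)] D(5) in simp)
    qed
  qed
  thus ?case by simp
next
  case (7 f)
  hence f: "f \<in> arrs" by simp
  obtain m e where "m \<in> rel_mon G" "e \<in> arrs" "target_obj e = source_obj m" "f = rel_comp m e"
    "\<And>a. node_set (target_obj e) a \<subseteq> rel_image e a" using image_factorization[OF f] by metis
  thus ?case using surj_perp[of e] by auto
next
  case (8 f e e' f')
  note p = 8(1) and D = rel.is_pullbackD[OF 8(1), simplified] and s = perp_surj[OF 8(2)]
  show ?case
  proof (rule surj_perp[OF D(3)], rule subsetI)
    fix a y assume "y \<in> node_set (target_obj e') a"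
    hence y: "y \<in> node_set (source_obj f) a" using D(7) by simp
    have "component f a y \<in> rel_image e a" using arrD(3)[OF D(1) y] D(5) s(2) by simp
    then obtain x where "x \<in> node_set (source_obj e) a" "component f a y = component e a x" by (auto simp: rel_image_def)
    from pullback_point[OF p y this] show "y \<in> rel_image e' a" unfolding rel_image_def by force
  qed
qed

sublocale rel: f_regular_category R by (rule f_regular_R)

lemma subobj_eq: "m \<in> rel_mon G \<Longrightarrow> subobj R m = sub_of (target_obj m) (rel_image m)"
proof (rule Set.set_eqI)
  fix n :: "('v, 'e, 'u) rel_arrow" assume m: "m \<in> rel_mon G"
  have im: "(\<forall>a. rel_image m a \<subseteq> rel_image n a) \<and> (\<forall>a. rel_image n a \<subseteq> rel_image m a) \<longleftrightarrow> rel_image n = rel_image m"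
    unfolding fun_eq_iff Set.set_eq_subset by blast
  show "n \<in> subobj R m \<longleftrightarrow> n \<in> sub_of (target_obj m) (rel_image m)"
  proof (cases "n \<in> rel_mon G \<and> target_obj n = target_obj m")
    case True
    hence "factors_through R m n \<and> factors_through R n m \<longleftrightarrow> rel_image n = rel_image m"
      using factors_iff[OF monD(1)[OF m], of n] factors_iff[OF monD(1) m, of n] im by simp
    thus ?thesis unfolding rel.subobj_mem sub_of_def using True m by simp
  qed (auto simp: rel.subobj_mem sub_of_def)
qed

lemma sub_of_closed: "X \<in> objs \<Longrightarrow> (\<And>a. B a \<subseteq> node_set X a) \<Longrightarrow> sub_of X B \<in> carrier (Sub R X)"
  using incl[of X B] subobj_eq[of "incl X B"] rel.subobj_closed[of "incl X B" X] by simp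

lemma carrier_sub_of:
  assumes "S \<in> carrier (Sub R X)"
  obtains B where "S = sub_of X B" "\<And>a. B a \<subseteq> node_set X a"
proof -
  obtain m where m: "m \<in> rel_mon G" "target_obj m = X" "S = subobj R m" using assms by (rule rel.carrierE) simp
  thus ?thesis using that[of "rel_image m"] subobj_eq[of m] image_sub monD(1)[OF m(1)] by blast
qed

lemma lies_in_sub_of:
  assumes "X \<in> objs" "\<And>a. B a \<subseteq> node_set X a" "f \<in> arrs" "target_obj f = X"
  shows "lies_in R f (sub_of X B) \<longleftrightarrow> (\<forall>a. rel_image f a \<subseteq> B a)"
  using incl[OF assms(1,2)] subobj_eq[of "incl X B"] rel.lies_in_subobj[of "incl X B" f] factors_iff[OF assms(3), of "incl X B"] assms(4)
  by simp

lemma sub_of_le: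
  assumes "X \<in> objs" "\<And>a. B a \<subseteq> node_set X a" "\<And>a. B' a \<subseteq> node_set X a"
  shows "sub_of X B \<sqsubseteq>\<^bsub>Sub R X\<^esub> sub_of X B' \<longleftrightarrow> (\<forall>a. B a \<subseteq> B' a)"
  using rel.Sub_le[OF sub_of_closed[OF assms(1,2)] sub_of_closed[OF assms(1,3)] incl(5)[OF assms(1,2)]]
    lies_in_sub_of[OF assms(1,3), of "incl X B"] incl[OF assms(1,2)] monD(1) by simp

lemma sub_of_inj:
  assumes "X \<in> objs" "\<And>a. B a \<subseteq> node_set X a" "\<And>a. B' a \<subseteq> node_set X a"
  shows "sub_of X B = sub_of X B' \<longleftrightarrow> B = B'"
proof
  assume e: "sub_of X B = sub_of X B'"
  note r = rel.Sub_refl[OF sub_of_closed[OF assms(1,2)]]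
  have "\<forall>a. B a \<subseteq> B' a" using sub_of_le[OF assms] r e by simp
  moreover have "\<forall>a. B' a \<subseteq> B a" using sub_of_le[OF assms(1,3,2)] r e by simp
  ultimately show "B = B'" unfolding fun_eq_iff Set.set_eq_subset by blast
qed simp

lemma extent_sub_of:
  assumes "X \<in> objs" "\<And>a. B a \<subseteq> node_set X a"
  shows "rel_extent (sub_of X B) = B"
  using incl(4,5)[OF assms] by (auto simp: rel_extent_def sub_of_def fun_eq_iff)

lemma image_comp_eq:
  assumes "g \<in> arrs"
  shows "rel_image (rel_comp f g) a = component f a ` rel_image g a"
  unfolding rel_image_def by (auto simp: image_iff)

lemma pb_sub_of:
  assumes "f \<in> arrs" "source_obj f = X" "target_obj f = Y" "\<And>a. B a \<subseteq> node_set Y a"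
  shows "pb R f (sub_of Y B) = sub_of X (\<lambda>a. {x \<in> node_set X a. component f a x \<in> B a})"
proof (rule rel.Sub_eqI)
  have o: "X \<in> objs" "Y \<in> objs" using arrD[OF assms(1)] assms(2,3) by auto
  have c: "sub_of Y B \<in> carrier (Sub R (Cod R f))" using sub_of_closed[OF o(2) assms(4)] assms(3) by simp
  show "pb R f (sub_of Y B) \<in> carrier (Sub R X)" using rel.pb_closed[OF _ c] assms by simp
  show "sub_of X (\<lambda>a. {x \<in> node_set X a. component f a x \<in> B a}) \<in> carrier (Sub R X)"
    using o by (intro sub_of_closed) auto
  fix g assume g: "g \<in> Arr R" "Cod R g = X"
  have fg: "rel_comp f g \<in> arrs" using comp_closed g assms by simp
  have "lies_in R g (pb R f (sub_of Y B)) \<longleftrightarrow> (\<forall>a. rel_image (rel_comp f g) a \<subseteq> B a)"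
    using rel.lies_in_pb[OF _ c, of g] g assms lies_in_sub_of[OF o(2) assms(4) fg] by simp
  also have "\<dots> \<longleftrightarrow> (\<forall>a. rel_image g a \<subseteq> {x \<in> node_set X a. component f a x \<in> B a})"
  proof -
    have "rel_image g a \<subseteq> node_set X a" for a using image_sub[of g a] g by simp
    thus ?thesis using image_comp_eq[of g f] g(1) by (simp add: image_subset_iff subset_iff) blast
  qed
  also have "\<dots> \<longleftrightarrow> lies_in R g (sub_of X (\<lambda>a. {x \<in> node_set X a. component f a x \<in> B a}))"
    using g by (intro lies_in_sub_of[OF o(1), symmetric]) auto
  finally show "lies_in R g (pb R f (sub_of Y B)) \<longleftrightarrow> lies_in R g (sub_of X (\<lambda>a. {x \<in> node_set X a. component f a x \<in> B a}))" .
qed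

lemma img_sub_of:
  assumes "f \<in> arrs"
  shows "rel.img f = sub_of (target_obj f) (rel_image f)"
proof -
  obtain m e where m: "m \<in> rel_mon G" "e \<in> MonPerp R" "target_obj e = source_obj m" "f = rel_comp m e" "rel.img f = subobj R m"
    by (rule rel.imgE[of f]) (use assms in auto)
  note e = perp_surj[OF m(2)]
  have "rel_image m = rel_image f"
  proof
    fix a
    have "rel_image f a = component m a ` node_set (source_obj m) a" using image_comp_eq[OF e(1), of m] e(2) m(3,4) by simp
    thus "rel_image m a = rel_image f a" by (simp add: rel_image_def)
  qed
  thus ?thesis using m subobj_eq[OF m(1)] by (metis comp_simps(2))
qed

lemma exists_sub_of:
  assumes "f \<in> arrs" "source_obj f = X" "target_obj f = Y" "\<And>a. B a \<subseteq> node_set X a"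
  shows "exists_along R f (sub_of X B) = sub_of Y (\<lambda>a. component f a ` B a)"
proof -
  have X: "X \<in> objs" using arrD[OF assms(1)] assms(2) by simp
  note i = incl[OF X assms(4)]
  have "exists_along R f (subobj R (incl X B)) = rel.img (rel_comp f (incl X B))"
    using rel.exists_along_eq[of f "incl X B"] assms i by simp
  also have "\<dots> = sub_of Y (\<lambda>a. component f a ` B a)"
  proof -
    have "rel_image (rel_comp f (incl X B)) = (\<lambda>a. component f a ` B a)"
      using image_comp_eq[OF monD(1)[OF i(1)], of f] i(4) by (simp add: fun_eq_iff)
    thus ?thesis using img_sub_of[OF comp_closed[OF monD(1)[OF i(1)] assms(1)]] i(3) assms(2,3) by simp
  qed
  finally show ?thesis using subobj_eq[OF i(1)] i(3,4) by simp
qed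

lemma lub_sub_of:
  assumes "X \<in> objs" "\<And>a. B a \<subseteq> node_set X a" "\<And>T a. T \<in> \<B> \<Longrightarrow> T a \<subseteq> node_set X a"
  shows "is_lub (Sub R X) (sub_of X B) (sub_of X ` \<B>) \<longleftrightarrow> B = (\<lambda>a. \<Union>T \<in> \<B>. T a)"
proof -
  have c: "sub_of X ` \<B> \<subseteq> carrier (Sub R X)" using sub_of_closed[OF assms(1)] assms(3) by auto
  let ?U = "\<lambda>a. \<Union>T \<in> \<B>. T a"
  have U: "?U a \<subseteq> node_set X a" for a using assms(3) by blast
  have cl: "sub_of X B \<in> carrier (Sub R X)" "sub_of X ?U \<in> carrier (Sub R X)" using sub_of_closed[OF assms(1)] assms(2) U by auto
  show ?thesis unfolding rel.is_lub_Sub[OF c]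
  proof safe
    assume ub: "\<forall>T \<in> sub_of X ` \<B>. T \<sqsubseteq>\<^bsub>Sub R X\<^esub> sub_of X B"
      and least: "\<forall>V \<in> carrier (Sub R X). (\<forall>T \<in> sub_of X ` \<B>. T \<sqsubseteq>\<^bsub>Sub R X\<^esub> V) \<longrightarrow> sub_of X B \<sqsubseteq>\<^bsub>Sub R X\<^esub> V"
    have 1: "T a \<subseteq> B a" if "T \<in> \<B>" for T a using ub that sub_of_le[OF assms(1) assms(3)[OF that] assms(2)] by blast
    have "T \<sqsubseteq>\<^bsub>Sub R X\<^esub> sub_of X ?U" if T: "T \<in> sub_of X ` \<B>" for T
    proof -
      obtain D where D: "D \<in> \<B>" "T = sub_of X D" using T by blast
      show ?thesis unfolding D(2) sub_of_le[OF assms(1) assms(3)[OF D(1)] U] using D(1) by blast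
    qed
    hence "sub_of X B \<sqsubseteq>\<^bsub>Sub R X\<^esub> sub_of X ?U" using least cl(2) by blast
    hence "\<forall>a. B a \<subseteq> ?U a" using sub_of_le[OF assms(1,2) U] by blast
    with 1 show "B = ?U" by (auto simp: fun_eq_iff)
  next
    assume B: "B = ?U"
    show "sub_of X ?U \<in> carrier (Sub R X)" by (rule cl)
    show "sub_of X T \<sqsubseteq>\<^bsub>Sub R X\<^esub> sub_of X ?U" if "T \<in> \<B>" for T
      using that sub_of_le[OF assms(1) assms(3)[OF that] U] by auto
    show "sub_of X ?U \<sqsubseteq>\<^bsub>Sub R X\<^esub> V" if V: "V \<in> carrier (Sub R X)" "\<forall>T \<in> sub_of X ` \<B>. T \<sqsubseteq>\<^bsub>Sub R X\<^esub> V" for V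
    proof -
      obtain D where D: "V = sub_of X D" "\<And>a. D a \<subseteq> node_set X a" using V(1) by (rule carrier_sub_of) (rule that)
      have "T a \<subseteq> D a" if "T \<in> \<B>" for T a using V(2) that sub_of_le[OF assms(1) assms(3)[OF that] D(2)] unfolding D(1) by blast
      thus ?thesis unfolding D(1) sub_of_le[OF assms(1) U D(2)] by blast
    qed
  qed
qed

lemma carrier_family:
  assumes "A \<subseteq> carrier (Sub R X)"
  obtains \<B> where "A = sub_of X ` \<B>" "\<And>T a. T \<in> \<B> \<Longrightarrow> T a \<subseteq> node_set X a"
proof (rule that[of "{B. (\<forall>a. B a \<subseteq> node_set X a) \<and> sub_of X B \<in> A}"])
  show "A = sub_of X ` {B. (\<forall>a. B a \<subseteq> node_set X a) \<and> sub_of X B \<in> A}"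
  proof safe
    fix T assume T: "T \<in> A"
    hence "T \<in> carrier (Sub R X)" using assms by blast
    then obtain B where "T = sub_of X B" "\<And>a. B a \<subseteq> node_set X a" by (rule carrier_sub_of) (rule that)
    thus "T \<in> sub_of X ` {B. (\<forall>a. B a \<subseteq> node_set X a) \<and> sub_of X B \<in> A}" using T by blast
  qed
qed blast

lemma preserves_joins:
  assumes "X \<in> objs" "Y \<in> objs" "\<And>B. (\<And>a. B a \<subseteq> node_set X a) \<Longrightarrow> h (sub_of X B) = sub_of Y (H B)"
    "\<And>B a. (\<And>a. B a \<subseteq> node_set X a) \<Longrightarrow> H B a \<subseteq> node_set Y a"
    "\<And>\<B> a. H (\<lambda>a. \<Union>T \<in> \<B>. T a) a = (\<Union>T \<in> \<B>. H T a)"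
  shows "preserves_finite_joins (Sub R X) (Sub R Y) h"
  unfolding preserves_finite_joins_def
proof (intro allI impI)
  fix A S assume A: "finite A \<and> A \<subseteq> carrier (Sub R X) \<and> is_lub (Sub R X) S A"
  obtain \<B> where AB: "A = sub_of X ` \<B>" and \<B>: "\<And>T a. T \<in> \<B> \<Longrightarrow> T a \<subseteq> node_set X a"
    using carrier_family[of A X] A by blast
  have "S \<in> carrier (Sub R X)" using A rel.is_lub_Sub[of A X S] by blast
  then obtain B where B: "S = sub_of X B" "\<And>a. B a \<subseteq> node_set X a" by (rule carrier_sub_of) (rule that)
  have Beq: "B = (\<lambda>a. \<Union>T \<in> \<B>. T a)" using A lub_sub_of[of X B \<B>] assms(1) B(2) \<B> unfolding AB B(1) by simp
  have "h ` A = sub_of Y ` (H ` \<B>)" unfolding AB image_image using assms(3) \<B> by (intro image_cong) auto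
  moreover have "h S = sub_of Y (H B)" unfolding B(1) using assms(3) B(2) by blast
  moreover have "is_lub (Sub R Y) (sub_of Y (H B)) (sub_of Y ` (H ` \<B>))"
  proof -
    have HT: "T a \<subseteq> node_set Y a" if T: "T \<in> H ` \<B>" for T a
    proof -
      obtain D where D: "D \<in> \<B>" "T = H D" using T by blast
      have "D a \<subseteq> node_set X a" for a by (rule \<B>[OF D(1)])
      from assms(4)[of D a, OF this] show ?thesis unfolding D(2) .
    qed
    have HB: "H B a \<subseteq> node_set Y a" for a using assms(4) B(2) by blast
    have "H B = (\<lambda>a. \<Union>T \<in> H ` \<B>. T a)" unfolding Beq using assms(5)[of \<B>] by (simp add: fun_eq_iff)
    thus ?thesis using lub_sub_of[of Y "H B" "H ` \<B>"] assms(2) HT HB by blast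
  qed
  ultimately show "is_lub (Sub R Y) (h S) (h ` A)" by simp
qed

end

section \<open>Lattices of subobjects as families of sets\<close>

context relational
begin

lemma lub_carrier:
  assumes "X \<in> objs" "A \<subseteq> carrier (Sub R X)"
  shows "\<exists>S. is_lub (Sub R X) S A"
proof -
  obtain \<B> where \<B>: "A = sub_of X ` \<B>" "\<And>T a. T \<in> \<B> \<Longrightarrow> T a \<subseteq> node_set X a"
    using assms(2) by (rule carrier_family) (rule that)
  have "is_lub (Sub R X) (sub_of X (\<lambda>a. \<Union>T \<in> \<B>. T a)) (sub_of X ` \<B>)"
    by (subst lub_sub_of[OF assms(1)]) (use \<B>(2) in auto)
  thus ?thesis using \<B>(1) by blast
qed

lemma f_coherent_R: "f_coherent_category R"
proof (unfold_locales, goal_cases)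
  case (1 X A)
  thus ?case using lub_carrier by simp
next
  case (2 f)
  hence f: "f \<in> arrs" by simp
  have "preserves_finite_joins (Sub R (target_obj f)) (Sub R (source_obj f)) (pb R f)"
    by (rule preserves_joins[where H = "\<lambda>B a. {x \<in> node_set (source_obj f) a. component f a x \<in> B a}"])
      (use f arrD in \<open>auto simp: pb_sub_of\<close>)
  thus ?case by simp
qed

sublocale rel: f_coherent_category R by (rule f_coherent_R)

lemma partial_order_Sub: "X \<in> objs \<Longrightarrow> partial_order (Sub R X)"
proof unfold_locales
  assume X: "X \<in> objs"
  show "x .=\<^bsub>Sub R X\<^esub> x" for x by (simp add: Sub_def)
  show "y .=\<^bsub>Sub R X\<^esub> x" if "x .=\<^bsub>Sub R X\<^esub> y" for x y using that by (simp add: Sub_def)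
  show "x .=\<^bsub>Sub R X\<^esub> z" if "x .=\<^bsub>Sub R X\<^esub> y" "y .=\<^bsub>Sub R X\<^esub> z" for x y z using that by (simp add: Sub_def)
  show "x \<sqsubseteq>\<^bsub>Sub R X\<^esub> x" if "x \<in> carrier (Sub R X)" for x using rel.Sub_refl[OF that] .
  show "x .=\<^bsub>Sub R X\<^esub> y" if "x \<sqsubseteq>\<^bsub>Sub R X\<^esub> y" "y \<sqsubseteq>\<^bsub>Sub R X\<^esub> x" "x \<in> carrier (Sub R X)" "y \<in> carrier (Sub R X)" for x y
    using rel.Sub_antisym[OF that(3,4,1,2)] by (simp add: Sub_def)
  show "x \<sqsubseteq>\<^bsub>Sub R X\<^esub> z" if "x \<sqsubseteq>\<^bsub>Sub R X\<^esub> y" "y \<sqsubseteq>\<^bsub>Sub R X\<^esub> z" "x \<in> carrier (Sub R X)" "y \<in> carrier (Sub R X)"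
    "z \<in> carrier (Sub R X)" for x y z using rel.Sub_trans[OF that] .
  show "x \<sqsubseteq>\<^bsub>Sub R X\<^esub> z \<longleftrightarrow> y \<sqsubseteq>\<^bsub>Sub R X\<^esub> w" if "x .=\<^bsub>Sub R X\<^esub> y" "z .=\<^bsub>Sub R X\<^esub> w" for x y z w
    using that by (simp add: Sub_def)
  show "(.=\<^bsub>Sub R X\<^esub>) = (=)" by (simp add: Sub_def)
qed

lemma lub_union:
  assumes "X \<in> objs" "\<And>a. B a \<subseteq> node_set X a" "\<And>a. B' a \<subseteq> node_set X a"
  shows "is_lub (Sub R X) (sub_of X (\<lambda>a. B a \<union> B' a)) {sub_of X B, sub_of X B'}"
proof -
  have "is_lub (Sub R X) (sub_of X (\<lambda>a. B a \<union> B' a)) (sub_of X ` {B, B'})"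
    by (subst lub_sub_of[OF assms(1)]) (use assms(2,3) in auto)
  thus ?thesis by simp
qed

lemma glb_inter:
  assumes "X \<in> objs" "\<And>a. B a \<subseteq> node_set X a" "\<And>a. B' a \<subseteq> node_set X a"
  shows "is_glb (Sub R X) (sub_of X (\<lambda>a. B a \<inter> B' a)) {sub_of X B, sub_of X B'}"
proof -
  have i: "B a \<inter> B' a \<subseteq> node_set X a" for a using assms(2) by blast
  have c: "sub_of X B \<in> carrier (Sub R X)" "sub_of X B' \<in> carrier (Sub R X)" "sub_of X (\<lambda>a. B a \<inter> B' a) \<in> carrier (Sub R X)"
    using sub_of_closed[OF assms(1)] assms(2,3) i by auto
  have "V \<sqsubseteq>\<^bsub>Sub R X\<^esub> sub_of X (\<lambda>a. B a \<inter> B' a)"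
    if V: "V \<in> carrier (Sub R X)" "V \<sqsubseteq>\<^bsub>Sub R X\<^esub> sub_of X B" "V \<sqsubseteq>\<^bsub>Sub R X\<^esub> sub_of X B'" for V
  proof -
    obtain D where D: "V = sub_of X D" "\<And>a. D a \<subseteq> node_set X a" using V(1) by (rule carrier_sub_of) (rule that)
    show ?thesis using V(2,3) unfolding D(1) sub_of_le[OF assms(1) D(2) i] sub_of_le[OF assms(1) D(2) assms(2)]
      sub_of_le[OF assms(1) D(2) assms(3)] by blast
  qed
  moreover have "sub_of X (\<lambda>a. B a \<inter> B' a) \<sqsubseteq>\<^bsub>Sub R X\<^esub> sub_of X B" "sub_of X (\<lambda>a. B a \<inter> B' a) \<sqsubseteq>\<^bsub>Sub R X\<^esub> sub_of X B'"
    unfolding sub_of_le[OF assms(1) i assms(2)] sub_of_le[OF assms(1) i assms(3)] by blast+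
  ultimately show ?thesis using c unfolding greatest_def Lower_def by auto
qed

lemma top_sub_of: "X \<in> objs \<Longrightarrow> greatest (Sub R X) (sub_of X (node_set X)) (carrier (Sub R X))"
  unfolding greatest_def
proof (intro conjI ballI)
  assume X: "X \<in> objs"
  show "sub_of X (node_set X) \<in> carrier (Sub R X)" using sub_of_closed[OF X] by simp
  fix V assume "V \<in> carrier (Sub R X)"
  then obtain D where D: "V = sub_of X D" "\<And>a. D a \<subseteq> node_set X a" by (rule carrier_sub_of) (rule that)
  show "V \<sqsubseteq>\<^bsub>Sub R X\<^esub> sub_of X (node_set X)" unfolding D(1) using sub_of_le[OF X D(2)] D(2) by simp
qed simp

lemma bottom_sub_of: "X \<in> objs \<Longrightarrow> least (Sub R X) (sub_of X (\<lambda>a. {})) (carrier (Sub R X))"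
  unfolding least_def
proof (intro conjI ballI)
  assume X: "X \<in> objs"
  show "sub_of X (\<lambda>a. {}) \<in> carrier (Sub R X)" using sub_of_closed[OF X] by simp
  fix V assume "V \<in> carrier (Sub R X)"
  then obtain D where D: "V = sub_of X D" "\<And>a. D a \<subseteq> node_set X a" by (rule carrier_sub_of) (rule that)
  show "sub_of X (\<lambda>a. {}) \<sqsubseteq>\<^bsub>Sub R X\<^esub> V" unfolding D(1) using sub_of_le[OF X _ D(2)] by simp
qed simp

lemma lattice_ops:
  assumes "X \<in> objs"
  shows "(\<And>a. B a \<subseteq> node_set X a) \<Longrightarrow> (\<And>a. B' a \<subseteq> node_set X a) \<Longrightarrow>
      sub_of X B \<squnion>\<^bsub>Sub R X\<^esub> sub_of X B' = sub_of X (\<lambda>a. B a \<union> B' a)"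
    "(\<And>a. B a \<subseteq> node_set X a) \<Longrightarrow> (\<And>a. B' a \<subseteq> node_set X a) \<Longrightarrow>
      sub_of X B \<sqinter>\<^bsub>Sub R X\<^esub> sub_of X B' = sub_of X (\<lambda>a. B a \<inter> B' a)"
    "\<top>\<^bsub>Sub R X\<^esub> = sub_of X (node_set X)" "\<bottom>\<^bsub>Sub R X\<^esub> = sub_of X (\<lambda>a. {})"
proof -
  interpret P: partial_order "Sub R X" using partial_order_Sub[OF assms] .
  show "sub_of X B \<squnion>\<^bsub>Sub R X\<^esub> sub_of X B' = sub_of X (\<lambda>a. B a \<union> B' a)"
    if "\<And>a. B a \<subseteq> node_set X a" "\<And>a. B' a \<subseteq> node_set X a"
    unfolding join_def sup_def
    by (rule some_equality) (use lub_union[OF assms that] P.least_unique in blast)+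
  show "sub_of X B \<sqinter>\<^bsub>Sub R X\<^esub> sub_of X B' = sub_of X (\<lambda>a. B a \<inter> B' a)"
    if "\<And>a. B a \<subseteq> node_set X a" "\<And>a. B' a \<subseteq> node_set X a"
    unfolding meet_def inf_def
    by (rule some_equality) (use glb_inter[OF assms that] P.greatest_unique in blast)+
  show "\<top>\<^bsub>Sub R X\<^esub> = sub_of X (node_set X)" unfolding top_def
    by (rule some_equality) (use top_sub_of[OF assms] P.greatest_unique in blast)+
  show "\<bottom>\<^bsub>Sub R X\<^esub> = sub_of X (\<lambda>a. {})" unfolding bottom_def
    by (rule some_equality) (use bottom_sub_of[OF assms] P.least_unique in blast)+
qed

lemma complement_sub_of:
  assumes "X \<in> objs" "\<And>a. B a \<union> B' a = node_set X a" "\<And>a. B a \<inter> B' a = {}"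
  shows "is_complement (Sub R X) (sub_of X B) (sub_of X B')"
proof -
  have b: "B a \<subseteq> node_set X a" "B' a \<subseteq> node_set X a" for a using assms(2) by blast+
  have "(\<lambda>a. B a \<union> B' a) = node_set X" "(\<lambda>a. B a \<inter> B' a) = (\<lambda>a. {})" using assms(2,3) by (simp_all add: fun_eq_iff)
  thus ?thesis unfolding is_complement_def
    using lattice_ops(1)[OF assms(1), of B B'] lattice_ops(2)[OF assms(1), of B B'] b lattice_ops(3,4)[OF assms(1)]
      sub_of_closed[OF assms(1)] by simp
qed

lemma boolean_lattice_Sub:
  assumes "X \<in> objs"
  shows "boolean_lattice (Sub R X)"
proof -
  interpret P: partial_order "Sub R X" using partial_order_Sub[OF assms] .
  show ?thesis
  proof unfold_locales
    fix x y assume xy: "x \<in> carrier (Sub R X)" "y \<in> carrier (Sub R X)"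
    obtain B where B: "x = sub_of X B" "\<And>a. B a \<subseteq> node_set X a" using xy(1) by (rule carrier_sub_of) (rule that)
    obtain B' where B': "y = sub_of X B'" "\<And>a. B' a \<subseteq> node_set X a" using xy(2) by (rule carrier_sub_of) (rule that)
    show "\<exists>s. is_lub (Sub R X) s {x, y}" using lub_union[OF assms B(2) B'(2)] B(1) B'(1) by blast
    show "\<exists>s. is_glb (Sub R X) s {x, y}" using glb_inter[OF assms B(2) B'(2)] B(1) B'(1) by blast
    show "\<exists>y. is_complement (Sub R X) x y" unfolding B(1)
      by (rule exI, rule complement_sub_of[OF assms, of B "\<lambda>a. node_set X a - B a"]) (use B(2) in auto)
    fix z assume z: "z \<in> carrier (Sub R X)"
    obtain D where D: "z = sub_of X D" "\<And>a. D a \<subseteq> node_set X a" using z by (rule carrier_sub_of) (rule that)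
    have s: "B' a \<union> D a \<subseteq> node_set X a" "B a \<inter> B' a \<subseteq> node_set X a" "B a \<inter> D a \<subseteq> node_set X a" for a
      using B(2) B'(2) D(2) by blast+
    show "x \<sqinter>\<^bsub>Sub R X\<^esub> (y \<squnion>\<^bsub>Sub R X\<^esub> z) = (x \<sqinter>\<^bsub>Sub R X\<^esub> y) \<squnion>\<^bsub>Sub R X\<^esub> (x \<sqinter>\<^bsub>Sub R X\<^esub> z)"
      unfolding B(1) B'(1) D(1) lattice_ops(1)[OF assms B'(2) D(2)] lattice_ops(2)[OF assms B(2) s(1)]
        lattice_ops(2)[OF assms B(2) B'(2)] lattice_ops(2)[OF assms B(2) D(2)] lattice_ops(1)[OF assms s(2,3)]
        Int_Un_distrib ..
  qed (use top_sub_of[OF assms] bottom_sub_of[OF assms] in blast)+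
qed

sublocale rel: boolean_f_coherent_category R
  by (intro boolean_f_coherent_category.intro boolean_f_coherent_category_axioms.intro f_coherent_R)
    (use boolean_lattice_Sub in simp)

subsection \<open>Modality, disjoint unions and quotients\<close>

definition dia :: "('v, 'e, 'u) rel_object \<Rightarrow> ('v \<Rightarrow> 'u set) \<Rightarrow> 'v \<Rightarrow> 'u set" where
  "dia X B a = {s. \<exists>k \<in> arcs G. tail G k = a \<and> (\<exists>t \<in> B (head G k). (s, t) \<in> edge_rel X k)}"

lemma dia_sub: "X \<in> objs \<Longrightarrow> dia X B a \<subseteq> node_set X a"
  unfolding dia_def using objD(3) by blast

lemma dia_sub_of:
  assumes "X \<in> objs" "\<And>a. B a \<subseteq> node_set X a"
  shows "rel_dia G X (sub_of X B) = sub_of X (dia X B)"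
  unfolding rel_dia_def extent_sub_of[OF assms] unfolding sub_of_def dia_def by (simp add: fun_eq_iff)

lemma boolean_modal_R: "boolean_modal_category R"
proof (unfold_locales, goal_cases)
  case (1 X S)
  then obtain B where B: "S = sub_of X B" "\<And>a. B a \<subseteq> node_set X a" by (auto elim: carrier_sub_of)
  show ?case using 1 dia_sub_of[OF _ B(2)] sub_of_closed[OF _ dia_sub] B(1) by simp
next
  case (2 X)
  have "preserves_finite_joins (Sub R X) (Sub R X) (rel_dia G X)"
    by (rule preserves_joins[where H = "dia X"]) (use 2 dia_sub_of dia_sub in \<open>auto simp: dia_def\<close>)
  thus ?case by simp
next
  case (3 f X Y S)
  hence f: "f \<in> arrs" "source_obj f = X" "target_obj f = Y" by (auto simp: Hom_iff)
  have o: "X \<in> objs" "Y \<in> objs" using arrD[OF f(1)] f by auto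
  obtain B where B: "S = sub_of Y B" "\<And>a. B a \<subseteq> node_set Y a" using 3(2) by (auto elim: carrier_sub_of)
  let ?B = "\<lambda>a. {x \<in> node_set X a. component f a x \<in> B a}" and ?D = "\<lambda>a. {x \<in> node_set X a. component f a x \<in> dia Y B a}"
  have s: "?B a \<subseteq> node_set X a" "?D a \<subseteq> node_set X a" for a by auto
  have "dia X ?B a \<subseteq> ?D a" for a
    unfolding dia_def using arrD(4)[OF f(1)] objD(3)[OF o(1)] f(2,3) by blast
  thus ?case using sub_of_le[OF o(1) dia_sub[OF o(1)] s(2)] dia_sub_of[OF o(1) s(1)] dia_sub_of[OF o(2) B(2)]
    pb_sub_of[OF f B(2)] pb_sub_of[OF f dia_sub[OF o(2)]] unfolding B(1) by simp
next
  case (4 i A X S)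
  hence i: "i \<in> rel_mon G" "i \<in> arrs" "source_obj i = A" "target_obj i = X" by (auto simp: Hom_iff)
  have o: "A \<in> objs" "X \<in> objs" using arrD[OF i(2)] i by auto
  obtain B where B: "S = sub_of X B" "\<And>a. B a \<subseteq> node_set X a" using 4(3) by (auto elim: carrier_sub_of)
  let ?B = "\<lambda>a. {x \<in> node_set A a. component i a x \<in> B a}"
  let ?E = "\<lambda>a. component i a ` ?B a"
  have s: "?B a \<subseteq> node_set A a" "?E a \<subseteq> node_set X a" for a using arrD(3)[OF i(2)] i by auto
  \<comment> \<open>From left to right edges are preserved by \<open>i\<close>. From right to left
    the direct image is essential: both ends of the edge then come from the subobject, and
    \<open>i\<close> reflects edges.\<close>
  have "dia A ?B = (\<lambda>a. {x \<in> node_set A a. component i a x \<in> dia X ?E a})"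
  proof (rule ext, rule Set.set_eqI, rule iffI)
    fix a x assume "x \<in> dia A ?B a"
    then obtain k t where k: "k \<in> arcs G" "tail G k = a" "t \<in> ?B (head G k)" "(x, t) \<in> edge_rel A k" unfolding dia_def by blast
    have "(component i a x, component i (head G k) t) \<in> edge_rel X k" using arrD(4)[OF i(2), of x t k] k i by simp
    hence "component i a x \<in> dia X ?E a" unfolding dia_def using k(1-3) by blast
    moreover have "x \<in> node_set A a" using objD(3)[OF o(1) k(4)] k(2) by simp
    ultimately show "x \<in> {x \<in> node_set A a. component i a x \<in> dia X ?E a}" by blast
  next
    fix a x assume x: "x \<in> {x \<in> node_set A a. component i a x \<in> dia X ?E a}"
    then obtain k t where k: "k \<in> arcs G" "tail G k = a" "t \<in> ?B (head G k)" "(component i a x, component i (head G k) t) \<in> edge_rel X k"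
      unfolding dia_def by blast
    have "(x, t) \<in> edge_rel A k" using monD(3)[OF i(1), of x k t] k x i by simp
    thus "x \<in> dia A ?B a" unfolding dia_def using k(1-3) by blast
  qed
  thus ?case unfolding B(1)
    using pb_sub_of[OF i(2-4) B(2)] dia_sub_of[OF o(1) s(1)] exists_sub_of[OF i(2-4) s(1)] dia_sub_of[OF o(2) s(2)]
      pb_sub_of[OF i(2-4) dia_sub[OF o(2)]] by simp
qed

sublocale rel: boolean_modal_category R by (rule boolean_modal_R)

lemma quo_surj:
  assumes "q \<in> rel_quo G"
  shows "q \<in> arrs" "node_set (target_obj q) a \<subseteq> rel_image q a"
    "(s, t) \<in> edge_rel (target_obj q) k \<Longrightarrow> \<exists>s' t'. (s', t') \<in> edge_rel (source_obj q) k \<and>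
      component q (tail G k) s' = s \<and> component q (head G k) t' = t"
proof -
  show q: "q \<in> arrs" using assms by (simp add: rel_quo_def)
  show "node_set (target_obj q) a \<subseteq> rel_image q a"
    using assms objD(1)[OF arrD(2)[OF q], of a] by (cases "a \<in> verts G") (auto simp: rel_quo_def rel_image_def)
  show "\<exists>s' t'. (s', t') \<in> edge_rel (source_obj q) k \<and> component q (tail G k) s' = s \<and> component q (head G k) t' = t"
    if st: "(s, t) \<in> edge_rel (target_obj q) k"
  proof -
    have "k \<in> arcs G" using objD(3)[OF arrD(2)[OF q] st] by blast
    thus ?thesis using assms st unfolding rel_quo_def by fast
  qed
qed

text \<open>An edge of the product with the quotient has two coordinate edges. The first lifts
  through \<open>q\<close>, the second is kept, and together they form an edge of the upper product
  because the relation on a product is given coordinatewise.\<close>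

lemma with_quotients_R: "boolean_modal_category_with_quotients R"
proof (unfold_locales, goal_cases)
  case 1
  show ?case using surj_perp quo_surj by auto
next
  case (2 q X Y Z P p1 p2 P' p1' p2' h S)
  have q: "q \<in> rel_quo G" "source_obj q = X" "target_obj q = Y" using 2(1,2) by (auto simp: Hom_iff)
  note Q = quo_surj[OF q(1)]
  note D = rel.is_productD[OF 2(3), simplified] and D' = rel.is_productD[OF 2(4), simplified]
  have h: "h \<in> arrs" "source_obj h = P" "target_obj h = P'" "rel_comp p1' h = rel_comp q p1" "rel_comp p2' h = p2"
    using 2(5-7) by (auto simp: Hom_iff)
  have o: "P \<in> objs" "P' \<in> objs" using D D' by auto
  obtain B where B: "S = sub_of P' B" "\<And>a. B a \<subseteq> node_set P' a" using 2(8) by (auto elim: carrier_sub_of)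
  let ?B = "\<lambda>a. {x \<in> node_set P a. component h a x \<in> B a}"
  have s: "?B a \<subseteq> node_set P a" for a by blast
  have e: "component h a ` dia P ?B a \<subseteq> node_set P' a" for a using dia_sub[OF o(1)] arrD(3)[OF h(1)] h(2,3) by blast
  have hz: "component h a z = s" if z: "z \<in> node_set P a" "s \<in> node_set P' a"
    "component q a (component p1 a z) = component p1' a s" "component p2 a z = component p2' a s" for a z s
  proof (rule product_unique[OF 2(4)])
    show "component h a z \<in> node_set P' a" using arrD(3)[OF h(1), of z a] z h(2,3) by simp
    show "component p1' a (component h a z) = component p1' a s"
      using arg_cong[OF h(4), of "\<lambda>f. component f a z"] z h(2) D(3) by simp
    show "component p2' a (component h a z) = component p2' a s"
      using arg_cong[OF h(5), of "\<lambda>f. component f a z"] z h(2) by simp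
  qed (rule z)
  have "dia P' B a \<subseteq> component h a ` dia P ?B a" for a
  proof
    fix s assume "s \<in> dia P' B a"
    then obtain k t where k: "k \<in> arcs G" "tail G k = a" "t \<in> B (head G k)" "(s, t) \<in> edge_rel P' k" unfolding dia_def by blast
    note st = objD(3)[OF o(2) k(4)]
    have "(component p1' (tail G k) s, component p1' (head G k) t) \<in> edge_rel (target_obj q) k"
      using arrD(4)[OF D'(1)] k(4) D' q(3) by simp
    from Q(3)[OF this] obtain x x' where x: "(x, x') \<in> edge_rel X k" "component q (tail G k) x = component p1' (tail G k) s"
      "component q (head G k) x' = component p1' (head G k) t" using q(2) by auto
    have e2: "(component p2' (tail G k) s, component p2' (head G k) t) \<in> edge_rel Z k"
      using arrD(4)[OF D'(2)] k(4) D' by simp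
    note x' = objD(3)[OF D(8) x(1)] and z' = objD(3)[OF D(9) e2]
    obtain z where z: "z \<in> node_set P (tail G k)" "component p1 (tail G k) z = x" "component p2 (tail G k) z = component p2' (tail G k) s"
      using product_point[OF 2(3)] x' z' by blast
    obtain w where w: "w \<in> node_set P (head G k)" "component p1 (head G k) w = x'" "component p2 (head G k) w = component p2' (head G k) t"
      using product_point[OF 2(3)] x' z' by blast
    have "(z, w) \<in> edge_rel P k" using product_edge[OF 2(3) z(1) w(1)] x(1) e2 z w by simp
    moreover have "component h (tail G k) z = s" using hz[OF z(1), of s] st x z by simp
    moreover have "component h (head G k) w = t" using hz[OF w(1), of t] st x w by simp
    ultimately show "s \<in> component h a ` dia P ?B a" unfolding dia_def using k w(1) by blast
  qed
  thus ?case using sub_of_le[OF o(2) dia_sub[OF o(2)] e] dia_sub_of[OF o(2) B(2)] pb_sub_of[OF h(1-3) B(2)]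
    dia_sub_of[OF o(1) s] exists_sub_of[OF h(1-3) dia_sub[OF o(1)]] unfolding B(1) by simp
qed

sublocale rel: boolean_modal_category_with_quotients R by (rule with_quotients_R)

text \<open>Points are tagged by \<open>u0\<close> and \<open>u1\<close>, and no edge joins the two
  summands. Each summand therefore contains all predecessors of its points, which is the condition
  on \<open>Dia\<close>.\<close>

lemma disjoint_union_R:
  assumes "A \<in> objs" "B \<in> objs"
  shows "\<exists>W i j. is_disjoint_union R A B W i j"
proof -
  define inl where "inl x = pair_code (u0, x)" for x
  define inr where "inr x = pair_code (u1, x)" for x
  have inj: "inl x = inl y \<longleftrightarrow> x = y" "inr x = inr y \<longleftrightarrow> x = y" "inl x \<noteq> inr y" "inr x \<noteq> inl y" for x y
    using inj_eq[OF pair_code] u01 by (auto simp: inl_def inr_def)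
  define W where "W = \<lparr>node_set = (\<lambda>a. inl ` node_set A a \<union> inr ` node_set B a),
    edge_rel = (\<lambda>k. (\<lambda>(s, t). (inl s, inl t)) ` edge_rel A k \<union> (\<lambda>(s, t). (inr s, inr t)) ` edge_rel B k)\<rparr>"
  have WE: "(\<exists>s' t'. s = inl s' \<and> t = inl t' \<and> (s', t') \<in> edge_rel A k) \<or>
    (\<exists>s' t'. s = inr s' \<and> t = inr t' \<and> (s', t') \<in> edge_rel B k)" if "(s, t) \<in> edge_rel W k" for s t k
    using that by (auto simp: W_def)
  have W: "W \<in> objs"
  proof (rule objI)
    show "a \<in> verts G" if "x \<in> node_set W a" for a x
      using that objD(1)[OF assms(1), of a] objD(1)[OF assms(2), of a] by (auto simp: W_def)
    show "k \<in> arcs G \<and> s \<in> node_set W (tail G k) \<and> t \<in> node_set W (head G k)" if st: "(s, t) \<in> edge_rel W k" for k s t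
      using WE[OF st]
    proof (elim disjE exE conjE)
      fix s' t' assume e: "s = inl s'" "t = inl t'" "(s', t') \<in> edge_rel A k"
      show ?thesis using objD(3)[OF assms(1) e(3)] e(1,2) by (simp add: W_def)
    next
      fix s' t' assume e: "s = inr s'" "t = inr t'" "(s', t') \<in> edge_rel B k"
      show ?thesis using objD(3)[OF assms(2) e(3)] e(1,2) by (simp add: W_def)
    qed
  qed
  define i where "i = mk A W (\<lambda>_. inl)"
  define j where "j = mk B W (\<lambda>_. inr)"
  have arr: "i \<in> arrs" "j \<in> arrs" unfolding i_def j_def using assms W by (auto intro!: mk_arr simp: W_def)
  have mon: "i \<in> rel_mon G" "j \<in> rel_mon G"
    by (rule monI; use arr in \<open>auto simp: i_def j_def inj W_def\<close>)+
  have st: "source_obj i = A" "target_obj i = W" "source_obj j = B" "target_obj j = W" by (simp_all add: i_def j_def)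
  have im: "rel_image i a = inl ` node_set A a" "rel_image j a = inr ` node_set B a" for a
    by (auto simp: rel_image_def i_def j_def)
  have sub: "rel_image i a \<subseteq> node_set W a" "rel_image j a \<subseteq> node_set W a" for a unfolding im by (auto simp: W_def)
  have s: "subobj R i = sub_of W (rel_image i)" "subobj R j = sub_of W (rel_image j)" using subobj_eq mon st by auto
  have "is_complement (Sub R W) (sub_of W (rel_image i)) (sub_of W (rel_image j))"
    by (rule complement_sub_of[OF W]) (auto simp: im W_def inj)
  moreover have "dia W (rel_image i) a \<subseteq> rel_image i a" for a
  proof
    fix s assume "s \<in> dia W (rel_image i) a"
    then obtain k t where k: "tail G k = a" "t \<in> inl ` node_set A (head G k)" "(s, t) \<in> edge_rel W k"
      unfolding dia_def im by blast
    from WE[OF k(3)] k(2) inj obtain s' t' where e: "s = inl s'" "(s', t') \<in> edge_rel A k" by blast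
    show "s \<in> rel_image i a" unfolding im using objD(3)[OF assms(1) e(2)] k(1) e(1) by blast
  qed
  moreover have "dia W (rel_image j) a \<subseteq> rel_image j a" for a
  proof
    fix s assume "s \<in> dia W (rel_image j) a"
    then obtain k t where k: "tail G k = a" "t \<in> inr ` node_set B (head G k)" "(s, t) \<in> edge_rel W k"
      unfolding dia_def im by blast
    from WE[OF k(3)] k(2) inj obtain s' t' where e: "s = inr s'" "(s', t') \<in> edge_rel B k" by blast
    show "s \<in> rel_image j a" unfolding im using objD(3)[OF assms(2) e(2)] k(1) e(1) by blast
  qed
  ultimately have "is_disjoint_union R A B W i j"
    unfolding is_disjoint_union_def s
    using W arr mon st dia_sub_of[OF W sub(1)] dia_sub_of[OF W sub(2)] sub_of_le[OF W dia_sub[OF W] sub(1)]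
      sub_of_le[OF W dia_sub[OF W] sub(2)] by (simp add: Hom_iff)
  thus ?thesis by blast
qed

text \<open>Points of the internal relation, read at each node, form an equivalence relation of
  sets, because arrows and pullbacks can be evaluated at points. The quotient has chosen
  representatives as points; the pullback property of the kernel pair extends to edges since
  \<open>r\<close> carries the relation induced from the product.\<close>

lemma effective_R:
  assumes P: "is_product R X X P p1 p2" and r: "r \<in> rel_mon G" "target_obj r = P"
    and eqv: "is_equivalence_relation R X (source_obj r) (rel_comp p1 r) (rel_comp p2 r)"
  shows "\<exists>q \<in> rel_quo G. source_obj q = X \<and> is_pullback R q q (rel_comp p1 r) (rel_comp p2 r)"
proof -
  note D = rel.is_productD[OF P, simplified] and M = monD[OF r(1)]
  let ?K = "source_obj r" and ?r1 = "rel_comp p1 r" and ?r2 = "rel_comp p2 r"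
  have ra: "?r1 \<in> arrs" "?r2 \<in> arrs" using comp_closed M D r by auto
  define E where "E a = {(component ?r1 a z, component ?r2 a z) | z. z \<in> node_set ?K a}" for a
  have EX: "x \<in> node_set X a" "y \<in> node_set X a" if "(x, y) \<in> E a" for a x y
    using that arrD(3)[OF ra(1)] arrD(3)[OF ra(2)] D unfolding E_def by auto
  have refl: "(x, x) \<in> E a" if "x \<in> node_set X a" for a x
  proof -
    obtain d where d: "d \<in> arrs" "source_obj d = X" "target_obj d = ?K" "rel_comp ?r1 d = rel_ident X" "rel_comp ?r2 d = rel_ident X"
      using eqv unfolding is_equivalence_relation_def by (auto simp: Hom_iff)
    have "component ?r1 a (component d a x) = x" "component ?r2 a (component d a x) = x" "component d a x \<in> node_set ?K a"
      using arg_cong[OF d(4), of "\<lambda>f. component f a x"] arg_cong[OF d(5), of "\<lambda>f. component f a x"] that d(2,3)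
        arrD(3)[OF d(1), of x a] by (simp_all del: comp_simps add: comp_simps(3)[of x d])
    hence "(x, x) = (component ?r1 a (component d a x), component ?r2 a (component d a x))" "component d a x \<in> node_set ?K a"
      by simp_all
    thus ?thesis unfolding E_def by blast
  qed
  have sym: "(y, x) \<in> E a" if xy: "(x, y) \<in> E a" for a x y
  proof -
    obtain s where s: "s \<in> arrs" "source_obj s = ?K" "target_obj s = ?K" "rel_comp ?r1 s = ?r2" "rel_comp ?r2 s = ?r1"
      using eqv unfolding is_equivalence_relation_def by (auto simp: Hom_iff)
    obtain z where z: "z \<in> node_set ?K a" "x = component ?r1 a z" "y = component ?r2 a z" using xy unfolding E_def by blast
    have "component ?r1 a (component s a z) = y" "component ?r2 a (component s a z) = x" "component s a z \<in> node_set ?K a"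
      using arg_cong[OF s(4), of "\<lambda>f. component f a z"] arg_cong[OF s(5), of "\<lambda>f. component f a z"] z s(2,3)
        arrD(3)[OF s(1), of z a] by (simp_all del: comp_simps add: comp_simps(3)[of z s])
    hence "(y, x) = (component ?r1 a (component s a z), component ?r2 a (component s a z))" "component s a z \<in> node_set ?K a"
      by simp_all
    thus ?thesis unfolding E_def by blast
  qed
  have trans: "(x, z) \<in> E a" if xy: "(x, y) \<in> E a" "(y, z) \<in> E a" for a x y z
  proof -
    obtain u v where uv: "is_pullback R ?r2 ?r1 u v" using rel.ex_limits(4)[of ?r2 ?r1] ra D by auto
    note U = rel.is_pullbackD[OF uv, simplified]
    have "\<exists>t \<in> Hom R (source_obj u) ?K. rel_comp ?r1 t = rel_comp ?r1 u \<and> rel_comp ?r2 t = rel_comp ?r2 v"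
      using eqv uv unfolding is_equivalence_relation_def by simp
    then obtain t where t: "t \<in> arrs" "source_obj t = source_obj u" "target_obj t = ?K"
      "rel_comp ?r1 t = rel_comp ?r1 u" "rel_comp ?r2 t = rel_comp ?r2 v" by (auto simp: Hom_iff)
    obtain z1 where z1: "z1 \<in> node_set ?K a" "x = component ?r1 a z1" "y = component ?r2 a z1" using xy(1) unfolding E_def by blast
    obtain z2 where z2: "z2 \<in> node_set ?K a" "y = component ?r1 a z2" "z = component ?r2 a z2" using xy(2) unfolding E_def by blast
    obtain w where w: "w \<in> node_set (source_obj u) a" "component u a w = z1" "component v a w = z2"
      using pullback_point[OF uv, of z1 a z2] z1 z2 by auto
    have "component ?r1 a (component t a w) = component ?r1 a (component u a w)"
      "component ?r2 a (component t a w) = component ?r2 a (component v a w)" "component t a w \<in> node_set ?K a"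
      using arg_cong[OF t(4), of "\<lambda>f. component f a w"] arg_cong[OF t(5), of "\<lambda>f. component f a w"] w(1) t(2,3) U(6)
        arrD(3)[OF t(1), of w a]
      by (simp_all del: comp_simps add: comp_simps(3)[of w t] comp_simps(3)[of w u] comp_simps(3)[of w v])
    hence "(x, z) = (component ?r1 a (component t a w), component ?r2 a (component t a w))" "component t a w \<in> node_set ?K a"
      using w(2,3) z1(2) z2(3) by simp_all
    thus ?thesis unfolding E_def by blast
  qed
  \<comment> \<open>Equivalent points receive the same representative because \<open>SOME\<close> is
    applied to the same class.\<close>
  define c where "c a x = (SOME y. (x, y) \<in> E a)" for a x
  have c: "(x, c a x) \<in> E a" if "x \<in> node_set X a" for a x
    unfolding c_def using refl[OF that] by (rule someI)
  have c_eq: "c a x = c a y \<longleftrightarrow> (x, y) \<in> E a" if "x \<in> node_set X a" "y \<in> node_set X a" for a x y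
  proof
    assume "c a x = c a y"
    thus "(x, y) \<in> E a" using c[OF that(1)] c[OF that(2)] sym trans by metis
  next
    assume "(x, y) \<in> E a"
    hence "(x, z) \<in> E a \<longleftrightarrow> (y, z) \<in> E a" for z using sym trans by blast
    thus "c a x = c a y" unfolding c_def by simp
  qed
  \<comment> \<open>Edges are exactly the images of edges, so that each of them lifts, as membership
    in \<open>rel_quo\<close> demands.\<close>
  define Q where "Q = \<lparr>node_set = (\<lambda>a. c a ` node_set X a),
    edge_rel = (\<lambda>k. (\<lambda>(s, t). (c (tail G k) s, c (head G k) t)) ` edge_rel X k)\<rparr>"
  have Q: "Q \<in> objs"
  proof (rule objI)
    show "a \<in> verts G" if "x \<in> node_set Q a" for a x using that objD(1)[OF D(8), of a] by (auto simp: Q_def)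
    show "k \<in> arcs G \<and> s \<in> node_set Q (tail G k) \<and> t \<in> node_set Q (head G k)" if "(s, t) \<in> edge_rel Q k" for k s t
    proof -
      obtain s' t' where e: "s = c (tail G k) s'" "t = c (head G k) t'" "(s', t') \<in> edge_rel X k"
        using \<open>(s, t) \<in> edge_rel Q k\<close> by (auto simp: Q_def)
      show ?thesis using objD(3)[OF D(8) e(3)] e(1,2) by (simp add: Q_def)
    qed
  qed
  define q where "q = mk X Q c"
  have qa: "q \<in> arrs" unfolding q_def by (rule mk_arr[OF D(8) Q]) (auto simp: Q_def)
  have qc: "component q a x = c a x" if "x \<in> node_set X a" for a x using that by (simp add: q_def)
  have sq: "source_obj q = X" "target_obj q = Q" by (simp_all add: q_def)
  have "q \<in> rel_quo G" unfolding rel_quo_def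
  proof (intro CollectI conjI ballI)
    show "component q a ` node_set (source_obj q) a = node_set (target_obj q) a" for a
      using qc unfolding sq by (auto simp: Q_def)
    fix k p assume p: "p \<in> edge_rel (target_obj q) k"
    then obtain s t where st: "p = (c (tail G k) s, c (head G k) t)" "(s, t) \<in> edge_rel X k" unfolding sq by (auto simp: Q_def)
    note st' = objD(3)[OF D(8) st(2)]
    show "case p of (s, t) \<Rightarrow> \<exists>(s', t') \<in> edge_rel (source_obj q) k. component q (tail G k) s' = s \<and> component q (head G k) t' = t"
      unfolding st(1) sq using st(2) st' qc by auto
  qed (rule qa)
  moreover have "is_pullback R q q ?r1 ?r2"
  proof (rule pullbackI)
    have r12: "component ?r1 a z \<in> node_set X a" "component ?r2 a z \<in> node_set X a" "(component ?r1 a z, component ?r2 a z) \<in> E a"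
      if "z \<in> node_set (source_obj ?r1) a" for a z
    proof -
      have "z \<in> node_set ?K a" using that by simp
      thus "(component ?r1 a z, component ?r2 a z) \<in> E a" unfolding E_def by blast
      thus "component ?r1 a z \<in> node_set X a" "component ?r2 a z \<in> node_set X a" using EX by blast+
    qed
    show "component q a (component ?r1 a z) = component q a (component ?r2 a z)" if "z \<in> node_set (source_obj ?r1) a" for a z
      using r12[OF that] c_eq qc by metis
    show "\<exists>z \<in> node_set (source_obj ?r1) a. component ?r1 a z = s \<and> component ?r2 a z = t"
      if "s \<in> node_set (source_obj q) a" "t \<in> node_set (source_obj q) a" "component q a s = component q a t" for a s t
    proof -
      have "(s, t) \<in> E a" using that c_eq[of s a t] qc sq by simp
      thus ?thesis unfolding E_def by auto
    qed
    have uniq: "z = w" if zw: "z \<in> node_set ?K a" "w \<in> node_set ?K a"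
      "component p1 a (component r a z) = component p1 a (component r a w)"
      "component p2 a (component r a z) = component p2 a (component r a w)" for a z w
    proof -
      have "component r a z = component r a w"
        by (rule product_unique[OF P _ _ zw(3,4)]) (use arrD(3)[OF M(1)] zw r(2) in auto)
      thus ?thesis using M(2) zw by blast
    qed
    show "z = w" if "z \<in> node_set (source_obj ?r1) a" "w \<in> node_set (source_obj ?r1) a"
      "component ?r1 a z = component ?r1 a w" "component ?r2 a z = component ?r2 a w" for a z w
      by (rule uniq) (use that in auto)
    show "(z, w) \<in> edge_rel (source_obj ?r1) k"
      if zw: "z \<in> node_set (source_obj ?r1) (tail G k)" "w \<in> node_set (source_obj ?r1) (head G k)"
      "(component ?r1 (tail G k) z, component ?r1 (head G k) w) \<in> edge_rel (source_obj q) k"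
      "(component ?r2 (tail G k) z, component ?r2 (head G k) w) \<in> edge_rel (source_obj q) k" for k z w
    proof -
      have zw': "z \<in> node_set ?K (tail G k)" "w \<in> node_set ?K (head G k)" using zw by auto
      have "(component r (tail G k) z, component r (head G k) w) \<in> edge_rel P k"
        by (rule product_edge[OF P]) (use arrD(3)[OF M(1)] zw zw' r(2) sq in auto)
      thus ?thesis using M(3)[OF zw'] r(2) by simp
    qed
  qed (use qa ra sq D in auto)
  ultimately show ?thesis using sq by blast
qed

theorem quasi_pretopos_R: "boolean_modal_quasi_pretopos R"
proof (unfold_locales, goal_cases)
  case (1 A B)
  thus ?case using disjoint_union_R by simp
next
  case (2 X P p1 p2 r)
  thus ?case using effective_R[OF 2(1), of r] by (auto simp: MonInto_def is_kernel_pair_def)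
qed

end

section \<open>Flat functors preserve finite limits\<close>

context f_regular_category
begin

text \<open>Only existence of preimages is asked for products and equalisers. The type of points is
  arbitrary, so the notion applies to models and also to accessibility relations, whose points are
  pairs.\<close>

definition flat :: "('o \<Rightarrow> 'e set) \<Rightarrow> ('a \<Rightarrow> 'e \<Rightarrow> 'e) \<Rightarrow> bool" where
  "flat F act \<longleftrightarrow>
    (\<forall>f x. f \<in> Arr C \<longrightarrow> x \<in> F (Dom C f) \<longrightarrow> act f x \<in> F (Cod C f)) \<and>
    (\<forall>X x. X \<in> Obj C \<longrightarrow> x \<in> F X \<longrightarrow> act (Ident C X) x = x) \<and>
    (\<forall>f g x. f \<in> Arr C \<longrightarrow> g \<in> Arr C \<longrightarrow> Cod C f = Dom C g \<longrightarrow> x \<in> F (Dom C f) \<longrightarrow> act (g \<cdot> f) x = act g (act f x)) \<and>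
    (\<forall>T. is_terminal C T \<longrightarrow> F T \<noteq> {}) \<and>
    (\<forall>X Y P p q x y. is_product C X Y P p q \<longrightarrow> x \<in> F X \<longrightarrow> y \<in> F Y \<longrightarrow> (\<exists>z \<in> F P. act p z = x \<and> act q z = y)) \<and>
    (\<forall>f g m x. is_equalizer C f g m \<longrightarrow> x \<in> F (Dom C f) \<longrightarrow> act f x = act g x \<longrightarrow> (\<exists>z \<in> F (Dom C m). act m z = x))"

lemma flatD:
  assumes "flat F act"
  shows "f \<in> Arr C \<Longrightarrow> x \<in> F (Dom C f) \<Longrightarrow> act f x \<in> F (Cod C f)"
    "X \<in> Obj C \<Longrightarrow> x \<in> F X \<Longrightarrow> act (Ident C X) x = x"
    "f \<in> Arr C \<Longrightarrow> g \<in> Arr C \<Longrightarrow> Cod C f = Dom C g \<Longrightarrow> x \<in> F (Dom C f) \<Longrightarrow> act (g \<cdot> f) x = act g (act f x)"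
    "is_terminal C T \<Longrightarrow> F T \<noteq> {}"
    "is_product C X Y P p q \<Longrightarrow> x \<in> F X \<Longrightarrow> y \<in> F Y \<Longrightarrow> \<exists>z \<in> F P. act p z = x \<and> act q z = y"
    "is_equalizer C f g m \<Longrightarrow> x \<in> F (Dom C f) \<Longrightarrow> act f x = act g x \<Longrightarrow> \<exists>z \<in> F (Dom C m). act m z = x"
proof -
  note d = assms[unfolded flat_def]
  show "f \<in> Arr C \<Longrightarrow> x \<in> F (Dom C f) \<Longrightarrow> act f x \<in> F (Cod C f)" using d[THEN conjunct1] by simp
  show "X \<in> Obj C \<Longrightarrow> x \<in> F X \<Longrightarrow> act (Ident C X) x = x" using d[THEN conjunct2, THEN conjunct1] by simp
  show "f \<in> Arr C \<Longrightarrow> g \<in> Arr C \<Longrightarrow> Cod C f = Dom C g \<Longrightarrow> x \<in> F (Dom C f) \<Longrightarrow> act (g \<cdot> f) x = act g (act f x)"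
    using d[THEN conjunct2, THEN conjunct2, THEN conjunct1] by simp
  show "is_terminal C T \<Longrightarrow> F T \<noteq> {}"
    using d[THEN conjunct2, THEN conjunct2, THEN conjunct2, THEN conjunct1] by simp
  show "is_product C X Y P p q \<Longrightarrow> x \<in> F X \<Longrightarrow> y \<in> F Y \<Longrightarrow> \<exists>z \<in> F P. act p z = x \<and> act q z = y"
    using d[THEN conjunct2, THEN conjunct2, THEN conjunct2, THEN conjunct2, THEN conjunct1] by blast
  show "is_equalizer C f g m \<Longrightarrow> x \<in> F (Dom C f) \<Longrightarrow> act f x = act g x \<Longrightarrow> \<exists>z \<in> F (Dom C m). act m z = x"
    using d[THEN conjunct2, THEN conjunct2, THEN conjunct2, THEN conjunct2, THEN conjunct2] by blast
qed

text \<open>Finitely many equations that hold at a point are made to hold identically, on an arrow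
  through which the point comes. Each equation costs one equaliser, to which the point
  lifts.\<close>

lemma flat_joint_equalizer:
  assumes "flat F act" "finite S" "W \<in> Obj C" "w \<in> F W"
    "\<And>s. s \<in> S \<Longrightarrow> f s \<in> Arr C \<and> g s \<in> Arr C \<and> Dom C (f s) = W \<and> Dom C (g s) = W \<and> Cod C (f s) = Cod C (g s) \<and>
      act (f s) w = act (g s) w"
  shows "\<exists>t w'. t \<in> Arr C \<and> Cod C t = W \<and> w' \<in> F (Dom C t) \<and> act t w' = w \<and> (\<forall>s \<in> S. f s \<cdot> t = g s \<cdot> t)"
  using assms(2,5)
proof (induction S rule: finite_induct)
  case empty
  show ?case by (rule exI[of _ "Ident C W"], rule exI[of _ w]) (use assms flatD(2)[OF assms(1)] in auto)
next
  case (insert s S)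
  note FD = flatD[OF assms(1)]
  obtain t w' where t: "t \<in> Arr C" "Cod C t = W" "w' \<in> F (Dom C t)" "act t w' = w" "\<forall>s \<in> S. f s \<cdot> t = g s \<cdot> t"
    using insert.IH insert.prems by blast
  have s: "f s \<in> Arr C" "g s \<in> Arr C" "Dom C (f s) = W" "Dom C (g s) = W" "Cod C (f s) = Cod C (g s)" "act (f s) w = act (g s) w"
    using insert.prems[of s] by auto
  obtain m where m: "is_equalizer C (f s \<cdot> t) (g s \<cdot> t) m" using ex_limits(3)[of "f s \<cdot> t" "g s \<cdot> t"] s t by auto
  note D = is_equalizerD[OF m]
  have cm: "Cod C m = Dom C t" using D(6) t s by simp
  have "act (f s \<cdot> t) w' = act (g s \<cdot> t) w'" using FD(3)[OF t(1) s(1)] FD(3)[OF t(1) s(2)] t s by simp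
  moreover have "w' \<in> F (Dom C (f s \<cdot> t))" using t s by simp
  ultimately obtain w'' where w: "w'' \<in> F (Dom C m)" "act m w'' = w'" using FD(6)[OF m] by blast
  have "act (t \<cdot> m) w'' = w" using FD(3)[OF D(3) t(1) cm w(1)] w(2) t(4) by simp
  moreover have "f r \<cdot> t \<cdot> m = g r \<cdot> t \<cdot> m" if "r \<in> insert s S" for r
  proof -
    have r: "f r \<in> Arr C" "g r \<in> Arr C" "Dom C (f r) = W" "Dom C (g r) = W" using insert.prems[OF that] by auto
    have "(f r \<cdot> t) \<cdot> m = (g r \<cdot> t) \<cdot> m"
    proof (cases "r = s")
      case False
      hence "f r \<cdot> t = g r \<cdot> t" using t(5) that by blast
      thus ?thesis by simp
    qed (use D(7) in simp)
    thus ?thesis using r t(1,2) D(3) cm by simp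
  qed
  ultimately show ?case using t D(3) cm w(1) by (intro exI[of _ "t \<cdot> m"] exI[of _ w'']) auto
qed

lemma flat_common:
  assumes "flat F act" "x \<in> F X" "y \<in> F Y" "X \<in> Obj C" "Y \<in> Obj C"
  obtains W w f g where "W \<in> Obj C" "w \<in> F W" "f \<in> Arr C" "g \<in> Arr C" "Dom C f = W" "Dom C g = W" "Cod C f = X" "Cod C g = Y"
    "act f w = x" "act g w = y"
proof -
  obtain P p q where P: "is_product C X Y P p q" using ex_limits(2)[OF assms(4,5)] by blast
  obtain z where "z \<in> F P" "act p z = x" "act q z = y" using flatD(5)[OF assms(1) P assms(2,3)] by blast
  thus ?thesis using that[of P z p q] is_productD[OF P] by simp
qed

text \<open>Both points come from one point of a product. The equation between their images holds
  identically after some \<open>t\<close>, where the monomorphism can be cancelled.\<close>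

lemma flat_mono_inj:
  assumes "flat F act" "is_mono C m" "x \<in> F (Dom C m)" "y \<in> F (Dom C m)" "act m x = act m y"
  shows "x = y"
proof -
  note FD = flatD[OF assms(1)]
  have m: "m \<in> Arr C" using assms(2) by (simp add: is_mono_def)
  obtain W w f g where w: "W \<in> Obj C" "w \<in> F W" "f \<in> Arr C" "g \<in> Arr C" "Dom C f = W" "Dom C g = W" "Cod C f = Dom C m"
    "Cod C g = Dom C m" "act f w = x" "act g w = y"
    by (rule flat_common[OF assms(1,3,4)]) (use m in auto)
  have "act (m \<cdot> f) w = act (m \<cdot> g) w" using FD(3)[OF w(3) m w(7)] FD(3)[OF w(4) m w(8)] w assms(5) by simp
  then obtain t w' where t: "t \<in> Arr C" "Cod C t = W" "w' \<in> F (Dom C t)" "act t w' = w" "(m \<cdot> f) \<cdot> t = (m \<cdot> g) \<cdot> t"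
    using flat_joint_equalizer[OF assms(1) _ w(1,2), of "{()}" "\<lambda>_. m \<cdot> f" "\<lambda>_. m \<cdot> g"] w m by auto
  have "m \<cdot> f \<cdot> t = m \<cdot> g \<cdot> t" using t(1,2,5) w m by simp
  hence "f \<cdot> t = g \<cdot> t" by (rule monoD[OF assms(2), rotated -1]) (use t(1,2) w in auto)
  moreover have "act (f \<cdot> t) w' = x" "act (g \<cdot> t) w' = y"
    using FD(3)[OF t(1) w(3)] FD(3)[OF t(1) w(4)] t w by simp_all
  ultimately show ?thesis by simp
qed

text \<open>A compatible family comes from one point \<open>w\<close> of a common object, by
  products; its compatibility, an equation at \<open>w\<close> for each edge, becomes identical
  after some \<open>t\<close>. This makes a cone, and the image of \<open>w'\<close> under its
  factorisation is the required point. Uniqueness applies the same method to two maps into the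
  limit.\<close>

lemma flat_limit:
  assumes "flat F act" "fin_digraph J" "is_diagram C J DO DA" "is_limit C J DO DA L pr"
  shows "(\<And>v. v \<in> verts J \<Longrightarrow> \<phi> v \<in> F (DO v)) \<Longrightarrow>
      (\<And>e. e \<in> arcs J \<Longrightarrow> act (DA e) (\<phi> (tail J e)) = \<phi> (head J e)) \<Longrightarrow>
      \<exists>z \<in> F L. \<forall>v \<in> verts J. act (pr v) z = \<phi> v"
    "z \<in> F L \<Longrightarrow> z' \<in> F L \<Longrightarrow> (\<And>v. v \<in> verts J \<Longrightarrow> act (pr v) z = act (pr v) z') \<Longrightarrow> z = z'"
proof -
  interpret J: fin_digraph J by (rule assms(2))
  note FD = flatD[OF assms(1)]
  have DO: "DO v \<in> Obj C" if "v \<in> verts J" for v using assms(3) that unfolding is_diagram_def by blast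
  have DA: "DA e \<in> Arr C" "Dom C (DA e) = DO (tail J e)" "Cod C (DA e) = DO (head J e)" if "e \<in> arcs J" for e
    using assms(3) that unfolding is_diagram_def by (auto simp: Hom_def)
  have cone: "is_cone C J DO DA L pr" and lim: "\<And>T t. is_cone C J DO DA T t \<Longrightarrow>
      \<exists>!h. h \<in> Hom C T L \<and> (\<forall>v \<in> verts J. pr v \<cdot> h = t v)"
    using assms(4) unfolding is_limit_def by auto
  have L: "L \<in> Obj C" and pr: "\<And>v. v \<in> verts J \<Longrightarrow> pr v \<in> Arr C \<and> Dom C (pr v) = L \<and> Cod C (pr v) = DO v"
    using cone unfolding is_cone_def by (auto simp: Hom_def)
  {
    assume \<phi>: "\<And>v. v \<in> verts J \<Longrightarrow> \<phi> v \<in> F (DO v)"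
      and comm: "\<And>e. e \<in> arcs J \<Longrightarrow> act (DA e) (\<phi> (tail J e)) = \<phi> (head J e)"
    have "\<exists>W w h. W \<in> Obj C \<and> w \<in> F W \<and> (\<forall>v \<in> V. h v \<in> Arr C \<and> Dom C (h v) = W \<and> Cod C (h v) = DO v \<and> act (h v) w = \<phi> v)"
      if "finite V" "V \<subseteq> verts J" for V
      using that
    proof (induction V rule: finite_induct)
      case empty
      obtain T where T: "is_terminal C T" using ex_limits(1) by blast
      then obtain w where "w \<in> F T" using FD(4) by blast
      thus ?case using T unfolding is_terminal_def by blast
    next
      case (insert v V)
      then obtain W w h where w: "W \<in> Obj C" "w \<in> F W"
        "\<forall>v \<in> V. h v \<in> Arr C \<and> Dom C (h v) = W \<and> Cod C (h v) = DO v \<and> act (h v) w = \<phi> v" by blast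
      have v: "v \<in> verts J" using insert.prems by simp
      obtain W' w' f g where w': "W' \<in> Obj C" "w' \<in> F W'" "f \<in> Arr C" "g \<in> Arr C" "Dom C f = W'" "Dom C g = W'" "Cod C f = W"
        "Cod C g = DO v" "act f w' = w" "act g w' = \<phi> v" by (rule flat_common[OF assms(1) w(2) \<phi>[OF v] w(1) DO[OF v]])
      have "act (h r \<cdot> f) w' = \<phi> r" if "r \<in> V" for r using FD(3)[OF w'(3), of "h r" w'] w(3) that w' by simp
      thus ?case using w w' insert.hyps
        by (intro exI[of _ W'] exI[of _ w'] exI[of _ "\<lambda>r. if r = v then g else h r \<cdot> f"]) auto
    qed
    from this[OF J.finite_verts subset_refl] obtain W w h where w: "W \<in> Obj C" "w \<in> F W"
      "\<forall>v \<in> verts J. h v \<in> Arr C \<and> Dom C (h v) = W \<and> Cod C (h v) = DO v \<and> act (h v) w = \<phi> v"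
      by (elim exE conjE) (rule that)
    note w = w(1,2) w(3)[rule_format]
    have "\<exists>t w'. t \<in> Arr C \<and> Cod C t = W \<and> w' \<in> F (Dom C t) \<and> act t w' = w \<and>
      (\<forall>e \<in> arcs J. (DA e \<cdot> h (tail J e)) \<cdot> t = h (head J e) \<cdot> t)"
    proof (rule flat_joint_equalizer[OF assms(1) J.finite_arcs w(1,2)])
      fix e assume e: "e \<in> arcs J"
      note t = w(3)[OF J.tail_in_verts[OF e]] and h = w(3)[OF J.head_in_verts[OF e]]
      have "act (DA e \<cdot> h (tail J e)) w = \<phi> (head J e)"
        using FD(3)[of "h (tail J e)" "DA e" w] t DA[OF e] w(2) comm[OF e] by simp
      thus "DA e \<cdot> h (tail J e) \<in> Arr C \<and> h (head J e) \<in> Arr C \<and> Dom C (DA e \<cdot> h (tail J e)) = W \<and>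
        Dom C (h (head J e)) = W \<and> Cod C (DA e \<cdot> h (tail J e)) = Cod C (h (head J e)) \<and>
        act (DA e \<cdot> h (tail J e)) w = act (h (head J e)) w"
        using t h DA[OF e] by simp
    qed
    then obtain t w' where t: "t \<in> Arr C" "Cod C t = W" "w' \<in> F (Dom C t)" "act t w' = w"
      "\<And>e. e \<in> arcs J \<Longrightarrow> (DA e \<cdot> h (tail J e)) \<cdot> t = h (head J e) \<cdot> t" by blast
    have "is_cone C J DO DA (Dom C t) (\<lambda>v. h v \<cdot> t)" unfolding is_cone_def
    proof (intro conjI ballI)
      show "DA e \<cdot> h (tail J e) \<cdot> t = h (head J e) \<cdot> t" if e: "e \<in> arcs J" for e
        using t(5)[OF e] w(3)[OF J.tail_in_verts[OF e]] DA[OF e] t(1,2) by simp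
      show "h v \<cdot> t \<in> Hom C (Dom C t) (DO v)" if "v \<in> verts J" for v using w(3)[OF that] t(1,2) by (simp add: Hom_def)
    qed (use t in simp)
    from lim[OF this] obtain l where l: "l \<in> Hom C (Dom C t) L" "\<forall>v \<in> verts J. pr v \<cdot> l = h v \<cdot> t" by blast
    note l' = HomD[OF l(1)]
    have "act (pr v) (act l w') = \<phi> v" if v: "v \<in> verts J" for v
    proof -
      have "act (pr v) (act l w') = act (pr v \<cdot> l) w'" using FD(3)[of l "pr v" w'] l' pr[OF v] t(3) by simp
      also have "\<dots> = act (h v \<cdot> t) w'" using l(2) v by simp
      also have "\<dots> = \<phi> v" using FD(3)[of t "h v" w'] t w(3)[OF v] by simp
      finally show ?thesis .
    qed
    moreover have "act l w' \<in> F L" using FD(1)[of l w'] l' t(3) by simp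
    ultimately show "\<exists>z \<in> F L. \<forall>v \<in> verts J. act (pr v) z = \<phi> v" by blast
  }
  assume z: "z \<in> F L" "z' \<in> F L" "\<And>v. v \<in> verts J \<Longrightarrow> act (pr v) z = act (pr v) z'"
  obtain W w f g where w: "W \<in> Obj C" "w \<in> F W" "f \<in> Arr C" "g \<in> Arr C" "Dom C f = W" "Dom C g = W" "Cod C f = L"
    "Cod C g = L" "act f w = z" "act g w = z'" by (rule flat_common[OF assms(1) z(1,2) L L])
  have "\<exists>t w'. t \<in> Arr C \<and> Cod C t = W \<and> w' \<in> F (Dom C t) \<and> act t w' = w \<and> (\<forall>v \<in> verts J. (pr v \<cdot> f) \<cdot> t = (pr v \<cdot> g) \<cdot> t)"
  proof (rule flat_joint_equalizer[OF assms(1) J.finite_verts w(1,2)])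
    fix v assume v: "v \<in> verts J"
    show "pr v \<cdot> f \<in> Arr C \<and> pr v \<cdot> g \<in> Arr C \<and> Dom C (pr v \<cdot> f) = W \<and> Dom C (pr v \<cdot> g) = W \<and>
      Cod C (pr v \<cdot> f) = Cod C (pr v \<cdot> g) \<and> act (pr v \<cdot> f) w = act (pr v \<cdot> g) w"
      using FD(3)[of f "pr v" w] FD(3)[of g "pr v" w] pr[OF v] w z(3)[OF v] by simp
  qed
  then obtain t w' where t: "t \<in> Arr C" "Cod C t = W" "w' \<in> F (Dom C t)" "act t w' = w"
    "\<And>v. v \<in> verts J \<Longrightarrow> (pr v \<cdot> f) \<cdot> t = (pr v \<cdot> g) \<cdot> t" by blast
  have eq: "pr v \<cdot> f \<cdot> t = pr v \<cdot> g \<cdot> t" if "v \<in> verts J" for v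
    using t(5)[OF that] pr[OF that] w t(1,2) by simp
  have ft: "f \<cdot> t \<in> Hom C (Dom C t) L" "g \<cdot> t \<in> Hom C (Dom C t) L" using w t(1,2) by (auto simp: Hom_def)
  have "is_cone C J DO DA (Dom C t) (\<lambda>v. pr v \<cdot> f \<cdot> t)" unfolding is_cone_def
  proof (intro conjI ballI)
    show "DA e \<cdot> pr (tail J e) \<cdot> f \<cdot> t = pr (head J e) \<cdot> f \<cdot> t" if e: "e \<in> arcs J" for e
    proof -
      have "DA e \<cdot> pr (tail J e) \<cdot> f \<cdot> t = (DA e \<cdot> pr (tail J e)) \<cdot> f \<cdot> t"
        using DA[OF e] pr[OF J.tail_in_verts[OF e]] w t(1,2) by simp
      also have "DA e \<cdot> pr (tail J e) = pr (head J e)" using cone e unfolding is_cone_def by blast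
      finally show ?thesis .
    qed
    show "pr v \<cdot> f \<cdot> t \<in> Hom C (Dom C t) (DO v)" if "v \<in> verts J" for v using pr[OF that] w t(1,2) by (simp add: Hom_def)
  qed (use t in simp)
  from lim[OF this] have "f \<cdot> t = g \<cdot> t" by (rule ex1_unique) (use ft eq in auto)
  moreover have "act (f \<cdot> t) w' = z" "act (g \<cdot> t) w' = z'"
    using FD(3)[OF t(1) w(3)] FD(3)[OF t(1) w(4)] t w by simp_all
  ultimately show "z = z'" by simp
qed

end

context boolean_modal_category_with_quotients
begin

lemma flat_model: "model (Arr C) M \<Longrightarrow> flat (fst M) (snd M)"
  unfolding flat_def
proof (intro conjI allI impI)
  assume m: "model (Arr C) M"
  note D = modelD[OF m]
  show "snd M f x \<in> fst M (Cod C f)" if "f \<in> Arr C" "x \<in> fst M (Dom C f)" for f x using D(1) that .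
  show "snd M (Ident C X) x = x" if "X \<in> Obj C" "x \<in> fst M X" for X x using D(2) that by simp
  show "snd M (g \<cdot> f) x = snd M g (snd M f x)" if "f \<in> Arr C" "g \<in> Arr C" "Cod C f = Dom C g" "x \<in> fst M (Dom C f)" for f g x
    using D(3)[OF that(1-3) _ that(4)] that by simp
  show "fst M T \<noteq> {}" if T: "is_terminal C T" for T
  proof -
    have "T \<in> Obj C" using T by (simp add: is_terminal_def)
    thus ?thesis using D(4)[OF T] by simp
  qed
  show "\<exists>z \<in> fst M P. snd M p z = x \<and> snd M q z = y" if "is_product C X Y P p q" "x \<in> fst M X" "y \<in> fst M Y" for X Y P p q x y
    using D(5)[OF that(1) is_productD(1,2)[OF that(1)] that(2,3)] by blast
  show "\<exists>z \<in> fst M (Dom C m). snd M m z = x" if "is_equalizer C f g m" "x \<in> fst M (Dom C f)" "snd M f x = snd M g x" for f g m x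
    using D(6)[OF that(1) is_equalizerD(1,2,3)[OF that(1)] that(2,3)] by blast
qed

text \<open>Consequently relations on limits are computed as in sets. The equaliser clause combines
  the equalisers of the two models with the fact that equalisers belong to \<open>Mon\<close>, along
  which the relation is induced.\<close>

lemma flat_accessibility:
  assumes "model (Arr C) M" "model (Arr C) M'" "accessibility (Arr C) M M' R"
  shows "flat R (\<lambda>f p. (snd M f (fst p), snd M' f (snd p)))"
  unfolding flat_def
proof (intro conjI allI impI)
  note D = flatD[OF flat_model[OF assms(1)]] and D' = flatD[OF flat_model[OF assms(2)]] and A = accessibilityD[OF assms(3)]
  have RD: "fst p \<in> fst M X" "snd p \<in> fst M' X" if "p \<in> R X" for p X using A(1)[of X] that by auto
  show "(snd M f (fst p), snd M' f (snd p)) \<in> R (Cod C f)" if "f \<in> Arr C" "p \<in> R (Dom C f)" for f p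
    using A(2)[OF that(1), of "fst p" "snd p"] that(2) by simp
  show "(snd M (Ident C X) (fst p), snd M' (Ident C X) (snd p)) = p" if "X \<in> Obj C" "p \<in> R X" for X p
    using D(2)[OF that(1)] D'(2)[OF that(1)] RD[OF that(2)] by simp
  show "(snd M (g \<cdot> f) (fst p), snd M' (g \<cdot> f) (snd p)) =
    (snd M g (fst (snd M f (fst p), snd M' f (snd p))), snd M' g (snd (snd M f (fst p), snd M' f (snd p))))"
    if "f \<in> Arr C" "g \<in> Arr C" "Cod C f = Dom C g" "p \<in> R (Dom C f)" for f g p
    using D(3)[OF that(1-3)] D'(3)[OF that(1-3)] RD[OF that(4)] by simp
  show "R T \<noteq> {}" if T: "is_terminal C T" for T
  proof -
    have "T \<in> Obj C" using T by (simp add: is_terminal_def)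
    thus ?thesis using A(3)[OF T] by simp
  qed
  show "\<exists>z \<in> R P. (snd M p (fst z), snd M' p (snd z)) = x \<and> (snd M q (fst z), snd M' q (snd z)) = y"
    if P: "is_product C X Y P p q" "x \<in> R X" "y \<in> R Y" for X Y P p q x y
  proof -
    obtain z w where "(z, w) \<in> R P" "snd M p z = fst x" "snd M q z = fst y" "snd M' p w = snd x" "snd M' q w = snd y"
      using A(4)[OF P(1) is_productD(1,2)[OF P(1)], of "fst x" "snd x" "fst y" "snd y"] P(2,3) by auto
    thus ?thesis by (intro bexI[of _ "(z, w)"]) auto
  qed
  show "\<exists>z \<in> R (Dom C m). (snd M m (fst z), snd M' m (snd z)) = x"
    if e: "is_equalizer C f g m" "x \<in> R (Dom C f)" "(snd M f (fst x), snd M' f (snd x)) = (snd M g (fst x), snd M' g (snd x))" for f g m x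
  proof -
    note E = is_equalizerD[OF e(1)]
    obtain z where z: "z \<in> fst M (Dom C m)" "snd M m z = fst x" using D(6)[OF e(1)] RD[OF e(2)] e(3) by auto
    obtain w where w: "w \<in> fst M' (Dom C m)" "snd M' m w = snd x" using D'(6)[OF e(1)] RD[OF e(2)] e(3) by auto
    have "(z, w) \<in> R (Dom C m)"
      using A(5)[OF is_equalizer_Mon[OF e(1)] E(3) z(1) w(1)] z(2) w(2) E(6) e(2) by simp
    thus ?thesis using z w by (intro bexI[of _ "(z, w)"]) auto
  qed
qed

end

section \<open>The functor of a Kripke model\<close>

text \<open>Nodes and edges are mere names; \<open>nm\<close> and \<open>er\<close> decode them to
  models and relations. This separates the construction of the functor from the coding of the graph
  in a particular type.\<close>

locale kripke_functor = boolean_modal_category_with_quotients C + str: relational G univ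
  for C :: "('o, 'a, 'x) modal_category_with_quotients_scheme"
    and G :: "('v, 'e) pre_digraph" and univ :: "'u itself" +
  fixes nm :: "'v \<Rightarrow> ('o \<Rightarrow> 'u set) \<times> ('a \<Rightarrow> 'u \<Rightarrow> 'u)" and er :: "'e \<Rightarrow> 'o \<Rightarrow> ('u \<times> 'u) set"
  assumes node_model: "v \<in> verts G \<Longrightarrow> model (Arr C) (nm v)"
    and edge_accessibility: "k \<in> arcs G \<Longrightarrow> accessibility (Arr C) (nm (tail G k)) (nm (head G k)) (er k)"
    and successor: "v \<in> verts G \<Longrightarrow> m \<in> Mon C \<Longrightarrow> n \<in> Dia C (Cod C m) (subobj C m) \<Longrightarrow> n \<in> Arr C \<Longrightarrow> x \<in> fst (nm v) (Dom C n) \<Longrightarrow>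
      \<exists>k y. k \<in> arcs G \<and> tail G k = v \<and> y \<in> fst (nm (head G k)) (Dom C m) \<and>
        (snd (nm v) n x, snd (nm (head G k)) m y) \<in> er k (Cod C m)"
    and separating: "m \<in> Mon C \<Longrightarrow> n \<in> Mon C \<Longrightarrow> Cod C n = Cod C m \<Longrightarrow> \<not> factors_through C m n \<Longrightarrow>
      \<exists>v x. v \<in> verts G \<and> x \<in> fst (nm v) (Dom C m) \<and> (\<forall>y. y \<in> fst (nm v) (Dom C n) \<longrightarrow> snd (nm v) n y \<noteq> snd (nm v) m x)"
begin

definition ob :: "'o \<Rightarrow> ('v, 'e, 'u) rel_object" where
  "ob X = \<lparr>node_set = (\<lambda>v. if v \<in> verts G then fst (nm v) X else {}),
     edge_rel = (\<lambda>k. if k \<in> arcs G then er k X else {})\<rparr>"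

definition ar :: "'a \<Rightarrow> ('v, 'e, 'u) rel_arrow" where
  "ar f = str.mk (ob (Dom C f)) (ob (Cod C f)) (\<lambda>v. snd (nm v) f)"

definition fnc :: "('o, 'a, ('v, 'e, 'u) rel_object, ('v, 'e, 'u) rel_arrow) cat_functor" where
  "fnc = \<lparr>FObj = ob, FArr = ar\<rparr>"

lemma fnc_simps [simp]: "FObj fnc = ob" "FArr fnc = ar"
  by (simp_all add: fnc_def)

lemma ob_node: "x \<in> node_set (ob X) v \<longleftrightarrow> v \<in> verts G \<and> x \<in> fst (nm v) X"
  by (simp add: ob_def)

lemma ob_edge: "p \<in> edge_rel (ob X) k \<longleftrightarrow> k \<in> arcs G \<and> p \<in> er k X"
  by (simp add: ob_def)

lemma ob_obj: "ob X \<in> rel_objects G"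
proof (rule str.objI)
  fix k s t assume "(s, t) \<in> edge_rel (ob X) k"
  thus "k \<in> arcs G \<and> s \<in> node_set (ob X) (tail G k) \<and> t \<in> node_set (ob X) (head G k)"
    using accessibilityD(1)[OF edge_accessibility, of k X] by (auto simp: ob_node ob_edge)
qed (simp add: ob_node)

lemma ar_simps [simp]: "source_obj (ar f) = ob (Dom C f)" "target_obj (ar f) = ob (Cod C f)"
  "x \<in> node_set (ob (Dom C f)) v \<Longrightarrow> component (ar f) v x = snd (nm v) f x"
  by (simp_all add: ar_def)

lemma ar_arr: "f \<in> Arr C \<Longrightarrow> ar f \<in> rel_arrows G"
  unfolding ar_def
proof (rule str.mk_arr)
  fix v x assume "f \<in> Arr C" "x \<in> node_set (ob (Dom C f)) v"
  thus "snd (nm v) f x \<in> node_set (ob (Cod C f)) v" using modelD(1)[OF node_model] by (simp add: ob_node)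
next
  fix k s t assume "f \<in> Arr C" "(s, t) \<in> edge_rel (ob (Dom C f)) k"
  thus "(snd (nm (tail G k)) f s, snd (nm (head G k)) f t) \<in> edge_rel (ob (Cod C f)) k"
    using accessibilityD(2)[OF edge_accessibility] by (simp add: ob_edge)
qed (simp_all add: ob_obj)

lemma ar_ident: "X \<in> Obj C \<Longrightarrow> ar (Ident C X) = rel_ident (ob X)"
  by (rule str.arr_ext) (auto simp: ar_arr ob_obj str.ident_closed ob_node modelD(2)[OF node_model])

lemma ar_comp:
  assumes "f \<in> Arr C" "g \<in> Arr C" "Cod C f = Dom C g"
  shows "ar (Comp C g f) = rel_comp (ar g) (ar f)"
proof (rule str.arr_ext)
  show "ar (Comp C g f) \<in> rel_arrows G" using assms by (simp add: ar_arr)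
  show "rel_comp (ar g) (ar f) \<in> rel_arrows G" using assms by (simp add: ar_arr str.comp_closed)
  fix v x assume "x \<in> node_set (source_obj (ar (Comp C g f))) v"
  hence x: "v \<in> verts G" "x \<in> fst (nm v) (Dom C f)" using assms by (auto simp: ob_node)
  note D = modelD[OF node_model[OF x(1)]]
  have "snd (nm v) f x \<in> fst (nm v) (Dom C g)" using D(1)[OF assms(1) x(2)] assms(3) by simp
  thus "component (ar (Comp C g f)) v x = component (rel_comp (ar g) (ar f)) v x"
    using D(3)[OF assms _ x(2)] x assms by (simp add: ob_node)
qed (use assms in auto)

lemma functor_fnc: "is_functor C (Rel G) fnc"
  unfolding is_functor_def by (auto simp: ob_obj ar_arr ar_ident ar_comp Hom_def)

lemma preserves_limits: "preserves_finite_limits C (Rel G) fnc"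
  unfolding preserves_finite_limits_def
proof (intro allI impI, elim conjE)
  fix J :: "(nat, nat) pre_digraph" and DO DA L pr
  assume J: "fin_digraph J" and dia: "is_diagram C J DO DA" and lim: "is_limit C J DO DA L pr"
  interpret J: fin_digraph J by (rule J)
  have cone: "is_cone C J DO DA L pr" using lim unfolding is_limit_def by simp
  have pr: "pr v \<in> Arr C" "Dom C (pr v) = L" "Cod C (pr v) = DO v" if "v \<in> verts J" for v
    using cone that unfolding is_cone_def by (auto simp: Hom_def)
  have DA: "DA e \<in> Arr C" "Dom C (DA e) = DO (tail J e)" "Cod C (DA e) = DO (head J e)" if "e \<in> arcs J" for e
    using dia that unfolding is_diagram_def by (auto simp: Hom_def)
  have comm: "Comp C (DA e) (pr (tail J e)) = pr (head J e)" if "e \<in> arcs J" for e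
    using cone that unfolding is_cone_def by blast
  have cmp: "snd (nm a) (DA e) (snd (nm a) (pr (tail J e)) z) = snd (nm a) (pr (head J e)) z"
    if "e \<in> arcs J" "a \<in> verts G" "z \<in> fst (nm a) L" for e a z
    using modelD(3)[OF node_model[OF that(2)], of "pr (tail J e)" "DA e" z]
      pr[OF J.tail_in_verts[OF that(1)]] pr[OF J.head_in_verts[OF that(1)]] DA[OF that(1)] comm[OF that(1)] that(3) by simp
  have uniq: "z = w" if "a \<in> verts G" "z \<in> fst (nm a) L" "w \<in> fst (nm a) L"
    "\<And>v. v \<in> verts J \<Longrightarrow> snd (nm a) (pr v) z = snd (nm a) (pr v) w" for a z w
    by (rule flat_limit(2)[OF flat_model[OF node_model[OF that(1)]] J dia lim that(2,3) that(4)])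
  have "is_limit (Rel G) J (ob \<circ> DO) (ar \<circ> DA) (ob L) (ar \<circ> pr)"
  proof (rule str.limitI)
    show "is_cone (Rel G) J (ob \<circ> DO) (ar \<circ> DA) (ob L) (ar \<circ> pr)"
      unfolding is_cone_def
    proof (intro conjI ballI)
      show "(ar \<circ> pr) v \<in> Hom (Rel G) (ob L) ((ob \<circ> DO) v)" if "v \<in> verts J" for v
        using pr[OF that] by (simp add: Hom_def ar_arr)
      show "Comp (Rel G) ((ar \<circ> DA) e) ((ar \<circ> pr) (tail J e)) = (ar \<circ> pr) (head J e)" if e: "e \<in> arcs J" for e
        using ar_comp[of "pr (tail J e)" "DA e"] pr[OF J.tail_in_verts[OF e]] DA[OF e] comm[OF e] by simp
    qed (simp add: ob_obj)
    show "wf_digraph J" by unfold_locales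
    show "\<exists>z \<in> node_set (ob L) a. \<forall>v \<in> verts J. component ((ar \<circ> pr) v) a z = \<phi> v"
      if \<phi>0: "\<And>v. v \<in> verts J \<Longrightarrow> \<phi> v \<in> node_set ((ob \<circ> DO) v) a"
        and \<phi>1: "\<And>e. e \<in> arcs J \<Longrightarrow> component ((ar \<circ> DA) e) a (\<phi> (tail J e)) = \<phi> (head J e)" and a: "a \<in> verts G" for a \<phi>
    proof -
      have \<phi>: "\<phi> v \<in> fst (nm a) (DO v)" if "v \<in> verts J" for v using \<phi>0[OF that] by (simp add: ob_node)
      have "snd (nm a) (DA e) (\<phi> (tail J e)) = \<phi> (head J e)" if e: "e \<in> arcs J" for e
        using \<phi>1[OF e] \<phi>[OF J.tail_in_verts[OF e]] DA[OF e] a by (simp add: ob_node)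
      from flat_limit(1)[OF flat_model[OF node_model[OF a]] J dia lim, of \<phi>, OF \<phi> this]
      obtain z where "z \<in> fst (nm a) L" "\<forall>v \<in> verts J. snd (nm a) (pr v) z = \<phi> v" by blast
      thus ?thesis using a pr by (intro bexI[of _ z]) (auto simp: ob_node)
    qed
    show "z = w" if zw: "z \<in> node_set (ob L) a" "w \<in> node_set (ob L) a"
      "\<And>v. v \<in> verts J \<Longrightarrow> component ((ar \<circ> pr) v) a z = component ((ar \<circ> pr) v) a w" for a z w
    proof (rule uniq[of a])
      show "snd (nm a) (pr v) z = snd (nm a) (pr v) w" if v: "v \<in> verts J" for v
        using zw(3)[OF v] zw(1,2) pr[OF v] by simp
    qed (use zw(1,2) in \<open>auto simp: ob_node\<close>)
    show "(z, w) \<in> edge_rel (ob L) k"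
      if k: "k \<in> arcs G" "z \<in> node_set (ob L) (tail G k)" "w \<in> node_set (ob L) (head G k)"
        "\<And>v. v \<in> verts J \<Longrightarrow>
          (component ((ar \<circ> pr) v) (tail G k) z, component ((ar \<circ> pr) v) (head G k) w) \<in> edge_rel ((ob \<circ> DO) v) k" for k z w
    proof -
      let ?M = "nm (tail G k)" and ?M' = "nm (head G k)"
      note V = str.tail_in_verts[OF k(1)] str.head_in_verts[OF k(1)]
      note A = edge_accessibility[OF k(1)]
      have z: "z \<in> fst ?M L" "w \<in> fst ?M' L" using k(2,3) by (auto simp: ob_node)
      have 1: "(snd ?M (pr v) z, snd ?M' (pr v) w) \<in> er k (DO v)" if v: "v \<in> verts J" for v
        using k(4)[OF v] k(2,3) pr[OF v] by (simp add: ob_edge)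
      have 2: "(snd ?M (DA e) (fst (snd ?M (pr (tail J e)) z, snd ?M' (pr (tail J e)) w)),
        snd ?M' (DA e) (snd (snd ?M (pr (tail J e)) z, snd ?M' (pr (tail J e)) w))) =
        (snd ?M (pr (head J e)) z, snd ?M' (pr (head J e)) w)" if "e \<in> arcs J" for e
        using cmp[OF that V(1) z(1)] cmp[OF that V(2) z(2)] by simp
      \<comment> \<open>The limit property of the relation provides some related pair over the given
        values; uniqueness in the two models shows that it is the pair at hand.\<close>
      from flat_limit(1)[OF flat_accessibility[OF node_model[OF V(1)] node_model[OF V(2)] A] J dia lim,
          of "\<lambda>v. (snd ?M (pr v) z, snd ?M' (pr v) w)", OF 1 2]
      obtain p where p: "p \<in> er k L" "\<forall>v \<in> verts J. (snd ?M (pr v) (fst p), snd ?M' (pr v) (snd p)) =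
        (snd ?M (pr v) z, snd ?M' (pr v) w)" by blast
      have p': "fst p \<in> fst ?M L" "snd p \<in> fst ?M' L" using accessibilityD(1)[OF A, of L] p(1) by auto
      have "fst p = z" using uniq[OF V(1) p'(1) z(1)] p(2) by simp
      moreover have "snd p = w" using uniq[OF V(2) p'(2) z(2)] p(2) by simp
      ultimately have "p = (z, w)" by (cases p) simp
      thus ?thesis using p(1) k(1) by (simp add: ob_edge)
    qed
  qed
  thus "is_limit (Rel G) J (FObj fnc \<circ> DO) (FArr fnc \<circ> DA) (FObj fnc L) (FArr fnc \<circ> pr)" by simp
qed

lemma ar_Mon: "m \<in> Mon C \<Longrightarrow> ar m \<in> rel_mon G"
proof (rule str.monI)
  assume m: "m \<in> Mon C"
  show "ar m \<in> rel_arrows G" using m by (simp add: ar_arr)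
  show "x = y" if "x \<in> node_set (source_obj (ar m)) v" "y \<in> node_set (source_obj (ar m)) v"
    "component (ar m) v x = component (ar m) v y" for v x y
    by (rule flat_mono_inj[OF flat_model[OF node_model] Mon_mono[OF m], of v]) (use that in \<open>auto simp: ob_node\<close>)
  show "(s, t) \<in> edge_rel (source_obj (ar m)) k"
    if st: "s \<in> node_set (source_obj (ar m)) (tail G k)" "t \<in> node_set (source_obj (ar m)) (head G k)"
      "(component (ar m) (tail G k) s, component (ar m) (head G k) t) \<in> edge_rel (target_obj (ar m)) k" for k s t
  proof -
    have k: "k \<in> arcs G" "(snd (nm (tail G k)) m s, snd (nm (head G k)) m t) \<in> er k (Cod C m)"
      using st by (simp_all add: ob_edge)
    show ?thesis using accessibilityD(5)[OF edge_accessibility[OF k(1)] m Mon_arr[OF m] _ _ k(2)] st(1,2) k(1)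
      by (simp add: ob_node ob_edge)
  qed
qed

lemma rel_image_ar: "y \<in> rel_image (ar f) v \<longleftrightarrow> v \<in> verts G \<and> (\<exists>x \<in> fst (nm v) (Dom C f). y = snd (nm v) f x)"
  unfolding rel_image_def by (auto simp: ob_node image_iff)

lemma ar_MonPerp:
  assumes "e \<in> MonPerp C"
  shows "ar e \<in> MonPerp (Rel G)" "node_set (ob (Cod C e)) v \<subseteq> rel_image (ar e) v"
proof -
  have e: "e \<in> Arr C" using assms by simp
  show *: "node_set (ob (Cod C e)) v \<subseteq> rel_image (ar e) v" for v
  proof
    fix y assume y: "y \<in> node_set (ob (Cod C e)) v"
    hence v: "v \<in> verts G" "y \<in> fst (nm v) (Cod C e)" by (simp_all add: ob_node)
    show "y \<in> rel_image (ar e) v" using modelD(7)[OF node_model[OF v(1)] assms e v(2)] v(1) by (auto simp: rel_image_ar)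
  qed
  show "ar e \<in> MonPerp (Rel G)" by (rule str.surj_perp) (use * ar_arr[OF e] in auto)
qed

lemma ar_Quo:
  assumes "q \<in> Quo C"
  shows "ar q \<in> rel_quo G"
proof -
  have e: "q \<in> MonPerp C" using Quo_MonPerp assms by blast
  hence q: "q \<in> Arr C" by simp
  have "component (ar q) a ` node_set (source_obj (ar q)) a = node_set (target_obj (ar q)) a" for a
    using ar_MonPerp(2)[OF e, of a] str.image_sub[OF ar_arr[OF q], of a] unfolding rel_image_def by auto
  moreover have "\<exists>(s', t') \<in> edge_rel (source_obj (ar q)) k. component (ar q) (tail G k) s' = s \<and> component (ar q) (head G k) t' = t"
    if "(s, t) \<in> edge_rel (target_obj (ar q)) k" for k s t
  proof -
    have k: "k \<in> arcs G" "(s, t) \<in> er k (Cod C q)" using that by (simp_all add: ob_edge)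
    obtain s' t' where st: "(s', t') \<in> er k (Dom C q)" "snd (nm (tail G k)) q s' = s" "snd (nm (head G k)) q t' = t"
      using accessibilityD(6)[OF edge_accessibility[OF k(1)] assms q k(2)] by blast
    have e: "(s', t') \<in> edge_rel (ob (Dom C q)) k" using st(1) k(1) by (simp add: ob_edge)
    show ?thesis using str.objD(3)[OF ob_obj e] e st(2,3) by (intro bexI[of _ "(s', t')"]) auto
  qed
  ultimately show ?thesis unfolding rel_quo_def using ar_arr[OF q] by fast
qed

section \<open>Subobjects under the functor: joins, modality and conservativity\<close>

definition im :: "'a set \<Rightarrow> 'v \<Rightarrow> 'u set" where
  "im S v = (\<Union>m \<in> S. rel_image (ar m) v)"

lemma image_mono:
  assumes "factors_through C f n" "n \<in> Arr C"
  shows "rel_image (ar f) v \<subseteq> rel_image (ar n) v"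
proof -
  obtain h where h: "h \<in> Arr C" "Dom C h = Dom C f" "Cod C h = Dom C n" "f = Comp C n h"
    by (rule factors_throughE[OF assms(1)])
  have "snd (nm v) h x \<in> fst (nm v) (Dom C n)" "snd (nm v) f x = snd (nm v) n (snd (nm v) h x)"
    if "v \<in> verts G" "x \<in> fst (nm v) (Dom C f)" for x
  proof -
    note D = modelD[OF node_model[OF that(1)]]
    have x: "x \<in> fst (nm v) (Dom C h)" using that(2) h(2) by simp
    show "snd (nm v) h x \<in> fst (nm v) (Dom C n)" using D(1)[OF h(1) x] h(3) by simp
    show "snd (nm v) f x = snd (nm v) n (snd (nm v) h x)"
      unfolding h(4) by (rule D(3)[OF h(1) assms(2) h(3) _ x]) (use h(1,3) assms(2) in simp)
  qed
  thus ?thesis unfolding subset_iff rel_image_ar by blast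
qed

lemma im_rep:
  assumes "S \<in> carrier (Sub C X)" "m \<in> S"
  shows "im S = rel_image (ar m)"
proof (rule ext, rule subset_antisym)
  fix v
  show "im S v \<subseteq> rel_image (ar m) v"
    unfolding im_def
  proof (rule UN_least)
    fix n assume "n \<in> S"
    hence "factors_through C n m" using carrierD(3)[OF assms] subobj_mem by blast
    thus "rel_image (ar n) v \<subseteq> rel_image (ar m) v" using carrierD(1)[OF assms] by (intro image_mono) auto
  qed
  show "rel_image (ar m) v \<subseteq> im S v" unfolding im_def using assms(2) by blast
qed

lemma im_sub:
  assumes "S \<in> carrier (Sub C X)"
  shows "im S v \<subseteq> node_set (ob X) v"
proof -
  obtain m where m: "m \<in> S" "m \<in> Mon C" "Cod C m = X" by (rule carrierE[OF assms]) blast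
  show ?thesis using str.image_sub[of "ar m" v] ar_arr[of m] m im_rep[OF assms m(1)] by simp
qed

lemma FSub_eq:
  assumes "S \<in> carrier (Sub C X)"
  shows "FSub (Rel G) fnc S = str.sub_of (ob X) (im S)"
proof -
  have "subobj (Rel G) (ar m) = str.sub_of (ob X) (im S)" if "m \<in> S" for m
    using str.subobj_eq[OF ar_Mon[OF carrierD(1)[OF assms that]]] carrierD(2)[OF assms that] im_rep[OF assms that] by simp
  moreover have "S \<noteq> {}" using assms carrierE by blast
  ultimately show ?thesis unfolding FSub_def by simp
qed

text \<open>The join is pulled back along its own representative \<open>u\<close>, where it becomes
  the top. The pulled-back parts then cover \<open>Dom C u\<close>, and every model decides this
  cover, so a point of the join lies in one of the parts.\<close>

lemma im_lub_pair:
  assumes "S \<in> carrier (Sub C X)" "T \<in> carrier (Sub C X)" "is_lub (Sub C X) U {S, T}"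
  shows "im U v = im S v \<union> im T v"
proof -
  have ST: "{S, T} \<subseteq> carrier (Sub C X)" using assms by simp
  note L = assms(3)[unfolded is_lub_Sub[OF ST]]
  have U: "U \<in> carrier (Sub C X)" using L by blast
  obtain m where m: "m \<in> S" "m \<in> Mon C" "Cod C m = X" by (rule carrierE[OF assms(1)]) blast
  obtain n where n: "n \<in> T" "n \<in> Mon C" "Cod C n = X" by (rule carrierE[OF assms(2)]) blast
  obtain u where u: "u \<in> U" "u \<in> Mon C" "Cod C u = X" by (rule carrierE[OF U]) blast
  note I = im_rep[OF assms(1) m(1)] im_rep[OF assms(2) n(1)] im_rep[OF U u(1)]
  note ua = Mon_arr[OF u(2)]
  have "lies_in C m U" "lies_in C n U" using L Sub_le[OF assms(1) U m(1)] Sub_le[OF assms(2) U n(1)] by auto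
  hence "factors_through C m u" "factors_through C n u" using lies_in_rep[OF U u(1)] by auto
  hence 1: "im S v \<union> im T v \<subseteq> im U v" unfolding I using image_mono[OF _ ua] by blast
  note cl = pb_closed[OF ua, unfolded u(3)]
  have lub: "is_lub (Sub C (Dom C u)) (pb C u U) {pb C u S, pb C u T}"
    using preserves_finite_joinsD[OF pb_finite_joins[OF ua], of "{S, T}" U] assms ST u(3) by simp
  have DU: "Dom C u \<in> Obj C" using ua by (rule Dom_Obj)
  have "lies_in C u U" using lies_in_rep[OF U u(1)] factors_refl[OF ua] by simp
  hence li: "lies_in C (Ident C (Dom C u)) (pb C u U)" using lies_in_pb[OF ua, of U "Ident C (Dom C u)"] U u(3) DU ua by simp
  have part: "rel_image (ar (Comp C u m')) v \<subseteq> im S' v" "m' \<in> Arr C" "Cod C m' = Dom C u"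
    if "m' \<in> pb C u S'" "S' \<in> carrier (Sub C X)" for m' S'
  proof -
    note S' = that(2)
    obtain r where r: "r \<in> S'" "r \<in> Mon C" by (rule carrierE[OF S']) blast
    note c = carrierD[OF cl[OF that(2)] that(1)]
    show m': "m' \<in> Arr C" "Cod C m' = Dom C u" using c by auto
    have "lies_in C m' (pb C u S')" using lies_in_rep[OF cl[OF that(2)] that(1)] factors_refl[OF m'(1)] by simp
    hence "lies_in C (Comp C u m') S'" using lies_in_pb[OF ua, of S' m'] that(2) u(3) m' by simp
    hence "factors_through C (Comp C u m') r" using lies_in_rep[OF that(2) r(1)] by simp
    from image_mono[OF this] show "rel_image (ar (Comp C u m')) v \<subseteq> im S' v" using im_rep[OF that(2) r(1)] r(2) by simp
  qed
  obtain m' where m': "m' \<in> pb C u S" by (rule carrierE[OF cl[OF assms(1)]]) blast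
  obtain n' where n': "n' \<in> pb C u T" by (rule carrierE[OF cl[OF assms(2)]]) blast
  note pm = part[OF m' assms(1)] and pn = part[OF n' assms(2)]
  have cov: "cover m' n'" by (rule coverI[OF cl[OF assms(1)] cl[OF assms(2)] cl[OF U] m' n' lub li DU])
  have comp: "snd (nm v) u (snd (nm v) r y) \<in> rel_image (ar (Comp C u r)) v"
    if "v \<in> verts G" "r \<in> Arr C" "Cod C r = Dom C u" "y \<in> fst (nm v) (Dom C r)" for r y
    unfolding rel_image_ar
    by (intro conjI bexI[of _ y]) (use modelD(3)[OF node_model[OF that(1)], of r u y] that ua in simp_all)
  have "im U v \<subseteq> im S v \<union> im T v"
  proof
    fix y assume "y \<in> im U v"
    then obtain x where x: "v \<in> verts G" "x \<in> fst (nm v) (Dom C u)" "y = snd (nm v) u x" unfolding I by (auto simp: rel_image_ar)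
    from modelD(8)[OF node_model[OF x(1)] cov pm(2) pn(2), of x] x(2) pm(3)
    have "(\<exists>z. z \<in> fst (nm v) (Dom C m') \<and> snd (nm v) m' z = x) \<or> (\<exists>z. z \<in> fst (nm v) (Dom C n') \<and> snd (nm v) n' z = x)" by simp
    thus "y \<in> im S v \<union> im T v"
      using comp[OF x(1) pm(2,3)] comp[OF x(1) pn(2,3)] pm(1) pn(1) x(3) by blast
  qed
  thus ?thesis using 1 by (rule subset_antisym)
qed

lemma im_lub:
  assumes "finite A" "A \<subseteq> carrier (Sub C X)" "is_lub (Sub C X) S A" "X \<in> Obj C"
  shows "im S v = (\<Union>T \<in> A. im T v)"
  using assms(1-3)
proof (induction A arbitrary: S rule: finite_induct)
  \<comment> \<open>A representative of the empty join has an inconsistent domain, to which every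
    model assigns the empty set.\<close>
  case empty
  have S: "S \<in> carrier (Sub C X)" using empty.prems(2) is_lub_Sub[of "{}" X] by simp
  obtain m where m: "m \<in> S" "m \<in> Mon C" by (rule carrierE[OF S]) blast
  have "lies_in C m S" using lies_in_rep[OF S m(1)] factors_refl[of m] m(2) by simp
  hence z: "zero (Dom C m)" using zero_lies_in_bottom[OF empty.prems(2)] by simp
  have "fst (nm v) (Dom C m) = {}" if "v \<in> verts G"
    using modelD(9)[OF node_model[OF that] z] Dom_Obj[of m] m(2) by simp
  thus ?case unfolding im_rep[OF S m(1)] by (auto simp: rel_image_ar)
next
  case (insert T A)
  have A: "A \<subseteq> carrier (Sub C X)" "T \<in> carrier (Sub C X)" using insert.prems by auto
  obtain U where U: "is_lub (Sub C X) U A" using finite_joins[OF assms(4) insert.hyps(1) A(1)] by blast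
  note LU = U[unfolded is_lub_Sub[OF A(1)]] and LS = insert.prems(2)[unfolded is_lub_Sub[OF insert.prems(1)]]
  have Uc: "U \<in> carrier (Sub C X)" using LU by blast
  \<comment> \<open>Associativity of joins: \<open>U\<close> is the join of the remaining members,
    and \<open>S\<close> is the join of \<open>T\<close> with it.\<close>
  have "is_lub (Sub C X) S {T, U}"
    unfolding is_lub_Sub[of "{T, U}" X, simplified, OF conjI[OF A(2) Uc]]
  proof (intro conjI ballI impI)
    show "S \<in> carrier (Sub C X)" "T \<sqsubseteq>\<^bsub>Sub C X\<^esub> S" "U \<sqsubseteq>\<^bsub>Sub C X\<^esub> S" using LS LU by auto
    fix W assume W: "W \<in> carrier (Sub C X)" "T \<sqsubseteq>\<^bsub>Sub C X\<^esub> W \<and> U \<sqsubseteq>\<^bsub>Sub C X\<^esub> W"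
    have "T' \<sqsubseteq>\<^bsub>Sub C X\<^esub> W" if "T' \<in> insert T A" for T'
    proof (cases "T' = T")
      case False
      hence T': "T' \<in> A" using that by simp
      show ?thesis by (rule Sub_trans[of X T' U W]) (use T' LU W A Uc in auto)
    qed (use W in simp)
    thus "S \<sqsubseteq>\<^bsub>Sub C X\<^esub> W" using LS W(1) by blast
  qed
  from im_lub_pair[OF A(2) Uc this, of v] show ?case using insert.IH[OF A(1) U] by simp
qed

lemma preserves_joins:
  assumes "X \<in> Obj C"
  shows "preserves_finite_joins (Sub C X) (Sub (Rel G) (FObj fnc X)) (FSub (Rel G) fnc)"
  unfolding preserves_finite_joins_def
proof (intro allI impI, elim conjE)
  fix A S assume A: "finite A" "A \<subseteq> carrier (Sub C X)" "is_lub (Sub C X) S A"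
  have S: "S \<in> carrier (Sub C X)" using A(3) is_lub_Sub[OF A(2)] by simp
  have "is_lub (Sub (Rel G) (ob X)) (str.sub_of (ob X) (im S)) (str.sub_of (ob X) ` im ` A)"
  proof (subst str.lub_sub_of[of "ob X" "im S" "im ` A"])
    show "im S = (\<lambda>v. \<Union>T \<in> im ` A. T v)" using im_lub[OF A assms] by auto
    show "T v \<subseteq> node_set (ob X) v" if "T \<in> im ` A" for T v using that im_sub A(2) by blast
  qed (use ob_obj im_sub[OF S] in auto)
  moreover have "FSub (Rel G) fnc ` A = str.sub_of (ob X) ` im ` A"
    unfolding image_image by (rule image_cong[OF refl]) (use FSub_eq A(2) in blast)
  ultimately show "is_lub (Sub (Rel G) (FObj fnc X)) (FSub (Rel G) fnc S) (FSub (Rel G) fnc ` A)"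
    using FSub_eq[OF S] by simp
qed

text \<open>The two inclusions are the two halves of the meaning of \<open>Dia\<close>:
  \<open>successor\<close> provides an edge to a point of \<open>S\<close>, and the last clause of
  \<open>accessibility\<close> says that any such edge starts in \<open>Dia C X S\<close>.\<close>

lemma preserves_Dia:
  assumes "X \<in> Obj C" "S \<in> carrier (Sub C X)"
  shows "FSub (Rel G) fnc (Dia C X S) = rel_dia G (ob X) (FSub (Rel G) fnc S)"
proof -
  have DS: "Dia C X S \<in> carrier (Sub C X)" using Dia_closed[OF assms] .
  obtain m where m: "m \<in> S" "m \<in> Mon C" "Cod C m = X" "S = subobj C m" by (rule carrierE[OF assms(2)]) blast
  obtain n where n: "n \<in> Dia C X S" "n \<in> Mon C" "Cod C n = X" by (rule carrierE[OF DS]) blast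
  note I = im_rep[OF assms(2) m(1)] im_rep[OF DS n(1)]
  have n': "n \<in> Dia C (Cod C m) (subobj C m)" using n(1) m(3,4) by simp
  have "im (Dia C X S) v = str.dia (ob X) (im S) v" for v
  proof (rule Set.set_eqI, rule iffI)
    fix s assume "s \<in> im (Dia C X S) v"
    then obtain x where x: "v \<in> verts G" "x \<in> fst (nm v) (Dom C n)" "s = snd (nm v) n x" unfolding I by (auto simp: rel_image_ar)
    obtain k y where k: "k \<in> arcs G" "tail G k = v" "y \<in> fst (nm (head G k)) (Dom C m)"
      "(snd (nm v) n x, snd (nm (head G k)) m y) \<in> er k (Cod C m)"
      using successor[OF x(1) m(2) n' Mon_arr[OF n(2)] x(2)] by blast
    have "snd (nm (head G k)) m y \<in> im S (head G k)" unfolding I using k(1,3) by (auto simp: rel_image_ar)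
    moreover have "(s, snd (nm (head G k)) m y) \<in> edge_rel (ob X) k" using k(1,4) x(3) m(3) by (simp add: ob_edge)
    ultimately show "s \<in> str.dia (ob X) (im S) v" unfolding str.dia_def using k(1,2) by blast
  next
    fix s assume "s \<in> str.dia (ob X) (im S) v"
    then obtain k t where k: "k \<in> arcs G" "tail G k = v" "t \<in> im S (head G k)" "(s, t) \<in> edge_rel (ob X) k"
      unfolding str.dia_def by blast
    obtain y where y: "y \<in> fst (nm (head G k)) (Dom C m)" "t = snd (nm (head G k)) m y" using k(3) unfolding I by (auto simp: rel_image_ar)
    have "(s, snd (nm (head G k)) m y) \<in> er k (Cod C m)" using k(4) y(2) m(3) by (simp add: ob_edge)
    from accessibilityD(7)[OF edge_accessibility[OF k(1)] m(2) n' Mon_arr[OF m(2)] Mon_arr[OF n(2)] y(1) this]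
    show "s \<in> im (Dia C X S) v" unfolding I using k(1,2) by (auto simp: rel_image_ar)
  qed
  hence "im (Dia C X S) = str.dia (ob X) (im S)" by (rule ext)
  thus ?thesis using FSub_eq[OF assms(2)] FSub_eq[OF DS] str.dia_sub_of[OF ob_obj im_sub[OF assms(2)]] by simp
qed

text \<open>If \<open>S\<close> were not below \<open>T\<close>, a separating model would contain a
  point of the extent of \<open>S\<close> outside that of \<open>T\<close>.\<close>

lemma conservative: "Mon_conservative C (Rel G) fnc"
  unfolding Mon_conservative_def
proof (intro ballI inj_onI)
  fix X S T assume ST: "S \<in> carrier (Sub C X)" "T \<in> carrier (Sub C X)" "FSub (Rel G) fnc S = FSub (Rel G) fnc T"
  have im: "im S = im T"
    using ST(3) str.sub_of_inj[OF ob_obj im_sub[OF ST(1)] im_sub[OF ST(2)]] FSub_eq[OF ST(1)] FSub_eq[OF ST(2)] by simp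
  have le: "S \<sqsubseteq>\<^bsub>Sub C X\<^esub> T" if st: "S \<in> carrier (Sub C X)" "T \<in> carrier (Sub C X)" "im S = im T" for S T
  proof -
    obtain m where m: "m \<in> S" "m \<in> Mon C" "Cod C m = X" by (rule carrierE[OF st(1)]) blast
    obtain n where n: "n \<in> T" "n \<in> Mon C" "Cod C n = X" by (rule carrierE[OF st(2)]) blast
    have "factors_through C m n"
    proof (rule ccontr)
      assume nf: "\<not> factors_through C m n"
      have c: "Cod C n = Cod C m" using m n by simp
      obtain v x where x: "v \<in> verts G" "x \<in> fst (nm v) (Dom C m)"
        "\<forall>y. y \<in> fst (nm v) (Dom C n) \<longrightarrow> snd (nm v) n y \<noteq> snd (nm v) m x"
        using separating[OF m(2) n(2) c nf] by blast
      have "snd (nm v) m x \<in> im T v" using im_rep[OF st(1) m(1)] st(3) x(1,2) by (auto simp: rel_image_ar)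
      thus False using im_rep[OF st(2) n(1)] x(3) by (auto simp: rel_image_ar)
    qed
    thus ?thesis using Sub_le[OF st(1,2) m(1)] lies_in_rep[OF st(2) n(1)] by simp
  qed
  show "S = T" by (rule Sub_antisym[OF ST(1,2) le[OF ST(1,2) im] le[OF ST(2,1) im[symmetric]]])
qed

lemma morphism:
  assumes "boolean_modal_quasi_pretopos C"
  shows "boolean_modal_quasi_pretopos_morphism C (Rel G) fnc"
proof (rule boolean_modal_quasi_pretopos_morphism.intro[OF assms str.quasi_pretopos_R], unfold_locales)
  show "is_functor C (Rel G) fnc" by (rule functor_fnc)
  show "preserves_finite_limits C (Rel G) fnc" by (rule preserves_limits)
  show "FArr fnc ` Mon C \<subseteq> Mon (Rel G)" using ar_Mon by auto
  show "FArr fnc ` MonPerp C \<subseteq> MonPerp (Rel G)" using ar_MonPerp(1) by auto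
  show "preserves_finite_joins (Sub C X) (Sub (Rel G) (FObj fnc X)) (FSub (Rel G) fnc)" if "X \<in> Obj C" for X
    by (rule preserves_joins[OF that])
  show "FSub (Rel G) fnc (Dia C X S) = Dia (Rel G) (FObj fnc X) (FSub (Rel G) fnc S)"
    if "X \<in> Obj C" "S \<in> carrier (Sub C X)" for X S using preserves_Dia[OF that] by simp
  show "FArr fnc ` Quo C \<subseteq> Quo (Rel G)" using ar_Quo by auto
qed

end

section \<open>Encoding of the nodes and edges\<close>

text \<open>The origin of the two power sets in \<open>universe\<close>: a triple of a set of
  arrows, a number and an arrow fits into one subset of \<open>nat + 'o + 'a\<close>, and a function
  from sets of arrows to sets of germ representatives is a set of such triples, its graph.\<close>

lemma ex_inj_powerset:
  "\<exists>emb :: ('a set \<Rightarrow> (nat \<times> 'a) set) \<Rightarrow> (nat + 'o + 'a) set set. inj emb"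
proof -
  have "infinite (UNIV :: (nat + 'o + 'a) set)" by simp
  from ex_inj_pair[OF this] obtain p :: "(nat + 'o + 'a) \<times> (nat + 'o + 'a) \<Rightarrow> nat + 'o + 'a" where p: "inj p" by blast
  \<comment> \<open>The first components \<open>0\<close>, \<open>1\<close> and \<open>2\<close>
    tell apart the members of \<open>A\<close>, the number \<open>n\<close> and the arrow
    \<open>x\<close>; the pairs are afterwards compressed by \<open>p\<close>.\<close>
  define j :: "'a set \<Rightarrow> nat \<Rightarrow> 'a \<Rightarrow> ((nat + 'o + 'a) \<times> (nat + 'o + 'a)) set"
    where "j A n x = (\<lambda>y. (Inl 0, Inr (Inr y))) ` A \<union> {(Inl 1, Inl n), (Inl 2, Inr (Inr x))}"
    for A n x
  have j: "(Inl 0, Inr (Inr y)) \<in> j A n x \<longleftrightarrow> y \<in> A" "(Inl 1, Inl m) \<in> j A n x \<longleftrightarrow> m = n"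
    "(Inl 2, Inr (Inr y)) \<in> j A n x \<longleftrightarrow> y = x" for A n m x y unfolding j_def by auto
  define i where "i A n x = p ` j A n x" for A n x
  have i: "A = B \<and> n = m \<and> x = y" if "i A n x = i B m y" for A B n m x y
  proof -
    have "j A n x = j B m y" using that unfolding i_def inj_image_eq_iff[OF p] .
    hence "z \<in> A \<longleftrightarrow> z \<in> B" "n = n \<longleftrightarrow> n = m" "x = x \<longleftrightarrow> x = y" for z
      using j(1)[of z A n x] j(1)[of z B m y] j(2)[of n A n x] j(2)[of n B m y] j(3)[of x A n x] j(3)[of x B m y] by simp_all
    thus ?thesis by blast
  qed
  define e where "e f = {i A n x | A n x. (n, x) \<in> f A}" for f
  have mem: "i A n x \<in> e f \<longleftrightarrow> (n, x) \<in> f A" for A n x f unfolding e_def using i by blast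
  have "inj e"
  proof (intro injI ext)
    fix f g A assume "e f = e g"
    thus "f A = g A" using mem by (metis prod.exhaust subsetI subset_antisym)
  qed
  thus ?thesis by blast
qed

text \<open>Models and relations between them are small enough to be coded by subsets of the type of
  their points, which is why nodes and edges have the type of sets over
  \<open>universe\<close>.\<close>

lemma ex_inj_model:
  fixes i :: "nat + 'o + 'a \<Rightarrow> 'u"
  assumes "inj i"
  shows "\<exists>enc :: ('o \<Rightarrow> 'u set) \<times> ('a \<Rightarrow> 'u \<Rightarrow> 'u) \<Rightarrow> 'u set. inj enc"
    "\<exists>enc :: (('o \<Rightarrow> 'u set) \<times> ('a \<Rightarrow> 'u \<Rightarrow> 'u)) \<times> (('o \<Rightarrow> 'u set) \<times> ('a \<Rightarrow> 'u \<Rightarrow> 'u)) \<times> ('o \<Rightarrow> ('u \<times> 'u) set) \<Rightarrow> 'u set. inj enc"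
proof -
  have "infinite (UNIV :: 'u set)"
  proof
    assume "finite (UNIV :: 'u set)"
    hence "finite (UNIV :: (nat + 'o + 'a) set)" using finite_imageD[OF finite_subset[OF subset_UNIV] assms] by simp
    thus False by simp
  qed
  from ex_inj_pair[OF this] obtain p :: "'u \<times> 'u \<Rightarrow> 'u" where p: "inj p" by blast
  note eq = inj_eq[OF p] inj_eq[OF assms]
  \<comment> \<open>The graphs of both parts of the model, marked by objects and by arrows. The
    action is recorded on all elements, also off the carriers, so that equal codes give equal
    models.\<close>
  define enc where "enc M = {p (i (Inr (Inl X)), x) | X x. x \<in> fst M X} \<union> {p (i (Inr (Inr f)), p (x, snd M f x)) | f x. True}"
    for M :: "('o \<Rightarrow> 'u set) \<times> ('a \<Rightarrow> 'u \<Rightarrow> 'u)"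
  have mem: "p (i (Inr (Inl X)), x) \<in> enc M \<longleftrightarrow> x \<in> fst M X" "p (i (Inr (Inr f)), p (x, y)) \<in> enc M \<longleftrightarrow> snd M f x = y"
    for X f x y M unfolding enc_def by (auto simp: eq)
  have enc: "inj enc"
  proof (rule injI)
    fix M M' assume e: "enc M = enc M'"
    have "fst M X = fst M' X" for X using mem(1)[of X _ M] mem(1)[of X _ M'] e by blast
    moreover have "snd M f x = snd M' f x" for f x using mem(2)[of f x "snd M f x" M] mem(2)[of f x "snd M f x" M'] e by simp
    ultimately show "M = M'" by (intro prod_eqI ext) auto
  qed
  thus "\<exists>enc :: ('o \<Rightarrow> 'u set) \<times> ('a \<Rightarrow> 'u \<Rightarrow> 'u) \<Rightarrow> 'u set. inj enc" by blast
  \<comment> \<open>The codes of the two models and the graph of the relation, kept apart by the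
    numbers \<open>0\<close>, \<open>1\<close> and \<open>2\<close>.\<close>
  define enc' where "enc' k = (\<lambda>x. p (i (Inl 0), x)) ` enc (fst k) \<union> (\<lambda>x. p (i (Inl 1), x)) ` enc (fst (snd k)) \<union>
      {p (i (Inl 2), p (i (Inr (Inl X)), p q)) | X q. q \<in> snd (snd k) X}"
    for k :: "(('o \<Rightarrow> 'u set) \<times> ('a \<Rightarrow> 'u \<Rightarrow> 'u)) \<times> (('o \<Rightarrow> 'u set) \<times> ('a \<Rightarrow> 'u \<Rightarrow> 'u)) \<times> ('o \<Rightarrow> ('u \<times> 'u) set)"
  have mem': "p (i (Inl 0), x) \<in> enc' k \<longleftrightarrow> x \<in> enc (fst k)" "p (i (Inl 1), x) \<in> enc' k \<longleftrightarrow> x \<in> enc (fst (snd k))"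
    "p (i (Inl 2), p (i (Inr (Inl X)), p q)) \<in> enc' k \<longleftrightarrow> q \<in> snd (snd k) X" for x X q k
    unfolding enc'_def by (auto simp: eq image_iff simp del: split_paired_Ex split_paired_All)
  have "inj enc'"
  proof (rule injI)
    fix k k' assume e: "enc' k = enc' k'"
    have "enc (fst k) = enc (fst k')" using mem'(1)[of _ k] mem'(1)[of _ k'] e by blast
    moreover have "enc (fst (snd k)) = enc (fst (snd k'))" using mem'(2)[of _ k] mem'(2)[of _ k'] e by blast
    moreover have "snd (snd k) X = snd (snd k') X" for X using mem'(3)[of X _ k] mem'(3)[of X _ k'] e by blast
    ultimately show "k = k'" using enc by (intro prod_eqI ext) (auto dest: injD)
  qed
  thus "\<exists>enc :: (('o \<Rightarrow> 'u set) \<times> ('a \<Rightarrow> 'u \<Rightarrow> 'u)) \<times> (('o \<Rightarrow> 'u set) \<times> ('a \<Rightarrow> 'u \<Rightarrow> 'u)) \<times> ('o \<Rightarrow> ('u \<times> 'u) set) \<Rightarrow> 'u set. inj enc"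
    by blast
qed

theorem mainTheorem2:
  fixes E :: "('o, 'a) modal_category_with_quotients"
  assumes "boolean_modal_quasi_pretopos E"
  shows "\<exists>(G :: (('o, 'a) universe set, ('o, 'a) universe set) pre_digraph)
      (F :: ('o, 'a,
        (('o, 'a) universe set, ('o, 'a) universe set, ('o, 'a) universe) rel_object,
        (('o, 'a) universe set, ('o, 'a) universe set, ('o, 'a) universe) rel_arrow) cat_functor).
    wf_digraph G \<and>
    boolean_modal_quasi_pretopos_morphism E (Rel G) F \<and>
    Mon_conservative E (Rel G) F"
proof -
  interpret E: boolean_modal_quasi_pretopos E by (rule assms)
  obtain emb :: "('a set \<Rightarrow> (nat \<times> 'a) set) \<Rightarrow> ('o, 'a) universe" where "inj emb" using ex_inj_powerset by blast
  from E.ex_kripke[OF this] obtain N :: "(('o \<Rightarrow> ('o, 'a) universe set) \<times> ('a \<Rightarrow> ('o, 'a) universe \<Rightarrow> ('o, 'a) universe)) set"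
    and K where NK: "E.kripke (Arr E) N K" by blast
  \<comment> \<open>Double singletons embed the base type into \<open>universe\<close>; this
    provides the tags used in the codes of models.\<close>
  have "inj (\<lambda>x :: nat + 'o + 'a. {{x}})" by (rule injI) simp
  note enc = ex_inj_model[OF this]
  obtain encN :: "('o \<Rightarrow> ('o, 'a) universe set) \<times> ('a \<Rightarrow> ('o, 'a) universe \<Rightarrow> ('o, 'a) universe) \<Rightarrow> ('o, 'a) universe set"
    where encN: "inj encN" using enc(1) by blast
  obtain encK :: "(('o \<Rightarrow> ('o, 'a) universe set) \<times> ('a \<Rightarrow> ('o, 'a) universe \<Rightarrow> ('o, 'a) universe)) \<times>
      (('o \<Rightarrow> ('o, 'a) universe set) \<times> ('a \<Rightarrow> ('o, 'a) universe \<Rightarrow> ('o, 'a) universe)) \<times>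
      ('o \<Rightarrow> (('o, 'a) universe \<times> ('o, 'a) universe) set) \<Rightarrow> ('o, 'a) universe set"
    where encK: "inj encK" using enc(2) by blast
  note k = E.kripkeD[OF NK]
  \<comment> \<open>Nodes are codes of models. An edge codes a whole triple of two models and a
    relation, so its ends can be read off and parallel edges stay distinct.\<close>
  define G where "G = \<lparr>verts = encN ` N, arcs = encK ` K, tail = (\<lambda>k. encN (fst (inv encK k))),
    head = (\<lambda>k. encN (fst (snd (inv encK k))))\<rparr>"
  have G [simp]: "verts G = encN ` N" "arcs G = encK ` K" "tail G (encK k) = encN (fst k)" "head G (encK k) = encN (fst (snd k))" for k
    by (simp_all add: G_def inv_f_f[OF encK])
  have KD: "fst k \<in> N" "fst (snd k) \<in> N" "E.accessibility (Arr E) (fst k) (fst (snd k)) (snd (snd k))" if "k \<in> K" for k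
    using k(2)[of "fst k" "fst (snd k)" "snd (snd k)"] that by auto
  have inf: "infinite (UNIV :: ('o, 'a) universe set)" by (simp add: Finite_Set.finite_set)
  have wf: "wf_digraph G" by unfold_locales (use KD in auto)
  \<comment> \<open>The decodings \<open>nm\<close> and \<open>er\<close> are the inverses of the
    two codes; on nodes and edges of \<open>G\<close> they return exactly the model and the relation
    that were coded.\<close>
  interpret kripke_functor E G "TYPE(('o, 'a) universe)" "inv encN" "\<lambda>k. snd (snd (inv encK k))"
  proof (intro kripke_functor.intro relational.intro wf)
    show "boolean_modal_category_with_quotients E" by unfold_locales
    show "relational_axioms TYPE(('o, 'a) universe)" using inf by unfold_locales
    show "kripke_functor_axioms E G (inv encN) (\<lambda>k. snd (snd (inv encK k)))"
    proof
      show "E.model (Arr E) (inv encN v)" if "v \<in> verts G" for v using that k(1) by (auto simp: inv_f_f[OF encN])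
      show "E.accessibility (Arr E) (inv encN (tail G e)) (inv encN (head G e)) (snd (snd (inv encK e)))" if "e \<in> arcs G" for e
        using that KD(3) by (auto simp: inv_f_f[OF encN] inv_f_f[OF encK])
      show "\<exists>e y. e \<in> arcs G \<and> tail G e = v \<and> y \<in> fst (inv encN (head G e)) (Dom E m) \<and>
          (snd (inv encN v) n x, snd (inv encN (head G e)) m y) \<in> snd (snd (inv encK e)) (Cod E m)"
        if v: "v \<in> verts G" "m \<in> Mon E" "n \<in> Dia E (Cod E m) (subobj E m)" "n \<in> Arr E" "x \<in> fst (inv encN v) (Dom E n)" for v m n x
      proof -
        have "v \<in> encN ` N" using v(1) by simp
        then obtain M where M: "v = encN M" "M \<in> N" by blast
        have x: "x \<in> fst M (Dom E n)" using v(5) M(1) by (simp add: inv_f_f[OF encN])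
        obtain M' R y where r: "(M, M', R) \<in> K" "y \<in> fst M' (Dom E m)" "(snd M n x, snd M' m y) \<in> R (Cod E m)"
          using k(3)[OF M(2) v(2,3) E.Mon_arr[OF v(2)] v(4) x] by blast
        show ?thesis
          by (rule exI[of _ "encK (M, M', R)"], rule exI[of _ y]) (use r M in \<open>simp add: inv_f_f[OF encN] inv_f_f[OF encK]\<close>)
      qed
      show "\<exists>v x. v \<in> verts G \<and> x \<in> fst (inv encN v) (Dom E m) \<and>
          (\<forall>y. y \<in> fst (inv encN v) (Dom E n) \<longrightarrow> snd (inv encN v) n y \<noteq> snd (inv encN v) m x)"
        if mn: "m \<in> Mon E" "n \<in> Mon E" "Cod E n = Cod E m" "\<not> factors_through E m n" for m n
      proof -
        obtain M x where M: "M \<in> N" "x \<in> fst M (Dom E m)" "\<forall>y. y \<in> fst M (Dom E n) \<longrightarrow> snd M n y \<noteq> snd M m x"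
          using k(4)[OF mn(1,2) E.Mon_arr[OF mn(1)] E.Mon_arr[OF mn(2)] mn(3,4)] by blast
        show ?thesis by (rule exI[of _ "encN M"], rule exI[of _ x]) (use M in \<open>simp add: inv_f_f[OF encN]\<close>)
      qed
    qed
  qed
  show ?thesis using wf morphism[OF assms] conservative by blast
qed

end
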